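(* Let $\mathcal{C}$ be a groupoidant 2-category. Then for any cartesian closed object $X\in\mathcal{C}$ there is an exponential morphism $\exp:X^{\mathrm{op}}\times X\to X$, and it is unique up to isomorphism.
   Context: Conventions. 2-categories are strict. Composition is in diagrammatic order: $fg$ means first $f$, then $g$ (also for functors and whiskerings). $|\mathcal{C}|$ is the underlying 1-category of $\mathcal{C}$. For $f:X\to Y$ and an object $A$, $f_*:\mathcal{C}(A,X)\to\mathcal{C}(A,Y)$ and $f^*:\mathcal{C}(Y,A)\to\mathcal{C}(X,A)$ are given by composition with $f$. $[k]$ is the linear order $\{0<\dots<k\}$ viewed as a category, and $\delta_{a_0\dots a_k}:[k]\to[l]$ is the functor $j\mapsto a_j$. Limits. A functor $F$ is an isofibration if every isomorphism $Fx\to b$ lifts to an isomorphism with domain $x$; it is a discrete opfibration (DOF) if every morphism $Fx\to b$ has a unique lift with domain $x$. A morphism $f$ of $\mathcal{C}$ is an isofibration (resp. DOF) if $f_*:\mathcal{C}(A,X)\to\mathcal{C}(A,Y)$ is one for all $A$. A commutative square with vertex $P$ over a cospan $X\to Z\leftarrow Y$ is a strict pullback if $\mathcal{C}(B,P)\to\mathcal{C}(B,X)\times_{\mathcal{C}(B,Z)}\mathcal{C}(B,Y)$ is an isomorphism of categories for all $B$ (strict products are defined likewise). A strict terminal object has all $\mathcal{C}(A,\mathbf 1)$ equal to the one-morphism category. A strict cotensor of $X$ with a category $J$ is an object $X^J$ with a functor $\mathrm{ev}:J\to\mathcal{C}(X^J,X)$ inducing isomorphisms of categories $\mathcal{C}(A,X^J)\cong\mathrm{Fun}(J,\mathcal{C}(A,X))$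 for all $A$; functors $J\to J'$ induce $X^{J'}\to X^J$. The arrow object is $X^\to=X^{[1]}$, with universal 2-cell $\partial:\partial_0\Rightarrow\partial_1:X^\to\to X$. $\mathcal{C}$ is pita if it has a strict terminal object, strict arrow objects, and strict pullbacks of isofibrations along arbitrary morphisms (it then has products and cotensors with finite categories). Groupoids and cores. $X$ is a groupoid if every $\mathcal{C}(A,X)$ is a groupoid. $f:A\to X$ is an arrow-wise iso if $\alpha f$ is invertible for every 2-cell $\alpha$ between morphisms into $A$. A core of $X$ is an object $X^{\mathrm{iso}}$ with an arrow-wise iso $i:X^{\mathrm{iso}}\to X$ such that for all $A$, $i_*$ is an isomorphism from $\mathcal{C}(A,X^{\mathrm{iso}})$ onto the subcategory of $\mathcal{C}(A,X)$ of arrow-wise isos and invertible 2-cells. Any $f:X\to Y$ induces $f^{\mathrm{iso}}:X^{\mathrm{iso}}\to Y^{\mathrm{iso}}$ with $f^{\mathrm{iso}}i=if$; if $A$ is a groupoid and $f:A\to X$, write $f^{\mathrm{iso}}:A\to X^{\mathrm{iso}}$ for the unique morphism with $f^{\mathrm{iso}}i=f$. Congruences. An internal category $C$ in a 1-category has objects $C_0,C_1,C_2$ and morphisms $\pi_0,\pi_1:C_1\to C_0$ (source, target), $e:C_0\to C_1$ (identities), $\pi_{01},\pi_{12},\pi_{02}:C_2\to C_1$ (first arrow, second arrow, composite), with $C_2=C_1\times_{C_0}C_1$ via $\pi_{01}\pi_1=\pi_{12}\pi_0$, satisfying the usual axioms. $C_3=C_2\times_{C_1}C_2$ (along $\pi_{12},\pi_{01}$)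 is the object of composable triples; $\langle a,b,c\rangle:A\to C_3$ is the morphism with consecutive components $a,b,c:A\to C_1$, and $\pi_{02},\pi_{13}:C_3\to C_1$ give the composite of the first two, resp. last two, arrows. In a pita 2-category $\mathcal{C}$, an internal double category is an internal category in $|\mathcal{C}|$ with $\langle\pi_0,\pi_1\rangle:C_1\to C_0\times C_0$ an isofibration. It is a gbo-congruence if $C_0,C_1,C_2$ are groupoids and $\langle\pi_0,\pi_1\rangle$ is a DOF. Then there is a unique $r:C_0^\to\to C_1$ (the reflection morphism) for which there exists a 2-cell $\bar\rho:r\Rightarrow\partial_1e$ with $\bar\rho\langle\pi_0,\pi_1\rangle=\langle\partial,\mathrm{id}_{\partial_1}\rangle$. Let $\tau:C_0^\to\to C_0^\to$ be the morphism with $\tau\partial=\partial^{-1}$. A gbo-congruence $C$ is complete (a complete congruence) if the square with top $\langle r,\tau r,r\rangle:C_0^\to\to C_3$, left $\langle\partial_0,\partial_1\rangle:C_0^\to\to C_0\times C_0$, right $\langle\pi_{02},\pi_{13}\rangle:C_3\to C_1\times C_1$ and bottom $e\times e$ is a strict pullback. Nerves and quotients. A nerve $\mathrm{Nv}(X)$ of $X$ is the internal double category with objects $X^{\mathrm{iso}},(X^\to)^{\mathrm{iso}},(X^{[2]})^{\mathrm{iso}}$ (for some choice of cores and cotensors) and structure maps $\pi_{jk}=(X^{\delta_{jk}})^{\mathrm{iso}}$, $\pi_j=(X^{\delta_j})^{\mathrm{iso}}=\partial_j^{\mathrm{iso}}$, $e=(X^{\delta_{00}})^{\mathrm{iso}}$.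 A cocone under $C$ with vertex $Y$ is a morphism $\gamma:C_0\to Y$ and a 2-cell $\gamma_{01}:\pi_0\gamma\Rightarrow\pi_1\gamma$ with $e\gamma_{01}=\mathrm{id}_\gamma$ and $\pi_{02}\gamma_{01}=(\pi_{01}\gamma_{01})(\pi_{12}\gamma_{01})$; a morphism $(\gamma,\gamma_{01})\to(\gamma',\gamma'_{01})$ is a 2-cell $\alpha:\gamma\Rightarrow\gamma'$ with $(\pi_0\alpha)\gamma'_{01}=\gamma_{01}(\pi_1\alpha)$. A cocone with vertex $X$ is a strict quotient of $C$ if the induced functor $\mathcal{C}(X,Y)\to\mathrm{Cocone}(C,Y)$ is an isomorphism for all $Y$. The tautological cocone under $\mathrm{Nv}(X)$ is $\gamma=i:X^{\mathrm{iso}}\to X$, $\gamma_{01}=i\partial$ (with $i:(X^\to)^{\mathrm{iso}}\to X^\to$). $\mathcal{C}$ is groupoidant if: it is pita; every object has a core; every complete congruence is a nerve (of some object); and the tautological cocone under any nerve is a strict quotient. Opposites. The opposite $C^{\mathrm{op}}$ of an internal double category $C$ is obtained by exchanging $\pi_0$ with $\pi_1$ and $\pi_{01}$ with $\pi_{12}$. An opposition between $X$ and $X^{\mathrm{op}}$ is a complete congruence $C$ with a quotient cocone $(X,\gamma,\gamma_{01})$ of $C$ and a quotient cocone $(X^{\mathrm{op}},\gamma^{\mathrm{op}}:C_0\to X^{\mathrm{op}},\gamma^{\mathrm{op}}_{01}:\pi_1\gamma^{\mathrm{op}}\Rightarrow\pi_0\gamma^{\mathrm{op}})$ of $C^{\mathrm{op}}$.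 In a groupoidant 2-category every $X$ has such an opposite $X^{\mathrm{op}}$, unique up to isomorphism, and $C$ with $(\gamma,\gamma_{01})$ is a nerve of $X$ with its tautological cocone. For a groupoid $A$ and $f:A\to X$, $f^{\mathrm{op}}:A\to X^{\mathrm{op}}$ is $\bar f\gamma^{\mathrm{op}}$, where $\bar f:A\to C_0$ is the unique morphism with $\bar f\gamma=f$; for a 2-cell $\alpha:f\Rightarrow g:A\to X$, $\alpha^{\mathrm{op}}:g^{\mathrm{op}}\Rightarrow f^{\mathrm{op}}$ is $a\gamma_{01}^{\mathrm{op}}$, where $a:A\to C_1$ is the unique morphism with $a\gamma_{01}=\alpha$. Cartesian closed objects. $X\in\mathcal{C}$ is cartesian closed if for each groupoid $A\in\mathcal{C}$ the category $\mathcal{C}(A,X)$ is cartesian closed (finite products and exponentials), and for each $f:A'\to A$ between groupoids the functor $f^*:\mathcal{C}(A,X)\to\mathcal{C}(A',X)$ preserves finite products and exponentials. (In a groupoidant 2-category, such an $X$ has finite products, i.e. every $\mathcal{C}(A,X)$ has finite products, preserved by every $f^*$.) Exponential diagrams. Let $\check L$ be the preorder generated by $3\to2$, $3\to0$, $3\to1$. For $X$ with finite products, $X^{\check L}$ denotes an object with a functor $\check L\to\mathcal{C}(X^{\check L},X)$ inducing, for all $A$, an isomorphism from $\mathcal{C}(A,X^{\check L})$ onto the full subcategory of $\mathrm{Fun}(\check L,\mathcal{C}(A,X))$ of diagrams in which $2\leftarrow3\to0$ is a product diagram preserved by all $h^*$, $h:A'\to A$. (It exists when $\mathcal{C}$ is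 pita.) Let $X^\iota:X^{\check L}\to X\times X$ be the morphism restricting a diagram to its values at $0$ and $1$. A morphism $A\to X^{\check L}$ is an exponential object diagram if in the corresponding diagram $D$ in $\mathcal{C}(A,X)$ the morphism $D(2)\times D(0)=D(3)\to D(1)$ exhibits $D(2)$ as the exponential object $D(1)^{D(0)}$, with this morphism as evaluation; $D(2)$ is the underlying exponential object. Exponential morphisms. A morphism $\exp:X^{\mathrm{op}}\times X\to X$ is an exponential morphism if there is a morphism $E:(X\times X)^{\mathrm{iso}}\to(X^{\check L})^{\mathrm{iso}}$ with $E(X^\iota)^{\mathrm{iso}}=\mathrm{id}$, such that for every groupoid $A$ and $f,g:A\to X$, $\langle f,g\rangle^{\mathrm{iso}}Ei:A\to X^{\check L}$ is an exponential object diagram (on $f,g$), and such that: for each groupoid $A$ and $f,g:A\to X$, $\langle f^{\mathrm{op}},g\rangle\exp\in\mathcal{C}(A,X)$ is the exponential object $g^f$ underlying $\langle f,g\rangle^{\mathrm{iso}}Ei$; and for $f',g':A\to X$ and 2-cells $\alpha:f'\Rightarrow f$, $\beta:g\Rightarrow g'$, the 2-cell $\langle\alpha^{\mathrm{op}},\beta\rangle\exp:\langle f^{\mathrm{op}},g\rangle\exp\Rightarrow\langle f'^{\mathrm{op}},g'\rangle\exp$ is the corresponding induced morphism $g^f\to g'^{f'}$ of exponential objects. *)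

theory Defs
  imports Main "HOL-Library.FuncSet"
begin

section \<open>Categories and functors\<close>

text \<open>All compositions are written in diagrammatic order: \<open>f \<cdot> g\<close> is first \<open>f\<close>, then \<open>g\<close>.\<close>

record ('o, 'a) cat =
  Obj :: "'o set"
  Arr :: "'a set"
  Dom :: "'a \<Rightarrow> 'o"
  Cod :: "'a \<Rightarrow> 'o"
  Ide :: "'o \<Rightarrow> 'a"
  Comp :: "'a \<Rightarrow> 'a \<Rightarrow> 'a" (infixl "\<cdot>\<index>" 75)

definition in_hom :: "('o, 'a, 'x) cat_scheme \<Rightarrow> 'a \<Rightarrow> 'o \<Rightarrow> 'o \<Rightarrow> bool" where
  "in_hom D f x y \<longleftrightarrow> f \<in> Arr D \<and> Dom D f = x \<and> Cod D f = y"

locale category =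
  fixes D :: "('o, 'a, 'x) cat_scheme" (structure)
  assumes dom_obj: "f \<in> Arr D \<Longrightarrow> Dom D f \<in> Obj D"
    and cod_obj: "f \<in> Arr D \<Longrightarrow> Cod D f \<in> Obj D"
    and ide_hom: "x \<in> Obj D \<Longrightarrow> in_hom D (Ide D x) x x"
    and comp_hom: "in_hom D f x y \<Longrightarrow> in_hom D g y z \<Longrightarrow> in_hom D (f \<cdot> g) x z"
    and ide_comp: "in_hom D f x y \<Longrightarrow> Ide D x \<cdot> f = f"
    and comp_ide: "in_hom D f x y \<Longrightarrow> f \<cdot> Ide D y = f"
    and comp_assoc: "in_hom D f w x \<Longrightarrow> in_hom D g x y \<Longrightarrow> in_hom D h y z
          \<Longrightarrow> (f \<cdot> g) \<cdot> h = f \<cdot> (g \<cdot> h)"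

definition is_inverse :: "('o, 'a, 'x) cat_scheme \<Rightarrow> 'a \<Rightarrow> 'a \<Rightarrow> bool" where
  "is_inverse D f g \<longleftrightarrow> f \<in> Arr D \<and> in_hom D g (Cod D f) (Dom D f) \<and>
     f \<cdot>\<^bsub>D\<^esub> g = Ide D (Dom D f) \<and> g \<cdot>\<^bsub>D\<^esub> f = Ide D (Cod D f)"

definition is_iso :: "('o, 'a, 'x) cat_scheme \<Rightarrow> 'a \<Rightarrow> bool" where
  "is_iso D f \<longleftrightarrow> (\<exists>g. is_inverse D f g)"

definition isomorphic :: "('o, 'a, 'x) cat_scheme \<Rightarrow> 'o \<Rightarrow> 'o \<Rightarrow> bool" where
  "isomorphic D x y \<longleftrightarrow> (\<exists>f. in_hom D f x y \<and> is_iso D f)"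

definition groupoid_cat :: "('o, 'a, 'x) cat_scheme \<Rightarrow> bool" where
  "groupoid_cat D \<longleftrightarrow> (\<forall>f \<in> Arr D. is_iso D f)"

text \<open>A functor is the pair of its actions on objects and on arrows.\<close>

type_synonym ('o, 'a, 'p, 'b) fctr = "('o \<Rightarrow> 'p) \<times> ('a \<Rightarrow> 'b)"

definition is_functor ::
  "('o, 'a, 'x) cat_scheme \<Rightarrow> ('p, 'b, 'y) cat_scheme \<Rightarrow> ('o, 'a, 'p, 'b) fctr \<Rightarrow> bool" where
  "is_functor D E F \<longleftrightarrow>
     (\<forall>x \<in> Obj D. fst F x \<in> Obj E \<and> snd F (Ide D x) = Ide E (fst F x)) \<and>
     (\<forall>f \<in> Arr D. in_hom E (snd F f) (fst F (Dom D f)) (fst F (Cod D f))) \<and>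
     (\<forall>f \<in> Arr D. \<forall>g \<in> Arr D. Cod D f = Dom D g \<longrightarrow>
        snd F (f \<cdot>\<^bsub>D\<^esub> g) = snd F f \<cdot>\<^bsub>E\<^esub> snd F g)"

definition iso_functor ::
  "('o, 'a, 'x) cat_scheme \<Rightarrow> ('p, 'b, 'y) cat_scheme \<Rightarrow> ('o, 'a, 'p, 'b) fctr \<Rightarrow> bool" where
  "iso_functor D E F \<longleftrightarrow> is_functor D E F \<and>
     bij_betw (fst F) (Obj D) (Obj E) \<and> bij_betw (snd F) (Arr D) (Arr E)"

definition isofibration_functor ::
  "('o, 'a, 'x) cat_scheme \<Rightarrow> ('p, 'b, 'y) cat_scheme \<Rightarrow> ('o, 'a, 'p, 'b) fctr \<Rightarrow> bool" where
  "isofibration_functor D E F \<longleftrightarrow>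
     (\<forall>x \<in> Obj D. \<forall>b. is_iso E b \<and> Dom E b = fst F x \<longrightarrow>
        (\<exists>a. is_iso D a \<and> Dom D a = x \<and> snd F a = b))"

definition dof_functor ::
  "('o, 'a, 'x) cat_scheme \<Rightarrow> ('p, 'b, 'y) cat_scheme \<Rightarrow> ('o, 'a, 'p, 'b) fctr \<Rightarrow> bool" where
  "dof_functor D E F \<longleftrightarrow>
     (\<forall>x \<in> Obj D. \<forall>b \<in> Arr E. Dom E b = fst F x \<longrightarrow>
        (\<exists>!a. a \<in> Arr D \<and> Dom D a = x \<and> snd F a = b))"

definition full_subcat :: "('o, 'a) cat \<Rightarrow> 'o set \<Rightarrow> ('o, 'a) cat" where
  "full_subcat D S = D\<lparr>Obj := Obj D \<inter> S, Arr := {a \<in> Arr D. Dom D a \<in> S \<and> Cod D a \<in> S}\<rparr>"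

definition prod_cat :: "('o, 'a) cat \<Rightarrow> ('p, 'b) cat \<Rightarrow> ('o \<times> 'p, 'a \<times> 'b) cat" where
  "prod_cat D E =
     \<lparr>Obj = Obj D \<times> Obj E, Arr = Arr D \<times> Arr E,
      Dom = (\<lambda>(a, b). (Dom D a, Dom E b)), Cod = (\<lambda>(a, b). (Cod D a, Cod E b)),
      Ide = (\<lambda>(x, y). (Ide D x, Ide E y)),
      Comp = (\<lambda>(a, b) (a', b'). (a \<cdot>\<^bsub>D\<^esub> a', b \<cdot>\<^bsub>E\<^esub> b'))\<rparr>"

text \<open>The pullback of categories along \<open>F\<close> and \<open>G\<close>, functors with a common codomain.\<close>

definition pullback_cat ::
  "('o, 'a) cat \<Rightarrow> ('o, 'a, 'q, 'c) fctr \<Rightarrow> ('p, 'b) cat \<Rightarrow> ('p, 'b, 'q, 'c) fctr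
     \<Rightarrow> ('o \<times> 'p, 'a \<times> 'b) cat" where
  "pullback_cat D F E G = (prod_cat D E)
     \<lparr>Obj := {(x, y). x \<in> Obj D \<and> y \<in> Obj E \<and> fst F x = fst G y},
      Arr := {(a, b). a \<in> Arr D \<and> b \<in> Arr E \<and> snd F a = snd G b}\<rparr>"

text \<open>Functor categories. Functors and families of components are taken to be extensional, so
  that equality in the functor category is equality of functors and transformations; an arrow
  is a triple (domain, components, codomain).\<close>

definition fun_cat :: "('o, 'a) cat \<Rightarrow> ('p, 'b) cat \<Rightarrow>
    (('o, 'a, 'p, 'b) fctr,
     ('o, 'a, 'p, 'b) fctr \<times> ('o \<Rightarrow> 'b) \<times> ('o, 'a, 'p, 'b) fctr) cat" where
  "fun_cat J D =
    (let Fs = {F. is_functor J D F \<and> fst F \<in> extensional (Obj J) \<and> snd F \<in> extensional (Arr J)}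
     in \<lparr>Obj = Fs,
         Arr = {(F, t, G). F \<in> Fs \<and> G \<in> Fs \<and> t \<in> extensional (Obj J) \<and>
                 (\<forall>j \<in> Obj J. in_hom D (t j) (fst F j) (fst G j)) \<and>
                 (\<forall>u \<in> Arr J. snd F u \<cdot>\<^bsub>D\<^esub> t (Cod J u) = t (Dom J u) \<cdot>\<^bsub>D\<^esub> snd G u)},
         Dom = (\<lambda>(F, t, G). F), Cod = (\<lambda>(F, t, G). G),
         Ide = (\<lambda>F. (F, \<lambda>j \<in> Obj J. Ide D (fst F j), F)),
         Comp = (\<lambda>(F, t, G) (G', s, H). (F, \<lambda>j \<in> Obj J. t j \<cdot>\<^bsub>D\<^esub> s j, H))\<rparr>)"

text \<open>A preorder as a category: the arrow from \<open>i\<close> to \<open>j\<close> is the pair \<open>(i, j)\<close>.\<close>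

definition preorder_cat :: "'i set \<Rightarrow> ('i \<Rightarrow> 'i \<Rightarrow> bool) \<Rightarrow> ('i, 'i \<times> 'i) cat" where
  "preorder_cat S le =
     \<lparr>Obj = S, Arr = {(i, j). i \<in> S \<and> j \<in> S \<and> le i j}, Dom = fst, Cod = snd,
      Ide = (\<lambda>i. (i, i)), Comp = (\<lambda>u v. (fst u, snd v))\<rparr>"

definition ordinal :: "nat \<Rightarrow> (nat, nat \<times> nat) cat" where
  "ordinal k = preorder_cat {0..k} (\<le>)"

text \<open>\<open>delta [a\<^sub>0, \<dots>, a\<^sub>k]\<close> is the functor \<open>j \<mapsto> a\<^sub>j\<close> out of \<open>ordinal k\<close>.\<close>

definition delta :: "nat list \<Rightarrow> (nat, nat \<times> nat, nat, nat \<times> nat) fctr" where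
  "delta as = ((\<lambda>j. as ! j), (\<lambda>(i, j). (as ! i, as ! j)))"

section \<open>Products and exponentials in a category\<close>

definition is_terminal :: "('o, 'a, 'x) cat_scheme \<Rightarrow> 'o \<Rightarrow> bool" where
  "is_terminal D t \<longleftrightarrow> t \<in> Obj D \<and> (\<forall>x \<in> Obj D. \<exists>!f. in_hom D f x t)"

definition product_diagram :: "('o, 'a, 'x) cat_scheme \<Rightarrow> 'a \<Rightarrow> 'a \<Rightarrow> bool" where
  "product_diagram D p q \<longleftrightarrow> p \<in> Arr D \<and> q \<in> Arr D \<and> Dom D p = Dom D q \<and>
     (\<forall>z a b. in_hom D a z (Cod D p) \<and> in_hom D b z (Cod D q) \<longrightarrow>
        (\<exists>!m. in_hom D m z (Dom D p) \<and> m \<cdot>\<^bsub>D\<^esub> p = a \<and> m \<cdot>\<^bsub>D\<^esub> q = b))"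

text \<open>The arrow \<open>\<langle>a, b\<rangle>\<close> into the vertex of a product or pullback with projections \<open>p\<close> and \<open>q\<close>.\<close>

definition pairing :: "('o, 'a, 'x) cat_scheme \<Rightarrow> 'a \<Rightarrow> 'a \<Rightarrow> 'a \<Rightarrow> 'a \<Rightarrow> 'a" where
  "pairing D p q a b =
     (THE m. in_hom D m (Dom D a) (Dom D p) \<and> m \<cdot>\<^bsub>D\<^esub> p = a \<and> m \<cdot>\<^bsub>D\<^esub> q = b)"

definition pullback_square ::
  "('o, 'a, 'x) cat_scheme \<Rightarrow> 'a \<Rightarrow> 'a \<Rightarrow> 'a \<Rightarrow> 'a \<Rightarrow> bool" where
  "pullback_square D p q f g \<longleftrightarrow>
     (\<exists>w x y z. in_hom D p w x \<and> in_hom D q w y \<and> in_hom D f x z \<and> in_hom D g y z \<and>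
        p \<cdot>\<^bsub>D\<^esub> f = q \<cdot>\<^bsub>D\<^esub> g \<and>
        (\<forall>v a b. in_hom D a v x \<and> in_hom D b v y \<and> a \<cdot>\<^bsub>D\<^esub> f = b \<cdot>\<^bsub>D\<^esub> g \<longrightarrow>
           (\<exists>!m. in_hom D m v w \<and> m \<cdot>\<^bsub>D\<^esub> p = a \<and> m \<cdot>\<^bsub>D\<^esub> q = b)))"

text \<open>\<open>exponential_diagram D p q e\<close>: in \<open>b \<leftarrow>\<^sup>p w \<rightarrow>\<^sup>q x\<close> and \<open>e : w \<rightarrow> y\<close>, the object \<open>w\<close> is the product
  \<open>b \<times> x\<close>, and \<open>b\<close> is the exponential \<open>y\<^sup>x\<close> with evaluation \<open>e\<close>: every \<open>h : z \<times> x \<rightarrow> y\<close> is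
  \<open>(k \<times> x) \<cdot> e\<close> for a unique \<open>k : z \<rightarrow> b\<close>.\<close>

definition exponential_diagram :: "('o, 'a, 'x) cat_scheme \<Rightarrow> 'a \<Rightarrow> 'a \<Rightarrow> 'a \<Rightarrow> bool" where
  "exponential_diagram D p q e \<longleftrightarrow>
     product_diagram D p q \<and> e \<in> Arr D \<and> Dom D e = Dom D p \<and>
     (\<forall>p' q' h. product_diagram D p' q' \<and> Cod D q' = Cod D q \<and>
        in_hom D h (Dom D p') (Cod D e) \<longrightarrow>
        (\<exists>!k. in_hom D k (Cod D p') (Cod D p) \<and>
           pairing D p q (p' \<cdot>\<^bsub>D\<^esub> k) q' \<cdot>\<^bsub>D\<^esub> e = h))"

definition cartesian_closed_cat :: "('o, 'a, 'x) cat_scheme \<Rightarrow> bool" where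
  "cartesian_closed_cat D \<longleftrightarrow>
     (\<exists>t. is_terminal D t) \<and>
     (\<forall>x \<in> Obj D. \<forall>y \<in> Obj D. \<exists>p q. product_diagram D p q \<and> Cod D p = x \<and> Cod D q = y) \<and>
     (\<forall>x \<in> Obj D. \<forall>y \<in> Obj D. \<exists>p q e.
        exponential_diagram D p q e \<and> Cod D q = x \<and> Cod D e = y)"

definition preserves_finite_products ::
  "('o, 'a, 'x) cat_scheme \<Rightarrow> ('p, 'b, 'y) cat_scheme \<Rightarrow> ('o, 'a, 'p, 'b) fctr \<Rightarrow> bool" where
  "preserves_finite_products D E F \<longleftrightarrow>
     (\<forall>t. is_terminal D t \<longrightarrow> is_terminal E (fst F t)) \<and>
     (\<forall>p q. product_diagram D p q \<longrightarrow> product_diagram E (snd F p) (snd F q))"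

definition preserves_exponentials ::
  "('o, 'a, 'x) cat_scheme \<Rightarrow> ('p, 'b, 'y) cat_scheme \<Rightarrow> ('o, 'a, 'p, 'b) fctr \<Rightarrow> bool" where
  "preserves_exponentials D E F \<longleftrightarrow>
     (\<forall>p q e. exponential_diagram D p q e \<longrightarrow>
        exponential_diagram E (snd F p) (snd F q) (snd F e))"

text \<open>Given exponential diagrams \<open>(p, q, e)\<close> of \<open>y\<^sup>x\<close> and \<open>(p', q', e')\<close> of \<open>y'\<^sup>x\<^sup>'\<close> and arrows
  \<open>\<alpha> : x' \<rightarrow> x\<close>, \<open>\<beta> : y \<rightarrow> y'\<close>, the induced arrow is the \<open>k : y\<^sup>x \<rightarrow> y'\<^sup>x\<^sup>'\<close> for which
  \<open>y\<^sup>x \<times> x' \<rightarrow> y'\<^sup>x\<^sup>' \<times> x' \<rightarrow> y'\<close> equals \<open>y\<^sup>x \<times> x' \<rightarrow> y\<^sup>x \<times> x \<rightarrow> y \<rightarrow> y'\<close>.\<close>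

definition exponential_induced ::
  "('o, 'a, 'x) cat_scheme \<Rightarrow> 'a \<times> 'a \<times> 'a \<Rightarrow> 'a \<times> 'a \<times> 'a \<Rightarrow> 'a \<Rightarrow> 'a \<Rightarrow> 'a \<Rightarrow> bool" where
  "exponential_induced D = (\<lambda>(p, q, e) (p', q', e') \<alpha> \<beta> k.
     in_hom D k (Cod D p) (Cod D p') \<and>
     (\<forall>u v. product_diagram D u v \<and> Cod D u = Cod D p \<and> Cod D v = Cod D q' \<longrightarrow>
        pairing D p' q' (u \<cdot>\<^bsub>D\<^esub> k) v \<cdot>\<^bsub>D\<^esub> e' = pairing D p q u (v \<cdot>\<^bsub>D\<^esub> \<alpha>) \<cdot>\<^bsub>D\<^esub> e \<cdot>\<^bsub>D\<^esub> \<beta>))"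

section \<open>Strict 2-categories\<close>

text \<open>The inherited fields are those of the underlying 1-category; \<open>VComp\<close> and \<open>HComp\<close> are vertical
  and horizontal composition of 2-cells.\<close>

record ('o, 'm, 'c) twocat = "('o, 'm) cat" +
  Cell :: "'c set"
  Dom2 :: "'c \<Rightarrow> 'm"
  Cod2 :: "'c \<Rightarrow> 'm"
  Ide2 :: "'m \<Rightarrow> 'c"
  VComp :: "'c \<Rightarrow> 'c \<Rightarrow> 'c" (infixl "\<bullet>\<index>" 75)
  HComp :: "'c \<Rightarrow> 'c \<Rightarrow> 'c" (infixl "\<star>\<index>" 80)

definition hom_cat :: "('o, 'm, 'c) twocat \<Rightarrow> 'o \<Rightarrow> 'o \<Rightarrow> ('m, 'c) cat" where
  "hom_cat C A X =
     \<lparr>Obj = {f. in_hom C f A X},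
      Arr = {\<alpha> \<in> Cell C. in_hom C (Dom2 C \<alpha>) A X \<and> in_hom C (Cod2 C \<alpha>) A X},
      Dom = Dom2 C, Cod = Cod2 C, Ide = Ide2 C, Comp = VComp C\<rparr>"

locale two_category = category C for C :: "('o, 'm, 'c) twocat" (structure) +
  assumes cell_hom: "\<alpha> \<in> Cell C \<Longrightarrow> \<exists>X Y. \<alpha> \<in> Arr (hom_cat C X Y)"
    and hom_category: "X \<in> Obj C \<Longrightarrow> Y \<in> Obj C \<Longrightarrow> category (hom_cat C X Y)"
    and hcomp_hom: "\<alpha> \<in> Arr (hom_cat C X Y) \<Longrightarrow> \<beta> \<in> Arr (hom_cat C Y Z) \<Longrightarrow>
          in_hom (hom_cat C X Z) (\<alpha> \<star> \<beta>) (Dom2 C \<alpha> \<cdot> Dom2 C \<beta>) (Cod2 C \<alpha> \<cdot> Cod2 C \<beta>)"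
    and hcomp_ide2: "in_hom C f X Y \<Longrightarrow> in_hom C g Y Z \<Longrightarrow>
          Ide2 C f \<star> Ide2 C g = Ide2 C (f \<cdot> g)"
    and interchange: "\<alpha> \<in> Arr (hom_cat C X Y) \<Longrightarrow> \<alpha>' \<in> Arr (hom_cat C X Y) \<Longrightarrow>
          \<beta> \<in> Arr (hom_cat C Y Z) \<Longrightarrow> \<beta>' \<in> Arr (hom_cat C Y Z) \<Longrightarrow>
          Cod2 C \<alpha> = Dom2 C \<alpha>' \<Longrightarrow> Cod2 C \<beta> = Dom2 C \<beta>' \<Longrightarrow>
          (\<alpha> \<bullet> \<alpha>') \<star> (\<beta> \<bullet> \<beta>') = (\<alpha> \<star> \<beta>) \<bullet> (\<alpha>' \<star> \<beta>')"
    and hcomp_assoc: "\<alpha> \<in> Arr (hom_cat C W X) \<Longrightarrow> \<beta> \<in> Arr (hom_cat C X Y) \<Longrightarrow>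
          \<delta> \<in> Arr (hom_cat C Y Z) \<Longrightarrow> (\<alpha> \<star> \<beta>) \<star> \<delta> = \<alpha> \<star> (\<beta> \<star> \<delta>)"
    and ide_hcomp: "\<alpha> \<in> Arr (hom_cat C X Y) \<Longrightarrow> Ide2 C (Ide C X) \<star> \<alpha> = \<alpha>"
    and hcomp_ide: "\<alpha> \<in> Arr (hom_cat C X Y) \<Longrightarrow> \<alpha> \<star> Ide2 C (Ide C Y) = \<alpha>"

definition whisker_l :: "('o, 'm, 'c) twocat \<Rightarrow> 'm \<Rightarrow> 'c \<Rightarrow> 'c" (infixr "\<rhd>\<index>" 80) where
  "f \<rhd>\<^bsub>C\<^esub> \<alpha> = Ide2 C f \<star>\<^bsub>C\<^esub> \<alpha>"

definition whisker_r :: "('o, 'm, 'c) twocat \<Rightarrow> 'c \<Rightarrow> 'm \<Rightarrow> 'c" (infixl "\<lhd>\<index>" 80) where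
  "\<alpha> \<lhd>\<^bsub>C\<^esub> f = \<alpha> \<star>\<^bsub>C\<^esub> Ide2 C f"

text \<open>\<open>postcomp C f\<close> is \<open>f\<^sub>*\<close> and \<open>precomp C f\<close> is \<open>f\<^sup>*\<close>.\<close>

definition postcomp :: "('o, 'm, 'c) twocat \<Rightarrow> 'm \<Rightarrow> ('m, 'c, 'm, 'c) fctr" where
  "postcomp C f = ((\<lambda>h. h \<cdot>\<^bsub>C\<^esub> f), (\<lambda>\<alpha>. \<alpha> \<lhd>\<^bsub>C\<^esub> f))"

definition precomp :: "('o, 'm, 'c) twocat \<Rightarrow> 'm \<Rightarrow> ('m, 'c, 'm, 'c) fctr" where
  "precomp C f = ((\<lambda>h. f \<cdot>\<^bsub>C\<^esub> h), (\<lambda>\<alpha>. f \<rhd>\<^bsub>C\<^esub> \<alpha>))"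

definition isofibration :: "('o, 'm, 'c) twocat \<Rightarrow> 'm \<Rightarrow> bool" where
  "isofibration C f \<longleftrightarrow> f \<in> Arr C \<and>
     (\<forall>A \<in> Obj C. isofibration_functor
        (hom_cat C A (Dom C f)) (hom_cat C A (Cod C f)) (postcomp C f))"

definition discrete_opfibration :: "('o, 'm, 'c) twocat \<Rightarrow> 'm \<Rightarrow> bool" where
  "discrete_opfibration C f \<longleftrightarrow> f \<in> Arr C \<and>
     (\<forall>A \<in> Obj C. dof_functor
        (hom_cat C A (Dom C f)) (hom_cat C A (Cod C f)) (postcomp C f))"

definition groupoid_obj :: "('o, 'm, 'c) twocat \<Rightarrow> 'o \<Rightarrow> bool" where
  "groupoid_obj C X \<longleftrightarrow> X \<in> Obj C \<and> (\<forall>A \<in> Obj C. groupoid_cat (hom_cat C A X))"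

section \<open>Strict limits\<close>

definition strict_terminal :: "('o, 'm, 'c) twocat \<Rightarrow> 'o \<Rightarrow> bool" where
  "strict_terminal C T \<longleftrightarrow> T \<in> Obj C \<and>
     (\<forall>A \<in> Obj C. \<exists>f. Obj (hom_cat C A T) = {f} \<and> Arr (hom_cat C A T) = {Ide2 C f})"

text \<open>The functor \<open>\<C>(B, P) \<rightarrow> \<C>(B, X) \<times> \<C>(B, Y)\<close> given by a span \<open>p\<close>, \<open>q\<close>.\<close>

definition span_functor ::
  "('o, 'm, 'c) twocat \<Rightarrow> 'm \<Rightarrow> 'm \<Rightarrow> ('m, 'c, 'm \<times> 'm, 'c \<times> 'c) fctr" where
  "span_functor C p q =
     ((\<lambda>h. (h \<cdot>\<^bsub>C\<^esub> p, h \<cdot>\<^bsub>C\<^esub> q)), (\<lambda>\<alpha>. (\<alpha> \<lhd>\<^bsub>C\<^esub> p, \<alpha> \<lhd>\<^bsub>C\<^esub> q)))"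

definition strict_product ::
  "('o, 'm, 'c) twocat \<Rightarrow> 'o \<Rightarrow> 'o \<Rightarrow> 'o \<Rightarrow> 'm \<Rightarrow> 'm \<Rightarrow> bool" where
  "strict_product C X Y P p q \<longleftrightarrow> in_hom C p P X \<and> in_hom C q P Y \<and>
     (\<forall>B \<in> Obj C. iso_functor (hom_cat C B P)
        (prod_cat (hom_cat C B X) (hom_cat C B Y)) (span_functor C p q))"

definition strict_pullback ::
  "('o, 'm, 'c) twocat \<Rightarrow> 'm \<Rightarrow> 'm \<Rightarrow> 'm \<Rightarrow> 'm \<Rightarrow> bool" where
  "strict_pullback C p q f g \<longleftrightarrow>
     (\<exists>P X Y Z. in_hom C p P X \<and> in_hom C q P Y \<and> in_hom C f X Z \<and> in_hom C g Y Z \<and>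
        p \<cdot>\<^bsub>C\<^esub> f = q \<cdot>\<^bsub>C\<^esub> g \<and>
        (\<forall>B \<in> Obj C. iso_functor (hom_cat C B P)
           (pullback_cat (hom_cat C B X) (postcomp C f) (hom_cat C B Y) (postcomp C g))
           (span_functor C p q)))"

text \<open>The 2-cell \<open>\<langle>\<alpha>, \<beta>\<rangle>\<close> into the vertex of a strict product with projections \<open>p\<close> and \<open>q\<close>.\<close>

definition pairing2 :: "('o, 'm, 'c) twocat \<Rightarrow> 'm \<Rightarrow> 'm \<Rightarrow> 'c \<Rightarrow> 'c \<Rightarrow> 'c" where
  "pairing2 C p q \<alpha> \<beta> =
     (THE \<theta>. \<theta> \<in> Arr (hom_cat C (Dom C (Dom2 C \<alpha>)) (Dom C p)) \<and>
        \<theta> \<lhd>\<^bsub>C\<^esub> p = \<alpha> \<and> \<theta> \<lhd>\<^bsub>C\<^esub> q = \<beta>)"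

text \<open>The functor \<open>\<C>(A, P) \<rightarrow> Fun(J, \<C>(A, X))\<close> induced by \<open>ev : J \<rightarrow> \<C>(P, X)\<close>.\<close>

definition cotensor_functor ::
  "('o, 'm, 'c) twocat \<Rightarrow> ('i, 'u) cat \<Rightarrow> ('i, 'u, 'm, 'c) fctr \<Rightarrow>
     ('m, 'c, ('i, 'u, 'm, 'c) fctr,
      ('i, 'u, 'm, 'c) fctr \<times> ('i \<Rightarrow> 'c) \<times> ('i, 'u, 'm, 'c) fctr) fctr" where
  "cotensor_functor C J ev =
    (let d = (\<lambda>h. ((\<lambda>j \<in> Obj J. h \<cdot>\<^bsub>C\<^esub> fst ev j), (\<lambda>u \<in> Arr J. h \<rhd>\<^bsub>C\<^esub> snd ev u)))
     in (d, \<lambda>\<theta>. (d (Dom2 C \<theta>), \<lambda>j \<in> Obj J. \<theta> \<lhd>\<^bsub>C\<^esub> fst ev j, d (Cod2 C \<theta>))))"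

definition strict_cotensor ::
  "('o, 'm, 'c) twocat \<Rightarrow> ('i, 'u) cat \<Rightarrow> 'o \<Rightarrow> 'o \<Rightarrow> ('i, 'u, 'm, 'c) fctr \<Rightarrow> bool" where
  "strict_cotensor C J X P ev \<longleftrightarrow>
     X \<in> Obj C \<and> P \<in> Obj C \<and> is_functor J (hom_cat C P X) ev \<and>
     (\<forall>A \<in> Obj C. iso_functor (hom_cat C A P) (fun_cat J (hom_cat C A X))
        (cotensor_functor C J ev))"

text \<open>The morphism \<open>X\<^bsup>J'\<^esup> \<rightarrow> X\<^bsup>J\<^esup>\<close> induced by \<open>\<phi> : J \<rightarrow> J'\<close>.\<close>

definition cotensor_map ::
  "('o, 'm, 'c) twocat \<Rightarrow> ('i, 'u) cat \<Rightarrow> ('i, 'u, 'j, 'v) fctr \<Rightarrow>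
     'o \<Rightarrow> ('j, 'v, 'm, 'c) fctr \<Rightarrow> 'o \<Rightarrow> ('i, 'u, 'm, 'c) fctr \<Rightarrow> 'm" where
  "cotensor_map C J \<phi> P' ev' P ev =
     (THE m. in_hom C m P' P \<and>
        (\<forall>j \<in> Obj J. m \<cdot>\<^bsub>C\<^esub> fst ev j = fst ev' (fst \<phi> j)) \<and>
        (\<forall>u \<in> Arr J. m \<rhd>\<^bsub>C\<^esub> snd ev u = snd ev' (snd \<phi> u)))"

text \<open>\<open>X\<close> itself as the cotensor of \<open>X\<close> with \<open>ordinal 0\<close>.\<close>

definition trivial_ev :: "('o, 'm, 'c) twocat \<Rightarrow> 'o \<Rightarrow> (nat, nat \<times> nat, 'm, 'c) fctr" where
  "trivial_ev C X = ((\<lambda>_. Ide C X), (\<lambda>_. Ide2 C (Ide C X)))"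

definition arrow_object ::
  "('o, 'm, 'c) twocat \<Rightarrow> 'o \<Rightarrow> 'o \<Rightarrow> (nat, nat \<times> nat, 'm, 'c) fctr \<Rightarrow> bool" where
  "arrow_object C = strict_cotensor C (ordinal 1)"

text \<open>The universal 2-cell \<open>\<partial> : \<partial>\<^sub>0 \<Rightarrow> \<partial>\<^sub>1\<close>; here \<open>\<partial>\<^sub>0 = fst ev 0\<close> and \<open>\<partial>\<^sub>1 = fst ev 1\<close>.\<close>

abbreviation univ_cell :: "(nat, nat \<times> nat, 'm, 'c) fctr \<Rightarrow> 'c" where
  "univ_cell ev \<equiv> snd ev (0, 1)"

definition pita :: "('o, 'm, 'c) twocat \<Rightarrow> bool" where
  "pita C \<longleftrightarrow>
     (\<exists>T. strict_terminal C T) \<and>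
     (\<forall>X \<in> Obj C. \<exists>P ev. arrow_object C X P ev) \<and>
     (\<forall>f g. isofibration C f \<and> g \<in> Arr C \<and> Cod C g = Cod C f \<longrightarrow>
        (\<exists>p q. strict_pullback C p q f g))"

section \<open>Cores\<close>

definition arrowwise_iso :: "('o, 'm, 'c) twocat \<Rightarrow> 'm \<Rightarrow> bool" where
  "arrowwise_iso C f \<longleftrightarrow> f \<in> Arr C \<and>
     (\<forall>B \<in> Obj C. \<forall>\<alpha> \<in> Arr (hom_cat C B (Dom C f)).
        is_iso (hom_cat C B (Cod C f)) (\<alpha> \<lhd>\<^bsub>C\<^esub> f))"

definition core_hom_cat :: "('o, 'm, 'c) twocat \<Rightarrow> 'o \<Rightarrow> 'o \<Rightarrow> ('m, 'c) cat" where
  "core_hom_cat C A X = (hom_cat C A X)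
     \<lparr>Obj := {f. in_hom C f A X \<and> arrowwise_iso C f},
      Arr := {\<alpha>. is_iso (hom_cat C A X) \<alpha> \<and>
                 arrowwise_iso C (Dom2 C \<alpha>) \<and> arrowwise_iso C (Cod2 C \<alpha>)}\<rparr>"

definition is_core :: "('o, 'm, 'c) twocat \<Rightarrow> 'o \<Rightarrow> 'o \<Rightarrow> 'm \<Rightarrow> bool" where
  "is_core C X K i \<longleftrightarrow> in_hom C i K X \<and> arrowwise_iso C i \<and>
     (\<forall>A \<in> Obj C. iso_functor (hom_cat C A K) (core_hom_cat C A X) (postcomp C i))"

definition lift_along :: "('o, 'm, 'c) twocat \<Rightarrow> 'm \<Rightarrow> 'm \<Rightarrow> 'm" where
  "lift_along C i f = (THE h. in_hom C h (Dom C f) (Dom C i) \<and> h \<cdot>\<^bsub>C\<^esub> i = f)"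

text \<open>\<open>f\<^sup>i\<^sup>s\<^sup>o\<close> for a morphism \<open>f\<close> between objects with cores \<open>i\<close> and \<open>i'\<close>.\<close>

definition core_map :: "('o, 'm, 'c) twocat \<Rightarrow> 'm \<Rightarrow> 'm \<Rightarrow> 'm \<Rightarrow> 'm" where
  "core_map C i i' f = lift_along C i' (i \<cdot>\<^bsub>C\<^esub> f)"

section \<open>Internal categories and congruences\<close>

record ('o, 'm) intcat =
  C0 :: 'o
  C1 :: 'o
  C2 :: 'o
  pi0 :: 'm
  pi1 :: 'm
  ident :: 'm
  pi01 :: 'm
  pi12 :: 'm
  pi02 :: 'm

text \<open>The composite of generalized elements \<open>a\<close>, \<open>b\<close> of the object of arrows.\<close>

definition icomp :: "('o, 'm, 'x) cat_scheme \<Rightarrow> ('o, 'm) intcat \<Rightarrow> 'm \<Rightarrow> 'm \<Rightarrow> 'm" where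
  "icomp D N a b = pairing D (pi01 N) (pi12 N) a b \<cdot>\<^bsub>D\<^esub> pi02 N"

definition internal_category :: "('o, 'm, 'x) cat_scheme \<Rightarrow> ('o, 'm) intcat \<Rightarrow> bool" where
  "internal_category D N \<longleftrightarrow>
     in_hom D (pi0 N) (C1 N) (C0 N) \<and> in_hom D (pi1 N) (C1 N) (C0 N) \<and>
     in_hom D (ident N) (C0 N) (C1 N) \<and>
     in_hom D (pi01 N) (C2 N) (C1 N) \<and> in_hom D (pi12 N) (C2 N) (C1 N) \<and>
     in_hom D (pi02 N) (C2 N) (C1 N) \<and>
     pullback_square D (pi01 N) (pi12 N) (pi1 N) (pi0 N) \<and>
     ident N \<cdot>\<^bsub>D\<^esub> pi0 N = Ide D (C0 N) \<and> ident N \<cdot>\<^bsub>D\<^esub> pi1 N = Ide D (C0 N) \<and>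
     pi02 N \<cdot>\<^bsub>D\<^esub> pi0 N = pi01 N \<cdot>\<^bsub>D\<^esub> pi0 N \<and>
     pi02 N \<cdot>\<^bsub>D\<^esub> pi1 N = pi12 N \<cdot>\<^bsub>D\<^esub> pi1 N \<and>
     icomp D N (pi0 N \<cdot>\<^bsub>D\<^esub> ident N) (Ide D (C1 N)) = Ide D (C1 N) \<and>
     icomp D N (Ide D (C1 N)) (pi1 N \<cdot>\<^bsub>D\<^esub> ident N) = Ide D (C1 N) \<and>
     (\<forall>A a b c. in_hom D a A (C1 N) \<and> in_hom D b A (C1 N) \<and> in_hom D c A (C1 N) \<and>
        a \<cdot>\<^bsub>D\<^esub> pi1 N = b \<cdot>\<^bsub>D\<^esub> pi0 N \<and> b \<cdot>\<^bsub>D\<^esub> pi1 N = c \<cdot>\<^bsub>D\<^esub> pi0 N \<longrightarrow>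
        icomp D N (icomp D N a b) c = icomp D N a (icomp D N b c))"

text \<open>Products, arrow objects, cores and the like are determined up to isomorphism only. Notions
  that refer to one of them without depending on the choice ask for the existence of a suitable
  choice.\<close>

definition internal_double_category ::
  "('o, 'm, 'c) twocat \<Rightarrow> ('o, 'm) intcat \<Rightarrow> bool" where
  "internal_double_category C N \<longleftrightarrow> internal_category C N \<and>
     (\<exists>Q p q. strict_product C (C0 N) (C0 N) Q p q \<and>
        isofibration C (pairing C p q (pi0 N) (pi1 N)))"

definition gbo_congruence :: "('o, 'm, 'c) twocat \<Rightarrow> ('o, 'm) intcat \<Rightarrow> bool" where
  "gbo_congruence C N \<longleftrightarrow> internal_double_category C N \<and>
     groupoid_obj C (C0 N) \<and> groupoid_obj C (C1 N) \<and> groupoid_obj C (C2 N) \<and>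
     (\<exists>Q p q. strict_product C (C0 N) (C0 N) Q p q \<and>
        discrete_opfibration C (pairing C p q (pi0 N) (pi1 N)))"

text \<open>The reflection morphism; \<open>p\<close>, \<open>q\<close> are the projections of \<open>C\<^sub>0 \<times> C\<^sub>0\<close>, and \<open>P\<close>, \<open>ev\<close> is the arrow
  object of \<open>C\<^sub>0\<close>.\<close>

definition reflection :: "('o, 'm, 'c) twocat \<Rightarrow> ('o, 'm) intcat \<Rightarrow> 'm \<Rightarrow> 'm \<Rightarrow>
    'o \<Rightarrow> (nat, nat \<times> nat, 'm, 'c) fctr \<Rightarrow> 'm" where
  "reflection C N p q P ev =
     (THE r. in_hom C r P (C1 N) \<and>
        (\<exists>\<rho>. in_hom (hom_cat C P (C1 N)) \<rho> r (fst ev 1 \<cdot>\<^bsub>C\<^esub> ident N) \<and>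
             \<rho> \<lhd>\<^bsub>C\<^esub> pairing C p q (pi0 N) (pi1 N) =
               pairing2 C p q (univ_cell ev) (Ide2 C (fst ev 1))))"

definition arrow_reversal ::
  "('o, 'm, 'c) twocat \<Rightarrow> 'o \<Rightarrow> 'o \<Rightarrow> (nat, nat \<times> nat, 'm, 'c) fctr \<Rightarrow> 'm" where
  "arrow_reversal C X P ev =
     (THE t. in_hom C t P P \<and>
        is_inverse (hom_cat C P X) (univ_cell ev) (t \<rhd>\<^bsub>C\<^esub> univ_cell ev))"

text \<open>\<open>\<langle>a, b, c\<rangle>\<close> into \<open>C\<^sub>3\<close>, the pullback with projections \<open>u\<close>, \<open>v\<close> to \<open>C\<^sub>2\<close> (the first two and the
  last two of three composable arrows).\<close>

definition triple :: "('o, 'm, 'x) cat_scheme \<Rightarrow> ('o, 'm) intcat \<Rightarrow> 'm \<Rightarrow> 'm \<Rightarrow>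
    'm \<Rightarrow> 'm \<Rightarrow> 'm \<Rightarrow> 'm" where
  "triple D N u v a b c =
     pairing D u v (pairing D (pi01 N) (pi12 N) a b) (pairing D (pi01 N) (pi12 N) b c)"

definition complete_congruence :: "('o, 'm, 'c) twocat \<Rightarrow> ('o, 'm) intcat \<Rightarrow> bool" where
  "complete_congruence C N \<longleftrightarrow> gbo_congruence C N \<and>
     (\<exists>Q p q R s t u v P ev.
        strict_product C (C0 N) (C0 N) Q p q \<and> strict_product C (C1 N) (C1 N) R s t \<and>
        pullback_square C u v (pi12 N) (pi01 N) \<and> arrow_object C (C0 N) P ev \<and>
        (let r = reflection C N p q P ev;
             \<tau> = arrow_reversal C (C0 N) P ev
         in strict_pullback C
              (triple C N u v r (\<tau> \<cdot>\<^bsub>C\<^esub> r) r)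
              (pairing C p q (fst ev 0) (fst ev 1))
              (pairing C s t (u \<cdot>\<^bsub>C\<^esub> pi02 N) (v \<cdot>\<^bsub>C\<^esub> pi02 N))
              (pairing C s t (p \<cdot>\<^bsub>C\<^esub> ident N) (q \<cdot>\<^bsub>C\<^esub> ident N))))"

section \<open>Nerves and quotients\<close>

text \<open>\<open>nerve C X N \<gamma> \<gamma>\<^sub>0\<^sub>1\<close>: \<open>N\<close> is a nerve of \<open>X\<close>, for some choice of cores and cotensors, and
  \<open>(\<gamma>, \<gamma>\<^sub>0\<^sub>1)\<close> is its tautological cocone.\<close>

definition nerve ::
  "('o, 'm, 'c) twocat \<Rightarrow> 'o \<Rightarrow> ('o, 'm) intcat \<Rightarrow> 'm \<Rightarrow> 'c \<Rightarrow> bool" where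
  "nerve C X N \<gamma> \<gamma>\<^sub>0\<^sub>1 \<longleftrightarrow>
     (\<exists>X1 ev1 X2 ev2 i0 i1 i2.
        arrow_object C X X1 ev1 \<and> strict_cotensor C (ordinal 2) X X2 ev2 \<and>
        is_core C X (C0 N) i0 \<and> is_core C X1 (C1 N) i1 \<and> is_core C X2 (C2 N) i2 \<and>
        (let d0 = (\<lambda>j. core_map C i1 i0
                     (cotensor_map C (ordinal 0) (delta [j]) X1 ev1 X (trivial_ev C X)));
             d = (\<lambda>j k. core_map C i2 i1
                     (cotensor_map C (ordinal 1) (delta [j, k]) X2 ev2 X1 ev1))
         in pi0 N = d0 0 \<and> pi1 N = d0 1 \<and>
            pi01 N = d 0 1 \<and> pi12 N = d 1 2 \<and> pi02 N = d 0 2 \<and>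
            ident N = core_map C i0 i1
              (cotensor_map C (ordinal 1) (delta [0, 0]) X (trivial_ev C X) X1 ev1)) \<and>
        \<gamma> = i0 \<and> \<gamma>\<^sub>0\<^sub>1 = i1 \<rhd>\<^bsub>C\<^esub> univ_cell ev1)"

definition is_cocone ::
  "('o, 'm, 'c) twocat \<Rightarrow> ('o, 'm) intcat \<Rightarrow> 'o \<Rightarrow> 'm \<Rightarrow> 'c \<Rightarrow> bool" where
  "is_cocone C N Y \<gamma> \<gamma>\<^sub>0\<^sub>1 \<longleftrightarrow> in_hom C \<gamma> (C0 N) Y \<and>
     in_hom (hom_cat C (C1 N) Y) \<gamma>\<^sub>0\<^sub>1 (pi0 N \<cdot>\<^bsub>C\<^esub> \<gamma>) (pi1 N \<cdot>\<^bsub>C\<^esub> \<gamma>) \<and>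
     ident N \<rhd>\<^bsub>C\<^esub> \<gamma>\<^sub>0\<^sub>1 = Ide2 C \<gamma> \<and>
     pi02 N \<rhd>\<^bsub>C\<^esub> \<gamma>\<^sub>0\<^sub>1 = (pi01 N \<rhd>\<^bsub>C\<^esub> \<gamma>\<^sub>0\<^sub>1) \<bullet>\<^bsub>C\<^esub> (pi12 N \<rhd>\<^bsub>C\<^esub> \<gamma>\<^sub>0\<^sub>1)"

text \<open>An arrow of cocones is a triple (domain, 2-cell, codomain), since the 2-cell alone does not
  determine the cocones.\<close>

definition cocone_cat :: "('o, 'm, 'c) twocat \<Rightarrow> ('o, 'm) intcat \<Rightarrow> 'o \<Rightarrow>
    ('m \<times> 'c, ('m \<times> 'c) \<times> 'c \<times> ('m \<times> 'c)) cat" where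
  "cocone_cat C N Y =
     \<lparr>Obj = {(\<gamma>, \<gamma>\<^sub>0\<^sub>1). is_cocone C N Y \<gamma> \<gamma>\<^sub>0\<^sub>1},
      Arr = {((\<gamma>, \<gamma>\<^sub>0\<^sub>1), \<alpha>, (\<gamma>', \<gamma>'\<^sub>0\<^sub>1)). is_cocone C N Y \<gamma> \<gamma>\<^sub>0\<^sub>1 \<and> is_cocone C N Y \<gamma>' \<gamma>'\<^sub>0\<^sub>1 \<and>
               in_hom (hom_cat C (C0 N) Y) \<alpha> \<gamma> \<gamma>' \<and>
               (pi0 N \<rhd>\<^bsub>C\<^esub> \<alpha>) \<bullet>\<^bsub>C\<^esub> \<gamma>'\<^sub>0\<^sub>1 = \<gamma>\<^sub>0\<^sub>1 \<bullet>\<^bsub>C\<^esub> (pi1 N \<rhd>\<^bsub>C\<^esub> \<alpha>)},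
      Dom = (\<lambda>(c, \<alpha>, c'). c), Cod = (\<lambda>(c, \<alpha>, c'). c'),
      Ide = (\<lambda>c. (c, Ide2 C (fst c), c)),
      Comp = (\<lambda>(c, \<alpha>, c') (d, \<beta>, d'). (c, \<alpha> \<bullet>\<^bsub>C\<^esub> \<beta>, d'))\<rparr>"

text \<open>The functor \<open>\<C>(X, Y) \<rightarrow> Cocone(N, Y)\<close> induced by a cocone with vertex \<open>X\<close>.\<close>

definition cocone_functor :: "('o, 'm, 'c) twocat \<Rightarrow> 'm \<Rightarrow> 'c \<Rightarrow>
    ('m, 'c, 'm \<times> 'c, ('m \<times> 'c) \<times> 'c \<times> ('m \<times> 'c)) fctr" where
  "cocone_functor C \<gamma> \<gamma>\<^sub>0\<^sub>1 =
     (let k = (\<lambda>h. (\<gamma> \<cdot>\<^bsub>C\<^esub> h, \<gamma>\<^sub>0\<^sub>1 \<lhd>\<^bsub>C\<^esub> h))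
      in (k, \<lambda>\<theta>. (k (Dom2 C \<theta>), \<gamma> \<rhd>\<^bsub>C\<^esub> \<theta>, k (Cod2 C \<theta>))))"

definition strict_quotient ::
  "('o, 'm, 'c) twocat \<Rightarrow> ('o, 'm) intcat \<Rightarrow> 'o \<Rightarrow> 'm \<Rightarrow> 'c \<Rightarrow> bool" where
  "strict_quotient C N X \<gamma> \<gamma>\<^sub>0\<^sub>1 \<longleftrightarrow> is_cocone C N X \<gamma> \<gamma>\<^sub>0\<^sub>1 \<and>
     (\<forall>Y \<in> Obj C. iso_functor (hom_cat C X Y) (cocone_cat C N Y) (cocone_functor C \<gamma> \<gamma>\<^sub>0\<^sub>1))"

definition groupoidant :: "('o, 'm, 'c) twocat \<Rightarrow> bool" where
  "groupoidant C \<longleftrightarrow> pita C \<and>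
     (\<forall>X \<in> Obj C. \<exists>K i. is_core C X K i) \<and>
     (\<forall>N. complete_congruence C N \<longrightarrow> (\<exists>X \<gamma> \<gamma>\<^sub>0\<^sub>1. nerve C X N \<gamma> \<gamma>\<^sub>0\<^sub>1)) \<and>
     (\<forall>X N \<gamma> \<gamma>\<^sub>0\<^sub>1. nerve C X N \<gamma> \<gamma>\<^sub>0\<^sub>1 \<longrightarrow> strict_quotient C N X \<gamma> \<gamma>\<^sub>0\<^sub>1)"

section \<open>Opposites\<close>

definition op_intcat :: "('o, 'm) intcat \<Rightarrow> ('o, 'm) intcat" where
  "op_intcat N = N\<lparr>pi0 := pi1 N, pi1 := pi0 N, pi01 := pi12 N, pi12 := pi01 N\<rparr>"

definition opposition :: "('o, 'm, 'c) twocat \<Rightarrow> ('o, 'm) intcat \<Rightarrow>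
    'o \<Rightarrow> 'm \<Rightarrow> 'c \<Rightarrow> 'o \<Rightarrow> 'm \<Rightarrow> 'c \<Rightarrow> bool" where
  "opposition C N X \<gamma> \<gamma>\<^sub>0\<^sub>1 X\<^sub>o \<gamma>\<^sub>o \<gamma>\<^sub>o\<^sub>0\<^sub>1 \<longleftrightarrow> complete_congruence C N \<and>
     strict_quotient C N X \<gamma> \<gamma>\<^sub>0\<^sub>1 \<and> strict_quotient C (op_intcat N) X\<^sub>o \<gamma>\<^sub>o \<gamma>\<^sub>o\<^sub>0\<^sub>1"

definition op1 :: "('o, 'm, 'c) twocat \<Rightarrow> 'm \<Rightarrow> 'm \<Rightarrow> 'm \<Rightarrow> 'm" where
  "op1 C \<gamma> \<gamma>\<^sub>o f = lift_along C \<gamma> f \<cdot>\<^bsub>C\<^esub> \<gamma>\<^sub>o"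

definition op2 ::
  "('o, 'm, 'c) twocat \<Rightarrow> ('o, 'm) intcat \<Rightarrow> 'c \<Rightarrow> 'c \<Rightarrow> 'c \<Rightarrow> 'c" where
  "op2 C N \<gamma>\<^sub>0\<^sub>1 \<gamma>\<^sub>o\<^sub>0\<^sub>1 \<alpha> =
     (THE a. in_hom C a (Dom C (Dom2 C \<alpha>)) (C1 N) \<and> a \<rhd>\<^bsub>C\<^esub> \<gamma>\<^sub>0\<^sub>1 = \<alpha>) \<rhd>\<^bsub>C\<^esub> \<gamma>\<^sub>o\<^sub>0\<^sub>1"

section \<open>Cartesian closed objects and exponential morphisms\<close>

definition cartesian_closed_obj :: "('o, 'm, 'c) twocat \<Rightarrow> 'o \<Rightarrow> bool" where
  "cartesian_closed_obj C X \<longleftrightarrow> X \<in> Obj C \<and>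
     (\<forall>A. groupoid_obj C A \<longrightarrow> cartesian_closed_cat (hom_cat C A X)) \<and>
     (\<forall>A A' f. groupoid_obj C A \<and> groupoid_obj C A' \<and> in_hom C f A' A \<longrightarrow>
        preserves_finite_products (hom_cat C A X) (hom_cat C A' X) (precomp C f) \<and>
        preserves_exponentials (hom_cat C A X) (hom_cat C A' X) (precomp C f))"

text \<open>The preorder on \<open>{0, 1, 2, 3}\<close> generated by \<open>3 \<rightarrow> 2\<close>, \<open>3 \<rightarrow> 0\<close> and \<open>3 \<rightarrow> 1\<close>.\<close>

definition L_cat :: "(nat, nat \<times> nat) cat" where
  "L_cat = preorder_cat {0..3} (\<lambda>i j. i = j \<or> i = 3)"

definition L_diagrams ::
  "('o, 'm, 'c) twocat \<Rightarrow> 'o \<Rightarrow> 'o \<Rightarrow> (nat, nat \<times> nat, 'm, 'c) fctr set" where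
  "L_diagrams C A X =
     {F. \<forall>A' h. in_hom C h A' A \<longrightarrow>
        product_diagram (hom_cat C A' X) (h \<rhd>\<^bsub>C\<^esub> snd F (3, 2)) (h \<rhd>\<^bsub>C\<^esub> snd F (3, 0))}"

definition L_object ::
  "('o, 'm, 'c) twocat \<Rightarrow> 'o \<Rightarrow> 'o \<Rightarrow> (nat, nat \<times> nat, 'm, 'c) fctr \<Rightarrow> bool" where
  "L_object C X L ev \<longleftrightarrow>
     X \<in> Obj C \<and> L \<in> Obj C \<and> is_functor L_cat (hom_cat C L X) ev \<and>
     (\<forall>A \<in> Obj C. iso_functor (hom_cat C A L)
        (full_subcat (fun_cat L_cat (hom_cat C A X)) (L_diagrams C A X))
        (cotensor_functor C L_cat ev))"

text \<open>The arrows \<open>3 \<rightarrow> 2\<close>, \<open>3 \<rightarrow> 0\<close>, \<open>3 \<rightarrow> 1\<close> of the diagram corresponding to \<open>d : A \<rightarrow> L\<close>.\<close>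

definition L_arrows ::
  "('o, 'm, 'c) twocat \<Rightarrow> (nat, nat \<times> nat, 'm, 'c) fctr \<Rightarrow> 'm \<Rightarrow> 'c \<times> 'c \<times> 'c" where
  "L_arrows C ev d = (d \<rhd>\<^bsub>C\<^esub> snd ev (3, 2), d \<rhd>\<^bsub>C\<^esub> snd ev (3, 0), d \<rhd>\<^bsub>C\<^esub> snd ev (3, 1))"

definition exponential_object_diagram ::
  "('o, 'm, 'c) twocat \<Rightarrow> 'o \<Rightarrow> (nat, nat \<times> nat, 'm, 'c) fctr \<Rightarrow> 'm \<Rightarrow> bool" where
  "exponential_object_diagram C X ev d \<longleftrightarrow>
     (case L_arrows C ev d of (p, q, e) \<Rightarrow> exponential_diagram (hom_cat C (Dom C d) X) p q e)"

text \<open>\<open>exponential_morphism\<close>: \<open>P\<close> is the product of \<open>X\<^sub>o\<close>, the opposite of \<open>X\<close>, and \<open>X\<close>, with projections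
  \<open>p\<close> and \<open>q\<close>. In the body, \<open>S\<close> is \<open>X \<times> X\<close> with core \<open>i\<close>, and \<open>L\<close> is the object of \<open>L_cat\<close>-diagrams
  with core \<open>j\<close>. The morphism \<open>diag f g\<close> is \<open>\<langle>f, g\<rangle>\<^sup>i\<^sup>s\<^sup>o E j\<close>, and \<open>diag f g \<cdot> fst ev 2\<close> is the exponential
  object \<open>g\<^sup>f\<close> underlying it.\<close>

definition exponential_morphism :: "('o, 'm, 'c) twocat \<Rightarrow> ('o, 'm) intcat \<Rightarrow>
    'o \<Rightarrow> 'm \<Rightarrow> 'c \<Rightarrow> 'm \<Rightarrow> 'c \<Rightarrow> 'o \<Rightarrow> 'm \<Rightarrow> 'm \<Rightarrow> 'm \<Rightarrow> bool" where
  "exponential_morphism C N X \<gamma> \<gamma>\<^sub>0\<^sub>1 \<gamma>\<^sub>o \<gamma>\<^sub>o\<^sub>0\<^sub>1 P p q ex \<longleftrightarrow> in_hom C ex P X \<and>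
     (\<exists>S s t K i L ev M j E.
        strict_product C X X S s t \<and> is_core C S K i \<and>
        L_object C X L ev \<and> is_core C L M j \<and>
        in_hom C E K M \<and>
        E \<cdot>\<^bsub>C\<^esub> core_map C j i (pairing C s t (fst ev 0) (fst ev 1)) = Ide C K \<and>
        (let diag = (\<lambda>f g. lift_along C i (pairing C s t f g) \<cdot>\<^bsub>C\<^esub> E \<cdot>\<^bsub>C\<^esub> j)
         in \<forall>A. groupoid_obj C A \<longrightarrow>
              (\<forall>f g. in_hom C f A X \<and> in_hom C g A X \<longrightarrow>
                 exponential_object_diagram C X ev (diag f g) \<and>
                 pairing C p q (op1 C \<gamma> \<gamma>\<^sub>o f) g \<cdot>\<^bsub>C\<^esub> ex = diag f g \<cdot>\<^bsub>C\<^esub> fst ev 2) \<and>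
              (\<forall>f f' g g' \<alpha> \<beta>.
                 in_hom C f A X \<and> in_hom C f' A X \<and> in_hom C g A X \<and> in_hom C g' A X \<and>
                 in_hom (hom_cat C A X) \<alpha> f' f \<and> in_hom (hom_cat C A X) \<beta> g g' \<longrightarrow>
                 exponential_induced (hom_cat C A X)
                   (L_arrows C ev (diag f g)) (L_arrows C ev (diag f' g')) \<alpha> \<beta>
                   (pairing2 C p q (op2 C N \<gamma>\<^sub>0\<^sub>1 \<gamma>\<^sub>o\<^sub>0\<^sub>1 \<alpha>) \<beta> \<lhd>\<^bsub>C\<^esub> ex))))"

end

theory Submission
  imports Defs
begin

text \<open>Every object is the strict quotient of its nerve, so morphisms and 2-cells out of \<open>X\<^sub>o \<times> X\<close> amount to
  compatible data on groupoids. Choosing an exponential diagram for the universal pair of morphisms,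
  which lives on the core of \<open>X \<times> X\<close>, and restricting it along arbitrary morphisms between groupoids gives
  exponentials \<open>g\<^sup>f\<close> that are strictly natural; the induced arrows then form a cocone under the nerve of
  \<open>X\<^sub>o \<times> X\<close>, whose quotient morphism is \<open>exp\<close>. Two such choices of exponentials are compared by a unique
  family of induced isomorphisms, which is a morphism of cocones and hence descends to an isomorphism.
  For \<open>X\<^sub>o\<close>, the opposite of a complete congruence is again complete, because its reflection morphism is
  \<open>\<tau> r\<close>, so that it too is a nerve.\<close>

text \<open>Opposites of morphisms and 2-cells are available only out of groupoids, and cartesian
  closedness is assumed only there, so no formula gives \<open>exp\<close> at a general stage; this
  forces the detour through nerves. Strict naturality is possible because every pair
  \<open>f\<close>, \<open>g\<close> out of a groupoid factors uniquely through the core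
  \<open>K\<close> of \<open>X\<close> times \<open>X\<close>; the morphism \<open>E\<close> encodes
  the diagram chosen over \<open>K\<close>. All cocone identities then follow from uniqueness of
  induced arrows, once these are closed under identities, composition and restriction. The object of
  exponential-shaped diagrams is harder, since its product condition quantifies over all stages and
  not only over groupoids. Products over groupoids are therefore first assembled into a single
  morphism \<open>m\<close> from \<open>X\<close> times \<open>X\<close> to \<open>X\<close> that is
  a product at every stage. A product diagram then amounts to a pair of morphisms with an
  isomorphism onto the corresponding restriction of \<open>m\<close>, and this is classified by
  pullbacks along isofibrations; hence the classifiers of composable pairs, retractions and
  isomorphisms.\<close>

subsection \<open>Products and exponentials in a category\<close>

context category
begin

lemma in_homD:
  assumes "in_hom D f x y"
  shows "f \<in> Arr D" "Dom D f = x" "Cod D f = y" "x \<in> Obj D" "y \<in> Obj D"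
  using assms dom_obj cod_obj by (auto simp: in_hom_def)

lemma comp_in_Arr [simp]: "f \<in> Arr D \<Longrightarrow> g \<in> Arr D \<Longrightarrow> Cod D f = Dom D g \<Longrightarrow> f \<cdot> g \<in> Arr D"
  and Dom_comp [simp]: "f \<in> Arr D \<Longrightarrow> g \<in> Arr D \<Longrightarrow> Cod D f = Dom D g \<Longrightarrow> Dom D (f \<cdot> g) = Dom D f"
  and Cod_comp [simp]: "f \<in> Arr D \<Longrightarrow> g \<in> Arr D \<Longrightarrow> Cod D f = Dom D g \<Longrightarrow> Cod D (f \<cdot> g) = Cod D g"
  using comp_hom[of f "Dom D f" "Cod D f" g "Cod D g"] by (auto simp: in_hom_def)

lemma Ide_in_Arr [simp]: "x \<in> Obj D \<Longrightarrow> Ide D x \<in> Arr D"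
  and Dom_Ide [simp]: "x \<in> Obj D \<Longrightarrow> Dom D (Ide D x) = x"
  and Cod_Ide [simp]: "x \<in> Obj D \<Longrightarrow> Cod D (Ide D x) = x"
  using ide_hom by (auto simp: in_hom_def)

lemma Dom_in_Obj [simp]: "f \<in> Arr D \<Longrightarrow> Dom D f \<in> Obj D"
  and Cod_in_Obj [simp]: "f \<in> Arr D \<Longrightarrow> Cod D f \<in> Obj D"
  using dom_obj cod_obj by auto

lemma Ide_comp [simp]: "f \<in> Arr D \<Longrightarrow> Dom D f = x \<Longrightarrow> Ide D x \<cdot> f = f"
  and comp_Ide [simp]: "f \<in> Arr D \<Longrightarrow> Cod D f = x \<Longrightarrow> f \<cdot> Ide D x = f"
  using ide_comp[of f x] comp_ide[of f _ x] by (auto simp: in_hom_def)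

lemma comp_assoc' [simp]:
  "f \<in> Arr D \<Longrightarrow> g \<in> Arr D \<Longrightarrow> h \<in> Arr D \<Longrightarrow> Cod D f = Dom D g \<Longrightarrow> Cod D g = Dom D h \<Longrightarrow>
   (f \<cdot> g) \<cdot> h = f \<cdot> (g \<cdot> h)"
  using comp_assoc[of f _ _ g _ h] by (auto simp: in_hom_def)

lemma is_inverse_unique:
  assumes "is_inverse D f g" "is_inverse D f g'"
  shows "g = g'"
proof -
  have "(g \<cdot> f) \<cdot> g' = g \<cdot> (f \<cdot> g')"
    by (rule comp_assoc') (use assms in \<open>auto simp: is_inverse_def in_hom_def\<close>)
  then show ?thesis using assms by (auto simp: is_inverse_def in_hom_def)
qed

lemma is_inverse_comp:
  assumes "is_inverse D f f'" "is_inverse D g g'" "Cod D f = Dom D g"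
  shows "is_inverse D (f \<cdot> g) (g' \<cdot> f')"
proof -
  have T: "f \<in> Arr D" "g \<in> Arr D" "f' \<in> Arr D" "g' \<in> Arr D" "Dom D f' = Dom D g" "Cod D f' = Dom D f"
    "Dom D g' = Cod D g" "Cod D g' = Dom D g"
    using assms by (auto simp: is_inverse_def in_hom_def)
  have "(f \<cdot> g) \<cdot> (g' \<cdot> f') = f \<cdot> ((g \<cdot> g') \<cdot> f')" "(g' \<cdot> f') \<cdot> (f \<cdot> g) = g' \<cdot> ((f' \<cdot> f) \<cdot> g)"
    using T assms(3) by auto
  moreover have "g \<cdot> g' = Ide D (Dom D g)" "f' \<cdot> f = Ide D (Dom D g)" "f \<cdot> f' = Ide D (Dom D f)"
    "g' \<cdot> g = Ide D (Cod D g)"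
    using assms by (auto simp: is_inverse_def in_hom_def)
  ultimately show ?thesis using T assms(3) by (auto simp: is_inverse_def in_hom_def)
qed

section \<open>Mediating arrows into products\<close>

lemma product_diagram_arr:
  "product_diagram D p q \<Longrightarrow> p \<in> Arr D \<and> q \<in> Arr D \<and> Dom D q = Dom D p"
  unfolding product_diagram_def by metis

lemma pairing_hom:
  assumes "product_diagram D p q" "in_hom D a z (Cod D p)" "in_hom D b z (Cod D q)"
  shows "in_hom D (pairing D p q a b) z (Dom D p)" "pairing D p q a b \<cdot> p = a"
    "pairing D p q a b \<cdot> q = b"
proof -
  have "\<exists>!m. in_hom D m z (Dom D p) \<and> m \<cdot> p = a \<and> m \<cdot> q = b"
    using assms unfolding product_diagram_def by blast
  then have "\<exists>!m. in_hom D m (Dom D a) (Dom D p) \<and> m \<cdot> p = a \<and> m \<cdot> q = b"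
    using assms(2) by (simp add: in_hom_def)
  from theI'[OF this] show "in_hom D (pairing D p q a b) z (Dom D p)"
    "pairing D p q a b \<cdot> p = a" "pairing D p q a b \<cdot> q = b"
    using assms by (auto simp: pairing_def in_hom_def)
qed

lemma product_arr_eqI:
  assumes "product_diagram D p q" "in_hom D m z (Dom D p)" "in_hom D m' z (Dom D p)"
    "m \<cdot> p = m' \<cdot> p" "m \<cdot> q = m' \<cdot> q"
  shows "m = m'"
proof -
  have "in_hom D (m \<cdot> p) z (Cod D p)" "in_hom D (m \<cdot> q) z (Cod D q)"
    using assms by (auto simp: in_hom_def dest: product_diagram_arr)
  then show ?thesis using assms unfolding product_diagram_def by metis
qed

lemma pairing_eqI:
  assumes "product_diagram D p q" "in_hom D m z (Dom D p)" "m \<cdot> p = a" "m \<cdot> q = b"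
  shows "pairing D p q a b = m"
proof -
  have "in_hom D a z (Cod D p)" "in_hom D b z (Cod D q)"
    using assms by (auto simp: in_hom_def dest: product_diagram_arr)
  note * = pairing_hom[OF assms(1) this]
  show ?thesis by (rule product_arr_eqI[OF assms(1) *(1) assms(2)]) (use * assms in auto)
qed

lemma comp_pairing:
  assumes "product_diagram D p q" "in_hom D a z (Cod D p)" "in_hom D b z (Cod D q)" "in_hom D n y z"
  shows "n \<cdot> pairing D p q a b = pairing D p q (n \<cdot> a) (n \<cdot> b)"
proof (rule pairing_eqI[symmetric, OF assms(1)])
  note * = pairing_hom[OF assms(1-3)]
  show "in_hom D (n \<cdot> pairing D p q a b) y (Dom D p)" using * assms(4) by (auto simp: in_hom_def)
  show "n \<cdot> pairing D p q a b \<cdot> p = n \<cdot> a" "n \<cdot> pairing D p q a b \<cdot> q = n \<cdot> b"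
    using * assms by (auto simp: in_hom_def dest: product_diagram_arr)
qed

section \<open>Induced arrows between exponentials\<close>

lemma exponential_induced_iff:
  "exponential_induced D (p, q, e) (p', q', e') \<alpha> \<beta> k \<longleftrightarrow> in_hom D k (Cod D p) (Cod D p') \<and>
     (\<forall>u v. product_diagram D u v \<and> Cod D u = Cod D p \<and> Cod D v = Cod D q' \<longrightarrow>
        pairing D p' q' (u \<cdot> k) v \<cdot> e' = pairing D p q u (v \<cdot> \<alpha>) \<cdot> e \<cdot> \<beta>)"
  by (simp add: exponential_induced_def)

text \<open>The definition quantifies over all products of \<open>Cod D p\<close> and
  \<open>Cod D q'\<close>. Any pair of generalized elements \<open>a\<close>, \<open>b\<close>
  factors through the single product \<open>u\<close>, \<open>v\<close>, so precomposing the
  equation there with the mediating arrow gives it for every pair, in particular for the projections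
  of every other product.\<close>

lemma exponential_inducedI:
  assumes d: "product_diagram D p q" "product_diagram D p' q'"
    and e: "in_hom D e (Dom D p) y" "in_hom D e' (Dom D p') y'"
    and \<alpha>: "in_hom D \<alpha> (Cod D q') (Cod D q)" and \<beta>: "in_hom D \<beta> y y'"
    and k: "in_hom D k (Cod D p) (Cod D p')"
    and uv: "product_diagram D u v" "Cod D u = Cod D p" "Cod D v = Cod D q'"
    and eq: "pairing D p' q' (u \<cdot> k) v \<cdot> e' = pairing D p q u (v \<cdot> \<alpha>) \<cdot> e \<cdot> \<beta>"
  shows exponential_induced_elements: "\<And>z a b. in_hom D a z (Cod D p) \<Longrightarrow> in_hom D b z (Cod D q') \<Longrightarrow>
      pairing D p' q' (a \<cdot> k) b \<cdot> e' = pairing D p q a (b \<cdot> \<alpha>) \<cdot> e \<cdot> \<beta>"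
    and "exponential_induced D (p, q, e) (p', q', e') \<alpha> \<beta> k"
proof -
  show *: "pairing D p' q' (a \<cdot> k) b \<cdot> e' = pairing D p q a (b \<cdot> \<alpha>) \<cdot> e \<cdot> \<beta>"
    if a: "in_hom D a z (Cod D p)" and b: "in_hom D b z (Cod D q')" for z a b
  proof -
    have u: "in_hom D u (Dom D u) (Cod D p)" "in_hom D v (Dom D u) (Cod D q')"
      using uv by (auto simp: in_hom_def dest: product_diagram_arr)
    define n where "n = pairing D u v a b"
    have n: "in_hom D n z (Dom D u)" "n \<cdot> u = a" "n \<cdot> v = b"
      using pairing_hom[OF uv(1), of a z b] a b uv by (auto simp: n_def)
    have uk: "in_hom D (u \<cdot> k) (Dom D u) (Cod D p')" "in_hom D (v \<cdot> \<alpha>) (Dom D u) (Cod D q)"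
      using u k \<alpha> by (auto simp: in_hom_def)
    note P1 = pairing_hom[OF d(2) uk(1) u(2)] and P2 = pairing_hom[OF d(1) u(1) uk(2)]
    have "n \<cdot> pairing D p' q' (u \<cdot> k) v = pairing D p' q' (a \<cdot> k) b"
      using comp_pairing[OF d(2) uk(1) u(2) n(1)] n(2,3)[symmetric] n(1) u k by (auto simp: in_hom_def)
    moreover have "n \<cdot> pairing D p q u (v \<cdot> \<alpha>) = pairing D p q a (b \<cdot> \<alpha>)"
      using comp_pairing[OF d(1) u(1) uk(2) n(1)] n(2,3)[symmetric] n(1) u \<alpha> by (auto simp: in_hom_def)
    moreover have "n \<cdot> pairing D p' q' (u \<cdot> k) v \<cdot> e' = n \<cdot> pairing D p q u (v \<cdot> \<alpha>) \<cdot> e \<cdot> \<beta>"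
      using eq n(1) P1 P2 e \<beta> by (auto simp: in_hom_def)
    ultimately show ?thesis by simp
  qed
  show "exponential_induced D (p, q, e) (p', q', e') \<alpha> \<beta> k"
    unfolding exponential_induced_iff
  proof (intro conjI allI impI k)
    fix u v assume "product_diagram D u v \<and> Cod D u = Cod D p \<and> Cod D v = Cod D q'"
    then have "in_hom D u (Dom D u) (Cod D p)" "in_hom D v (Dom D u) (Cod D q')"
      by (auto simp: in_hom_def dest: product_diagram_arr)
    then show "pairing D p' q' (u \<cdot> k) v \<cdot> e' = pairing D p q u (v \<cdot> \<alpha>) \<cdot> e \<cdot> \<beta>" by (rule *)
  qed
qed

lemma cartesian_closed_productE:
  assumes "cartesian_closed_cat D" "x \<in> Obj D" "y \<in> Obj D"
  obtains u v where "product_diagram D u v" "Cod D u = x" "Cod D v = y"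
  using assms unfolding cartesian_closed_cat_def by blast

lemma exponential_diagramD:
  assumes "exponential_diagram D p q e"
  shows "product_diagram D p q" "p \<in> Arr D" "q \<in> Arr D" "e \<in> Arr D"
    "Dom D q = Dom D p" "Dom D e = Dom D p"
    "in_hom D e (Dom D p) (Cod D e)" "Cod D p \<in> Obj D" "Cod D q \<in> Obj D" "Cod D e \<in> Obj D"
proof -
  have "product_diagram D p q \<and> e \<in> Arr D \<and> Dom D e = Dom D p"
    using assms unfolding exponential_diagram_def by blast
  with product_diagram_arr[of p q] show "product_diagram D p q" "p \<in> Arr D" "q \<in> Arr D" "e \<in> Arr D"
    "Dom D q = Dom D p" "Dom D e = Dom D p"
    "in_hom D e (Dom D p) (Cod D e)" "Cod D p \<in> Obj D" "Cod D q \<in> Obj D" "Cod D e \<in> Obj D"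
    by (auto simp: in_hom_def)
qed

text \<open>The definition speaks only of products, so some product of \<open>Cod D p\<close> and
  \<open>Cod D q'\<close> has to exist before the equation can be read at arbitrary elements;
  \<open>cc\<close> supplies one.\<close>

lemma exponential_inducedD:
  assumes cc: "cartesian_closed_cat D"
    and d: "exponential_diagram D p q e" "exponential_diagram D p' q' e'"
    and \<alpha>: "in_hom D \<alpha> (Cod D q') (Cod D q)" and \<beta>: "in_hom D \<beta> (Cod D e) (Cod D e')"
    and k: "exponential_induced D (p, q, e) (p', q', e') \<alpha> \<beta> k"
    and "in_hom D a z (Cod D p)" "in_hom D b z (Cod D q')"
  shows "pairing D p' q' (a \<cdot> k) b \<cdot> e' = pairing D p q a (b \<cdot> \<alpha>) \<cdot> e \<cdot> \<beta>"
proof -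
  note D = exponential_diagramD[OF d(1)] exponential_diagramD[OF d(2)]
  obtain u v where uv: "product_diagram D u v" "Cod D u = Cod D p" "Cod D v = Cod D q'"
    using cartesian_closed_productE[OF cc] D by metis
  have "in_hom D k (Cod D p) (Cod D p')"
    "pairing D p' q' (u \<cdot> k) v \<cdot> e' = pairing D p q u (v \<cdot> \<alpha>) \<cdot> e \<cdot> \<beta>"
    using k uv unfolding exponential_induced_iff by blast+
  then show ?thesis
    using exponential_induced_elements[OF D(1) D(11) D(7) D(17) \<alpha> \<beta> _ uv] assms(7,8) by blast
qed

text \<open>Over one product \<open>u\<close>, \<open>v\<close>, the defining equation is the
  universal property of the second exponential applied to \<open>pairing D p q u (v \<cdot>
  \<alpha>) \<cdot> e \<cdot> \<beta>\<close>. It yields exactly one \<open>k\<close>, and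
  \<open>exponential_inducedI\<close> carries the equation to all other products.\<close>

lemma exponential_induced_unique:
  assumes cc: "cartesian_closed_cat D"
    and d: "exponential_diagram D p q e" "exponential_diagram D p' q' e'"
    and \<alpha>: "in_hom D \<alpha> (Cod D q') (Cod D q)" and \<beta>: "in_hom D \<beta> (Cod D e) (Cod D e')"
  shows "\<exists>!k. exponential_induced D (p, q, e) (p', q', e') \<alpha> \<beta> k"
proof -
  note D = exponential_diagramD[OF d(1)] exponential_diagramD[OF d(2)]
  obtain u v where uv: "product_diagram D u v" "Cod D u = Cod D p" "Cod D v = Cod D q'"
    using cartesian_closed_productE[OF cc] D by metis
  have u: "in_hom D u (Dom D u) (Cod D p)" "in_hom D (v \<cdot> \<alpha>) (Dom D u) (Cod D q)"
    using uv \<alpha> by (auto simp: in_hom_def dest: product_diagram_arr)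
  have "in_hom D (pairing D p q u (v \<cdot> \<alpha>) \<cdot> e \<cdot> \<beta>) (Dom D u) (Cod D e')"
    using pairing_hom[OF D(1) u] D \<beta> by (auto simp: in_hom_def)
  then have ex1: "\<exists>!k. in_hom D k (Cod D u) (Cod D p') \<and>
      pairing D p' q' (u \<cdot> k) v \<cdot> e' = pairing D p q u (v \<cdot> \<alpha>) \<cdot> e \<cdot> \<beta>"
    using d(2) uv unfolding exponential_diagram_def by (metis (no_types, lifting))
  then obtain k where "in_hom D k (Cod D u) (Cod D p')"
      "pairing D p' q' (u \<cdot> k) v \<cdot> e' = pairing D p q u (v \<cdot> \<alpha>) \<cdot> e \<cdot> \<beta>" by blast
  then have "exponential_induced D (p, q, e) (p', q', e') \<alpha> \<beta> k"
    using exponential_inducedI(2)[OF D(1) D(11) D(7) D(17) \<alpha> \<beta> _ uv] uv by auto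
  moreover have "k' = k" if "exponential_induced D (p, q, e) (p', q', e') \<alpha> \<beta> k'"
      "exponential_induced D (p, q, e) (p', q', e') \<alpha> \<beta> k" for k k'
    using ex1 that uv unfolding exponential_induced_iff by metis
  ultimately show ?thesis by blast
qed

lemma exponential_induced_Ide:
  assumes d: "exponential_diagram D p q e"
  shows "exponential_induced D (p, q, e) (p, q, e) (Ide D (Cod D q)) (Ide D (Cod D e)) (Ide D (Cod D p))"
proof -
  note D = exponential_diagramD[OF d]
  have "pairing D p q (u \<cdot> Ide D (Cod D p)) v \<cdot> e =
      pairing D p q u (v \<cdot> Ide D (Cod D q)) \<cdot> e \<cdot> Ide D (Cod D e)"
    if "product_diagram D u v \<and> Cod D u = Cod D p \<and> Cod D v = Cod D q" for u v
  proof -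
    have "in_hom D u (Dom D u) (Cod D p)" "in_hom D v (Dom D u) (Cod D q)"
      using that by (auto simp: in_hom_def dest: product_diagram_arr)
    from this pairing_hom[OF D(1) this] D show ?thesis by (auto simp: in_hom_def)
  qed
  then show ?thesis using D unfolding exponential_induced_iff by (simp add: in_hom_def)
qed

text \<open>Evaluation is unfolded twice: first for \<open>k'\<close> at the elements
  \<open>u \<cdot> k\<close> and \<open>v\<close>, then for \<open>k\<close> at \<open>u\<close> and
  \<open>v \<cdot> \<alpha>'\<close>. These are not pairs of projections, hence the element form of
  the equation.\<close>

lemma exponential_induced_comp:
  assumes cc: "cartesian_closed_cat D"
    and d: "exponential_diagram D p q e" "exponential_diagram D p' q' e'" "exponential_diagram D p'' q'' e''"
    and \<alpha>: "in_hom D \<alpha> (Cod D q') (Cod D q)" and \<beta>: "in_hom D \<beta> (Cod D e) (Cod D e')"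
    and \<alpha>': "in_hom D \<alpha>' (Cod D q'') (Cod D q')" and \<beta>': "in_hom D \<beta>' (Cod D e') (Cod D e'')"
    and k: "exponential_induced D (p, q, e) (p', q', e') \<alpha> \<beta> k"
    and k': "exponential_induced D (p', q', e') (p'', q'', e'') \<alpha>' \<beta>' k'"
  shows "exponential_induced D (p, q, e) (p'', q'', e'') (\<alpha>' \<cdot> \<alpha>) (\<beta> \<cdot> \<beta>') (k \<cdot> k')"
proof -
  have kh: "in_hom D k (Cod D p) (Cod D p')" "in_hom D k' (Cod D p') (Cod D p'')"
    using k k' unfolding exponential_induced_iff by blast+
  note D = exponential_diagramD[OF d(1)] exponential_diagramD[OF d(2)] exponential_diagramD[OF d(3)]
  have "pairing D p'' q'' (u \<cdot> (k \<cdot> k')) v \<cdot> e'' = pairing D p q u (v \<cdot> (\<alpha>' \<cdot> \<alpha>)) \<cdot> e \<cdot> (\<beta> \<cdot> \<beta>')"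
    if "product_diagram D u v \<and> Cod D u = Cod D p \<and> Cod D v = Cod D q''" for u v
  proof -
    have u: "in_hom D u (Dom D u) (Cod D p)" "in_hom D v (Dom D u) (Cod D q'')"
      using that by (auto simp: in_hom_def dest: product_diagram_arr)
    have uk: "in_hom D (u \<cdot> k) (Dom D u) (Cod D p')" "in_hom D (v \<cdot> \<alpha>') (Dom D u) (Cod D q')"
      "in_hom D (v \<cdot> \<alpha>' \<cdot> \<alpha>) (Dom D u) (Cod D q)"
      using u kh \<alpha> \<alpha>' by (auto simp: in_hom_def)
    have "pairing D p'' q'' (u \<cdot> k \<cdot> k') v \<cdot> e'' = pairing D p' q' (u \<cdot> k) (v \<cdot> \<alpha>') \<cdot> e' \<cdot> \<beta>'"
      by (rule exponential_inducedD[OF cc d(2,3) \<alpha>' \<beta>' k' uk(1) u(2)])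
    also have "pairing D p' q' (u \<cdot> k) (v \<cdot> \<alpha>') \<cdot> e' = pairing D p q u (v \<cdot> \<alpha>' \<cdot> \<alpha>) \<cdot> e \<cdot> \<beta>"
      by (rule exponential_inducedD[OF cc d(1,2) \<alpha> \<beta> k u(1) uk(2)])
    finally show ?thesis using u kh \<alpha> \<alpha>' \<beta> \<beta>' pairing_hom[OF D(1) u(1) uk(3)] D
      by (auto simp: in_hom_def)
  qed
  moreover have "in_hom D (k \<cdot> k') (Cod D p) (Cod D p'')" using kh by (auto simp: in_hom_def)
  ultimately show ?thesis unfolding exponential_induced_iff by blast
qed

section \<open>Product diagrams up to isomorphism\<close>

lemma product_diagram_iso:
  assumes pq: "product_diagram D p q" and \<sigma>: "is_inverse D \<sigma> \<sigma>'" "Cod D \<sigma> = Dom D p"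
  shows "product_diagram D (\<sigma> \<cdot> p) (\<sigma> \<cdot> q)"
proof -
  have h: "p \<in> Arr D" "q \<in> Arr D" "Dom D q = Dom D p" using product_diagram_arr[OF pq] by auto
  have s: "\<sigma> \<in> Arr D" "\<sigma>' \<in> Arr D" "Dom D \<sigma>' = Dom D p" "Cod D \<sigma>' = Dom D \<sigma>"
      "\<sigma> \<cdot> \<sigma>' = Ide D (Dom D \<sigma>)" "\<sigma>' \<cdot> \<sigma> = Ide D (Dom D p)"
    using \<sigma> by (auto simp: is_inverse_def in_hom_def)
  have "\<exists>!m. in_hom D m z (Dom D \<sigma>) \<and> m \<cdot> (\<sigma> \<cdot> p) = a \<and> m \<cdot> (\<sigma> \<cdot> q) = b"
    if "in_hom D a z (Cod D p)" "in_hom D b z (Cod D q)" for z a b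
  proof -
    note * = pairing_hom[OF pq that]
    define m where "m = pairing D p q a b \<cdot> \<sigma>'"
    have mh: "in_hom D m z (Dom D \<sigma>)" using * s by (auto simp: m_def in_hom_def)
    have ms: "m \<cdot> \<sigma> = pairing D p q a b" using * s by (auto simp: m_def in_hom_def)
    have "m \<cdot> (\<sigma> \<cdot> p) = a \<and> m \<cdot> (\<sigma> \<cdot> q) = b"
      using ms mh s h * by (metis comp_assoc' in_hom_def \<sigma>(2))
    moreover have "m' = m" if m': "in_hom D m' z (Dom D \<sigma>)" "m' \<cdot> (\<sigma> \<cdot> p) = a" "m' \<cdot> (\<sigma> \<cdot> q) = b" for m'
    proof -
      have "m' \<cdot> \<sigma> = pairing D p q a b"
        by (rule pairing_eqI[OF pq, of _ z, symmetric]) (use m' s h \<sigma> in \<open>auto simp: in_hom_def\<close>)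
      then have "m' \<cdot> \<sigma> \<cdot> \<sigma>' = m" by (simp add: m_def)
      then show ?thesis using m' s \<sigma> by (auto simp: in_hom_def)
    qed
    ultimately show ?thesis using mh by blast
  qed
  then show ?thesis using h s \<sigma> unfolding product_diagram_def by simp
qed

text \<open>The two mediating arrows are mutually inverse because each composite agrees with the
  identity on both projections. The resulting \<sigma> is how an arbitrary product diagram is later
  compared with the chosen internal one.\<close>

lemma product_diagram_comparison:
  assumes pq: "product_diagram D p q" and pq': "product_diagram D p' q'"
    and c: "Cod D p' = Cod D p" "Cod D q' = Cod D q"
  shows "\<exists>\<sigma> \<sigma>'. is_inverse D \<sigma> \<sigma>' \<and> in_hom D \<sigma> (Dom D p) (Dom D p') \<and> \<sigma> \<cdot> p' = p \<and> \<sigma> \<cdot> q' = q"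
proof -
  have h: "p \<in> Arr D" "q \<in> Arr D" "Dom D q = Dom D p" "p' \<in> Arr D" "q' \<in> Arr D" "Dom D q' = Dom D p'"
    using product_diagram_arr[OF pq] product_diagram_arr[OF pq'] by auto
  define \<sigma> where "\<sigma> = pairing D p' q' p q"
  define \<sigma>' where "\<sigma>' = pairing D p q p' q'"
  have s: "in_hom D \<sigma> (Dom D p) (Dom D p')" "\<sigma> \<cdot> p' = p" "\<sigma> \<cdot> q' = q"
    using pairing_hom[OF pq', of p "Dom D p" q] h c by (auto simp: \<sigma>_def in_hom_def)
  have s': "in_hom D \<sigma>' (Dom D p') (Dom D p)" "\<sigma>' \<cdot> p = p'" "\<sigma>' \<cdot> q = q'"
    using pairing_hom[OF pq, of p' "Dom D p'" q'] h c by (auto simp: \<sigma>'_def in_hom_def)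
  have "\<sigma> \<cdot> \<sigma>' = Ide D (Dom D p)"
    by (rule product_arr_eqI[OF pq, of _ "Dom D p"]) (use s s' h in \<open>auto simp: in_hom_def\<close>)
  moreover have "\<sigma>' \<cdot> \<sigma> = Ide D (Dom D p')"
    by (rule product_arr_eqI[OF pq', of _ "Dom D p'"]) (use s s' h in \<open>auto simp: in_hom_def\<close>)
  ultimately have "is_inverse D \<sigma> \<sigma>'" using s s' by (auto simp: is_inverse_def in_hom_def)
  with s show ?thesis by blast
qed

end

subsection \<open>Isomorphisms of categories\<close>

text \<open>Only closure of objects under domain and codomain is asked of the two sides, so the
  criterion applies directly to functor categories and to products and pullbacks of hom-categories.
  Bijectivity on arrows splits into bijectivity on each hom-set, the endpoints being controlled by
  the object part.\<close>

lemma iso_functorI: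
  assumes F: "is_functor D E F"
    and D: "\<And>f. f \<in> Arr D \<Longrightarrow> Dom D f \<in> Obj D \<and> Cod D f \<in> Obj D"
    and E: "\<And>f. f \<in> Arr E \<Longrightarrow> Dom E f \<in> Obj E \<and> Cod E f \<in> Obj E"
    and obj: "\<And>y. y \<in> Obj E \<Longrightarrow> \<exists>!x. x \<in> Obj D \<and> fst F x = y"
    and arr: "\<And>x x' b. x \<in> Obj D \<Longrightarrow> x' \<in> Obj D \<Longrightarrow> in_hom E b (fst F x) (fst F x') \<Longrightarrow>
       \<exists>!a. in_hom D a x x' \<and> snd F a = b"
  shows "iso_functor D E F"
proof -
  have o: "fst F x \<in> Obj E" if "x \<in> Obj D" for x using F that by (auto simp: is_functor_def)
  have a: "in_hom E (snd F f) (fst F (Dom D f)) (fst F (Cod D f))" if "f \<in> Arr D" for f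
    using F that by (auto simp: is_functor_def)
  have inj: "x = x'" if "x \<in> Obj D" "x' \<in> Obj D" "fst F x = fst F x'" for x x'
    using obj[OF o[OF that(1)]] that by metis
  have "bij_betw (fst F) (Obj D) (Obj E)"
    unfolding bij_betw_def inj_on_def using inj o obj by (auto simp: image_iff) metis
  moreover have "f = g" if fg: "f \<in> Arr D" "g \<in> Arr D" "snd F f = snd F g" for f g
  proof -
    have "Dom D f = Dom D g" "Cod D f = Cod D g"
      using a[OF fg(1)] a[OF fg(2)] fg D inj by (auto simp: in_hom_def)
    then show ?thesis using arr[OF _ _ a[OF fg(1)]] D fg unfolding in_hom_def by metis
  qed
  moreover have "b \<in> snd F ` Arr D" if b: "b \<in> Arr E" for b
  proof -
    obtain x x' where x: "x \<in> Obj D" "x' \<in> Obj D" "fst F x = Dom E b" "fst F x' = Cod E b"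
      using obj E[OF b] by metis
    then have "in_hom E b (fst F x) (fst F x')" using b by (auto simp: in_hom_def)
    from arr[OF x(1,2) this] show ?thesis by (auto simp: in_hom_def)
  qed
  moreover have "snd F f \<in> Arr E" if "f \<in> Arr D" for f using a[OF that] by (simp add: in_hom_def)
  ultimately show ?thesis
    using F unfolding iso_functor_def bij_betw_def inj_on_def by blast
qed

lemma iso_functor_obj:
  assumes "iso_functor D E F" "y \<in> Obj E"
  shows "\<exists>!x. x \<in> Obj D \<and> fst F x = y"
  using assms unfolding iso_functor_def bij_betw_def inj_on_def by (metis imageE)

lemma iso_functor_arr:
  assumes "iso_functor D E F"
    and D: "\<And>f. f \<in> Arr D \<Longrightarrow> Dom D f \<in> Obj D \<and> Cod D f \<in> Obj D"
    and "x \<in> Obj D" "x' \<in> Obj D" "in_hom E b (fst F x) (fst F x')"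
  shows "\<exists>!a. in_hom D a x x' \<and> snd F a = b"
proof -
  obtain a where a: "a \<in> Arr D" "snd F a = b"
    using assms unfolding iso_functor_def bij_betw_def in_hom_def by (metis imageE)
  have F: "in_hom E (snd F a) (fst F (Dom D a)) (fst F (Cod D a))"
    using a(1) assms(1) by (auto simp: iso_functor_def is_functor_def)
  have "inj_on (fst F) (Obj D)" "inj_on (snd F) (Arr D)"
    using assms(1) by (auto simp: iso_functor_def bij_betw_def)
  then show ?thesis using a F D assms(3-5) unfolding in_hom_def inj_on_def by metis
qed

lemma functor_inverse:
  assumes "category D" "is_functor D E F" "is_inverse D f g"
  shows "is_inverse E (snd F f) (snd F g)"
proof -
  interpret category D by fact
  have fg: "f \<in> Arr D" "g \<in> Arr D" "Dom D g = Cod D f" "Cod D g = Dom D f"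
      "f \<cdot>\<^bsub>D\<^esub> g = Ide D (Dom D f)" "g \<cdot>\<^bsub>D\<^esub> f = Ide D (Cod D f)"
    using assms(3) by (auto simp: is_inverse_def in_hom_def)
  have c: "\<And>a b. a \<in> Arr D \<Longrightarrow> b \<in> Arr D \<Longrightarrow> Cod D a = Dom D b \<Longrightarrow>
      snd F (a \<cdot>\<^bsub>D\<^esub> b) = snd F a \<cdot>\<^bsub>E\<^esub> snd F b"
    and i: "\<And>x. x \<in> Obj D \<Longrightarrow> snd F (Ide D x) = Ide E (fst F x)"
    and h: "\<And>a. a \<in> Arr D \<Longrightarrow> in_hom E (snd F a) (fst F (Dom D a)) (fst F (Cod D a))"
    using assms(2) by (auto simp: is_functor_def)
  show ?thesis unfolding is_inverse_def
    using h[OF fg(1)] h[OF fg(2)] c[OF fg(1,2)] c[OF fg(2,1)] i fg by (auto simp: in_hom_def)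
qed

text \<open>The inverse of the image has a preimage in the opposite direction; both composites with
  it are sent to images of identities, and injectivity on arrows finishes. This is what makes cores
  groupoids.\<close>

lemma iso_functor_reflects_iso:
  assumes "category D" "category E" "iso_functor D E F" "a \<in> Arr D" "is_iso E (snd F a)"
  shows "is_iso D a"
proof -
  interpret D: category D by fact
  interpret E: category E by fact
  have F: "is_functor D E F" using assms by (simp add: iso_functor_def)
  then have c: "\<And>a b. a \<in> Arr D \<Longrightarrow> b \<in> Arr D \<Longrightarrow> Cod D a = Dom D b \<Longrightarrow>
      snd F (a \<cdot>\<^bsub>D\<^esub> b) = snd F a \<cdot>\<^bsub>E\<^esub> snd F b"
    and i: "\<And>x. x \<in> Obj D \<Longrightarrow> snd F (Ide D x) = Ide E (fst F x)"
    and h: "\<And>a. a \<in> Arr D \<Longrightarrow> in_hom E (snd F a) (fst F (Dom D a)) (fst F (Cod D a))"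
    by (auto simp: is_functor_def)
  obtain b where b: "is_inverse E (snd F a) b" using assms(5) by (auto simp: is_iso_def)
  then have "in_hom E b (fst F (Cod D a)) (fst F (Dom D a))"
    using h[OF assms(4)] by (auto simp: is_inverse_def in_hom_def)
  from iso_functor_arr[OF assms(3) _ _ _ this] assms(4)
  obtain g where g: "in_hom D g (Cod D a) (Dom D a)" "snd F g = b" by auto
  have inj: "inj_on (snd F) (Arr D)" using assms(3) by (simp add: iso_functor_def bij_betw_def)
  have gA: "g \<in> Arr D" "Dom D g = Cod D a" "Cod D g = Dom D a" using g by (auto simp: in_hom_def)
  have "a \<cdot>\<^bsub>D\<^esub> g = Ide D (Dom D a)"
    by (rule inj_onD[OF inj]) (use gA c[of a g] b g(2) i h[OF assms(4)] assms(4) in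
        \<open>auto simp: is_inverse_def in_hom_def\<close>)
  moreover have "g \<cdot>\<^bsub>D\<^esub> a = Ide D (Cod D a)"
    by (rule inj_onD[OF inj]) (use gA c[of g a] b g(2) i h[OF assms(4)] assms(4) in
        \<open>auto simp: is_inverse_def in_hom_def\<close>)
  ultimately show ?thesis using g assms(4) by (auto simp: is_iso_def is_inverse_def)
qed

subsection \<open>Whiskering\<close>

lemma hom_cat_simps [simp]:
  "Obj (hom_cat C A X) = {f. in_hom C f A X}"
  "Dom (hom_cat C A X) = Dom2 C" "Cod (hom_cat C A X) = Cod2 C"
  "Ide (hom_cat C A X) = Ide2 C" "Comp (hom_cat C A X) = VComp C"
  by (simp_all add: hom_cat_def)

context two_category
begin

lemma Dom2_in_Arr [simp]: "\<alpha> \<in> Cell C \<Longrightarrow> Dom2 C \<alpha> \<in> Arr C"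
  and Cod2_in_Arr [simp]: "\<alpha> \<in> Cell C \<Longrightarrow> Cod2 C \<alpha> \<in> Arr C"
  and Dom_Cod2 [simp]: "\<alpha> \<in> Cell C \<Longrightarrow> Dom C (Cod2 C \<alpha>) = Dom C (Dom2 C \<alpha>)"
  and Cod_Cod2 [simp]: "\<alpha> \<in> Cell C \<Longrightarrow> Cod C (Cod2 C \<alpha>) = Cod C (Dom2 C \<alpha>)"
  using cell_hom[of \<alpha>] by (auto simp: hom_cat_def in_hom_def)

lemma Arr_hom_cat [simp]: "\<alpha> \<in> Arr (hom_cat C A X) \<longleftrightarrow>
    \<alpha> \<in> Cell C \<and> Dom C (Dom2 C \<alpha>) = A \<and> Cod C (Dom2 C \<alpha>) = X"
  by (auto simp: hom_cat_def in_hom_def)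

lemma in_hom_hom_cat: "in_hom (hom_cat C A X) \<alpha> f g \<longleftrightarrow>
    \<alpha> \<in> Cell C \<and> Dom2 C \<alpha> = f \<and> Cod2 C \<alpha> = g \<and> Dom C f = A \<and> Cod C f = X"
  by (auto simp: in_hom_def)

lemma Ide2_in_Cell [simp]: "f \<in> Arr C \<Longrightarrow> Ide2 C f \<in> Cell C"
  and Dom2_Ide2 [simp]: "f \<in> Arr C \<Longrightarrow> Dom2 C (Ide2 C f) = f"
  and Cod2_Ide2 [simp]: "f \<in> Arr C \<Longrightarrow> Cod2 C (Ide2 C f) = f"
  using category.ide_hom[OF hom_category[of "Dom C f" "Cod C f"], of f]
  by (auto simp: in_hom_def)

lemma VComp_in_Cell [simp]: "\<alpha> \<in> Cell C \<Longrightarrow> \<beta> \<in> Cell C \<Longrightarrow> Cod2 C \<alpha> = Dom2 C \<beta> \<Longrightarrow> \<alpha> \<bullet> \<beta> \<in> Cell C"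
  and Dom2_VComp [simp]: "\<alpha> \<in> Cell C \<Longrightarrow> \<beta> \<in> Cell C \<Longrightarrow> Cod2 C \<alpha> = Dom2 C \<beta> \<Longrightarrow> Dom2 C (\<alpha> \<bullet> \<beta>) = Dom2 C \<alpha>"
  and Cod2_VComp [simp]: "\<alpha> \<in> Cell C \<Longrightarrow> \<beta> \<in> Cell C \<Longrightarrow> Cod2 C \<alpha> = Dom2 C \<beta> \<Longrightarrow> Cod2 C (\<alpha> \<bullet> \<beta>) = Cod2 C \<beta>"
proof -
  assume *: "\<alpha> \<in> Cell C" "\<beta> \<in> Cell C" "Cod2 C \<alpha> = Dom2 C \<beta>"
  then have [simp]: "Dom C (Dom2 C \<beta>) = Dom C (Dom2 C \<alpha>)" "Cod C (Dom2 C \<beta>) = Cod C (Dom2 C \<alpha>)"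
    using Dom_Cod2 Cod_Cod2 by metis+
  have "in_hom (hom_cat C (Dom C (Dom2 C \<alpha>)) (Cod C (Dom2 C \<alpha>))) (\<alpha> \<bullet> \<beta>) (Dom2 C \<alpha>) (Cod2 C \<beta>)"
    using * category.comp_hom[OF hom_category[of "Dom C (Dom2 C \<alpha>)" "Cod C (Dom2 C \<alpha>)"],
        of \<alpha> "Dom2 C \<alpha>" "Cod2 C \<alpha>" \<beta> "Cod2 C \<beta>"] by (auto simp: in_hom_hom_cat)
  then show "\<alpha> \<bullet> \<beta> \<in> Cell C" "Dom2 C (\<alpha> \<bullet> \<beta>) = Dom2 C \<alpha>" "Cod2 C (\<alpha> \<bullet> \<beta>) = Cod2 C \<beta>"
    by (auto simp: in_hom_hom_cat)
qed

lemma Ide2_VComp [simp]: "\<alpha> \<in> Cell C \<Longrightarrow> Dom2 C \<alpha> = f \<Longrightarrow> Ide2 C f \<bullet> \<alpha> = \<alpha>"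
  and VComp_Ide2 [simp]: "\<alpha> \<in> Cell C \<Longrightarrow> Cod2 C \<alpha> = f \<Longrightarrow> \<alpha> \<bullet> Ide2 C f = \<alpha>"
  using category.Ide_comp[OF hom_category[of "Dom C (Dom2 C \<alpha>)" "Cod C (Dom2 C \<alpha>)"], of \<alpha> f]
    category.comp_Ide[OF hom_category[of "Dom C (Dom2 C \<alpha>)" "Cod C (Dom2 C \<alpha>)"], of \<alpha> f]
  by auto

lemma VComp_assoc [simp]:
  assumes "\<alpha> \<in> Cell C" "\<beta> \<in> Cell C" "\<delta> \<in> Cell C" "Cod2 C \<alpha> = Dom2 C \<beta>" "Cod2 C \<beta> = Dom2 C \<delta>"
  shows "(\<alpha> \<bullet> \<beta>) \<bullet> \<delta> = \<alpha> \<bullet> (\<beta> \<bullet> \<delta>)"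
proof -
  have "Dom C (Dom2 C \<beta>) = Dom C (Dom2 C \<alpha>)" "Cod C (Dom2 C \<beta>) = Cod C (Dom2 C \<alpha>)"
    "Dom C (Dom2 C \<delta>) = Dom C (Dom2 C \<alpha>)" "Cod C (Dom2 C \<delta>) = Cod C (Dom2 C \<alpha>)"
    using Dom_Cod2 Cod_Cod2 assms by metis+
  then show ?thesis
    using category.comp_assoc'[OF hom_category[of "Dom C (Dom2 C \<alpha>)" "Cod C (Dom2 C \<alpha>)"], of \<alpha> \<beta> \<delta>]
      assms by auto
qed

lemma HComp_type:
  assumes "\<alpha> \<in> Cell C" "\<beta> \<in> Cell C" "Cod C (Dom2 C \<alpha>) = Dom C (Dom2 C \<beta>)"
  shows "\<alpha> \<star> \<beta> \<in> Cell C" "Dom2 C (\<alpha> \<star> \<beta>) = Dom2 C \<alpha> \<cdot> Dom2 C \<beta>" "Cod2 C (\<alpha> \<star> \<beta>) = Cod2 C \<alpha> \<cdot> Cod2 C \<beta>"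
  using hcomp_hom[of \<alpha> "Dom C (Dom2 C \<alpha>)" "Cod C (Dom2 C \<alpha>)" \<beta> "Cod C (Dom2 C \<beta>)"] assms
  by (auto simp: in_hom_hom_cat)

lemma whisker_l_type [simp]:
  assumes "f \<in> Arr C" "\<alpha> \<in> Cell C" "Cod C f = Dom C (Dom2 C \<alpha>)"
  shows "f \<rhd> \<alpha> \<in> Cell C" "Dom2 C (f \<rhd> \<alpha>) = f \<cdot> Dom2 C \<alpha>" "Cod2 C (f \<rhd> \<alpha>) = f \<cdot> Cod2 C \<alpha>"
  using HComp_type[of "Ide2 C f" \<alpha>] assms by (auto simp: whisker_l_def)

lemma whisker_r_type [simp]:
  assumes "f \<in> Arr C" "\<alpha> \<in> Cell C" "Dom C f = Cod C (Dom2 C \<alpha>)"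
  shows "\<alpha> \<lhd> f \<in> Cell C" "Dom2 C (\<alpha> \<lhd> f) = Dom2 C \<alpha> \<cdot> f" "Cod2 C (\<alpha> \<lhd> f) = Cod2 C \<alpha> \<cdot> f"
  using HComp_type[of \<alpha> "Ide2 C f"] assms by (auto simp: whisker_r_def)

lemma whisker_l_Ide2 [simp]:
  "f \<in> Arr C \<Longrightarrow> g \<in> Arr C \<Longrightarrow> Cod C f = Dom C g \<Longrightarrow> f \<rhd> Ide2 C g = Ide2 C (f \<cdot> g)"
  and whisker_r_Ide2 [simp]:
  "f \<in> Arr C \<Longrightarrow> g \<in> Arr C \<Longrightarrow> Cod C f = Dom C g \<Longrightarrow> Ide2 C f \<lhd> g = Ide2 C (f \<cdot> g)"
  using hcomp_ide2[of f "Dom C f" "Cod C f" g "Cod C g"]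
  by (auto simp: whisker_l_def whisker_r_def in_hom_def)

lemma Ide_whisker_l [simp]: "\<alpha> \<in> Cell C \<Longrightarrow> Dom C (Dom2 C \<alpha>) = x \<Longrightarrow> Ide C x \<rhd> \<alpha> = \<alpha>"
  and whisker_r_Ide [simp]: "\<alpha> \<in> Cell C \<Longrightarrow> Cod C (Dom2 C \<alpha>) = x \<Longrightarrow> \<alpha> \<lhd> Ide C x = \<alpha>"
  using ide_hcomp[of \<alpha> x "Cod C (Dom2 C \<alpha>)"] hcomp_ide[of \<alpha> "Dom C (Dom2 C \<alpha>)" x]
  by (auto simp: whisker_l_def whisker_r_def)

lemma whisker_l_comp [simp]:
  assumes "f \<in> Arr C" "g \<in> Arr C" "\<alpha> \<in> Cell C" "Cod C f = Dom C g" "Cod C g = Dom C (Dom2 C \<alpha>)"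
  shows "(f \<cdot> g) \<rhd> \<alpha> = f \<rhd> (g \<rhd> \<alpha>)"
  using hcomp_assoc[of "Ide2 C f" "Dom C f" "Cod C f" "Ide2 C g" "Cod C g" \<alpha> "Cod C (Dom2 C \<alpha>)"]
    hcomp_ide2[of f "Dom C f" "Cod C f" g "Cod C g"] assms
  by (auto simp: whisker_l_def in_hom_def)

lemma whisker_r_comp [simp]:
  assumes "f \<in> Arr C" "g \<in> Arr C" "\<alpha> \<in> Cell C" "Cod C f = Dom C g" "Dom C f = Cod C (Dom2 C \<alpha>)"
  shows "\<alpha> \<lhd> (f \<cdot> g) = (\<alpha> \<lhd> f) \<lhd> g"
  using hcomp_assoc[of \<alpha> "Dom C (Dom2 C \<alpha>)" "Dom C f" "Ide2 C f" "Cod C f" "Ide2 C g" "Cod C g"]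
    hcomp_ide2[of f "Dom C f" "Cod C f" g "Cod C g"] assms
  by (auto simp: whisker_r_def in_hom_def)

lemma whisker_l_r [simp]:
  assumes "f \<in> Arr C" "g \<in> Arr C" "\<alpha> \<in> Cell C" "Cod C f = Dom C (Dom2 C \<alpha>)" "Dom C g = Cod C (Dom2 C \<alpha>)"
  shows "(f \<rhd> \<alpha>) \<lhd> g = f \<rhd> (\<alpha> \<lhd> g)"
  using hcomp_assoc[of "Ide2 C f" "Dom C f" "Cod C f" \<alpha> "Dom C g" "Ide2 C g" "Cod C g"] assms
  by (auto simp: whisker_l_def whisker_r_def)

lemma whisker_l_VComp [simp]:
  assumes "f \<in> Arr C" "\<alpha> \<in> Cell C" "\<beta> \<in> Cell C" "Cod2 C \<alpha> = Dom2 C \<beta>" "Cod C f = Dom C (Dom2 C \<alpha>)"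
  shows "f \<rhd> (\<alpha> \<bullet> \<beta>) = (f \<rhd> \<alpha>) \<bullet> (f \<rhd> \<beta>)"
proof -
  have "Dom C (Dom2 C \<beta>) = Dom C (Dom2 C \<alpha>)" "Cod C (Dom2 C \<beta>) = Cod C (Dom2 C \<alpha>)"
    using Dom_Cod2 Cod_Cod2 assms by metis+
  then show ?thesis
    using interchange[of "Ide2 C f" "Dom C f" "Cod C f" "Ide2 C f" \<alpha> "Cod C (Dom2 C \<alpha>)" \<beta>] assms
    by (auto simp: whisker_l_def)
qed

lemma whisker_r_VComp [simp]:
  assumes "f \<in> Arr C" "\<alpha> \<in> Cell C" "\<beta> \<in> Cell C" "Cod2 C \<alpha> = Dom2 C \<beta>" "Dom C f = Cod C (Dom2 C \<alpha>)"
  shows "(\<alpha> \<bullet> \<beta>) \<lhd> f = (\<alpha> \<lhd> f) \<bullet> (\<beta> \<lhd> f)"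
proof -
  have "Dom C (Dom2 C \<beta>) = Dom C (Dom2 C \<alpha>)" "Cod C (Dom2 C \<beta>) = Cod C (Dom2 C \<alpha>)"
    using Dom_Cod2 Cod_Cod2 assms by metis+
  then show ?thesis
    using interchange[of \<alpha> "Dom C (Dom2 C \<alpha>)" "Dom C f" \<beta> "Ide2 C f" "Cod C f" "Ide2 C f"] assms
    by (auto simp: whisker_r_def)
qed

text \<open>Both sides are the horizontal composite \<open>\<alpha> \<star> \<beta>\<close>, by
  interchange with identities inserted on one side or the other. Naturality squares of whiskered
  2-cells are obtained from it below.\<close>

lemma whisker_exchange:
  assumes "\<alpha> \<in> Cell C" "\<beta> \<in> Cell C" "Cod C (Dom2 C \<alpha>) = Dom C (Dom2 C \<beta>)"
  shows "(Dom2 C \<alpha> \<rhd> \<beta>) \<bullet> (\<alpha> \<lhd> Cod2 C \<beta>) = (\<alpha> \<lhd> Dom2 C \<beta>) \<bullet> (Cod2 C \<alpha> \<rhd> \<beta>)"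
proof -
  have "(Dom2 C \<alpha> \<rhd> \<beta>) \<bullet> (\<alpha> \<lhd> Cod2 C \<beta>) = \<alpha> \<star> \<beta>"
    using interchange[of "Ide2 C (Dom2 C \<alpha>)" "Dom C (Dom2 C \<alpha>)" "Cod C (Dom2 C \<alpha>)" \<alpha> \<beta>
        "Cod C (Dom2 C \<beta>)" "Ide2 C (Cod2 C \<beta>)"] assms
    by (auto simp: whisker_r_def whisker_l_def)
  moreover have "(\<alpha> \<lhd> Dom2 C \<beta>) \<bullet> (Cod2 C \<alpha> \<rhd> \<beta>) = \<alpha> \<star> \<beta>"
    using interchange[of \<alpha> "Dom C (Dom2 C \<alpha>)" "Cod C (Dom2 C \<alpha>)" "Ide2 C (Cod2 C \<alpha>)"
        "Ide2 C (Dom2 C \<beta>)" "Cod C (Dom2 C \<beta>)" \<beta>] assms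
    by (auto simp: whisker_r_def whisker_l_def)
  ultimately show ?thesis by simp
qed

section \<open>Composition functors and inverse 2-cells\<close>

lemma postcomp_functor:
  assumes "in_hom C f X Y"
  shows "is_functor (hom_cat C A X) (hom_cat C A Y) (postcomp C f)"
  using assms by (auto simp: is_functor_def postcomp_def in_hom_def)

lemma precomp_functor:
  assumes "in_hom C f A' A"
  shows "is_functor (hom_cat C A X) (hom_cat C A' X) (precomp C f)"
  using assms by (auto simp: is_functor_def precomp_def in_hom_def)

lemma inverse_cell_iff:
  "is_inverse (hom_cat C A X) \<alpha> \<beta> \<longleftrightarrow> \<alpha> \<in> Cell C \<and> \<beta> \<in> Cell C \<and> Dom C (Dom2 C \<alpha>) = A \<and>
     Cod C (Dom2 C \<alpha>) = X \<and> Dom2 C \<beta> = Cod2 C \<alpha> \<and> Cod2 C \<beta> = Dom2 C \<alpha> \<and>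
     \<alpha> \<bullet> \<beta> = Ide2 C (Dom2 C \<alpha>) \<and> \<beta> \<bullet> \<alpha> = Ide2 C (Cod2 C \<alpha>)"
  by (auto simp: is_inverse_def in_hom_hom_cat)

subsection \<open>Universal properties on 1-cells and 2-cells\<close>

lemma hom_cat_Dom_Cod: "\<alpha> \<in> Arr (hom_cat C A X) \<Longrightarrow>
    Dom (hom_cat C A X) \<alpha> \<in> Obj (hom_cat C A X) \<and> Cod (hom_cat C A X) \<alpha> \<in> Obj (hom_cat C A X)"
  by (auto simp: in_hom_def)

section \<open>Strict products\<close>

lemma strict_product_hom:
  assumes "strict_product C X Y P p q"
  shows "in_hom C p P X" "in_hom C q P Y"
  using assms by (auto simp: strict_product_def)

lemma strict_product_lift:
  assumes P: "strict_product C X Y P p q" and "in_hom C f A X" "in_hom C g A Y"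
  shows "\<exists>!h. in_hom C h A P \<and> h \<cdot> p = f \<and> h \<cdot> q = g"
proof -
  have "A \<in> Obj C" using in_homD[OF assms(2)] by auto
  then have "iso_functor (hom_cat C A P) (prod_cat (hom_cat C A X) (hom_cat C A Y)) (span_functor C p q)"
    using P by (auto simp: strict_product_def)
  from iso_functor_obj[OF this, of "(f, g)"] show ?thesis
    using assms(2,3) by (simp add: prod_cat_def span_functor_def)
qed

lemma strict_product_lift_cell:
  assumes P: "strict_product C X Y P p q" and h: "in_hom C h A P" "in_hom C h' A P"
    and c: "in_hom (hom_cat C A X) \<alpha> (h \<cdot> p) (h' \<cdot> p)" "in_hom (hom_cat C A Y) \<beta> (h \<cdot> q) (h' \<cdot> q)"
  shows "\<exists>!\<theta>. in_hom (hom_cat C A P) \<theta> h h' \<and> \<theta> \<lhd> p = \<alpha> \<and> \<theta> \<lhd> q = \<beta>"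
proof -
  have "A \<in> Obj C" using in_homD[OF h(1)] by auto
  then have "iso_functor (hom_cat C A P) (prod_cat (hom_cat C A X) (hom_cat C A Y)) (span_functor C p q)"
    using P by (auto simp: strict_product_def)
  moreover have "in_hom (prod_cat (hom_cat C A X) (hom_cat C A Y)) (\<alpha>, \<beta>)
      (fst (span_functor C p q) h) (fst (span_functor C p q) h')"
    using c by (auto simp: prod_cat_def span_functor_def in_hom_def)
  ultimately show ?thesis
    using iso_functor_arr[OF _ hom_cat_Dom_Cod, of A P _ "span_functor C p q" h h' "(\<alpha>, \<beta>)"] h
    by (simp add: span_functor_def)
qed

lemma strict_product_eqI:
  assumes P: "strict_product C X Y P p q" and "in_hom C h A P" "in_hom C h' A P"
    "h \<cdot> p = h' \<cdot> p" "h \<cdot> q = h' \<cdot> q"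
  shows "h = h'"
proof -
  note * = strict_product_hom[OF P]
  have "in_hom C (h \<cdot> p) A X" "in_hom C (h \<cdot> q) A Y" using assms * by (auto simp: in_hom_def)
  from strict_product_lift[OF P this] show ?thesis using assms by metis
qed

lemma strict_product_cell_eqI:
  assumes P: "strict_product C X Y P p q"
    and \<theta>: "in_hom (hom_cat C A P) \<theta> h h'" "in_hom (hom_cat C A P) \<theta>' h h'"
    and "\<theta> \<lhd> p = \<theta>' \<lhd> p" "\<theta> \<lhd> q = \<theta>' \<lhd> q"
  shows "\<theta> = \<theta>'"
proof -
  note * = strict_product_hom[OF P]
  have "in_hom C h A P" "in_hom C h' A P"
    "in_hom (hom_cat C A X) (\<theta> \<lhd> p) (h \<cdot> p) (h' \<cdot> p)" "in_hom (hom_cat C A Y) (\<theta> \<lhd> q) (h \<cdot> q) (h' \<cdot> q)"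
    using \<theta> * by (auto simp: in_hom_def)
  from strict_product_lift_cell[OF P this] show ?thesis using assms by metis
qed

lemma strict_product_pairing:
  assumes P: "strict_product C X Y P p q" and "in_hom C f A X" "in_hom C g A Y"
  shows "in_hom C (pairing C p q f g) A P" "pairing C p q f g \<cdot> p = f" "pairing C p q f g \<cdot> q = g"
proof -
  from strict_product_lift[OF assms]
  have "\<exists>!m. in_hom C m (Dom C f) (Dom C p) \<and> m \<cdot> p = f \<and> m \<cdot> q = g"
    using assms strict_product_hom[OF P] by (simp add: in_hom_def)
  from theI'[OF this] show "in_hom C (pairing C p q f g) A P" "pairing C p q f g \<cdot> p = f" "pairing C p q f g \<cdot> q = g"
    using assms strict_product_hom[OF P] by (auto simp: pairing_def in_hom_def)
qed

lemma strict_product_pairing_eqI: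
  assumes P: "strict_product C X Y P p q" and h: "in_hom C h A P" and e: "h \<cdot> p = f" "h \<cdot> q = g"
  shows "pairing C p q f g = h"
proof -
  note * = strict_product_hom[OF P]
  have f: "in_hom C f A X" "in_hom C g A Y" using h e * by (auto simp: in_hom_def)
  note ** = strict_product_pairing[OF P f]
  show ?thesis by (rule strict_product_eqI[OF P **(1) h]) (simp_all add: ** e)
qed

lemma strict_product_pairing2:
  assumes P: "strict_product C X Y P p q" and h: "in_hom C h A P" "in_hom C h' A P"
    and c: "in_hom (hom_cat C A X) \<alpha> (h \<cdot> p) (h' \<cdot> p)" "in_hom (hom_cat C A Y) \<beta> (h \<cdot> q) (h' \<cdot> q)"
  shows "in_hom (hom_cat C A P) (pairing2 C p q \<alpha> \<beta>) h h'" "pairing2 C p q \<alpha> \<beta> \<lhd> p = \<alpha>"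
    "pairing2 C p q \<alpha> \<beta> \<lhd> q = \<beta>"
    "\<And>\<theta>. in_hom (hom_cat C A P) \<theta> h h' \<Longrightarrow> \<theta> \<lhd> p = \<alpha> \<Longrightarrow> \<theta> \<lhd> q = \<beta> \<Longrightarrow> pairing2 C p q \<alpha> \<beta> = \<theta>"
proof -
  note * = strict_product_hom[OF P]
  \<comment> \<open>\<open>pairing2\<close> prescribes only the source and target objects of its
    2-cell. The equations with \<open>p\<close> and \<open>q\<close> fix domain and codomain by
    uniqueness on 1-cells, so the description agrees with the lifting property.\<close>
  have iff: "in_hom (hom_cat C A P) \<theta> h h' \<and> \<theta> \<lhd> p = \<alpha> \<and> \<theta> \<lhd> q = \<beta> \<longleftrightarrow>
      \<theta> \<in> Arr (hom_cat C (Dom C (Dom2 C \<alpha>)) (Dom C p)) \<and> \<theta> \<lhd> p = \<alpha> \<and> \<theta> \<lhd> q = \<beta>" (is "?l \<theta> \<longleftrightarrow> ?r \<theta>") for \<theta>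
  proof
    show "?l \<theta> \<Longrightarrow> ?r \<theta>" using * h c by (auto simp: in_hom_def)
    assume r: "?r \<theta>"
    have t: "\<theta> \<in> Cell C" "Dom C (Dom2 C \<theta>) = A" "Cod C (Dom2 C \<theta>) = P"
      using r * h c by (auto simp: in_hom_def)
    have "Dom2 C \<theta> = h"
      by (rule strict_product_eqI[OF P _ h(1)]) (use t r c * in \<open>auto simp: in_hom_def\<close>)
    moreover have "Cod2 C \<theta> = h'"
      by (rule strict_product_eqI[OF P _ h(2)]) (use t r c * in \<open>auto simp: in_hom_def\<close>)
    ultimately show "?l \<theta>" using t r by (auto simp: in_hom_def)
  qed
  from strict_product_lift_cell[OF assms]
  have ex: "\<exists>!\<theta>. \<theta> \<in> Arr (hom_cat C (Dom C (Dom2 C \<alpha>)) (Dom C p)) \<and> \<theta> \<lhd> p = \<alpha> \<and> \<theta> \<lhd> q = \<beta>"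
    using iff by simp
  have "in_hom (hom_cat C A P) (pairing2 C p q \<alpha> \<beta>) h h' \<and> pairing2 C p q \<alpha> \<beta> \<lhd> p = \<alpha> \<and>
    pairing2 C p q \<alpha> \<beta> \<lhd> q = \<beta>"
    unfolding pairing2_def iff by (rule theI'[OF ex])
  then show "in_hom (hom_cat C A P) (pairing2 C p q \<alpha> \<beta>) h h'" "pairing2 C p q \<alpha> \<beta> \<lhd> p = \<alpha>"
    "pairing2 C p q \<alpha> \<beta> \<lhd> q = \<beta>"
    "\<And>\<theta>. in_hom (hom_cat C A P) \<theta> h h' \<Longrightarrow> \<theta> \<lhd> p = \<alpha> \<Longrightarrow> \<theta> \<lhd> q = \<beta> \<Longrightarrow> pairing2 C p q \<alpha> \<beta> = \<theta>"
    using strict_product_lift_cell[OF assms] by metis+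
qed

section \<open>Strict pullbacks\<close>

lemma strict_pullback_lift:
  assumes P: "strict_pullback C p q f g" and "in_hom C a A (Dom C f)" "in_hom C b A (Dom C g)" "a \<cdot> f = b \<cdot> g"
  shows "\<exists>!h. in_hom C h A (Dom C p) \<and> h \<cdot> p = a \<and> h \<cdot> q = b"
proof -
  have "A \<in> Obj C" using in_homD[OF assms(2)] by auto
  then have "iso_functor (hom_cat C A (Dom C p)) (pullback_cat (hom_cat C A (Dom C f)) (postcomp C f)
      (hom_cat C A (Dom C g)) (postcomp C g)) (span_functor C p q)"
    using P unfolding strict_pullback_def by (metis in_hom_def)
  from iso_functor_obj[OF this, of "(a, b)"] show ?thesis
    using assms(2-) by (simp add: pullback_cat_def prod_cat_def span_functor_def postcomp_def)
qed

lemma strict_pullback_lift_cell: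
  assumes P: "strict_pullback C p q f g" and h: "in_hom C h A (Dom C p)" "in_hom C h' A (Dom C p)"
    and c: "in_hom (hom_cat C A (Dom C f)) \<alpha> (h \<cdot> p) (h' \<cdot> p)"
      "in_hom (hom_cat C A (Dom C g)) \<beta> (h \<cdot> q) (h' \<cdot> q)" "\<alpha> \<lhd> f = \<beta> \<lhd> g"
  shows "\<exists>!\<theta>. in_hom (hom_cat C A (Dom C p)) \<theta> h h' \<and> \<theta> \<lhd> p = \<alpha> \<and> \<theta> \<lhd> q = \<beta>"
proof -
  have "A \<in> Obj C" using in_homD[OF h(1)] by auto
  then have "iso_functor (hom_cat C A (Dom C p)) (pullback_cat (hom_cat C A (Dom C f)) (postcomp C f)
      (hom_cat C A (Dom C g)) (postcomp C g)) (span_functor C p q)"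
    using P unfolding strict_pullback_def by (metis in_hom_def)
  moreover have "in_hom (pullback_cat (hom_cat C A (Dom C f)) (postcomp C f)
      (hom_cat C A (Dom C g)) (postcomp C g)) (\<alpha>, \<beta>)
      (fst (span_functor C p q) h) (fst (span_functor C p q) h')"
    using c by (auto simp: prod_cat_def pullback_cat_def postcomp_def span_functor_def in_hom_def)
  ultimately show ?thesis
    using iso_functor_arr[OF _ hom_cat_Dom_Cod, of A "Dom C p" _ "span_functor C p q" h h' "(\<alpha>, \<beta>)"] h
    by (simp add: span_functor_def)
qed

lemma strict_pullback_hom:
  assumes "strict_pullback C p q f g"
  shows "in_hom C p (Dom C p) (Dom C f)" "in_hom C q (Dom C p) (Dom C g)" "p \<cdot> f = q \<cdot> g"
  using assms by (auto simp: strict_pullback_def in_hom_def)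

lemma strict_pullback_eqI:
  assumes P: "strict_pullback C p q f g" and h: "in_hom C h A (Dom C p)" "in_hom C h' A (Dom C p)"
    and e: "h \<cdot> p = h' \<cdot> p" "h \<cdot> q = h' \<cdot> q"
  shows "h = h'"
proof -
  note * = strict_pullback_hom[OF P]
  have fg: "in_hom C f (Dom C f) (Cod C f)" "in_hom C g (Dom C g) (Cod C f)"
    using P by (auto simp: strict_pullback_def in_hom_def)
  have a: "in_hom C (h \<cdot> p) A (Dom C f)" "in_hom C (h \<cdot> q) A (Dom C g)" using assms * by (auto simp: in_hom_def)
  have "(h \<cdot> p) \<cdot> f = (h \<cdot> q) \<cdot> g" using h fg * by (auto simp: in_hom_def)
  from strict_pullback_lift[OF P a this] show ?thesis using assms by metis
qed

subsection \<open>Groupoids and cores\<close>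

lemma groupoid_objD:
  assumes "groupoid_obj C A" "\<alpha> \<in> Cell C" "Cod C (Dom2 C \<alpha>) = A"
  shows "\<exists>\<beta>. is_inverse (hom_cat C (Dom C (Dom2 C \<alpha>)) A) \<alpha> \<beta>"
  using assms by (auto simp: groupoid_obj_def groupoid_cat_def is_iso_def)

lemma groupoid_arrowwise_iso:
  assumes "groupoid_obj C A" "in_hom C f A X"
  shows "arrowwise_iso C f"
proof -
  have "is_iso (hom_cat C B X) (\<alpha> \<lhd> f)" if B: "B \<in> Obj C" "\<alpha> \<in> Arr (hom_cat C B A)" for B \<alpha>
  proof -
    obtain \<beta> where "is_inverse (hom_cat C B A) \<alpha> \<beta>" using groupoid_objD[OF assms(1), of \<alpha>] B by auto
    from functor_inverse[OF hom_category postcomp_functor[OF assms(2)] this] B assms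
    show ?thesis by (auto simp: postcomp_def is_iso_def groupoid_obj_def)
  qed
  then show ?thesis using assms(2) by (auto simp: arrowwise_iso_def in_hom_def)
qed

lemma is_core_hom: "is_core C X K i \<Longrightarrow> in_hom C i K X"
  by (simp add: is_core_def)

text \<open>Invertible 2-cells contain the identities and are closed under composition. The result
  allows \<open>iso_functor_reflects_iso\<close> to be applied with the core hom-category as
  target.\<close>

lemma core_hom_category:
  assumes "A \<in> Obj C" "X \<in> Obj C"
  shows "category (core_hom_cat C A X)"
proof -
  interpret H: category "hom_cat C A X" using hom_category assms by simp
  have iso_hom: "\<alpha> \<in> Cell C \<and> Dom C (Dom2 C \<alpha>) = A \<and> Cod C (Dom2 C \<alpha>) = X"
    if "is_iso (hom_cat C A X) \<alpha>" for \<alpha>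
    using that by (auto simp: is_iso_def inverse_cell_iff)
  have comp: "is_iso (hom_cat C A X) (\<alpha> \<bullet> \<beta>)"
    if ab: "is_iso (hom_cat C A X) \<alpha>" "is_iso (hom_cat C A X) \<beta>" "Cod2 C \<alpha> = Dom2 C \<beta>" for \<alpha> \<beta>
  proof -
    obtain \<alpha>' \<beta>' where i: "is_inverse (hom_cat C A X) \<alpha> \<alpha>'" "is_inverse (hom_cat C A X) \<beta> \<beta>'"
      using ab by (auto simp: is_iso_def)
    then show ?thesis using H.is_inverse_comp[of \<alpha> \<alpha>' \<beta> \<beta>'] ab by (auto simp: is_iso_def)
  qed
  have ide: "is_iso (hom_cat C A X) (Ide2 C f)" if "in_hom C f A X" for f
    using that unfolding is_iso_def
    by (intro exI[of _ "Ide2 C f"]) (auto simp: inverse_cell_iff in_hom_def)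
  show ?thesis
    by unfold_locales (auto simp: core_hom_cat_def in_hom_def ide[unfolded in_hom_def] comp dest!: iso_hom)
qed

text \<open>Since \<open>i\<close> is arrow-wise iso, every \<open>\<alpha> \<lhd> i\<close> is
  invertible, and its inverse again lies in the subcategory of arrow-wise isos. Composition with
  \<open>i\<close> is an isomorphism onto that subcategory, so it reflects invertibility back to
  \<alpha>.\<close>

lemma core_groupoid:
  assumes K: "is_core C X K i"
  shows "groupoid_obj C K"
proof -
  have i: "in_hom C i K X" using K by (rule is_core_hom)
  have "is_iso (hom_cat C A K) \<alpha>" if "A \<in> Obj C" "\<alpha> \<in> Arr (hom_cat C A K)" for A \<alpha>
  proof -
    have F: "iso_functor (hom_cat C A K) (core_hom_cat C A X) (postcomp C i)"
      using K that by (auto simp: is_core_def)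
    have "X \<in> Obj C" "K \<in> Obj C" using in_homD[OF i] by auto
    have ai: "is_iso (hom_cat C A X) (\<alpha> \<lhd> i)"
      using K that i by (auto simp: is_core_def arrowwise_iso_def in_hom_def)
    then obtain \<beta> where b: "is_inverse (hom_cat C A X) (\<alpha> \<lhd> i) \<beta>" by (auto simp: is_iso_def)
    have "is_inverse (hom_cat C A X) \<beta> (\<alpha> \<lhd> i)" using b by (auto simp: inverse_cell_iff)
    then have "is_iso (hom_cat C A X) \<beta>" by (auto simp: is_iso_def)
    moreover have "in_hom (core_hom_cat C A X) (snd (postcomp C i) \<alpha>) (fst (postcomp C i) (Dom2 C \<alpha>)) (fst (postcomp C i) (Cod2 C \<alpha>))"
      using F that by (auto simp: iso_functor_def is_functor_def)
    moreover have "\<alpha> \<in> Cell C" "Cod C (Dom2 C \<alpha>) = K" "Dom C (Dom2 C \<alpha>) = A" using that by auto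
    ultimately have "is_inverse (core_hom_cat C A X) (\<alpha> \<lhd> i) \<beta>"
      using b i ai unfolding is_inverse_def
      by (auto simp: core_hom_cat_def in_hom_def postcomp_def)
    then have "is_iso (core_hom_cat C A X) (snd (postcomp C i) \<alpha>)" by (auto simp: is_iso_def postcomp_def)
    from iso_functor_reflects_iso[OF hom_category[OF that(1) \<open>K \<in> Obj C\<close>]
        core_hom_category[OF that(1) \<open>X \<in> Obj C\<close>] F that(2) this]
    show ?thesis .
  qed
  then show ?thesis using in_homD[OF i] by (auto simp: groupoid_obj_def groupoid_cat_def)
qed

text \<open>A morphism from a groupoid is automatically arrow-wise iso, since whiskering preserves
  inverses; both alternatives in \<open>a\<close> thus place \<open>f\<close> in the image of
  composition with \<open>i\<close>.\<close>

lemma core_lift: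
  assumes K: "is_core C X K i" and f: "in_hom C f A X" and a: "groupoid_obj C A \<or> arrowwise_iso C f"
  shows "\<exists>!h. in_hom C h A K \<and> h \<cdot> i = f"
proof -
  have "A \<in> Obj C" using in_homD[OF f] by auto
  then have F: "iso_functor (hom_cat C A K) (core_hom_cat C A X) (postcomp C i)"
    using K by (auto simp: is_core_def)
  have ai: "arrowwise_iso C f" using a groupoid_arrowwise_iso f by auto
  from iso_functor_obj[OF F, of f] show ?thesis
    using f ai by (simp add: core_hom_cat_def postcomp_def)
qed

lemma core_eqI:
  assumes K: "is_core C X K i" and h: "in_hom C h A K" "in_hom C h' A K" "h \<cdot> i = h' \<cdot> i"
  shows "h = h'"
proof -
  have "A \<in> Obj C" using in_homD[OF h(1)] by auto
  then have F: "iso_functor (hom_cat C A K) (core_hom_cat C A X) (postcomp C i)"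
    using K by (auto simp: is_core_def)
  then have "inj_on (\<lambda>h. h \<cdot> i) {h. in_hom C h A K}"
    by (auto simp: iso_functor_def bij_betw_def postcomp_def)
  then show ?thesis using h by (auto simp: inj_on_def)
qed

lemma core_lift_along:
  assumes K: "is_core C X K i" and f: "in_hom C f A X" and a: "groupoid_obj C A \<or> arrowwise_iso C f"
  shows "in_hom C (lift_along C i f) A K" "lift_along C i f \<cdot> i = f"
proof -
  have "\<exists>!h. in_hom C h (Dom C f) (Dom C i) \<and> h \<cdot> i = f"
    using core_lift[OF assms] f is_core_hom[OF K] by (simp add: in_hom_def)
  from theI'[OF this] show "in_hom C (lift_along C i f) A K" "lift_along C i f \<cdot> i = f"
    using f is_core_hom[OF K] by (auto simp: lift_along_def in_hom_def)
qed

lemma lift_along_eqI: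
  assumes K: "is_core C X K i" and h: "in_hom C h A K" "h \<cdot> i = f" and a: "groupoid_obj C A"
  shows "lift_along C i f = h"
proof -
  have f: "in_hom C f A X" using h is_core_hom[OF K] by (auto simp: in_hom_def)
  note * = core_lift_along[OF K f]
  show ?thesis by (rule core_eqI[OF K, of _ A]) (use * h a in auto)
qed

end

subsection \<open>Cotensors\<close>

lemma preorder_cat_simps [simp]:
  "Obj (preorder_cat S le) = S" "Arr (preorder_cat S le) = {(i, j). i \<in> S \<and> j \<in> S \<and> le i j}"
  "Dom (preorder_cat S le) = fst" "Cod (preorder_cat S le) = snd"
  "Ide (preorder_cat S le) = (\<lambda>i. (i, i))" "Comp (preorder_cat S le) = (\<lambda>u v. (fst u, snd v))"
  by (simp_all add: preorder_cat_def)

lemma category_preorder_cat: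
  assumes "\<And>i. i \<in> S \<Longrightarrow> le i i" "\<And>i j k. i \<in> S \<Longrightarrow> j \<in> S \<Longrightarrow> k \<in> S \<Longrightarrow> le i j \<Longrightarrow> le j k \<Longrightarrow> le i k"
  shows "category (preorder_cat S le)"
  by unfold_locales (auto simp: in_hom_def assms(1) intro: assms(2))

lemma category_ordinal: "category (ordinal k)"
  unfolding ordinal_def by (rule category_preorder_cat) auto

lemma category_L_cat: "category L_cat"
  unfolding L_cat_def by (rule category_preorder_cat) auto

lemma full_subcat_UNIV [simp]: "full_subcat D UNIV = D"
  by (simp add: full_subcat_def)

lemma full_subcat_simps [simp]:
  "Obj (full_subcat D S) = Obj D \<inter> S" "Arr (full_subcat D S) = {a \<in> Arr D. Dom D a \<in> S \<and> Cod D a \<in> S}"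
  "Dom (full_subcat D S) = Dom D" "Cod (full_subcat D S) = Cod D" "Ide (full_subcat D S) = Ide D"
  "Comp (full_subcat D S) = Comp D"
  by (simp_all add: full_subcat_def)

lemma fun_cat_simps [simp]:
  "Obj (fun_cat J D) = {F. is_functor J D F \<and> fst F \<in> extensional (Obj J) \<and> snd F \<in> extensional (Arr J)}"
  "Arr (fun_cat J D) = {(F, t, G). F \<in> Obj (fun_cat J D) \<and> G \<in> Obj (fun_cat J D) \<and> t \<in> extensional (Obj J) \<and>
                 (\<forall>j \<in> Obj J. in_hom D (t j) (fst F j) (fst G j)) \<and>
                 (\<forall>u \<in> Arr J. snd F u \<cdot>\<^bsub>D\<^esub> t (Cod J u) = t (Dom J u) \<cdot>\<^bsub>D\<^esub> snd G u)}"
  "Dom (fun_cat J D) = (\<lambda>(F, t, G). F)" "Cod (fun_cat J D) = (\<lambda>(F, t, G). G)"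
  "Ide (fun_cat J D) = (\<lambda>F. (F, \<lambda>j \<in> Obj J. Ide D (fst F j), F))"
  "Comp (fun_cat J D) = (\<lambda>(F, t, G) (G', s, H). (F, \<lambda>j \<in> Obj J. t j \<cdot>\<^bsub>D\<^esub> s j, H))"
  by (simp_all add: fun_cat_def Let_def)

lemma restrict_functor:
  assumes "category J" "is_functor J D F"
  shows "is_functor J D (restrict (fst F) (Obj J), restrict (snd F) (Arr J))"
proof -
  interpret J: category J by fact
  show ?thesis using assms(2) by (auto simp: is_functor_def)
qed

text \<open>The locally bound \<open>d\<close> of \<open>cotensor_functor\<close>, named so that its
  values can be tested for membership in a set of diagrams.\<close>

definition cotensor_obj ::
  "('o, 'm, 'c) twocat \<Rightarrow> ('i, 'u) cat \<Rightarrow> ('i, 'u, 'm, 'c) fctr \<Rightarrow> 'm \<Rightarrow> ('i, 'u, 'm, 'c) fctr" where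
  "cotensor_obj C J ev h = (\<lambda>j \<in> Obj J. h \<cdot>\<^bsub>C\<^esub> fst ev j, \<lambda>u \<in> Arr J. h \<rhd>\<^bsub>C\<^esub> snd ev u)"

lemma cotensor_functor_eq: "cotensor_functor C J ev =
   (cotensor_obj C J ev, \<lambda>\<theta>. (cotensor_obj C J ev (Dom2 C \<theta>), \<lambda>j \<in> Obj J. \<theta> \<lhd>\<^bsub>C\<^esub> fst ev j,
      cotensor_obj C J ev (Cod2 C \<theta>)))"
  by (simp add: cotensor_functor_def cotensor_obj_def[abs_def] Let_def)

lemma ordinal_simps [simp]:
  "Obj (ordinal k) = {0..k}" "Arr (ordinal k) = {(i, j). i \<le> k \<and> j \<le> k \<and> i \<le> j}"
  "Dom (ordinal k) = fst" "Cod (ordinal k) = snd" "Ide (ordinal k) = (\<lambda>i. (i, i))"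
  "Comp (ordinal k) = (\<lambda>u v. (fst u, snd v))"
  by (auto simp: ordinal_def)

lemma ball_ordinal_1:
  "(\<forall>j \<in> Obj (ordinal 1). Q j) \<longleftrightarrow> Q 0 \<and> Q 1"
  "(\<forall>u \<in> Arr (ordinal 1). R u) \<longleftrightarrow> R (0, 0) \<and> R (0, 1) \<and> R (1, 1)"
proof -
  have "Obj (ordinal 1) = {0, 1}" "Arr (ordinal 1) = {(0, 0), (0, 1), (1, 1)}"
    by (auto simp: ordinal_def)
  then show "(\<forall>j \<in> Obj (ordinal 1). Q j) \<longleftrightarrow> Q 0 \<and> Q 1"
    "(\<forall>u \<in> Arr (ordinal 1). R u) \<longleftrightarrow> R (0, 0) \<and> R (0, 1) \<and> R (1, 1)" by auto
qed

context two_category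
begin

lemma functorD_hom:
  assumes "category J" "is_functor J (hom_cat C A X) F"
  shows "\<And>j. j \<in> Obj J \<Longrightarrow> in_hom C (fst F j) A X"
    "\<And>j. j \<in> Obj J \<Longrightarrow> snd F (Ide J j) = Ide2 C (fst F j)"
    "\<And>u. u \<in> Arr J \<Longrightarrow> in_hom (hom_cat C A X) (snd F u) (fst F (Dom J u)) (fst F (Cod J u))"
    "\<And>u v. u \<in> Arr J \<Longrightarrow> v \<in> Arr J \<Longrightarrow> Cod J u = Dom J v \<Longrightarrow> snd F (Comp J u v) = snd F u \<bullet> snd F v"
  using assms(2) by (auto simp: is_functor_def)

lemma cotensor_obj_functor:
  assumes J: "category J" and ev: "is_functor J (hom_cat C P X) ev" and h: "in_hom C h A P"
  shows "is_functor J (hom_cat C A X) (cotensor_obj C J ev h)"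
proof -
  interpret J: category J by fact
  note * = functorD_hom[OF J ev, unfolded in_hom_hom_cat in_hom_def[of C]]
  show ?thesis using * h by (auto simp: is_functor_def cotensor_obj_def in_hom_def)
qed

text \<open>The parameter \<open>Z\<close> lets one criterion serve both strict cotensors, where it
  is \<open>UNIV\<close>, and the object of exponential-shaped diagrams, where it is
  \<open>L_diagrams\<close>. Bijectivity is reduced to lifting properties that mention only values
  on \<open>J\<close>.\<close>

lemma cotensorI:
  assumes J: "category J" and ev: "is_functor J (hom_cat C P X) ev" and A: "A \<in> Obj C"
    and Z: "\<And>h. in_hom C h A P \<Longrightarrow> cotensor_obj C J ev h \<in> Z"
    and obj: "\<And>F. is_functor J (hom_cat C A X) F \<Longrightarrow> F \<in> Z \<Longrightarrow> \<exists>!h. in_hom C h A P \<and>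
      (\<forall>j \<in> Obj J. h \<cdot> fst ev j = fst F j) \<and> (\<forall>u \<in> Arr J. h \<rhd> snd ev u = snd F u)"
    and cell: "\<And>h h' t. in_hom C h A P \<Longrightarrow> in_hom C h' A P \<Longrightarrow>
      \<forall>j \<in> Obj J. in_hom (hom_cat C A X) (t j) (h \<cdot> fst ev j) (h' \<cdot> fst ev j) \<Longrightarrow>
      \<forall>u \<in> Arr J. (h \<rhd> snd ev u) \<bullet> t (Cod J u) = t (Dom J u) \<bullet> (h' \<rhd> snd ev u) \<Longrightarrow>
      \<exists>!\<theta>. in_hom (hom_cat C A P) \<theta> h h' \<and> (\<forall>j \<in> Obj J. \<theta> \<lhd> fst ev j = t j)"
  shows "iso_functor (hom_cat C A P) (full_subcat (fun_cat J (hom_cat C A X)) Z) (cotensor_functor C J ev)"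
proof (rule iso_functorI)
  interpret J: category J by fact
  note ev' = functorD_hom[OF J ev, unfolded in_hom_hom_cat in_hom_def[of C]]
  have o: "cotensor_obj C J ev h \<in> Z \<inter> Obj (fun_cat J (hom_cat C A X))" if "in_hom C h A P" for h
    using Z[OF that] cotensor_obj_functor[OF J ev that] by (auto simp: cotensor_obj_def)
  show "is_functor (hom_cat C A P) (full_subcat (fun_cat J (hom_cat C A X)) Z) (cotensor_functor C J ev)"
    unfolding is_functor_def
  proof (intro conjI ballI impI)
    fix h assume "h \<in> Obj (hom_cat C A P)"
    then have h: "in_hom C h A P" by simp
    then show "fst (cotensor_functor C J ev) h \<in> Obj (full_subcat (fun_cat J (hom_cat C A X)) Z)"
      using o[OF h] by (simp add: cotensor_functor_eq)
    show "snd (cotensor_functor C J ev) (Ide (hom_cat C A P) h) =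
         Ide (full_subcat (fun_cat J (hom_cat C A X)) Z) (fst (cotensor_functor C J ev) h)"
      using h ev' by (auto simp: cotensor_functor_eq in_hom_def cotensor_obj_def intro!: restrict_ext)
  next
    fix \<theta> assume "\<theta> \<in> Arr (hom_cat C A P)"
    then have \<theta>: "\<theta> \<in> Cell C" "Dom C (Dom2 C \<theta>) = A" "Cod C (Dom2 C \<theta>) = P" by auto
    then have h: "in_hom C (Dom2 C \<theta>) A P" "in_hom C (Cod2 C \<theta>) A P" by (auto simp: in_hom_def)
    \<comment> \<open>Naturality of the whiskered family is the exchange law for \<theta> and
      \<open>snd ev u\<close>.\<close>
    have nat: "(Dom2 C \<theta> \<rhd> snd ev u) \<bullet> (\<theta> \<lhd> fst ev (Cod J u)) = (\<theta> \<lhd> fst ev (Dom J u)) \<bullet> (Cod2 C \<theta> \<rhd> snd ev u)"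
      if "u \<in> Arr J" for u
      using whisker_exchange[of \<theta> "snd ev u"] ev'(3)[OF that] \<theta> by auto
    show "in_hom (full_subcat (fun_cat J (hom_cat C A X)) Z) (snd (cotensor_functor C J ev) \<theta>)
          (fst (cotensor_functor C J ev) (Dom (hom_cat C A P) \<theta>)) (fst (cotensor_functor C J ev) (Cod (hom_cat C A P) \<theta>))"
      using o[OF h(1)] o[OF h(2)] nat \<theta> ev'
      by (auto simp: cotensor_functor_eq in_hom_def cotensor_obj_def)
  next
    fix \<theta> \<theta>' assume "\<theta> \<in> Arr (hom_cat C A P)" "\<theta>' \<in> Arr (hom_cat C A P)" "Cod (hom_cat C A P) \<theta> = Dom (hom_cat C A P) \<theta>'"
    then show "snd (cotensor_functor C J ev) (Comp (hom_cat C A P) \<theta> \<theta>') =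
       Comp (full_subcat (fun_cat J (hom_cat C A X)) Z) (snd (cotensor_functor C J ev) \<theta>) (snd (cotensor_functor C J ev) \<theta>')"
      using ev' by (auto simp: cotensor_functor_eq intro!: restrict_ext)
  qed
  show "Dom (hom_cat C A P) f \<in> Obj (hom_cat C A P) \<and> Cod (hom_cat C A P) f \<in> Obj (hom_cat C A P)"
    if "f \<in> Arr (hom_cat C A P)" for f using that by (rule hom_cat_Dom_Cod)
  show "Dom (full_subcat (fun_cat J (hom_cat C A X)) Z) f \<in> Obj (full_subcat (fun_cat J (hom_cat C A X)) Z) \<and>
        Cod (full_subcat (fun_cat J (hom_cat C A X)) Z) f \<in> Obj (full_subcat (fun_cat J (hom_cat C A X)) Z)"
    if "f \<in> Arr (full_subcat (fun_cat J (hom_cat C A X)) Z)" for f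
    using that by (cases f) simp
  \<comment> \<open>Objects of \<open>fun_cat\<close> are extensional, so equality with
    \<open>F\<close> can be tested on the objects and arrows of \<open>J\<close>.\<close>
  have iff: "cotensor_obj C J ev h = F \<longleftrightarrow>
      (\<forall>j \<in> Obj J. h \<cdot> fst ev j = fst F j) \<and> (\<forall>u \<in> Arr J. h \<rhd> snd ev u = snd F u)"
    if "fst F \<in> extensional (Obj J)" "snd F \<in> extensional (Arr J)" for F h
    using that by (cases F) (auto simp: cotensor_obj_def extensional_def restrict_def fun_eq_iff)
  show "\<exists>!x. x \<in> Obj (hom_cat C A P) \<and> fst (cotensor_functor C J ev) x = F"
    if "F \<in> Obj (full_subcat (fun_cat J (hom_cat C A X)) Z)" for F
    using obj[of F] that iff[of F] by (simp add: cotensor_functor_eq)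
  show "\<exists>!\<theta>. in_hom (hom_cat C A P) \<theta> h h' \<and> snd (cotensor_functor C J ev) \<theta> = b"
    if h: "h \<in> Obj (hom_cat C A P)" "h' \<in> Obj (hom_cat C A P)"
      and b: "in_hom (full_subcat (fun_cat J (hom_cat C A X)) Z) b (fst (cotensor_functor C J ev) h)
         (fst (cotensor_functor C J ev) h')" for h h' b
  proof -
    obtain t where bt: "b = (cotensor_obj C J ev h, t, cotensor_obj C J ev h')"
      using b by (cases b) (auto simp: in_hom_def cotensor_functor_eq)
    have t: "t \<in> extensional (Obj J)"
      "\<forall>j \<in> Obj J. in_hom (hom_cat C A X) (t j) (h \<cdot> fst ev j) (h' \<cdot> fst ev j)"
      "\<forall>u \<in> Arr J. (h \<rhd> snd ev u) \<bullet> t (Cod J u) = t (Dom J u) \<bullet> (h' \<rhd> snd ev u)"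
      using b unfolding bt by (simp_all add: in_hom_def[of "full_subcat _ _"] cotensor_obj_def)
    have "(\<forall>j \<in> Obj J. \<theta> \<lhd> fst ev j = t j) \<longleftrightarrow> snd (cotensor_functor C J ev) \<theta> = b"
      if "in_hom (hom_cat C A P) \<theta> h h'" for \<theta>
      using that t(1) by (auto simp: bt cotensor_functor_eq in_hom_def extensional_def restrict_def fun_eq_iff)
    with cell[of h h' t] t h show ?thesis by (simp cong: conj_cong)
  qed
qed

text \<open>The values of \<open>F\<close> outside \<open>J\<close> are arbitrary; its restriction
  is the extensional object of \<open>fun_cat\<close> that the isomorphism lifts, which is why
  membership in \<open>Z\<close> is asked of the restriction.\<close>

lemma cotensor_lift:
  assumes J: "category J" and F: "is_functor J (hom_cat C A X) F"
    and iso: "iso_functor (hom_cat C A P) (full_subcat (fun_cat J (hom_cat C A X)) Z) (cotensor_functor C J ev)"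
    and Z: "(restrict (fst F) (Obj J), restrict (snd F) (Arr J)) \<in> Z"
  shows "\<exists>!h. in_hom C h A P \<and>
      (\<forall>j \<in> Obj J. h \<cdot> fst ev j = fst F j) \<and> (\<forall>u \<in> Arr J. h \<rhd> snd ev u = snd F u)"
proof -
  have "(cotensor_obj C J ev h = (restrict (fst F) (Obj J), restrict (snd F) (Arr J))) =
      ((\<forall>j \<in> Obj J. h \<cdot> fst ev j = fst F j) \<and> (\<forall>u \<in> Arr J. h \<rhd> snd ev u = snd F u))" for h
    by (auto simp: cotensor_obj_def restrict_def fun_eq_iff)
  with iso_functor_obj[OF iso, of "(restrict (fst F) (Obj J), restrict (snd F) (Arr J))"]
    restrict_functor[OF J F] Z show ?thesis
    by (simp add: cotensor_functor_eq)
qed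

lemma cotensor_lift_cell:
  assumes J: "category J" and ev: "is_functor J (hom_cat C P X) ev"
    and iso: "iso_functor (hom_cat C A P) (full_subcat (fun_cat J (hom_cat C A X)) Z) (cotensor_functor C J ev)"
    and h: "in_hom C h A P" "in_hom C h' A P"
    and t: "\<forall>j \<in> Obj J. in_hom (hom_cat C A X) (t j) (h \<cdot> fst ev j) (h' \<cdot> fst ev j)"
      "\<forall>u \<in> Arr J. (h \<rhd> snd ev u) \<bullet> t (Cod J u) = t (Dom J u) \<bullet> (h' \<rhd> snd ev u)"
  shows "\<exists>!\<theta>. in_hom (hom_cat C A P) \<theta> h h' \<and> (\<forall>j \<in> Obj J. \<theta> \<lhd> fst ev j = t j)"
proof -
  interpret J: category J by fact
  define b where "b = (cotensor_obj C J ev h, restrict t (Obj J), cotensor_obj C J ev h')"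
  have o: "cotensor_obj C J ev k \<in> Z \<and> is_functor J (hom_cat C A X) (cotensor_obj C J ev k)" if "in_hom C k A P" for k
    using iso that by (auto simp: iso_functor_def is_functor_def[of "hom_cat C A P"] cotensor_functor_eq)
  have e: "fst (cotensor_obj C J ev k) \<in> extensional (Obj J)" "snd (cotensor_obj C J ev k) \<in> extensional (Arr J)" for k
    by (auto simp: cotensor_obj_def)
  have "in_hom (full_subcat (fun_cat J (hom_cat C A X)) Z) b (fst (cotensor_functor C J ev) h)
         (fst (cotensor_functor C J ev) h')"
    using o[OF h(1)] o[OF h(2)] e t unfolding in_hom_def[of "full_subcat _ _"]
    by (simp add: b_def cotensor_functor_eq) (simp add: cotensor_obj_def)
  from iso_functor_arr[OF iso hom_cat_Dom_Cod _ _ this] h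
  have "\<exists>!\<theta>. in_hom (hom_cat C A P) \<theta> h h' \<and> snd (cotensor_functor C J ev) \<theta> = b" by simp
  moreover have "(\<forall>j \<in> Obj J. \<theta> \<lhd> fst ev j = t j) \<longleftrightarrow> snd (cotensor_functor C J ev) \<theta> = b"
      if "in_hom (hom_cat C A P) \<theta> h h'" for \<theta>
    using that by (auto simp: b_def cotensor_functor_eq in_hom_def restrict_def fun_eq_iff)
  ultimately show ?thesis by (simp cong: conj_cong)
qed

lemma strict_cotensorD:
  assumes "strict_cotensor C J X P ev"
  shows "X \<in> Obj C" "P \<in> Obj C" "is_functor J (hom_cat C P X) ev"
    "\<And>A. A \<in> Obj C \<Longrightarrow> iso_functor (hom_cat C A P) (full_subcat (fun_cat J (hom_cat C A X)) UNIV)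
        (cotensor_functor C J ev)"
  using assms by (auto simp: strict_cotensor_def)

subsection \<open>Arrow objects\<close>

lemma arrow_functor:
  assumes "in_hom (hom_cat C A X) \<alpha> f g"
  shows "is_functor (ordinal 1) (hom_cat C A X)
    (\<lambda>j. if j = 0 then f else g, \<lambda>(i, j). if j = 0 then Ide2 C f else if i = 0 then \<alpha> else Ide2 C g)"
proof -
  have *: "\<alpha> \<in> Cell C" "Dom2 C \<alpha> = f" "Cod2 C \<alpha> = g" "Dom C f = A" "Cod C f = X" "f \<in> Arr C" "g \<in> Arr C"
    "Dom C g = A" "Cod C g = X" using assms by (auto simp: in_hom_def)
  show ?thesis using * by (auto simp: is_functor_def ordinal_def in_hom_def)
qed

lemma arrow_object_hom:
  assumes "arrow_object C X P ev"
  shows "X \<in> Obj C" "P \<in> Obj C" "in_hom C (fst ev 0) P X" "in_hom C (fst ev 1) P X" "in_hom C (fst ev (Suc 0)) P X"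
    "in_hom (hom_cat C P X) (univ_cell ev) (fst ev 0) (fst ev 1)"
    "snd ev (0, 0) = Ide2 C (fst ev 0)" "snd ev (1, 1) = Ide2 C (fst ev 1)"
    "snd ev (Suc 0, Suc 0) = Ide2 C (fst ev (Suc 0))"
proof -
  note * = strict_cotensorD[OF assms[unfolded arrow_object_def]]
  show "X \<in> Obj C" "P \<in> Obj C" by fact+
  note ** = functorD_hom[OF category_ordinal *(3)]
  show "in_hom C (fst ev 0) P X" "in_hom C (fst ev 1) P X" "in_hom C (fst ev (Suc 0)) P X"
    using **(1)[of 0] **(1)[of 1] by (auto simp: ordinal_def)
  show "in_hom (hom_cat C P X) (univ_cell ev) (fst ev 0) (fst ev 1)" using **(3)[of "(0, 1)"] by (auto simp: ordinal_def)
  show "snd ev (0, 0) = Ide2 C (fst ev 0)" "snd ev (1, 1) = Ide2 C (fst ev 1)"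
   "snd ev (Suc 0, Suc 0) = Ide2 C (fst ev (Suc 0))"
    using **(2)[of 0] **(2)[of 1] by (auto simp: ordinal_def)
qed

lemma arrow_object_lift:
  assumes P: "arrow_object C X P ev" and \<alpha>: "in_hom (hom_cat C A X) \<alpha> f g"
  shows "\<exists>!h. in_hom C h A P \<and> h \<rhd> univ_cell ev = \<alpha>"
proof -
  note * = strict_cotensorD[OF P[unfolded arrow_object_def]] and h = arrow_object_hom[OF P]
  have "A \<in> Obj C" using \<alpha> dom_obj[of f] by (auto simp: in_hom_def)
  note c = cotensor_lift[OF category_ordinal arrow_functor[OF \<alpha>] *(4)[OF this]]
  \<comment> \<open>The 2-cell named by \<open>k\<close> determines both vertices through its
    boundary, and the remaining arrows of the diagram are identities on these vertices.\<close>
  have "((\<forall>j\<in>Obj (ordinal 1). k \<cdot> fst ev j = (if j = 0 then f else g)) \<and>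
       (\<forall>u\<in>Arr (ordinal 1). k \<rhd> snd ev u = (case u of (i, j) \<Rightarrow>
          if j = 0 then Ide2 C f else if i = 0 then \<alpha> else Ide2 C g))) \<longleftrightarrow> k \<rhd> univ_cell ev = \<alpha>"
    (is "?l \<longleftrightarrow> ?r") if k: "in_hom C k A P" for k
  proof -
    have "k \<cdot> fst ev 0 = f \<and> k \<cdot> fst ev 1 = g" if r: ?r
      using h(6) k arg_cong[OF r, of "Dom2 C"] arg_cong[OF r, of "Cod2 C"] \<alpha> by (auto simp: in_hom_def)
    moreover have "k \<rhd> Ide2 C (fst ev 0) = Ide2 C (k \<cdot> fst ev 0)" "k \<rhd> Ide2 C (fst ev 1) = Ide2 C (k \<cdot> fst ev 1)"
      using h k by (auto simp: in_hom_def)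
    ultimately show ?thesis unfolding ball_ordinal_1 by (auto simp: h(7-9))
  qed
  with c show ?thesis by (simp cong: conj_cong)
qed

lemma arrow_object_lift_cell:
  assumes P: "arrow_object C X P ev" and k: "in_hom C h A P" "in_hom C h' A P"
    and t: "in_hom (hom_cat C A X) t0 (h \<cdot> fst ev 0) (h' \<cdot> fst ev 0)"
       "in_hom (hom_cat C A X) t1 (h \<cdot> fst ev 1) (h' \<cdot> fst ev 1)"
    and n: "(h \<rhd> univ_cell ev) \<bullet> t1 = t0 \<bullet> (h' \<rhd> univ_cell ev)"
  shows "\<exists>!\<theta>. in_hom (hom_cat C A P) \<theta> h h' \<and> \<theta> \<lhd> fst ev 0 = t0 \<and> \<theta> \<lhd> fst ev 1 = t1"
proof -
  note * = strict_cotensorD[OF P[unfolded arrow_object_def]] and h = arrow_object_hom[OF P]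
  have A: "A \<in> Obj C" using k dom_obj by (auto simp: in_hom_def)
  have "\<exists>!\<theta>. in_hom (hom_cat C A P) \<theta> h h' \<and> (\<forall>j \<in> Obj (ordinal 1). \<theta> \<lhd> fst ev j = (if j = 0 then t0 else t1))"
    by (rule cotensor_lift_cell[OF category_ordinal *(3) *(4)[OF A] k])
      (unfold ball_ordinal_1, use h t n k in \<open>simp_all add: in_hom_def\<close>)
  moreover have "(\<forall>j \<in> Obj (ordinal 1). \<theta> \<lhd> fst ev j = (if j = 0 then t0 else t1)) \<longleftrightarrow>
     \<theta> \<lhd> fst ev 0 = t0 \<and> \<theta> \<lhd> fst ev 1 = t1" for \<theta>
    unfolding ball_ordinal_1 by simp
  ultimately show ?thesis by simp
qed

subsection \<open>Limits in a pita 2-category\<close>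

text \<open>A product is a pullback over the terminal object: every morphism into \<open>T\<close>
  is an isofibration because the only 2-cells there are identities, so the pullback is among those
  that a pita 2-category provides.\<close>

lemma strict_product_exists:
  assumes "pita C" "X \<in> Obj C" "Y \<in> Obj C"
  shows "\<exists>P p q. strict_product C X Y P p q"
proof -
  obtain T where T: "strict_terminal C T" using assms(1) by (auto simp: pita_def)
  have one: "\<exists>f. in_hom C f A T" "\<And>f g. in_hom C f A T \<Longrightarrow> in_hom C g A T \<Longrightarrow> f = g"
    "\<And>\<alpha> \<beta>. \<alpha> \<in> Arr (hom_cat C A T) \<Longrightarrow> \<beta> \<in> Arr (hom_cat C A T) \<Longrightarrow> \<alpha> = \<beta>" if A: "A \<in> Obj C" for A
  proof -
    obtain f where f: "Obj (hom_cat C A T) = {f}" "Arr (hom_cat C A T) = {Ide2 C f}"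
      using T A by (auto simp: strict_terminal_def)
    have "f \<in> Obj (hom_cat C A T)" using f by blast
    then show "\<exists>f. in_hom C f A T" by auto
    show "g = h" if "in_hom C g A T" "in_hom C h A T" for g h
    proof -
      have "g \<in> Obj (hom_cat C A T)" "h \<in> Obj (hom_cat C A T)" using that by auto
      then show ?thesis unfolding f by simp
    qed
    show "\<alpha> = \<beta>" if "\<alpha> \<in> Arr (hom_cat C A T)" "\<beta> \<in> Arr (hom_cat C A T)" for \<alpha> \<beta>
      using that unfolding f by simp
  qed
  obtain f where f: "in_hom C f X T" using one(1)[OF assms(2)] by blast
  obtain g where g: "in_hom C g Y T" using one(1)[OF assms(3)] by blast
  have "isofibration_functor (hom_cat C A X) (hom_cat C A T) (postcomp C f)" if A: "A \<in> Obj C" for A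
    unfolding isofibration_functor_def
  proof (intro ballI allI impI)
    fix x b assume x: "x \<in> Obj (hom_cat C A X)"
      and b: "is_iso (hom_cat C A T) b \<and> Dom (hom_cat C A T) b = fst (postcomp C f) x"
    have "is_iso (hom_cat C A X) (Ide2 C x)" using x unfolding is_iso_def
      by (intro exI[of _ "Ide2 C x"]) (auto simp: inverse_cell_iff in_hom_def)
    moreover have "Ide2 C x \<lhd> f = b"
      by (rule one(3)[OF A]) (use b x f in \<open>auto simp: is_iso_def inverse_cell_iff in_hom_def\<close>)
    ultimately show "\<exists>a. is_iso (hom_cat C A X) a \<and> Dom (hom_cat C A X) a = x \<and> snd (postcomp C f) a = b"
      using x by (auto simp: postcomp_def in_hom_def)
  qed
  then have "isofibration C f" using f by (auto simp: isofibration_def in_hom_def)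
  then obtain p q where pq: "strict_pullback C p q f g"
    using assms(1) f g unfolding pita_def in_hom_def by metis
  \<comment> \<open>All 1-cells and all 2-cells from a fixed object into \<open>T\<close> coincide,
    so the matching conditions in the pullback of hom-categories hold automatically.\<close>
  have eq: "pullback_cat (hom_cat C B X) (postcomp C f) (hom_cat C B Y) (postcomp C g) =
       prod_cat (hom_cat C B X) (hom_cat C B Y)" if B: "B \<in> Obj C" for B
  proof -
    have "{(x, y). x \<in> Obj (hom_cat C B X) \<and> y \<in> Obj (hom_cat C B Y) \<and> fst (postcomp C f) x = fst (postcomp C g) y}
        = Obj (hom_cat C B X) \<times> Obj (hom_cat C B Y)"
      using f g by (auto simp: postcomp_def in_hom_def intro!: one(2)[OF B])
    moreover have "{(x, y). x \<in> Arr (hom_cat C B X) \<and> y \<in> Arr (hom_cat C B Y) \<and> snd (postcomp C f) x = snd (postcomp C g) y}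
        = Arr (hom_cat C B X) \<times> Arr (hom_cat C B Y)"
      using f g by (auto simp: postcomp_def in_hom_def intro!: one(3)[OF B])
    ultimately show ?thesis by (simp only: pullback_cat_def) (simp add: prod_cat_def)
  qed
  have "in_hom C p (Dom C p) X" "in_hom C q (Dom C p) Y"
    using strict_pullback_hom[OF pq] f g by (auto simp: in_hom_def)
  moreover have "iso_functor (hom_cat C B (Dom C p)) (prod_cat (hom_cat C B X) (hom_cat C B Y)) (span_functor C p q)"
    if "B \<in> Obj C" for B
    using pq f g that eq[OF that] unfolding strict_pullback_def in_hom_def by metis
  ultimately show ?thesis unfolding strict_product_def by blast
qed

section \<open>Invertible 2-cells into arrow objects, and isofibrations\<close>

lemma arrow_object_hom':
  assumes "arrow_object C X P ev"
  shows "fst ev 0 \<in> Arr C" "fst ev 1 \<in> Arr C" "fst ev (Suc 0) \<in> Arr C" "Dom C (fst ev 0) = P" "Dom C (fst ev 1) = P"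
    "Dom C (fst ev (Suc 0)) = P" "Cod C (fst ev 0) = X" "Cod C (fst ev 1) = X" "Cod C (fst ev (Suc 0)) = X"
    "univ_cell ev \<in> Cell C" "Dom2 C (univ_cell ev) = fst ev 0" "Cod2 C (univ_cell ev) = fst ev 1"
    "snd ev (0, Suc 0) \<in> Cell C" "Dom2 C (snd ev (0, Suc 0)) = fst ev 0" "Cod2 C (snd ev (0, Suc 0)) = fst ev (Suc 0)"
  using arrow_object_hom[OF assms] by (auto simp: in_hom_def)

lemma arrow_object_eqI:
  assumes P: "arrow_object C X P ev" and "in_hom C h A P" "in_hom C h' A P"
    "h \<rhd> univ_cell ev = h' \<rhd> univ_cell ev"
  shows "h = h'"
proof -
  have "in_hom (hom_cat C A X) (h \<rhd> univ_cell ev) (h \<cdot> fst ev 0) (h \<cdot> fst ev 1)"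
    using assms(2) arrow_object_hom'[OF P] by (auto simp: in_hom_def)
  from arrow_object_lift[OF P this] assms show ?thesis by metis
qed

lemma arrow_object_cell_eqI:
  assumes P: "arrow_object C X P ev"
    and t: "in_hom (hom_cat C A P) \<theta> h h'" "in_hom (hom_cat C A P) \<theta>' h h'"
    "\<theta> \<lhd> fst ev 0 = \<theta>' \<lhd> fst ev 0" "\<theta> \<lhd> fst ev 1 = \<theta>' \<lhd> fst ev 1"
  shows "\<theta> = \<theta>'"
proof -
  note * = arrow_object_hom'[OF P]
  have h: "in_hom C h A P" "in_hom C h' A P" using t by (auto simp: in_hom_def)
  have c: "in_hom (hom_cat C A X) (\<theta> \<lhd> fst ev 0) (h \<cdot> fst ev 0) (h' \<cdot> fst ev 0)"
    "in_hom (hom_cat C A X) (\<theta> \<lhd> fst ev 1) (h \<cdot> fst ev 1) (h' \<cdot> fst ev 1)" using t * by (auto simp: in_hom_def)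
  have n: "(h \<rhd> univ_cell ev) \<bullet> (\<theta> \<lhd> fst ev 1) = (\<theta> \<lhd> fst ev 0) \<bullet> (h' \<rhd> univ_cell ev)"
    using whisker_exchange[of \<theta> "univ_cell ev"] t * by (auto simp: in_hom_def)
  from arrow_object_lift_cell[OF P h c n] t show ?thesis by metis
qed

lemma VComp_cancel_l:
  assumes "is_inverse (hom_cat C A X) \<alpha> \<beta>" "\<delta> \<in> Cell C"
  shows "Dom2 C \<delta> = Cod2 C \<alpha> \<Longrightarrow> \<beta> \<bullet> (\<alpha> \<bullet> \<delta>) = \<delta>" "Dom2 C \<delta> = Dom2 C \<alpha> \<Longrightarrow> \<alpha> \<bullet> (\<beta> \<bullet> \<delta>) = \<delta>"
proof -
  have T: "\<alpha> \<in> Cell C" "\<beta> \<in> Cell C" "Dom2 C \<beta> = Cod2 C \<alpha>" "Cod2 C \<beta> = Dom2 C \<alpha>"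
    and E: "\<alpha> \<bullet> \<beta> = Ide2 C (Dom2 C \<alpha>)" "\<beta> \<bullet> \<alpha> = Ide2 C (Cod2 C \<alpha>)"
    using assms by (auto simp: inverse_cell_iff)
  show "\<beta> \<bullet> (\<alpha> \<bullet> \<delta>) = \<delta>" if "Dom2 C \<delta> = Cod2 C \<alpha>"
    using VComp_assoc[of \<beta> \<alpha> \<delta>] T E assms(2) that by simp
  show "\<alpha> \<bullet> (\<beta> \<bullet> \<delta>) = \<delta>" if "Dom2 C \<delta> = Dom2 C \<alpha>"
    using VComp_assoc[of \<alpha> \<beta> \<delta>] T E assms(2) that by simp
qed

text \<open>Cancelling the invertible sides turns a commuting square into the square of their
  inverses; candidate inverses given componentwise thereby satisfy the condition needed to lift
  them.\<close>

lemma inverse_cell_natural: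
  assumes \<alpha>: "is_inverse (hom_cat C A X) \<alpha> \<alpha>'" and \<beta>: "is_inverse (hom_cat C A X) \<beta> \<beta>'"
    and u: "in_hom (hom_cat C A X) u (Dom2 C \<alpha>) (Dom2 C \<beta>)"
    and v: "in_hom (hom_cat C A X) v (Cod2 C \<alpha>) (Cod2 C \<beta>)"
    and e: "u \<bullet> \<beta> = \<alpha> \<bullet> v"
  shows "v \<bullet> \<beta>' = \<alpha>' \<bullet> u"
proof -
  have T: "\<alpha> \<in> Cell C" "\<alpha>' \<in> Cell C" "Dom2 C \<alpha>' = Cod2 C \<alpha>" "Cod2 C \<alpha>' = Dom2 C \<alpha>"
    "\<beta> \<in> Cell C" "\<beta>' \<in> Cell C" "Dom2 C \<beta>' = Cod2 C \<beta>" "Cod2 C \<beta>' = Dom2 C \<beta>"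
    "u \<in> Cell C" "v \<in> Cell C" "Dom2 C u = Dom2 C \<alpha>" "Cod2 C u = Dom2 C \<beta>" "Dom2 C v = Cod2 C \<alpha>"
    "Cod2 C v = Cod2 C \<beta>"
    using assms by (auto simp: inverse_cell_iff in_hom_def)
  have v: "v = \<alpha>' \<bullet> (u \<bullet> \<beta>)" unfolding e by (rule VComp_cancel_l(1)[OF \<alpha>, symmetric]) (use T in auto)
  have "v \<bullet> \<beta>' = (\<alpha>' \<bullet> (u \<bullet> \<beta>)) \<bullet> \<beta>'" by (simp only: v[symmetric])
  also have "\<dots> = \<alpha>' \<bullet> (u \<bullet> (\<beta> \<bullet> \<beta>'))" using T by simp
  also have "\<beta> \<bullet> \<beta>' = Ide2 C (Dom2 C \<beta>)" using \<beta> by (simp add: inverse_cell_iff)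
  also have "u \<bullet> Ide2 C (Dom2 C \<beta>) = u" using T by simp
  finally show ?thesis .
qed

text \<open>The inverses of the two components again form a naturality square, so they lift to a
  2-cell in the opposite direction, and 2-cells into an arrow object are detected on
  components.\<close>

lemma arrow_object_inverse:
  assumes P: "arrow_object C X P ev" and t: "in_hom (hom_cat C A P) \<theta> h h'"
    and s: "is_inverse (hom_cat C A X) (\<theta> \<lhd> fst ev 0) s0" "is_inverse (hom_cat C A X) (\<theta> \<lhd> fst ev 1) s1"
  shows "is_iso (hom_cat C A P) \<theta>"
proof -
  note * = arrow_object_hom'[OF P]
  have h: "in_hom C h A P" "in_hom C h' A P" using t by (auto simp: in_hom_def)
  have n: "(h \<rhd> univ_cell ev) \<bullet> (\<theta> \<lhd> fst ev 1) = (\<theta> \<lhd> fst ev 0) \<bullet> (h' \<rhd> univ_cell ev)"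
    using whisker_exchange[of \<theta> "univ_cell ev"] t * by (auto simp: in_hom_def)
  have n': "(h' \<rhd> univ_cell ev) \<bullet> s1 = s0 \<bullet> (h \<rhd> univ_cell ev)"
    by (rule inverse_cell_natural[OF s _ _ n]) (use t h * in \<open>auto simp: in_hom_def\<close>)
  have "in_hom (hom_cat C A X) s0 (h' \<cdot> fst ev 0) (h \<cdot> fst ev 0)"
    "in_hom (hom_cat C A X) s1 (h' \<cdot> fst ev 1) (h \<cdot> fst ev 1)"
    using s t h * by (auto simp: inverse_cell_iff in_hom_def)
  from arrow_object_lift_cell[OF P h(2,1) this n']
  obtain \<theta>' where \<theta>': "in_hom (hom_cat C A P) \<theta>' h' h" "\<theta>' \<lhd> fst ev 0 = s0" "\<theta>' \<lhd> fst ev 1 = s1"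
    by blast
  have "\<theta> \<bullet> \<theta>' = Ide2 C h"
    by (rule arrow_object_cell_eqI[OF P, of A _ h h]) (use t \<theta>' s * in \<open>auto simp: in_hom_def inverse_cell_iff\<close>)
  moreover have "\<theta>' \<bullet> \<theta> = Ide2 C h'"
    by (rule arrow_object_cell_eqI[OF P, of A _ h' h']) (use t \<theta>' s * in \<open>auto simp: in_hom_def inverse_cell_iff\<close>)
  ultimately show ?thesis using t \<theta>' unfolding is_iso_def by (auto simp: inverse_cell_iff in_hom_def)
qed

lemma is_inverse_Ide2: "in_hom C f A X \<Longrightarrow> is_inverse (hom_cat C A X) (Ide2 C f) (Ide2 C f)"
  by (auto simp: inverse_cell_iff in_hom_def)

text \<open>Conjugating the arrow named by \<open>h\<close> with the two isomorphisms gives the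
  codomain of \<theta>. With an identity at one end, this shows that each endpoint projection is an
  isofibration, the property needed to form pullbacks along it.\<close>

lemma arrow_object_transport:
  assumes P: "arrow_object C X P ev" and h: "in_hom C h A P"
    and b: "is_inverse (hom_cat C A X) b0 b0'" "is_inverse (hom_cat C A X) b1 b1'"
      "Dom2 C b0 = h \<cdot> fst ev 0" "Dom2 C b1 = h \<cdot> fst ev 1"
  shows "\<exists>\<theta>. is_iso (hom_cat C A P) \<theta> \<and> Dom2 C \<theta> = h \<and> \<theta> \<lhd> fst ev 0 = b0 \<and> \<theta> \<lhd> fst ev 1 = b1"
proof -
  note * = arrow_object_hom'[OF P]
  define c where "c = b0' \<bullet> ((h \<rhd> univ_cell ev) \<bullet> b1)"
  have c: "in_hom (hom_cat C A X) c (Cod2 C b0) (Cod2 C b1)"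
    using b h * by (auto simp: c_def in_hom_def inverse_cell_iff)
  from arrow_object_lift[OF P this] obtain h' where h': "in_hom C h' A P" "h' \<rhd> univ_cell ev = c" by blast
  have e: "h' \<cdot> fst ev 0 = Cod2 C b0" "h' \<cdot> fst ev 1 = Cod2 C b1"
  proof -
    have "in_hom (hom_cat C A X) (h' \<rhd> univ_cell ev) (h' \<cdot> fst ev 0) (h' \<cdot> fst ev 1)"
      using h'(1) * by (auto simp: in_hom_def)
    with c show "h' \<cdot> fst ev 0 = Cod2 C b0" "h' \<cdot> fst ev 1 = Cod2 C b1"
      unfolding h'(2) by (auto simp: in_hom_def)
  qed
  have "(h \<rhd> univ_cell ev) \<bullet> b1 = b0 \<bullet> c" unfolding c_def
    by (rule VComp_cancel_l(2)[OF b(1), symmetric]) (use b h * in \<open>auto simp: in_hom_def inverse_cell_iff\<close>)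
  note n = this[folded h'(2)]
  have "in_hom (hom_cat C A X) b0 (h \<cdot> fst ev 0) (h' \<cdot> fst ev 0)"
    "in_hom (hom_cat C A X) b1 (h \<cdot> fst ev 1) (h' \<cdot> fst ev 1)"
    using b e h by (auto simp: in_hom_def inverse_cell_iff)
  from arrow_object_lift_cell[OF P h h'(1) this n]
  obtain \<theta> where t: "in_hom (hom_cat C A P) \<theta> h h'" "\<theta> \<lhd> fst ev 0 = b0" "\<theta> \<lhd> fst ev 1 = b1"
    by blast
  have "is_iso (hom_cat C A P) \<theta>" by (rule arrow_object_inverse[OF P t(1)]) (use t b in auto)
  with t show ?thesis by (auto simp: in_hom_def)
qed

lemma isofibration_arrow_cod:
  assumes P: "arrow_object C X P ev"
  shows "isofibration C (fst ev 1)"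
proof -
  note * = arrow_object_hom'[OF P]
  have "\<exists>a. is_iso (hom_cat C A P) a \<and> Dom2 C a = h \<and> a \<lhd> fst ev 1 = b"
    if h: "in_hom C h A P" and b: "is_iso (hom_cat C A X) b" "Dom2 C b = h \<cdot> fst ev 1" for A h b
  proof -
    obtain b' where b': "is_inverse (hom_cat C A X) b b'" using b by (auto simp: is_iso_def)
    have "in_hom C (h \<cdot> fst ev 0) A X" using h * by (auto simp: in_hom_def)
    from arrow_object_transport[OF P h is_inverse_Ide2[OF this] b' _ b(2)] h * show ?thesis
      by (auto simp: in_hom_def)
  qed
  then show ?thesis using * by (auto simp: isofibration_def isofibration_functor_def postcomp_def)
qed

lemma isofibration_arrow_dom:
  assumes P: "arrow_object C X P ev"
  shows "isofibration C (fst ev 0)"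
proof -
  note * = arrow_object_hom'[OF P]
  have "\<exists>a. is_iso (hom_cat C A P) a \<and> Dom2 C a = h \<and> a \<lhd> fst ev 0 = b"
    if h: "in_hom C h A P" and b: "is_iso (hom_cat C A X) b" "Dom2 C b = h \<cdot> fst ev 0" for A h b
  proof -
    obtain b' where b': "is_inverse (hom_cat C A X) b b'" using b by (auto simp: is_iso_def)
    have "in_hom C (h \<cdot> fst ev 1) A X" using h * by (auto simp: in_hom_def)
    from arrow_object_transport[OF P h b' is_inverse_Ide2[OF this] b(2)] h * show ?thesis
      by (auto simp: in_hom_def)
  qed
  then show ?thesis using * by (auto simp: isofibration_def isofibration_functor_def postcomp_def)
qed

end

text \<open>This is the cotensor of \<open>X\<close> with [2], presented by its two generating
  arrows \<open>u\<close> and \<open>v\<close>; the composite and the functor laws stay implicit,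
  which shortens lifting arguments. The last two clauses are its universal property for 1-cells and
  for 2-cells.\<close>

definition pair_classifier :: "('o, 'm, 'c) twocat \<Rightarrow> 'o \<Rightarrow> 'o \<Rightarrow> 'c \<Rightarrow> 'c \<Rightarrow> bool" where
  "pair_classifier C X V u v \<longleftrightarrow> X \<in> Obj C \<and> V \<in> Obj C \<and>
     u \<in> Arr (hom_cat C V X) \<and> v \<in> Arr (hom_cat C V X) \<and> Cod2 C u = Dom2 C v \<and>
     (\<forall>A \<alpha> \<beta>. \<alpha> \<in> Arr (hom_cat C A X) \<and> \<beta> \<in> Arr (hom_cat C A X) \<and> Cod2 C \<alpha> = Dom2 C \<beta> \<longrightarrow>
        (\<exists>!h. in_hom C h A V \<and> h \<rhd>\<^bsub>C\<^esub> u = \<alpha> \<and> h \<rhd>\<^bsub>C\<^esub> v = \<beta>)) \<and>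
     (\<forall>A h h' t0 t1 t2. in_hom C h A V \<and> in_hom C h' A V \<and>
        in_hom (hom_cat C A X) t0 (h \<cdot>\<^bsub>C\<^esub> Dom2 C u) (h' \<cdot>\<^bsub>C\<^esub> Dom2 C u) \<and>
        in_hom (hom_cat C A X) t1 (h \<cdot>\<^bsub>C\<^esub> Cod2 C u) (h' \<cdot>\<^bsub>C\<^esub> Cod2 C u) \<and>
        in_hom (hom_cat C A X) t2 (h \<cdot>\<^bsub>C\<^esub> Cod2 C v) (h' \<cdot>\<^bsub>C\<^esub> Cod2 C v) \<and>
        (h \<rhd>\<^bsub>C\<^esub> u) \<bullet>\<^bsub>C\<^esub> t1 = t0 \<bullet>\<^bsub>C\<^esub> (h' \<rhd>\<^bsub>C\<^esub> u) \<and> (h \<rhd>\<^bsub>C\<^esub> v) \<bullet>\<^bsub>C\<^esub> t2 = t1 \<bullet>\<^bsub>C\<^esub> (h' \<rhd>\<^bsub>C\<^esub> v) \<longrightarrow>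
        (\<exists>!\<theta>. in_hom (hom_cat C A V) \<theta> h h' \<and>
           \<theta> \<lhd>\<^bsub>C\<^esub> Dom2 C u = t0 \<and> \<theta> \<lhd>\<^bsub>C\<^esub> Cod2 C u = t1 \<and> \<theta> \<lhd>\<^bsub>C\<^esub> Cod2 C v = t2))"

lemma ball_ordinal_2:
  "(\<forall>j \<in> Obj (ordinal 2). Q j) \<longleftrightarrow> Q 0 \<and> Q 1 \<and> Q 2"
  "(\<forall>u \<in> Arr (ordinal 2). R u) \<longleftrightarrow> R (0, 0) \<and> R (0, 1) \<and> R (0, 2) \<and> R (1, 1) \<and> R (1, 2) \<and> R (2, 2)"
proof -
  have j: "j \<le> 2 \<longleftrightarrow> j = 0 \<or> j = 1 \<or> j = (2::nat)" for j by auto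
  have "Obj (ordinal 2) = {0, 1, 2}" "Arr (ordinal 2) = {(0, 0), (0, 1), (0, 2), (1, 1), (1, 2), (2, 2)}"
    by (auto simp: j simp del: One_nat_def)
  then show "(\<forall>j \<in> Obj (ordinal 2). Q j) \<longleftrightarrow> Q 0 \<and> Q 1 \<and> Q 2"
    "(\<forall>u \<in> Arr (ordinal 2). R u) \<longleftrightarrow> R (0, 0) \<and> R (0, 1) \<and> R (0, 2) \<and> R (1, 1) \<and> R (1, 2) \<and> R (2, 2)" by auto
qed

context two_category
begin

lemma pair_classifier_lift:
  assumes "pair_classifier C X V u v" "\<alpha> \<in> Arr (hom_cat C A X)" "\<beta> \<in> Arr (hom_cat C A X)" "Cod2 C \<alpha> = Dom2 C \<beta>"
  shows "\<exists>!h. in_hom C h A V \<and> h \<rhd> u = \<alpha> \<and> h \<rhd> v = \<beta>"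
  using assms unfolding pair_classifier_def by blast

lemma pair_classifier_lift_cell:
  assumes "pair_classifier C X V u v" "in_hom C h A V" "in_hom C h' A V"
    "in_hom (hom_cat C A X) t0 (h \<cdot> Dom2 C u) (h' \<cdot> Dom2 C u)"
    "in_hom (hom_cat C A X) t1 (h \<cdot> Cod2 C u) (h' \<cdot> Cod2 C u)"
    "in_hom (hom_cat C A X) t2 (h \<cdot> Cod2 C v) (h' \<cdot> Cod2 C v)"
    "(h \<rhd> u) \<bullet> t1 = t0 \<bullet> (h' \<rhd> u)" "(h \<rhd> v) \<bullet> t2 = t1 \<bullet> (h' \<rhd> v)"
  shows "\<exists>!\<theta>. in_hom (hom_cat C A V) \<theta> h h' \<and> \<theta> \<lhd> Dom2 C u = t0 \<and> \<theta> \<lhd> Cod2 C u = t1 \<and> \<theta> \<lhd> Cod2 C v = t2"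
  using assms unfolding pair_classifier_def by blast

lemma pair_classifier_hom:
  assumes "pair_classifier C X V u v"
  shows "X \<in> Obj C" "V \<in> Obj C" "u \<in> Cell C" "v \<in> Cell C" "Dom C (Dom2 C u) = V" "Dom C (Dom2 C v) = V"
    "Cod C (Dom2 C u) = X" "Cod C (Dom2 C v) = X" "Cod2 C u = Dom2 C v"
proof -
  have "X \<in> Obj C \<and> V \<in> Obj C \<and>
     u \<in> Arr (hom_cat C V X) \<and> v \<in> Arr (hom_cat C V X) \<and> Cod2 C u = Dom2 C v"
    using assms unfolding pair_classifier_def by blast
  then show "X \<in> Obj C" "V \<in> Obj C" "u \<in> Cell C" "v \<in> Cell C" "Dom C (Dom2 C u) = V" "Dom C (Dom2 C v) = V"
    "Cod C (Dom2 C u) = X" "Cod C (Dom2 C v) = X" "Cod2 C u = Dom2 C v" by auto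
qed

lemma pair_classifier_exists:
  assumes "pita C" "X \<in> Obj C"
  shows "\<exists>V u v. pair_classifier C X V u v"
proof -
  obtain P ev where P: "arrow_object C X P ev" using assms unfolding pita_def by blast
  note a = arrow_object_hom'[OF P]
  \<comment> \<open>The codomain of the arrow picked by \<open>p\<close> is identified with the
    domain of the one picked by \<open>q\<close>, so the pullback holds composable pairs.\<close>
  obtain p q where pq: "strict_pullback C p q (fst ev 1) (fst ev 0)"
    using assms(1) isofibration_arrow_cod[OF P] a unfolding pita_def by metis
  define V where "V = Dom C p"
  note h = strict_pullback_hom[OF pq, folded V_def]
  have pq': "p \<in> Arr C" "q \<in> Arr C" "Dom C p = V" "Dom C q = V" "Cod C p = P" "Cod C q = P"
    using h a by (auto simp: in_hom_def)
  have [simp]: "p \<cdot> fst ev (Suc 0) = q \<cdot> fst ev 0" using h(3) by simp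
  have V: "V \<in> Obj C" using pq' dom_obj by metis
  define u where "u = p \<rhd> univ_cell ev"
  define v where "v = q \<rhd> univ_cell ev"
  have uv: "u \<in> Cell C" "v \<in> Cell C" "Dom2 C u = p \<cdot> fst ev 0" "Cod2 C u = q \<cdot> fst ev 0"
    "Dom2 C v = q \<cdot> fst ev 0" "Cod2 C v = q \<cdot> fst ev 1"
    using pq' a by (auto simp: u_def v_def)
  have lift: "\<exists>!h. in_hom C h A V \<and> h \<rhd> u = \<alpha> \<and> h \<rhd> v = \<beta>"
    if c: "\<alpha> \<in> Arr (hom_cat C A X)" "\<beta> \<in> Arr (hom_cat C A X)" "Cod2 C \<alpha> = Dom2 C \<beta>" for A \<alpha> \<beta>
  proof -
    have "in_hom (hom_cat C A X) \<alpha> (Dom2 C \<alpha>) (Cod2 C \<alpha>)" "in_hom (hom_cat C A X) \<beta> (Dom2 C \<beta>) (Cod2 C \<beta>)"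
      using c by (auto simp: in_hom_def)
    note l = this[THEN arrow_object_lift[OF P]]
    obtain k where k: "in_hom C k A P" "k \<rhd> univ_cell ev = \<alpha>" using l(1) by blast
    obtain k' where k': "in_hom C k' A P" "k' \<rhd> univ_cell ev = \<beta>" using l(2) by blast
    have "k \<cdot> fst ev 1 = Cod2 C \<alpha>" "k' \<cdot> fst ev 0 = Dom2 C \<beta>"
      using k k' a by (auto simp: in_hom_def)
    then have eq: "k \<cdot> fst ev 1 = k' \<cdot> fst ev 0" using c by simp
    have "in_hom C k A (Dom C (fst ev 1))" "in_hom C k' A (Dom C (fst ev 0))" using k k' a by auto
    from strict_pullback_lift[OF pq this eq, folded V_def]
    have ex: "\<exists>!h. in_hom C h A V \<and> h \<cdot> p = k \<and> h \<cdot> q = k'" .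
    have "h \<rhd> u = \<alpha> \<and> h \<rhd> v = \<beta> \<longleftrightarrow> h \<cdot> p = k \<and> h \<cdot> q = k'" if hh: "in_hom C h A V" for h
    proof -
      have hpq: "in_hom C (h \<cdot> p) A P" "in_hom C (h \<cdot> q) A P" using hh pq' by (auto simp: in_hom_def)
      have "h \<rhd> u = (h \<cdot> p) \<rhd> univ_cell ev" "h \<rhd> v = (h \<cdot> q) \<rhd> univ_cell ev"
        using hh pq' a by (auto simp: u_def v_def in_hom_def)
      then show ?thesis using arrow_object_eqI[OF P hpq(1) k(1)] arrow_object_eqI[OF P hpq(2) k'(1)] k(2) k'(2) by metis
    qed
    with ex show ?thesis by (simp cong: conj_cong)
  qed
  \<comment> \<open>The component at the middle vertex is shared: it is the codomain component for
    the first arrow and the domain component for the second, which makes the two lifted 2-cells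
    compatible over the pullback.\<close>
  have cell: "\<exists>!\<theta>. in_hom (hom_cat C A V) \<theta> h h' \<and>
        \<theta> \<lhd> Dom2 C u = t0 \<and> \<theta> \<lhd> Cod2 C u = t1 \<and> \<theta> \<lhd> Cod2 C v = t2"
    if hh: "in_hom C h A V" "in_hom C h' A V"
      and t: "in_hom (hom_cat C A X) t0 (h \<cdot> Dom2 C u) (h' \<cdot> Dom2 C u)"
        "in_hom (hom_cat C A X) t1 (h \<cdot> Cod2 C u) (h' \<cdot> Cod2 C u)"
        "in_hom (hom_cat C A X) t2 (h \<cdot> Cod2 C v) (h' \<cdot> Cod2 C v)"
      and n: "(h \<rhd> u) \<bullet> t1 = t0 \<bullet> (h' \<rhd> u)" "(h \<rhd> v) \<bullet> t2 = t1 \<bullet> (h' \<rhd> v)" for A h h' t0 t1 t2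
  proof -
    have H: "h \<in> Arr C" "h' \<in> Arr C" "Dom C h = A" "Dom C h' = A" "Cod C h = V" "Cod C h' = V"
      using hh by (auto simp: in_hom_def)
    have hp: "in_hom C (h \<cdot> p) A P" "in_hom C (h' \<cdot> p) A P" "in_hom C (h \<cdot> q) A P" "in_hom C (h' \<cdot> q) A P"
      using H pq' by (auto simp: in_hom_def)
    have tp: "in_hom (hom_cat C A X) t0 ((h \<cdot> p) \<cdot> fst ev 0) ((h' \<cdot> p) \<cdot> fst ev 0)"
      "in_hom (hom_cat C A X) t1 ((h \<cdot> p) \<cdot> fst ev 1) ((h' \<cdot> p) \<cdot> fst ev 1)"
      "((h \<cdot> p) \<rhd> univ_cell ev) \<bullet> t1 = t0 \<bullet> ((h' \<cdot> p) \<rhd> univ_cell ev)"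
      "in_hom (hom_cat C A X) t1 ((h \<cdot> q) \<cdot> fst ev 0) ((h' \<cdot> q) \<cdot> fst ev 0)"
      "in_hom (hom_cat C A X) t2 ((h \<cdot> q) \<cdot> fst ev 1) ((h' \<cdot> q) \<cdot> fst ev 1)"
      "((h \<cdot> q) \<rhd> univ_cell ev) \<bullet> t2 = t1 \<bullet> ((h' \<cdot> q) \<rhd> univ_cell ev)"
      using t n H pq' a uv by (auto simp: u_def v_def)
    obtain tp where tpp: "in_hom (hom_cat C A P) tp (h \<cdot> p) (h' \<cdot> p)" "tp \<lhd> fst ev 0 = t0" "tp \<lhd> fst ev 1 = t1"
      using arrow_object_lift_cell[OF P hp(1,2) tp(1-3)] by blast
    obtain tq where tqq: "in_hom (hom_cat C A P) tq (h \<cdot> q) (h' \<cdot> q)" "tq \<lhd> fst ev 0 = t1" "tq \<lhd> fst ev 1 = t2"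
      using arrow_object_lift_cell[OF P hp(3,4) tp(4-6)] by blast
    have "\<exists>!\<theta>. in_hom (hom_cat C A V) \<theta> h h' \<and> \<theta> \<lhd> p = tp \<and> \<theta> \<lhd> q = tq"
      unfolding V_def
      by (rule strict_pullback_lift_cell[OF pq]) (use hh tpp tqq a in \<open>auto simp: V_def\<close>)
    moreover have "\<theta> \<lhd> p = tp \<and> \<theta> \<lhd> q = tq \<longleftrightarrow> \<theta> \<lhd> Dom2 C u = t0 \<and> \<theta> \<lhd> Cod2 C u = t1 \<and> \<theta> \<lhd> Cod2 C v = t2"
      if th: "in_hom (hom_cat C A V) \<theta> h h'" for \<theta>
    proof -
      have thc: "\<theta> \<in> Cell C" "Dom2 C \<theta> = h" "Cod2 C \<theta> = h'" using th by (auto simp: in_hom_def)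
      have ww: "(\<theta> \<lhd> p) \<lhd> fst ev 0 = \<theta> \<lhd> Dom2 C u" "(\<theta> \<lhd> p) \<lhd> fst ev 1 = \<theta> \<lhd> Cod2 C u"
        "(\<theta> \<lhd> q) \<lhd> fst ev 0 = \<theta> \<lhd> Cod2 C u" "(\<theta> \<lhd> q) \<lhd> fst ev 1 = \<theta> \<lhd> Cod2 C v"
        using thc H pq' a uv h(3) whisker_r_comp[symmetric, of p "fst ev (Suc 0)" \<theta>] by auto
      have "in_hom (hom_cat C A P) (\<theta> \<lhd> p) (h \<cdot> p) (h' \<cdot> p)" "in_hom (hom_cat C A P) (\<theta> \<lhd> q) (h \<cdot> q) (h' \<cdot> q)"
        using thc H pq' by (auto simp: in_hom_def)
      from arrow_object_cell_eqI[OF P this(1) tpp(1)] arrow_object_cell_eqI[OF P this(2) tqq(1)] ww tpp tqq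
      show ?thesis by metis
    qed
    ultimately show ?thesis by (simp cong: conj_cong)
  qed
  have T: "u \<in> Arr (hom_cat C V X)" "v \<in> Arr (hom_cat C V X)" "Cod2 C u = Dom2 C v"
    using uv pq' a by auto
  have "pair_classifier C X V u v"
    unfolding pair_classifier_def
    apply (intro conjI allI impI)
    subgoal by (rule assms(2))
    subgoal by (rule V)
    subgoal by (rule T)
    subgoal by (rule T)
    subgoal by (rule T)
    subgoal using lift by blast
    subgoal using cell by blast
    done
  then show ?thesis by blast
qed

text \<open>A diagram over [2] is determined by its two generating arrows, since the long edge must
  be their composite and the loops are identities. The pair classifier is therefore itself the
  cotensor.\<close>

lemma cotensor_2_exists:
  assumes "pita C" "X \<in> Obj C"
  shows "\<exists>P ev. strict_cotensor C (ordinal 2) X P ev"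
proof -
  obtain V u v where V: "pair_classifier C X V u v" using pair_classifier_exists[OF assms] by blast
  note h = pair_classifier_hom[OF V]
  define ev :: "(nat, nat \<times> nat, 'm, 'c) fctr" where
    "ev = (\<lambda>j. if j = 0 then Dom2 C u else if j = 1 then Cod2 C u else Cod2 C v,
        \<lambda>(i, j). if i = j then Ide2 C (if j = 0 then Dom2 C u else if j = 1 then Cod2 C u else Cod2 C v)
           else if j = 1 then u else if i = 1 then v else u \<bullet> v)"
  have ev: "fst ev 0 = Dom2 C u" "fst ev 1 = Cod2 C u" "fst ev 2 = Cod2 C v"
    "snd ev (0, 0) = Ide2 C (Dom2 C u)" "snd ev (1, 1) = Ide2 C (Cod2 C u)" "snd ev (2, 2) = Ide2 C (Cod2 C v)"
    "snd ev (0, 1) = u" "snd ev (1, 2) = v" "snd ev (0, 2) = u \<bullet> v"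
    by (auto simp: ev_def)
  have evf: "is_functor (ordinal 2) (hom_cat C V X) ev"
    unfolding is_functor_def ball_ordinal_2 using h by (simp add: ev in_hom_def del: One_nat_def)
  have "iso_functor (hom_cat C A V) (full_subcat (fun_cat (ordinal 2) (hom_cat C A X)) UNIV) (cotensor_functor C (ordinal 2) ev)"
    if A: "A \<in> Obj C" for A
  proof (rule cotensorI[OF category_ordinal evf A])
    show "cotensor_obj C (ordinal 2) ev h \<in> UNIV" for h by simp
    fix F :: "(nat, nat \<times> nat, 'm, 'c) fctr" assume F: "is_functor (ordinal 2) (hom_cat C A X) F"
    note f = functorD_hom[OF category_ordinal F]
    have fo: "in_hom C (fst F 0) A X" "in_hom C (fst F 1) A X" "in_hom C (fst F 2) A X"
      using f(1)[of 0] f(1)[of 1] f(1)[of 2] by simp_all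
    have fi: "snd F (0, 0) = Ide2 C (fst F 0)" "snd F (1, 1) = Ide2 C (fst F 1)" "snd F (2, 2) = Ide2 C (fst F 2)"
      using f(2)[of 0] f(2)[of 1] f(2)[of 2] by simp_all
    have fa: "in_hom (hom_cat C A X) (snd F (0, 1)) (fst F 0) (fst F 1)"
      "in_hom (hom_cat C A X) (snd F (1, 2)) (fst F 1) (fst F 2)"
      "snd F (0, 2) = snd F (0, 1) \<bullet> snd F (1, 2)"
      using f(3)[of "(0, 1)"] f(3)[of "(1, 2)"] f(4)[of "(0, 1)" "(1, 2)"] by simp_all
    have ex: "\<exists>!h. in_hom C h A V \<and> h \<rhd> u = snd F (0, 1) \<and> h \<rhd> v = snd F (1, 2)"
      by (rule pair_classifier_lift[OF V]) (use fa in \<open>auto simp: in_hom_def\<close>)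
    have "((\<forall>j\<in>Obj (ordinal 2). k \<cdot> fst ev j = fst F j) \<and>
        (\<forall>w\<in>Arr (ordinal 2). k \<rhd> snd ev w = snd F w)) \<longleftrightarrow> k \<rhd> u = snd F (0, 1) \<and> k \<rhd> v = snd F (1, 2)"
      (is "?l \<longleftrightarrow> ?r") if k: "in_hom C k A V" for k
    proof
      show "?l \<Longrightarrow> ?r" unfolding ball_ordinal_2 ev by blast
      assume r: ?r
      have t: "k \<rhd> u \<in> Cell C" "k \<rhd> v \<in> Cell C" "Dom2 C (k \<rhd> u) = k \<cdot> Dom2 C u" "Cod2 C (k \<rhd> u) = k \<cdot> Cod2 C u"
        "Cod2 C (k \<rhd> v) = k \<cdot> Cod2 C v"
        "k \<rhd> Ide2 C (Dom2 C u) = Ide2 C (k \<cdot> Dom2 C u)" "k \<rhd> Ide2 C (Cod2 C u) = Ide2 C (k \<cdot> Cod2 C u)"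
        "k \<rhd> Ide2 C (Cod2 C v) = Ide2 C (k \<cdot> Cod2 C v)" "k \<rhd> (u \<bullet> v) = (k \<rhd> u) \<bullet> (k \<rhd> v)"
        using k h by (auto simp: in_hom_def)
      then have "k \<cdot> Dom2 C u = fst F 0" "k \<cdot> Cod2 C u = fst F 1" "k \<cdot> Cod2 C v = fst F 2"
        using r fa by (auto simp: in_hom_def)
      then show ?l unfolding ball_ordinal_2 ev using t r fi fa by simp
    qed
    with ex show "\<exists>!h. in_hom C h A V \<and> (\<forall>j\<in>Obj (ordinal 2). h \<cdot> fst ev j = fst F j) \<and>
         (\<forall>w\<in>Arr (ordinal 2). h \<rhd> snd ev w = snd F w)" by (simp cong: conj_cong)
  next
    fix k k' t assume k: "in_hom C k A V" "in_hom C k' A V"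
      and t: "\<forall>j\<in>Obj (ordinal 2). in_hom (hom_cat C A X) (t j) (k \<cdot> fst ev j) (k' \<cdot> fst ev j)"
        "\<forall>w\<in>Arr (ordinal 2). (k \<rhd> snd ev w) \<bullet> t (Cod (ordinal 2) w) = t (Dom (ordinal 2) w) \<bullet> (k' \<rhd> snd ev w)"
    show "\<exists>!\<theta>. in_hom (hom_cat C A V) \<theta> k k' \<and> (\<forall>j\<in>Obj (ordinal 2). \<theta> \<lhd> fst ev j = t j)"
      unfolding ball_ordinal_2 ev
      by (rule pair_classifier_lift_cell[OF V k])
        (use t in \<open>unfold ball_ordinal_2 ev, simp_all\<close>)
  qed
  then have "strict_cotensor C (ordinal 2) X V ev"
    using h evf by (auto simp: strict_cotensor_def)
  then show ?thesis by blast
qed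

end

subsection \<open>Presentations of objects by their nerves\<close>

text \<open>The part of the nerve structure that determines morphisms out of \<open>Y\<close> by their restrictions
  to groupoids: morphisms and 2-cells into \<open>Y\<close> from a groupoid are classified by \<open>C0 N\<close> and \<open>C1 N\<close>.\<close>

definition nerve_presentation ::
  "('o, 'm, 'c) twocat \<Rightarrow> 'o \<Rightarrow> ('o, 'm) intcat \<Rightarrow> 'm \<Rightarrow> 'c \<Rightarrow> bool" where
  "nerve_presentation C Y N \<gamma> \<gamma>\<^sub>0\<^sub>1 \<longleftrightarrow>
     groupoid_obj C (C0 N) \<and> groupoid_obj C (C1 N) \<and> groupoid_obj C (C2 N) \<and>
     in_hom C (pi0 N) (C1 N) (C0 N) \<and> in_hom C (pi1 N) (C1 N) (C0 N) \<and> in_hom C (ident N) (C0 N) (C1 N) \<and>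
     in_hom C (pi01 N) (C2 N) (C1 N) \<and> in_hom C (pi12 N) (C2 N) (C1 N) \<and> in_hom C (pi02 N) (C2 N) (C1 N) \<and>
     ident N \<cdot>\<^bsub>C\<^esub> pi0 N = Ide C (C0 N) \<and> ident N \<cdot>\<^bsub>C\<^esub> pi1 N = Ide C (C0 N) \<and>
     pi02 N \<cdot>\<^bsub>C\<^esub> pi0 N = pi01 N \<cdot>\<^bsub>C\<^esub> pi0 N \<and> pi02 N \<cdot>\<^bsub>C\<^esub> pi1 N = pi12 N \<cdot>\<^bsub>C\<^esub> pi1 N \<and>
     pi01 N \<cdot>\<^bsub>C\<^esub> pi1 N = pi12 N \<cdot>\<^bsub>C\<^esub> pi0 N \<and>
     (\<forall>A f. groupoid_obj C A \<and> in_hom C f A Y \<longrightarrow> (\<exists>!h. in_hom C h A (C0 N) \<and> h \<cdot>\<^bsub>C\<^esub> \<gamma> = f)) \<and>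
     (\<forall>A \<alpha>. groupoid_obj C A \<and> \<alpha> \<in> Arr (hom_cat C A Y) \<longrightarrow>
        (\<exists>!a. in_hom C a A (C1 N) \<and> a \<rhd>\<^bsub>C\<^esub> \<gamma>\<^sub>0\<^sub>1 = \<alpha>)) \<and>
     strict_quotient C N Y \<gamma> \<gamma>\<^sub>0\<^sub>1"

context two_category
begin

section \<open>Induced maps between cotensors\<close>

lemma cotensor_map_eqI:
  assumes P: "strict_cotensor C J X P ev" and J: "category J" and m: "in_hom C m P' P"
    and "\<forall>j \<in> Obj J. m \<cdot> fst ev j = fst ev' (fst \<phi> j)" "\<forall>u \<in> Arr J. m \<rhd> snd ev u = snd ev' (snd \<phi> u)"
  shows "cotensor_map C J \<phi> P' ev' P ev = m"
  unfolding cotensor_map_def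
proof (rule the_equality)
  note * = strict_cotensorD[OF P]
  fix k assume k: "in_hom C k P' P \<and> (\<forall>j \<in> Obj J. k \<cdot> fst ev j = fst ev' (fst \<phi> j)) \<and>
     (\<forall>u \<in> Arr J. k \<rhd> snd ev u = snd ev' (snd \<phi> u))"
  have P': "P' \<in> Obj C" using m dom_obj by (auto simp: in_hom_def)
  have ex: "\<exists>!h. in_hom C h P' P \<and> (\<forall>j \<in> Obj J. h \<cdot> fst ev j = fst (cotensor_obj C J ev m) j) \<and>
     (\<forall>u \<in> Arr J. h \<rhd> snd ev u = snd (cotensor_obj C J ev m) u)" (is "\<exists>!h. ?Q h")
    by (rule cotensor_lift[OF J cotensor_obj_functor[OF J *(3) m] *(4)[OF P']]) simp
  have "?Q m" using m by (simp add: cotensor_obj_def)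
  moreover have "fst (cotensor_obj C J ev m) j = fst ev' (fst \<phi> j)" if "j \<in> Obj J" for j
    using that assms(4) by (simp add: cotensor_obj_def)
  moreover have "snd (cotensor_obj C J ev m) u = snd ev' (snd \<phi> u)" if "u \<in> Arr J" for u
    using that assms(5) by (simp add: cotensor_obj_def)
  ultimately show "k = m" using ex k by (metis (no_types, lifting))
qed (use assms in blast)

text \<open>With \<open>trivial_ev\<close>, the object \<open>X\<close> is its own cotensor with
  \<open>ordinal 0\<close>; composing with its identity leaves only the vertex projection satisfying
  the description.\<close>

lemma cotensor_map_vertex:
  assumes P: "arrow_object C X P ev" and j: "j \<le> 1"
  shows "cotensor_map C (ordinal 0) (delta [j]) P ev X (trivial_ev C X) = fst ev j"
proof -
  have j: "j = 0 \<or> j = 1" using j by auto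
  have h: "in_hom C (fst ev j) P X" "snd ev (j, j) = Ide2 C (fst ev j)"
    using arrow_object_hom[OF P] j by auto
  have b: "(\<forall>k \<in> Obj (ordinal 0). Q k) \<longleftrightarrow> Q 0" "(\<forall>u \<in> Arr (ordinal 0). R u) \<longleftrightarrow> R (0, 0)" for Q R
    by auto
  have "in_hom C m P X \<and> m \<cdot> Ide C X = fst ev j \<and> m \<rhd> Ide2 C (Ide C X) = Ide2 C (fst ev j) \<longleftrightarrow> m = fst ev j" for m
    using h(1) arrow_object_hom(1)[OF P] by (auto simp: in_hom_def)
  then show ?thesis unfolding cotensor_map_def b by (simp add: trivial_ev_def delta_def h(2))
qed

text \<open>A morphism into an arrow object is fixed by the 2-cell it names; the conditions of
  \<open>cotensor_map\<close> at vertices and identities follow from the boundary of that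
  2-cell.\<close>

lemma cotensor_map_arrow:
  assumes P: "arrow_object C X P ev" and m: "in_hom C m P' P" "m \<rhd> univ_cell ev = snd ev' (snd \<phi> (0, 1))"
    and e: "in_hom (hom_cat C P' X) (snd ev' (snd \<phi> (0, 1))) (fst ev' (fst \<phi> 0)) (fst ev' (fst \<phi> 1))"
      "snd ev' (snd \<phi> (0, 0)) = Ide2 C (fst ev' (fst \<phi> 0))" "snd ev' (snd \<phi> (1, 1)) = Ide2 C (fst ev' (fst \<phi> 1))"
  shows "cotensor_map C (ordinal 1) \<phi> P' ev' P ev = m" "m \<cdot> fst ev 0 = fst ev' (fst \<phi> 0)"
    "m \<cdot> fst ev 1 = fst ev' (fst \<phi> 1)"
proof -
  note * = arrow_object_hom'[OF P]
  have "in_hom (hom_cat C P' X) (m \<rhd> univ_cell ev) (m \<cdot> fst ev 0) (m \<cdot> fst ev 1)"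
    using m(1) * by (auto simp: in_hom_def)
  then show v: "m \<cdot> fst ev 0 = fst ev' (fst \<phi> 0)" "m \<cdot> fst ev 1 = fst ev' (fst \<phi> 1)"
    using e(1) unfolding m(2) by (auto simp: in_hom_def)
  have i: "m \<rhd> Ide2 C (fst ev 0) = Ide2 C (m \<cdot> fst ev 0)" "m \<rhd> Ide2 C (fst ev 1) = Ide2 C (m \<cdot> fst ev 1)"
    using m(1) * by (auto simp: in_hom_def)
  show "cotensor_map C (ordinal 1) \<phi> P' ev' P ev = m"
    by (rule cotensor_map_eqI[OF P[unfolded arrow_object_def] category_ordinal m(1)])
      (unfold ball_ordinal_1 arrow_object_hom(7,8)[OF P] i v m(2) e, simp_all)
qed

section \<open>Morphisms and 2-cells out of a strict quotient\<close>

lemma strict_quotient_lift: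
  assumes q: "strict_quotient C N X \<gamma> \<gamma>\<^sub>0\<^sub>1" and g: "is_cocone C N Y g g\<^sub>0\<^sub>1"
  shows "\<exists>!h. in_hom C h X Y \<and> \<gamma> \<cdot> h = g \<and> \<gamma>\<^sub>0\<^sub>1 \<lhd> h = g\<^sub>0\<^sub>1"
proof -
  have "Y \<in> Obj C" using g in_homD by (auto simp: is_cocone_def)
  then have "iso_functor (hom_cat C X Y) (cocone_cat C N Y) (cocone_functor C \<gamma> \<gamma>\<^sub>0\<^sub>1)"
    using q by (simp add: strict_quotient_def)
  from iso_functor_obj[OF this, of "(g, g\<^sub>0\<^sub>1)"] g show ?thesis
    by (simp add: cocone_cat_def cocone_functor_def Let_def)
qed

lemma strict_quotient_lift_cell:
  assumes q: "strict_quotient C N X \<gamma> \<gamma>\<^sub>0\<^sub>1" and h: "in_hom C h X Y" "in_hom C h' X Y"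
    and \<alpha>: "in_hom (hom_cat C (C0 N) Y) \<alpha> (\<gamma> \<cdot> h) (\<gamma> \<cdot> h')"
    and n: "(pi0 N \<rhd> \<alpha>) \<bullet> (\<gamma>\<^sub>0\<^sub>1 \<lhd> h') = (\<gamma>\<^sub>0\<^sub>1 \<lhd> h) \<bullet> (pi1 N \<rhd> \<alpha>)"
  shows "\<exists>!\<theta>. in_hom (hom_cat C X Y) \<theta> h h' \<and> \<gamma> \<rhd> \<theta> = \<alpha>"
proof -
  have Y: "Y \<in> Obj C" using h in_homD by auto
  then have F: "iso_functor (hom_cat C X Y) (cocone_cat C N Y) (cocone_functor C \<gamma> \<gamma>\<^sub>0\<^sub>1)"
    using q by (simp add: strict_quotient_def)
  have c: "is_cocone C N Y (\<gamma> \<cdot> k) (\<gamma>\<^sub>0\<^sub>1 \<lhd> k)" if "in_hom C k X Y" for k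
    using F that by (simp add: iso_functor_def is_functor_def cocone_cat_def cocone_functor_def Let_def)
  have "in_hom (cocone_cat C N Y) ((\<gamma> \<cdot> h, \<gamma>\<^sub>0\<^sub>1 \<lhd> h), \<alpha>, (\<gamma> \<cdot> h', \<gamma>\<^sub>0\<^sub>1 \<lhd> h'))
     (fst (cocone_functor C \<gamma> \<gamma>\<^sub>0\<^sub>1) h) (fst (cocone_functor C \<gamma> \<gamma>\<^sub>0\<^sub>1) h')"
    unfolding in_hom_def[of "cocone_cat C N Y"]
    using c h \<alpha> n by (simp add: cocone_functor_def Let_def cocone_cat_def)
  from iso_functor_arr[OF F hom_cat_Dom_Cod _ _ this] h
  have "\<exists>!\<theta>. in_hom (hom_cat C X Y) \<theta> h h' \<and>
      snd (cocone_functor C \<gamma> \<gamma>\<^sub>0\<^sub>1) \<theta> = ((\<gamma> \<cdot> h, \<gamma>\<^sub>0\<^sub>1 \<lhd> h), \<alpha>, (\<gamma> \<cdot> h', \<gamma>\<^sub>0\<^sub>1 \<lhd> h'))" by simp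
  moreover have "snd (cocone_functor C \<gamma> \<gamma>\<^sub>0\<^sub>1) \<theta> = ((\<gamma> \<cdot> h, \<gamma>\<^sub>0\<^sub>1 \<lhd> h), \<alpha>, (\<gamma> \<cdot> h', \<gamma>\<^sub>0\<^sub>1 \<lhd> h')) \<longleftrightarrow>
      \<gamma> \<rhd> \<theta> = \<alpha>" if "in_hom (hom_cat C X Y) \<theta> h h'" for \<theta>
    using that by (auto simp: in_hom_def cocone_functor_def Let_def)
  ultimately show ?thesis by (simp cong: conj_cong)
qed

lemma strict_quotient_hom:
  assumes "strict_quotient C N X \<gamma> \<gamma>\<^sub>0\<^sub>1"
  shows "in_hom C \<gamma> (C0 N) X" "in_hom (hom_cat C (C1 N) X) \<gamma>\<^sub>0\<^sub>1 (pi0 N \<cdot> \<gamma>) (pi1 N \<cdot> \<gamma>)"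
    "ident N \<rhd> \<gamma>\<^sub>0\<^sub>1 = Ide2 C \<gamma>" "pi02 N \<rhd> \<gamma>\<^sub>0\<^sub>1 = (pi01 N \<rhd> \<gamma>\<^sub>0\<^sub>1) \<bullet> (pi12 N \<rhd> \<gamma>\<^sub>0\<^sub>1)"
    "is_cocone C N X \<gamma> \<gamma>\<^sub>0\<^sub>1"
  using assms by (auto simp: strict_quotient_def is_cocone_def)

text \<open>Equations between the structure maps are checked after composing with the core
  inclusions, where they become equations between vertices of the cotensors. Morphisms from a
  groupoid lift uniquely to the core of \<open>Y\<close>, and 2-cells do so by way of the arrow
  object and its core.\<close>

lemma nerve_nerve_presentation:
  assumes g: "groupoidant C" and n: "nerve C Y N \<gamma> \<gamma>\<^sub>0\<^sub>1"
  shows "nerve_presentation C Y N \<gamma> \<gamma>\<^sub>0\<^sub>1"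
proof -
  have q: "strict_quotient C N Y \<gamma> \<gamma>\<^sub>0\<^sub>1" using g n unfolding groupoidant_def by blast
  from n obtain X1 ev1 X2 ev2 i1 i2 where
    X1: "arrow_object C Y X1 ev1" and X2: "strict_cotensor C (ordinal 2) Y X2 ev2" and
    K0: "is_core C Y (C0 N) \<gamma>" and K1: "is_core C X1 (C1 N) i1" and K2: "is_core C X2 (C2 N) i2" and
    pi0: "pi0 N = core_map C i1 \<gamma> (cotensor_map C (ordinal 0) (delta [0]) X1 ev1 Y (trivial_ev C Y))" and
    pi1: "pi1 N = core_map C i1 \<gamma> (cotensor_map C (ordinal 0) (delta [1]) X1 ev1 Y (trivial_ev C Y))" and
    pi01: "pi01 N = core_map C i2 i1 (cotensor_map C (ordinal 1) (delta [0, 1]) X2 ev2 X1 ev1)" and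
    pi12: "pi12 N = core_map C i2 i1 (cotensor_map C (ordinal 1) (delta [1, 2]) X2 ev2 X1 ev1)" and
    pi02: "pi02 N = core_map C i2 i1 (cotensor_map C (ordinal 1) (delta [0, 2]) X2 ev2 X1 ev1)" and
    idn: "ident N = core_map C \<gamma> i1 (cotensor_map C (ordinal 1) (delta [0, 0]) Y (trivial_ev C Y) X1 ev1)" and
    \<gamma>\<^sub>0\<^sub>1: "\<gamma>\<^sub>0\<^sub>1 = i1 \<rhd> univ_cell ev1"
    unfolding nerve_def Let_def by auto
  note X1h = arrow_object_hom'[OF X1]
  note X2h = strict_cotensorD[OF X2] and X2f = functorD_hom[OF category_ordinal strict_cotensorD(3)[OF X2]]
  have Y: "Y \<in> Obj C" by (rule X2h)
  note G = core_groupoid[OF K0] core_groupoid[OF K1] core_groupoid[OF K2]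
  have i: "\<gamma> \<in> Arr C" "Dom C \<gamma> = C0 N" "Cod C \<gamma> = Y" "i1 \<in> Arr C" "Dom C i1 = C1 N" "Cod C i1 = X1"
    "i2 \<in> Arr C" "Dom C i2 = C2 N" "Cod C i2 = X2"
    using is_core_hom[OF K0] is_core_hom[OF K1] is_core_hom[OF K2] by (auto simp: in_hom_def)
  have p0: "in_hom C (pi0 N) (C1 N) (C0 N)" "pi0 N \<cdot> \<gamma> = i1 \<cdot> fst ev1 0"
   and p1: "in_hom C (pi1 N) (C1 N) (C0 N)" "pi1 N \<cdot> \<gamma> = i1 \<cdot> fst ev1 1"
  proof -
    have "in_hom C (i1 \<cdot> fst ev1 0) (C1 N) Y" "in_hom C (i1 \<cdot> fst ev1 1) (C1 N) Y"
      using X1h i by (simp_all add: in_hom_def)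
    note l = core_lift_along[OF K0 this(1) disjI1[OF G(2)]] core_lift_along[OF K0 this(2) disjI1[OF G(2)]]
    show "in_hom C (pi0 N) (C1 N) (C0 N)" "pi0 N \<cdot> \<gamma> = i1 \<cdot> fst ev1 0"
      "in_hom C (pi1 N) (C1 N) (C0 N)" "pi1 N \<cdot> \<gamma> = i1 \<cdot> fst ev1 1"
      unfolding pi0 pi1 core_map_def cotensor_map_vertex[OF X1 zero_le_one] cotensor_map_vertex[OF X1 order.refl]
      using l by blast+
  qed
  have d: "\<exists>m. in_hom C m X2 X1 \<and> cotensor_map C (ordinal 1) (delta [j, k]) X2 ev2 X1 ev1 = m \<and>
      m \<cdot> fst ev1 0 = fst ev2 j \<and> m \<cdot> fst ev1 1 = fst ev2 k" if jk: "j \<le> k" "k \<le> 2" for j k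
  proof -
    have c: "in_hom (hom_cat C X2 Y) (snd ev2 (j, k)) (fst ev2 j) (fst ev2 k)"
      "snd ev2 (j, j) = Ide2 C (fst ev2 j)" "snd ev2 (k, k) = Ide2 C (fst ev2 k)"
      using X2f(3)[of "(j, k)"] X2f(2)[of j] X2f(2)[of k] jk by simp_all
    obtain m where m: "in_hom C m X2 X1" "m \<rhd> univ_cell ev1 = snd ev2 (j, k)"
      using arrow_object_lift[OF X1 c(1)] by blast
    show ?thesis using cotensor_map_arrow[OF X1, of m X2 ev2 "delta [j, k]"] m c
      by (auto simp: delta_def)
  qed
  \<comment> \<open>A face map followed by an endpoint map and \<gamma> selects a vertex of the
    triangle; this computes both ends of all three faces at once.\<close>
  have pp: "in_hom C (core_map C i2 i1 (cotensor_map C (ordinal 1) (delta [j, k]) X2 ev2 X1 ev1)) (C2 N) (C1 N) \<and>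
      core_map C i2 i1 (cotensor_map C (ordinal 1) (delta [j, k]) X2 ev2 X1 ev1) \<cdot> pi0 N \<cdot> \<gamma> = i2 \<cdot> fst ev2 j \<and>
      core_map C i2 i1 (cotensor_map C (ordinal 1) (delta [j, k]) X2 ev2 X1 ev1) \<cdot> pi1 N \<cdot> \<gamma> = i2 \<cdot> fst ev2 k"
    if jk: "j \<le> k" "k \<le> 2" for j k
  proof -
    obtain m where m: "in_hom C m X2 X1" "cotensor_map C (ordinal 1) (delta [j, k]) X2 ev2 X1 ev1 = m"
      "m \<cdot> fst ev1 0 = fst ev2 j" "m \<cdot> fst ev1 1 = fst ev2 k"
      using d[OF jk] by blast
    define c where "c = core_map C i2 i1 m"
    have c: "in_hom C c (C2 N) (C1 N)" "c \<cdot> i1 = i2 \<cdot> m"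
    proof -
      have "in_hom C (i2 \<cdot> m) (C2 N) X1" using m i by (simp add: in_hom_def)
      from core_lift_along[OF K1 this disjI1[OF G(3)]] show "in_hom C c (C2 N) (C1 N)" "c \<cdot> i1 = i2 \<cdot> m"
        unfolding core_map_def c_def .
    qed
    have "c \<cdot> (pi0 N \<cdot> \<gamma>) = (c \<cdot> i1) \<cdot> fst ev1 0" "c \<cdot> (pi1 N \<cdot> \<gamma>) = (c \<cdot> i1) \<cdot> fst ev1 1"
      unfolding p0 p1 using c(1) i X1h by (auto simp: in_hom_def)
    moreover have "(i2 \<cdot> m) \<cdot> fst ev1 0 = i2 \<cdot> fst ev2 j" "(i2 \<cdot> m) \<cdot> fst ev1 1 = i2 \<cdot> fst ev2 k"
      using m(1) X1h i unfolding m(3,4)[symmetric] by (auto simp: in_hom_def)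
    ultimately show ?thesis using c p0(1) p1(1) i unfolding m(2) c_def[symmetric] by (auto simp: in_hom_def)
  qed
  note P = pp[of 0 1, folded pi01] pp[of 1 2, folded pi12] pp[of 0 2, folded pi02]
  have P': "in_hom C (pi01 N) (C2 N) (C1 N)" "in_hom C (pi12 N) (C2 N) (C1 N)" "in_hom C (pi02 N) (C2 N) (C1 N)"
    "pi01 N \<cdot> pi0 N \<cdot> \<gamma> = i2 \<cdot> fst ev2 0" "pi01 N \<cdot> pi1 N \<cdot> \<gamma> = i2 \<cdot> fst ev2 1"
    "pi12 N \<cdot> pi0 N \<cdot> \<gamma> = i2 \<cdot> fst ev2 1" "pi12 N \<cdot> pi1 N \<cdot> \<gamma> = i2 \<cdot> fst ev2 2"
    "pi02 N \<cdot> pi0 N \<cdot> \<gamma> = i2 \<cdot> fst ev2 0" "pi02 N \<cdot> pi1 N \<cdot> \<gamma> = i2 \<cdot> fst ev2 2"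
    using P by (auto simp del: One_nat_def)
  \<comment> \<open>Maps into \<open>C0 N\<close> are compared after composing with \<gamma>, where
    each equation names the same vertex of the triangle on both sides.\<close>
  have P2: "pi02 N \<cdot> pi0 N = pi01 N \<cdot> pi0 N" "pi02 N \<cdot> pi1 N = pi12 N \<cdot> pi1 N" "pi01 N \<cdot> pi1 N = pi12 N \<cdot> pi0 N"
    by (rule core_eqI[OF K0, of _ "C2 N"]; use P' p0(1) p1(1) i in \<open>simp add: in_hom_def\<close>)+
  \<comment> \<open>The identity 2-cell on \<open>Ide C Y\<close> names the morphism
    \<open>m\<close> into the arrow object that underlies \<open>ident N\<close>.\<close>
  have "in_hom (hom_cat C Y Y) (Ide2 C (Ide C Y)) (Ide C Y) (Ide C Y)" using Y by (auto simp: in_hom_def)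
  from arrow_object_lift[OF X1 this] obtain m where
    m: "in_hom C m Y X1" "m \<rhd> univ_cell ev1 = Ide2 C (Ide C Y)" by blast
  have m': "cotensor_map C (ordinal 1) (delta [0, 0]) Y (trivial_ev C Y) X1 ev1 = m"
     "m \<cdot> fst ev1 0 = Ide C Y" "m \<cdot> fst ev1 1 = Ide C Y"
    using cotensor_map_arrow[OF X1 m(1), of "trivial_ev C Y" "delta [0, 0]"] m(2) Y
    by (auto simp: trivial_ev_def delta_def in_hom_def)
  have c: "in_hom C (ident N) (C0 N) (C1 N)" "ident N \<cdot> i1 = \<gamma> \<cdot> m"
  proof -
    have "in_hom C (\<gamma> \<cdot> m) (C0 N) X1" using m i by (simp add: in_hom_def)
    from core_lift_along[OF K1 this disjI1[OF G(1)]] show "in_hom C (ident N) (C0 N) (C1 N)" "ident N \<cdot> i1 = \<gamma> \<cdot> m"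
      unfolding idn m' core_map_def .
  qed
  have "ident N \<cdot> (pi0 N \<cdot> \<gamma>) = (ident N \<cdot> i1) \<cdot> fst ev1 0" "ident N \<cdot> (pi1 N \<cdot> \<gamma>) = (ident N \<cdot> i1) \<cdot> fst ev1 1"
    unfolding p0 p1 using c(1) i X1h by (auto simp: in_hom_def)
  moreover have "(ident N \<cdot> i1) \<cdot> fst ev1 0 = \<gamma> \<cdot> (m \<cdot> fst ev1 0)" "(ident N \<cdot> i1) \<cdot> fst ev1 1 = \<gamma> \<cdot> (m \<cdot> fst ev1 1)"
    unfolding c(2) using m(1) i X1h by (auto simp: in_hom_def)
  ultimately have "ident N \<cdot> (pi0 N \<cdot> \<gamma>) = \<gamma>" "ident N \<cdot> (pi1 N \<cdot> \<gamma>) = \<gamma>"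
    using m' i by simp_all
  then have "(ident N \<cdot> pi0 N) \<cdot> \<gamma> = \<gamma>" "(ident N \<cdot> pi1 N) \<cdot> \<gamma> = \<gamma>"
    using c(1) p0(1) p1(1) i by (auto simp: in_hom_def)
  then have e: "ident N \<cdot> pi0 N = Ide C (C0 N)" "ident N \<cdot> pi1 N = Ide C (C0 N)"
    using core_eqI[OF K0, of _ "C0 N" "Ide C (C0 N)"] c(1) p0(1) p1(1) i dom_obj[of \<gamma>] by (auto simp: in_hom_def)
  have l0: "\<exists>!h. in_hom C h A (C0 N) \<and> h \<cdot> \<gamma> = f" if "groupoid_obj C A" "in_hom C f A Y" for A f
    using core_lift[OF K0] that by blast
  have l1: "\<exists>!a. in_hom C a A (C1 N) \<and> a \<rhd> \<gamma>\<^sub>0\<^sub>1 = \<alpha>" if A: "groupoid_obj C A" "\<alpha> \<in> Arr (hom_cat C A Y)" for A \<alpha>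
  proof -
    have "in_hom (hom_cat C A Y) \<alpha> (Dom2 C \<alpha>) (Cod2 C \<alpha>)" using A by (auto simp: in_hom_def)
    from arrow_object_lift[OF X1 this]
    obtain k where k: "in_hom C k A X1" "k \<rhd> univ_cell ev1 = \<alpha>" by blast
    have "\<exists>!h. in_hom C h A (C1 N) \<and> h \<cdot> i1 = k" using core_lift[OF K1 k(1)] A by blast
    moreover have "h \<cdot> i1 = k \<longleftrightarrow> h \<rhd> \<gamma>\<^sub>0\<^sub>1 = \<alpha>" if h: "in_hom C h A (C1 N)" for h
    proof -
      have "in_hom C (h \<cdot> i1) A X1" "(h \<cdot> i1) \<rhd> univ_cell ev1 = h \<rhd> \<gamma>\<^sub>0\<^sub>1"
        using h i X1h by (auto simp: \<gamma>\<^sub>0\<^sub>1 in_hom_def)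
      then show ?thesis using arrow_object_eqI[OF X1 _ k(1)] k(2) by metis
    qed
    ultimately show ?thesis by (simp cong: conj_cong)
  qed
  show ?thesis unfolding nerve_presentation_def
    using G p0(1) p1(1) c(1) P'(1-3) e P2 q l0 l1 by blast
qed

text \<open>Arrow objects and cores are part of the hypotheses on the 2-category; the cotensor with
  [2] that a nerve also requires comes from the pair classifier.\<close>

lemma nerve_exists:
  assumes g: "groupoidant C" and Y: "Y \<in> Obj C"
  shows "\<exists>N \<gamma> \<gamma>\<^sub>0\<^sub>1. nerve_presentation C Y N \<gamma> \<gamma>\<^sub>0\<^sub>1"
proof -
  have cores: "\<exists>K i. is_core C X K i" if "X \<in> Obj C" for X
    using g that unfolding groupoidant_def by blast
  have p: "pita C" using g unfolding groupoidant_def by blast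
  obtain X1 ev1 where X1: "arrow_object C Y X1 ev1" using p Y unfolding pita_def by blast
  obtain X2 ev2 where X2: "strict_cotensor C (ordinal 2) Y X2 ev2" using cotensor_2_exists[OF p Y] by blast
  obtain K0 i0 where K0: "is_core C Y K0 i0" using cores[OF Y] by blast
  obtain K1 i1 where K1: "is_core C X1 K1 i1" using cores[OF arrow_object_hom(2)[OF X1]] by blast
  obtain K2 i2 where K2: "is_core C X2 K2 i2" using cores[OF strict_cotensorD(2)[OF X2]] by blast
  define N where "N = \<lparr>C0 = K0, C1 = K1, C2 = K2,
     pi0 = core_map C i1 i0 (cotensor_map C (ordinal 0) (delta [0]) X1 ev1 Y (trivial_ev C Y)),
     pi1 = core_map C i1 i0 (cotensor_map C (ordinal 0) (delta [1]) X1 ev1 Y (trivial_ev C Y)),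
     ident = core_map C i0 i1 (cotensor_map C (ordinal 1) (delta [0, 0]) Y (trivial_ev C Y) X1 ev1),
     pi01 = core_map C i2 i1 (cotensor_map C (ordinal 1) (delta [0, 1]) X2 ev2 X1 ev1),
     pi12 = core_map C i2 i1 (cotensor_map C (ordinal 1) (delta [1, 2]) X2 ev2 X1 ev1),
     pi02 = core_map C i2 i1 (cotensor_map C (ordinal 1) (delta [0, 2]) X2 ev2 X1 ev1)\<rparr>"
  have "nerve C Y N i0 (i1 \<rhd> univ_cell ev1)"
    unfolding nerve_def Let_def
    by (intro exI[of _ X1] exI[of _ ev1] exI[of _ X2] exI[of _ ev2] exI[of _ i0] exI[of _ i1] exI[of _ i2])
      (simp add: N_def X1 X2 K0 K1 K2)
  from nerve_nerve_presentation[OF g this] show ?thesis by blast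
qed

lemma nerve_presentationD:
  assumes "nerve_presentation C Y N \<gamma> \<gamma>\<^sub>0\<^sub>1"
  shows "groupoid_obj C (C0 N)" "groupoid_obj C (C1 N)" "groupoid_obj C (C2 N)"
     "in_hom C (pi0 N) (C1 N) (C0 N)" "in_hom C (pi1 N) (C1 N) (C0 N)" "in_hom C (ident N) (C0 N) (C1 N)"
     "in_hom C (pi01 N) (C2 N) (C1 N)" "in_hom C (pi12 N) (C2 N) (C1 N)" "in_hom C (pi02 N) (C2 N) (C1 N)"
     "ident N \<cdot> pi0 N = Ide C (C0 N)" "ident N \<cdot> pi1 N = Ide C (C0 N)"
     "pi02 N \<cdot> pi0 N = pi01 N \<cdot> pi0 N" "pi02 N \<cdot> pi1 N = pi12 N \<cdot> pi1 N" "pi01 N \<cdot> pi1 N = pi12 N \<cdot> pi0 N"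
     "\<And>A f. groupoid_obj C A \<Longrightarrow> in_hom C f A Y \<Longrightarrow> (\<exists>!h. in_hom C h A (C0 N) \<and> h \<cdot> \<gamma> = f)"
     "\<And>A \<alpha>. groupoid_obj C A \<Longrightarrow> \<alpha> \<in> Arr (hom_cat C A Y) \<Longrightarrow>
        (\<exists>!a. in_hom C a A (C1 N) \<and> a \<rhd> \<gamma>\<^sub>0\<^sub>1 = \<alpha>)"
     "strict_quotient C N Y \<gamma> \<gamma>\<^sub>0\<^sub>1"
  using assms unfolding nerve_presentation_def by blast+

lemma strict_quotient_unique:
  assumes q: "strict_quotient C N X \<gamma> \<gamma>\<^sub>0\<^sub>1" and q': "strict_quotient C N X' \<gamma>' \<gamma>'\<^sub>0\<^sub>1"
  shows "\<exists>\<phi> \<psi>. in_hom C \<phi> X X' \<and> in_hom C \<psi> X' X \<and> \<phi> \<cdot> \<psi> = Ide C X \<and> \<psi> \<cdot> \<phi> = Ide C X' \<and>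
    \<gamma> \<cdot> \<phi> = \<gamma>' \<and> \<gamma>\<^sub>0\<^sub>1 \<lhd> \<phi> = \<gamma>'\<^sub>0\<^sub>1"
proof -
  note h = strict_quotient_hom[OF q] and h' = strict_quotient_hom[OF q']
  obtain \<phi> where \<phi>: "in_hom C \<phi> X X'" "\<gamma> \<cdot> \<phi> = \<gamma>'" "\<gamma>\<^sub>0\<^sub>1 \<lhd> \<phi> = \<gamma>'\<^sub>0\<^sub>1"
    using strict_quotient_lift[OF q h'(5)] by blast
  obtain \<psi> where \<psi>: "in_hom C \<psi> X' X" "\<gamma>' \<cdot> \<psi> = \<gamma>" "\<gamma>'\<^sub>0\<^sub>1 \<lhd> \<psi> = \<gamma>\<^sub>0\<^sub>1"
    using strict_quotient_lift[OF q' h(5)] by blast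
  have T: "\<gamma> \<in> Arr C" "Cod C \<gamma> = X" "\<gamma>' \<in> Arr C" "Cod C \<gamma>' = X'" "\<gamma>\<^sub>0\<^sub>1 \<in> Cell C" "Cod C (Dom2 C \<gamma>\<^sub>0\<^sub>1) = X"
     "\<gamma>'\<^sub>0\<^sub>1 \<in> Cell C" "Cod C (Dom2 C \<gamma>'\<^sub>0\<^sub>1) = X'" "X \<in> Obj C" "X' \<in> Obj C"
     "\<phi> \<in> Arr C" "Dom C \<phi> = X" "Cod C \<phi> = X'" "\<psi> \<in> Arr C" "Dom C \<psi> = X'" "Cod C \<psi> = X"
    using h h' \<phi>(1) \<psi>(1) in_homD(5)[OF h(1)] in_homD(5)[OF h'(1)] unfolding in_hom_def by auto
  have "\<gamma> \<cdot> (\<phi> \<cdot> \<psi>) = (\<gamma> \<cdot> \<phi>) \<cdot> \<psi>" "\<gamma>\<^sub>0\<^sub>1 \<lhd> (\<phi> \<cdot> \<psi>) = (\<gamma>\<^sub>0\<^sub>1 \<lhd> \<phi>) \<lhd> \<psi>"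
    "\<gamma>' \<cdot> (\<psi> \<cdot> \<phi>) = (\<gamma>' \<cdot> \<psi>) \<cdot> \<phi>" "\<gamma>'\<^sub>0\<^sub>1 \<lhd> (\<psi> \<cdot> \<phi>) = (\<gamma>'\<^sub>0\<^sub>1 \<lhd> \<psi>) \<lhd> \<phi>"
    using T by simp_all
  then have "\<gamma> \<cdot> (\<phi> \<cdot> \<psi>) = \<gamma>" "\<gamma>\<^sub>0\<^sub>1 \<lhd> (\<phi> \<cdot> \<psi>) = \<gamma>\<^sub>0\<^sub>1" "\<gamma>' \<cdot> (\<psi> \<cdot> \<phi>) = \<gamma>'" "\<gamma>'\<^sub>0\<^sub>1 \<lhd> (\<psi> \<cdot> \<phi>) = \<gamma>'\<^sub>0\<^sub>1"
    by (simp_all only: \<phi> \<psi>)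
  moreover have "in_hom C (\<phi> \<cdot> \<psi>) X X" "in_hom C (\<psi> \<cdot> \<phi>) X' X'" "in_hom C (Ide C X) X X" "in_hom C (Ide C X') X' X'"
    using T by (simp_all add: in_hom_def)
  moreover have "\<gamma> \<cdot> Ide C X = \<gamma>" "\<gamma>\<^sub>0\<^sub>1 \<lhd> Ide C X = \<gamma>\<^sub>0\<^sub>1" "\<gamma>' \<cdot> Ide C X' = \<gamma>'" "\<gamma>'\<^sub>0\<^sub>1 \<lhd> Ide C X' = \<gamma>'\<^sub>0\<^sub>1"
    using T by simp_all
  ultimately have "\<phi> \<cdot> \<psi> = Ide C X" "\<psi> \<cdot> \<phi> = Ide C X'"
    using strict_quotient_lift[OF q h(5)] strict_quotient_lift[OF q' h'(5)] by metis+
  with \<phi> \<psi> show ?thesis by blast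
qed

text \<open>An opposition is given with arbitrary quotient cocones rather than tautological ones.
  Two quotients of the same congruence are isomorphic compatibly with their cocones, so the
  classification of morphisms and 2-cells passes along the isomorphism.\<close>

lemma nerve_presentation_transport:
  assumes n: "nerve_presentation C X N \<gamma> \<gamma>\<^sub>0\<^sub>1" and q': "strict_quotient C N X' \<gamma>' \<gamma>'\<^sub>0\<^sub>1"
  shows "nerve_presentation C X' N \<gamma>' \<gamma>'\<^sub>0\<^sub>1"
proof -
  note N = nerve_presentationD[OF n]
  note h = strict_quotient_hom[OF N(17)] and h' = strict_quotient_hom[OF q']
  obtain \<phi> \<psi> where \<phi>: "in_hom C \<phi> X X'" "in_hom C \<psi> X' X" "\<phi> \<cdot> \<psi> = Ide C X" "\<psi> \<cdot> \<phi> = Ide C X'"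
     "\<gamma> \<cdot> \<phi> = \<gamma>'" "\<gamma>\<^sub>0\<^sub>1 \<lhd> \<phi> = \<gamma>'\<^sub>0\<^sub>1"
    using strict_quotient_unique[OF N(17) q'] by blast
  have T: "\<gamma> \<in> Arr C" "Dom C \<gamma> = C0 N" "Cod C \<gamma> = X" "\<gamma>\<^sub>0\<^sub>1 \<in> Cell C" "Dom C (Dom2 C \<gamma>\<^sub>0\<^sub>1) = C1 N" "Cod C (Dom2 C \<gamma>\<^sub>0\<^sub>1) = X"
     "\<phi> \<in> Arr C" "Dom C \<phi> = X" "Cod C \<phi> = X'" "\<psi> \<in> Arr C" "Dom C \<psi> = X'" "Cod C \<psi> = X"
    using h \<phi>(1,2) unfolding in_hom_def by auto
  have "\<exists>!k. in_hom C k A (C0 N) \<and> k \<cdot> \<gamma>' = f" if A: "groupoid_obj C A" and f: "in_hom C f A X'" for A f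
  proof -
    have "in_hom C (f \<cdot> \<psi>) A X" using f T by (auto simp: in_hom_def)
    moreover have "k \<cdot> \<gamma>' = f \<longleftrightarrow> k \<cdot> \<gamma> = f \<cdot> \<psi>" if "in_hom C k A (C0 N)" for k
    proof -
      have "(k \<cdot> \<gamma>) \<cdot> (\<phi> \<cdot> \<psi>) = (k \<cdot> (\<gamma> \<cdot> \<phi>)) \<cdot> \<psi>" "k \<cdot> (\<gamma> \<cdot> \<phi>) = (k \<cdot> \<gamma>) \<cdot> \<phi>"
        "f \<cdot> (\<psi> \<cdot> \<phi>) = (f \<cdot> \<psi>) \<cdot> \<phi>" "f \<cdot> Ide C X' = f" "(k \<cdot> \<gamma>) \<cdot> Ide C X = k \<cdot> \<gamma>"
        using that f T by (simp_all add: in_hom_def)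
      then show ?thesis unfolding \<phi>(3-) by metis
    qed
    ultimately show ?thesis using N(15)[OF A] by (simp cong: conj_cong)
  qed
  moreover have "\<exists>!a. in_hom C a A (C1 N) \<and> a \<rhd> \<gamma>'\<^sub>0\<^sub>1 = \<alpha>"
    if A: "groupoid_obj C A" and \<alpha>: "\<alpha> \<in> Arr (hom_cat C A X')" for A \<alpha>
  proof -
    have "\<alpha> \<lhd> \<psi> \<in> Arr (hom_cat C A X)" using \<alpha> T by (auto simp: in_hom_def)
    moreover have "k \<rhd> \<gamma>'\<^sub>0\<^sub>1 = \<alpha> \<longleftrightarrow> k \<rhd> \<gamma>\<^sub>0\<^sub>1 = \<alpha> \<lhd> \<psi>" if "in_hom C k A (C1 N)" for k
    proof -
      have "(k \<rhd> \<gamma>\<^sub>0\<^sub>1) \<lhd> (\<phi> \<cdot> \<psi>) = (k \<rhd> (\<gamma>\<^sub>0\<^sub>1 \<lhd> \<phi>)) \<lhd> \<psi>" "k \<rhd> (\<gamma>\<^sub>0\<^sub>1 \<lhd> \<phi>) = (k \<rhd> \<gamma>\<^sub>0\<^sub>1) \<lhd> \<phi>"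
        "\<alpha> \<lhd> (\<psi> \<cdot> \<phi>) = (\<alpha> \<lhd> \<psi>) \<lhd> \<phi>" "\<alpha> \<lhd> Ide C X' = \<alpha>" "(k \<rhd> \<gamma>\<^sub>0\<^sub>1) \<lhd> Ide C X = k \<rhd> \<gamma>\<^sub>0\<^sub>1"
        using that \<alpha> T by (simp_all add: in_hom_def)
      then show ?thesis unfolding \<phi>(3-) by metis
    qed
    ultimately show ?thesis using N(16)[OF A] by (simp cong: conj_cong)
  qed
  ultimately show ?thesis unfolding nerve_presentation_def using N(1-14) q' by blast
qed

lemma complete_congruence_presentation:
  assumes "groupoidant C" "complete_congruence C N" "strict_quotient C N X \<gamma> \<gamma>\<^sub>0\<^sub>1"
  shows "nerve_presentation C X N \<gamma> \<gamma>\<^sub>0\<^sub>1"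
proof -
  obtain X' \<gamma>' \<gamma>'\<^sub>0\<^sub>1 where "nerve C X' N \<gamma>' \<gamma>'\<^sub>0\<^sub>1" using assms(1,2) unfolding groupoidant_def by blast
  from nerve_presentation_transport[OF nerve_nerve_presentation[OF assms(1) this] assms(3)] show ?thesis .
qed

section \<open>Calculating with the structure maps of a presentation\<close>

lemma nerve_presentation_type:
  assumes "nerve_presentation C Y N \<gamma> \<gamma>\<^sub>0\<^sub>1"
  shows "pi0 N \<in> Arr C" "pi1 N \<in> Arr C" "ident N \<in> Arr C" "pi01 N \<in> Arr C" "pi12 N \<in> Arr C" "pi02 N \<in> Arr C"
    "Dom C (pi0 N) = C1 N" "Dom C (pi1 N) = C1 N" "Dom C (ident N) = C0 N"
    "Dom C (pi01 N) = C2 N" "Dom C (pi12 N) = C2 N" "Dom C (pi02 N) = C2 N"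
    "Cod C (pi0 N) = C0 N" "Cod C (pi1 N) = C0 N" "Cod C (ident N) = C1 N"
    "Cod C (pi01 N) = C1 N" "Cod C (pi12 N) = C1 N" "Cod C (pi02 N) = C1 N"
    "\<gamma> \<in> Arr C" "Dom C \<gamma> = C0 N" "Cod C \<gamma> = Y" "Y \<in> Obj C" "C0 N \<in> Obj C" "C1 N \<in> Obj C" "C2 N \<in> Obj C"
    "\<gamma>\<^sub>0\<^sub>1 \<in> Cell C" "Dom2 C \<gamma>\<^sub>0\<^sub>1 = pi0 N \<cdot> \<gamma>" "Cod2 C \<gamma>\<^sub>0\<^sub>1 = pi1 N \<cdot> \<gamma>"
  using nerve_presentationD(1-9)[OF assms] strict_quotient_hom(1,2)[OF nerve_presentationD(17)[OF assms]]
    cod_obj[of \<gamma>]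
  by (auto simp: in_hom_def groupoid_obj_def)

text \<open>In right-nested composites, the normal form under associativity, the left-hand sides of
  the structure equations do not occur as subterms; these versions carry a trailing
  morphism.\<close>

lemma nerve_presentation_comp:
  assumes N: "nerve_presentation C Y N \<gamma> \<gamma>\<^sub>0\<^sub>1" and f: "f \<in> Arr C" "Dom C f = C0 N"
  shows "ident N \<cdot> (pi0 N \<cdot> f) = f" "ident N \<cdot> (pi1 N \<cdot> f) = f"
    "pi02 N \<cdot> (pi0 N \<cdot> f) = pi01 N \<cdot> (pi0 N \<cdot> f)" "pi02 N \<cdot> (pi1 N \<cdot> f) = pi12 N \<cdot> (pi1 N \<cdot> f)"
    "pi01 N \<cdot> (pi1 N \<cdot> f) = pi12 N \<cdot> (pi0 N \<cdot> f)"
proof -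
  note t = nerve_presentation_type[OF N] and d = nerve_presentationD(10-14)[OF N]
  have "ident N \<cdot> (pi0 N \<cdot> f) = (ident N \<cdot> pi0 N) \<cdot> f" "ident N \<cdot> (pi1 N \<cdot> f) = (ident N \<cdot> pi1 N) \<cdot> f"
    "pi02 N \<cdot> (pi0 N \<cdot> f) = (pi02 N \<cdot> pi0 N) \<cdot> f" "pi01 N \<cdot> (pi0 N \<cdot> f) = (pi01 N \<cdot> pi0 N) \<cdot> f"
    "pi02 N \<cdot> (pi1 N \<cdot> f) = (pi02 N \<cdot> pi1 N) \<cdot> f" "pi12 N \<cdot> (pi1 N \<cdot> f) = (pi12 N \<cdot> pi1 N) \<cdot> f"
    "pi01 N \<cdot> (pi1 N \<cdot> f) = (pi01 N \<cdot> pi1 N) \<cdot> f" "pi12 N \<cdot> (pi0 N \<cdot> f) = (pi12 N \<cdot> pi0 N) \<cdot> f"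
    using t f by (simp_all del: d)
  then show "ident N \<cdot> (pi0 N \<cdot> f) = f" "ident N \<cdot> (pi1 N \<cdot> f) = f"
    "pi02 N \<cdot> (pi0 N \<cdot> f) = pi01 N \<cdot> (pi0 N \<cdot> f)" "pi02 N \<cdot> (pi1 N \<cdot> f) = pi12 N \<cdot> (pi1 N \<cdot> f)"
    "pi01 N \<cdot> (pi1 N \<cdot> f) = pi12 N \<cdot> (pi0 N \<cdot> f)"
    unfolding d using f by simp_all
qed

lemma nerve_presentation_whisker:
  assumes N: "nerve_presentation C Y N \<gamma> \<gamma>\<^sub>0\<^sub>1" and f: "\<alpha> \<in> Cell C" "Dom C (Dom2 C \<alpha>) = C0 N"
  shows "ident N \<rhd> (pi0 N \<rhd> \<alpha>) = \<alpha>" "ident N \<rhd> (pi1 N \<rhd> \<alpha>) = \<alpha>"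
    "pi02 N \<rhd> (pi0 N \<rhd> \<alpha>) = pi01 N \<rhd> (pi0 N \<rhd> \<alpha>)" "pi02 N \<rhd> (pi1 N \<rhd> \<alpha>) = pi12 N \<rhd> (pi1 N \<rhd> \<alpha>)"
    "pi01 N \<rhd> (pi1 N \<rhd> \<alpha>) = pi12 N \<rhd> (pi0 N \<rhd> \<alpha>)"
proof -
  note t = nerve_presentation_type[OF N] and d = nerve_presentationD(10-14)[OF N]
  have "ident N \<rhd> (pi0 N \<rhd> \<alpha>) = (ident N \<cdot> pi0 N) \<rhd> \<alpha>" "ident N \<rhd> (pi1 N \<rhd> \<alpha>) = (ident N \<cdot> pi1 N) \<rhd> \<alpha>"
    "pi02 N \<rhd> (pi0 N \<rhd> \<alpha>) = (pi02 N \<cdot> pi0 N) \<rhd> \<alpha>" "pi01 N \<rhd> (pi0 N \<rhd> \<alpha>) = (pi01 N \<cdot> pi0 N) \<rhd> \<alpha>"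
    "pi02 N \<rhd> (pi1 N \<rhd> \<alpha>) = (pi02 N \<cdot> pi1 N) \<rhd> \<alpha>" "pi12 N \<rhd> (pi1 N \<rhd> \<alpha>) = (pi12 N \<cdot> pi1 N) \<rhd> \<alpha>"
    "pi01 N \<rhd> (pi1 N \<rhd> \<alpha>) = (pi01 N \<cdot> pi1 N) \<rhd> \<alpha>" "pi12 N \<rhd> (pi0 N \<rhd> \<alpha>) = (pi12 N \<cdot> pi0 N) \<rhd> \<alpha>"
    using t f by (simp_all del: d)
  then show "ident N \<rhd> (pi0 N \<rhd> \<alpha>) = \<alpha>" "ident N \<rhd> (pi1 N \<rhd> \<alpha>) = \<alpha>"
    "pi02 N \<rhd> (pi0 N \<rhd> \<alpha>) = pi01 N \<rhd> (pi0 N \<rhd> \<alpha>)" "pi02 N \<rhd> (pi1 N \<rhd> \<alpha>) = pi12 N \<rhd> (pi1 N \<rhd> \<alpha>)"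
    "pi01 N \<rhd> (pi1 N \<rhd> \<alpha>) = pi12 N \<rhd> (pi0 N \<rhd> \<alpha>)"
    unfolding d using f by simp_all
qed

section \<open>Restriction of products and exponentials, and detection of 2-cells on nerves\<close>

lemma cartesian_closed_product_precomp:
  assumes "cartesian_closed_obj C X" "groupoid_obj C A" "groupoid_obj C A'" "in_hom C f A' A"
    and "product_diagram (hom_cat C A X) p q"
  shows "product_diagram (hom_cat C A' X) (f \<rhd> p) (f \<rhd> q)"
  using assms unfolding cartesian_closed_obj_def preserves_finite_products_def precomp_def by fastforce

lemma cartesian_closed_exponential_precomp:
  assumes "cartesian_closed_obj C X" "groupoid_obj C A" "groupoid_obj C A'" "in_hom C f A' A"
    and "exponential_diagram (hom_cat C A X) p q e"
  shows "exponential_diagram (hom_cat C A' X) (f \<rhd> p) (f \<rhd> q) (f \<rhd> e)"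
  using assms unfolding cartesian_closed_obj_def preserves_exponentials_def precomp_def by fastforce

lemma cartesian_closed_objD:
  assumes "cartesian_closed_obj C X"
  shows "X \<in> Obj C" "groupoid_obj C A \<Longrightarrow> cartesian_closed_cat (hom_cat C A X)"
  using assms unfolding cartesian_closed_obj_def by blast+

text \<open>This is the exchange law at the universal cocone: whiskering a 2-cell with \<gamma>
  gives a morphism of cocones.\<close>

lemma nerve_presentation_natural:
  assumes N: "nerve_presentation C Y N \<gamma> \<gamma>\<^sub>0\<^sub>1" and t: "\<theta> \<in> Cell C" "Dom C (Dom2 C \<theta>) = Y"
  shows "(pi0 N \<rhd> (\<gamma> \<rhd> \<theta>)) \<bullet> (\<gamma>\<^sub>0\<^sub>1 \<lhd> Cod2 C \<theta>) = (\<gamma>\<^sub>0\<^sub>1 \<lhd> Dom2 C \<theta>) \<bullet> (pi1 N \<rhd> (\<gamma> \<rhd> \<theta>))"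
  using whisker_exchange[of \<gamma>\<^sub>0\<^sub>1 \<theta>] nerve_presentation_type[OF N] t by simp

text \<open>A morphism of cocones is a 2-cell on \<open>C0 N\<close>, and the quotient property
  lifts each such morphism to exactly one 2-cell with the given boundary; hence \<gamma> detects
  equality.\<close>

lemma nerve_presentation_cell_eqI:
  assumes N: "nerve_presentation C Y N \<gamma> \<gamma>\<^sub>0\<^sub>1"
    and t: "in_hom (hom_cat C Y Z) \<theta> h h'" "in_hom (hom_cat C Y Z) \<theta>' h h'" and e: "\<gamma> \<rhd> \<theta> = \<gamma> \<rhd> \<theta>'"
  shows "\<theta> = \<theta>'"
proof -
  note c = nerve_presentation_type[OF N]
  have h: "in_hom C h Y Z" "in_hom C h' Y Z" using t by (auto simp: in_hom_def)
  have "in_hom (hom_cat C (C0 N) Z) (\<gamma> \<rhd> \<theta>) (\<gamma> \<cdot> h) (\<gamma> \<cdot> h')" using t c by (auto simp: in_hom_def)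
  moreover have "(pi0 N \<rhd> (\<gamma> \<rhd> \<theta>)) \<bullet> (\<gamma>\<^sub>0\<^sub>1 \<lhd> h') = (\<gamma>\<^sub>0\<^sub>1 \<lhd> h) \<bullet> (pi1 N \<rhd> (\<gamma> \<rhd> \<theta>))"
    using nerve_presentation_natural[OF N, of \<theta>] t by (auto simp: in_hom_def)
  ultimately show ?thesis using strict_quotient_lift_cell[OF nerve_presentationD(17)[OF N] h] t e by metis
qed

text \<open>An arbitrary stage \<open>Y\<close> is the quotient of its nerve, which consists of groupoids.\<close>

lemma product_diagram_from_groupoids:
  assumes g: "groupoidant C"
    and A: "in_hom (hom_cat C S X) A m x" and B: "in_hom (hom_cat C S X) B m y"
    and gr: "\<And>Y f. groupoid_obj C Y \<Longrightarrow> in_hom C f Y S \<Longrightarrow> product_diagram (hom_cat C Y X) (f \<rhd> A) (f \<rhd> B)"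
    and f: "in_hom C f Y S"
  shows "product_diagram (hom_cat C Y X) (f \<rhd> A) (f \<rhd> B)"
proof -
  obtain N \<eta> \<eta>\<^sub>0\<^sub>1 where N: "nerve_presentation C Y N \<eta> \<eta>\<^sub>0\<^sub>1" using nerve_exists[OF g in_homD(4)[OF f]] by blast
  note T = nerve_presentation_type[OF N] and G = nerve_presentationD(1-3)[OF N]
  have S: "A \<in> Cell C" "B \<in> Cell C" "Dom2 C A = m" "Dom2 C B = m" "Cod2 C A = x" "Cod2 C B = y"
    "Dom C m = S" "Cod C m = X" "Dom C x = S" "Dom C y = S" "m \<in> Arr C" "x \<in> Arr C" "y \<in> Arr C"
    "Cod C x = X" "Cod C y = X" "f \<in> Arr C" "Dom C f = Y" "Cod C f = S"
    using A B f Dom2_in_Arr Cod2_in_Arr Dom_Cod2 Cod_Cod2 unfolding in_hom_def by auto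
  have X: "X \<in> Obj C" using S cod_obj by metis
  interpret H0: category "hom_cat C (C0 N) X" by (rule hom_category) (use T X in auto)
  interpret H1: category "hom_cat C (C1 N) X" by (rule hom_category) (use T X in auto)
  have "in_hom C (\<eta> \<cdot> f) (C0 N) S" using T S by (auto simp: in_hom_def)
  from gr[OF G(1) this] have P0: "product_diagram (hom_cat C (C0 N) X) (\<eta> \<rhd> (f \<rhd> A)) (\<eta> \<rhd> (f \<rhd> B))"
    using T S by simp
  have "in_hom C (pi1 N \<cdot> (\<eta> \<cdot> f)) (C1 N) S" using T S by (auto simp: in_hom_def)
  from gr[OF G(2) this]
  have P1: "product_diagram (hom_cat C (C1 N) X) (pi1 N \<rhd> (\<eta> \<rhd> (f \<rhd> A))) (pi1 N \<rhd> (\<eta> \<rhd> (f \<rhd> B)))"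
    using T S by simp
  have "\<exists>!w. in_hom (hom_cat C Y X) w z (f \<cdot> m) \<and> w \<bullet> (f \<rhd> A) = u \<and> w \<bullet> (f \<rhd> B) = v"
    if u: "in_hom (hom_cat C Y X) u z (f \<cdot> x)" and v: "in_hom (hom_cat C Y X) v z (f \<cdot> y)" for z u v
  proof -
    have U: "u \<in> Cell C" "v \<in> Cell C" "Dom2 C u = z" "Dom2 C v = z" "Cod2 C u = f \<cdot> x" "Cod2 C v = f \<cdot> y"
      "z \<in> Arr C" "Dom C z = Y" "Cod C z = X"
      using u v Dom2_in_Arr unfolding in_hom_def by auto
    \<comment> \<open>The mediating 2-cell over the groupoid \<open>C0 N\<close>, where the product
      property is available; it remains to descend it to \<open>Y\<close>.\<close>
    define w0 where "w0 = pairing (hom_cat C (C0 N) X) (\<eta> \<rhd> (f \<rhd> A)) (\<eta> \<rhd> (f \<rhd> B)) (\<eta> \<rhd> u) (\<eta> \<rhd> v)"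
    have w0: "in_hom (hom_cat C (C0 N) X) w0 (\<eta> \<cdot> z) (\<eta> \<cdot> (f \<cdot> m))"
      "w0 \<bullet> (\<eta> \<rhd> (f \<rhd> A)) = \<eta> \<rhd> u" "w0 \<bullet> (\<eta> \<rhd> (f \<rhd> B)) = \<eta> \<rhd> v"
      using H0.pairing_hom[OF P0, of "\<eta> \<rhd> u" "\<eta> \<cdot> z" "\<eta> \<rhd> v"] T S U unfolding w0_def by (simp_all add: in_hom_def)
    have W: "w0 \<in> Cell C" "Dom2 C w0 = \<eta> \<cdot> z" "Cod2 C w0 = \<eta> \<cdot> (f \<cdot> m)" using w0(1) by (auto simp: in_hom_def)
    \<comment> \<open>\<open>E\<close> stands for either projection and \<open>e\<close> for the
      matching component; naturality of \<open>f \<rhd> E\<close> and of \<open>e\<close> moves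
      \<open>\<eta>\<^sub>0\<^sub>1\<close> from one side of the square to the other.\<close>
    have key: "((pi0 N \<rhd> w0) \<bullet> (\<eta>\<^sub>0\<^sub>1 \<lhd> (f \<cdot> m))) \<bullet> (pi1 N \<rhd> (\<eta> \<rhd> (f \<rhd> E))) =
       ((\<eta>\<^sub>0\<^sub>1 \<lhd> z) \<bullet> (pi1 N \<rhd> w0)) \<bullet> (pi1 N \<rhd> (\<eta> \<rhd> (f \<rhd> E)))"
      if E: "E \<in> Cell C" "Dom2 C E = m" and e: "e \<in> Cell C" "Dom2 C e = z" "Cod2 C e = f \<cdot> Cod2 C E"
        "w0 \<bullet> (\<eta> \<rhd> (f \<rhd> E)) = \<eta> \<rhd> e" for E e
    proof -
      have D: "Dom C (Cod2 C E) = S" "Cod C (Cod2 C E) = X" "Cod2 C E \<in> Arr C" using E S by simp_all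
      have "((pi0 N \<rhd> w0) \<bullet> (\<eta>\<^sub>0\<^sub>1 \<lhd> (f \<cdot> m))) \<bullet> (pi1 N \<rhd> (\<eta> \<rhd> (f \<rhd> E))) =
          (pi0 N \<rhd> w0) \<bullet> ((\<eta>\<^sub>0\<^sub>1 \<lhd> Dom2 C (f \<rhd> E)) \<bullet> (pi1 N \<rhd> (\<eta> \<rhd> (f \<rhd> E))))"
        using T S E W D U by simp
      also have "\<dots> = (pi0 N \<rhd> w0) \<bullet> ((pi0 N \<rhd> (\<eta> \<rhd> (f \<rhd> E))) \<bullet> (\<eta>\<^sub>0\<^sub>1 \<lhd> Cod2 C (f \<rhd> E)))"
        using nerve_presentation_natural[OF N, of "f \<rhd> E"] S E by simp
      also have "\<dots> = (pi0 N \<rhd> (w0 \<bullet> (\<eta> \<rhd> (f \<rhd> E)))) \<bullet> (\<eta>\<^sub>0\<^sub>1 \<lhd> Cod2 C e)"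
        using T S E W D U e(1-3) by simp
      also have "\<dots> = (pi0 N \<rhd> (\<eta> \<rhd> e)) \<bullet> (\<eta>\<^sub>0\<^sub>1 \<lhd> Cod2 C e)" by (simp only: e(4))
      also have "\<dots> = (\<eta>\<^sub>0\<^sub>1 \<lhd> z) \<bullet> (pi1 N \<rhd> (w0 \<bullet> (\<eta> \<rhd> (f \<rhd> E))))"
        using nerve_presentation_natural[OF N, of e] e U unfolding e(4) by simp
      also have "\<dots> = ((\<eta>\<^sub>0\<^sub>1 \<lhd> z) \<bullet> (pi1 N \<rhd> w0)) \<bullet> (pi1 N \<rhd> (\<eta> \<rhd> (f \<rhd> E)))"
        using T S E W D U by simp
      finally show ?thesis .
    qed
    \<comment> \<open>The restricted projections form a product over \<open>C1 N\<close> and are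
      therefore jointly monic, so \<open>w0\<close> is a morphism of cocones.\<close>
    have nat: "(pi0 N \<rhd> w0) \<bullet> (\<eta>\<^sub>0\<^sub>1 \<lhd> (f \<cdot> m)) = (\<eta>\<^sub>0\<^sub>1 \<lhd> z) \<bullet> (pi1 N \<rhd> w0)"
      by (rule H1.product_arr_eqI[OF P1, of _ "pi0 N \<cdot> (\<eta> \<cdot> z)"])
        (use T S U W key[of A u] key[of B v] w0(2,3) in \<open>simp_all add: in_hom_hom_cat\<close>)
    have zm: "in_hom C z Y X" "in_hom C (f \<cdot> m) Y X" using S U by (auto simp: in_hom_def)
    obtain w where w: "in_hom (hom_cat C Y X) w z (f \<cdot> m)" "\<eta> \<rhd> w = w0"
      using strict_quotient_lift_cell[OF nerve_presentationD(17)[OF N] zm w0(1) nat] by blast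
    have W': "w \<in> Cell C" "Dom2 C w = z" "Cod2 C w = f \<cdot> m" using w by (auto simp: in_hom_def)
    have "w \<bullet> (f \<rhd> A) = u"
    proof (rule nerve_presentation_cell_eqI[OF N _ u])
      show "in_hom (hom_cat C Y X) (w \<bullet> (f \<rhd> A)) z (f \<cdot> x)" using W' S U by (auto simp: in_hom_def)
      have "\<eta> \<rhd> (w \<bullet> (f \<rhd> A)) = (\<eta> \<rhd> w) \<bullet> (\<eta> \<rhd> (f \<rhd> A))" using W' S U T by simp
      then show "\<eta> \<rhd> (w \<bullet> (f \<rhd> A)) = \<eta> \<rhd> u" by (simp only: w(2) w0)
    qed
    moreover have "w \<bullet> (f \<rhd> B) = v"
    proof (rule nerve_presentation_cell_eqI[OF N _ v])
      show "in_hom (hom_cat C Y X) (w \<bullet> (f \<rhd> B)) z (f \<cdot> y)" using W' S U by (auto simp: in_hom_def)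
      have "\<eta> \<rhd> (w \<bullet> (f \<rhd> B)) = (\<eta> \<rhd> w) \<bullet> (\<eta> \<rhd> (f \<rhd> B))" using W' S U T by simp
      then show "\<eta> \<rhd> (w \<bullet> (f \<rhd> B)) = \<eta> \<rhd> v" by (simp only: w(2) w0)
    qed
    moreover have "w' = w" if w': "in_hom (hom_cat C Y X) w' z (f \<cdot> m)" "w' \<bullet> (f \<rhd> A) = u" "w' \<bullet> (f \<rhd> B) = v" for w'
    proof (rule nerve_presentation_cell_eqI[OF N w'(1) w(1)])
      have W'': "w' \<in> Cell C" "Dom2 C w' = z" "Cod2 C w' = f \<cdot> m" using w' by (auto simp: in_hom_def)
      have e: "(\<eta> \<rhd> w') \<bullet> (\<eta> \<rhd> (f \<rhd> A)) = \<eta> \<rhd> (w' \<bullet> (f \<rhd> A))" "(\<eta> \<rhd> w') \<bullet> (\<eta> \<rhd> (f \<rhd> B)) = \<eta> \<rhd> (w' \<bullet> (f \<rhd> B))"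
        using W'' S U T by simp_all
      have "\<eta> \<rhd> w' = w0"
      proof (rule H0.product_arr_eqI[OF P0, of _ "\<eta> \<cdot> z"])
        show "in_hom (hom_cat C (C0 N) X) (\<eta> \<rhd> w') (\<eta> \<cdot> z) (Dom (hom_cat C (C0 N) X) (\<eta> \<rhd> (f \<rhd> A)))"
          "in_hom (hom_cat C (C0 N) X) w0 (\<eta> \<cdot> z) (Dom (hom_cat C (C0 N) X) (\<eta> \<rhd> (f \<rhd> A)))"
          using W W'' S U T by (simp_all add: in_hom_hom_cat)
        show "Comp (hom_cat C (C0 N) X) (\<eta> \<rhd> w') (\<eta> \<rhd> (f \<rhd> A)) = Comp (hom_cat C (C0 N) X) w0 (\<eta> \<rhd> (f \<rhd> A))"
          "Comp (hom_cat C (C0 N) X) (\<eta> \<rhd> w') (\<eta> \<rhd> (f \<rhd> B)) = Comp (hom_cat C (C0 N) X) w0 (\<eta> \<rhd> (f \<rhd> B))"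
          by (simp_all only: hom_cat_simps e w' w0)
      qed
      then show "\<eta> \<rhd> w' = \<eta> \<rhd> w" by (simp only: w(2))
    qed
    ultimately show ?thesis using w(1) by blast
  qed
  then show ?thesis using S by (simp add: product_diagram_def)
qed

text \<open>Products are determined only up to isomorphism at each groupoid, so the choice is made
  once, over \<open>C0 N\<close>. The transition 2-cell over \<open>C1 N\<close> is the one induced
  on products, which makes the choice a cocone under the nerve of \<open>S\<close>; its quotient
  morphism is the internal product.\<close>

lemma internal_product_exists:
  assumes g: "groupoidant C" and cc: "cartesian_closed_obj C X" and S: "strict_product C X X S s t"
  shows "\<exists>m A B. in_hom (hom_cat C S X) A m s \<and> in_hom (hom_cat C S X) B m t \<and>
    (\<forall>Y f. in_hom C f Y S \<longrightarrow> product_diagram (hom_cat C Y X) (f \<rhd> A) (f \<rhd> B))"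
proof -
  have st: "s \<in> Arr C" "t \<in> Arr C" "Dom C s = S" "Dom C t = S" "Cod C s = X" "Cod C t = X"
    using strict_product_hom[OF S] by (auto simp: in_hom_def)
  have SO: "S \<in> Obj C" "X \<in> Obj C" using st dom_obj cod_obj by metis+
  obtain N \<kappa> \<kappa>\<^sub>0\<^sub>1 where N: "nerve_presentation C S N \<kappa> \<kappa>\<^sub>0\<^sub>1" using nerve_exists[OF g SO(1)] by blast
  note T = nerve_presentation_type[OF N] and G = nerve_presentationD(1-3)[OF N] and c = nerve_presentation_comp[OF N]
    and W = nerve_presentation_whisker[OF N] and q = nerve_presentationD(17)[OF N]
  note Q = strict_quotient_hom[OF q]
  interpret H0: category "hom_cat C (C0 N) X" by (rule hom_category) (use T SO in auto)
  interpret H1: category "hom_cat C (C1 N) X" by (rule hom_category) (use T SO in auto)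
  interpret H2: category "hom_cat C (C2 N) X" by (rule hom_category) (use T SO in auto)
  have "\<kappa> \<cdot> s \<in> Obj (hom_cat C (C0 N) X)" "\<kappa> \<cdot> t \<in> Obj (hom_cat C (C0 N) X)" using T st by (auto simp: in_hom_def)
  from H0.cartesian_closed_productE[OF cartesian_closed_objD(2)[OF cc G(1)] this]
  obtain a b where ab: "product_diagram (hom_cat C (C0 N) X) a b" "Cod2 C a = \<kappa> \<cdot> s" "Cod2 C b = \<kappa> \<cdot> t"
    by auto
  define m0 where "m0 = Dom2 C a"
  have P: "a \<in> Cell C" "b \<in> Cell C" "Dom2 C a = m0" "Dom2 C b = m0" "Dom C m0 = C0 N" "Cod C m0 = X" "m0 \<in> Arr C"
    using H0.product_diagram_arr[OF ab(1)] by (auto simp: m0_def)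
  have P1: "product_diagram (hom_cat C (C1 N) X) (pi1 N \<rhd> a) (pi1 N \<rhd> b)"
    by (rule cartesian_closed_product_precomp[OF cc G(1) G(2) _ ab(1)]) (use T in \<open>auto simp: in_hom_def\<close>)
  have P2: "product_diagram (hom_cat C (C2 N) X) (pi12 N \<rhd> (pi1 N \<rhd> a)) (pi12 N \<rhd> (pi1 N \<rhd> b))"
    by (rule cartesian_closed_product_precomp[OF cc G(2) G(3) _ P1]) (use T in \<open>auto simp: in_hom_def\<close>)
  \<comment> \<open>The action of the product on the two components of the universal 2-cell of the
    nerve.\<close>
  define \<mu> where "\<mu> = pairing (hom_cat C (C1 N) X) (pi1 N \<rhd> a) (pi1 N \<rhd> b)
     ((pi0 N \<rhd> a) \<bullet> (\<kappa>\<^sub>0\<^sub>1 \<lhd> s)) ((pi0 N \<rhd> b) \<bullet> (\<kappa>\<^sub>0\<^sub>1 \<lhd> t))"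
  have mu: "in_hom (hom_cat C (C1 N) X) \<mu> (pi0 N \<cdot> m0) (pi1 N \<cdot> m0)"
    "\<mu> \<bullet> (pi1 N \<rhd> a) = (pi0 N \<rhd> a) \<bullet> (\<kappa>\<^sub>0\<^sub>1 \<lhd> s)" "\<mu> \<bullet> (pi1 N \<rhd> b) = (pi0 N \<rhd> b) \<bullet> (\<kappa>\<^sub>0\<^sub>1 \<lhd> t)"
    using H1.pairing_hom[OF P1, of "(pi0 N \<rhd> a) \<bullet> (\<kappa>\<^sub>0\<^sub>1 \<lhd> s)" "pi0 N \<cdot> m0" "(pi0 N \<rhd> b) \<bullet> (\<kappa>\<^sub>0\<^sub>1 \<lhd> t)"]
      T P ab(2,3) st unfolding \<mu>_def by (simp_all add: in_hom_hom_cat)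
  have M: "\<mu> \<in> Cell C" "Dom2 C \<mu> = pi0 N \<cdot> m0" "Cod2 C \<mu> = pi1 N \<cdot> m0" using mu(1) by (auto simp: in_hom_def)
  \<comment> \<open>After composition with a projection \<open>e\<close> over the component
    \<open>r\<close>, which is \<open>s\<close> or \<open>t\<close>, the identity law reduces to
    that of \<open>\<kappa>\<^sub>0\<^sub>1\<close>.\<close>
  have k1: "(ident N \<rhd> \<mu>) \<bullet> e = e"
    if E: "e \<in> Cell C" "Dom2 C e = m0" "Cod2 C e = \<kappa> \<cdot> r" "r \<in> Arr C" "Dom C r = S" "Cod C r = X"
      and e: "\<mu> \<bullet> (pi1 N \<rhd> e) = (pi0 N \<rhd> e) \<bullet> (\<kappa>\<^sub>0\<^sub>1 \<lhd> r)" for e r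
  proof -
    have "(ident N \<rhd> \<mu>) \<bullet> e = (ident N \<rhd> \<mu>) \<bullet> (ident N \<rhd> (pi1 N \<rhd> e))" using W(2)[of e] E P by simp
    also have "\<dots> = ident N \<rhd> (\<mu> \<bullet> (pi1 N \<rhd> e))" using E P M T by simp
    also have "\<dots> = (ident N \<rhd> (pi0 N \<rhd> e)) \<bullet> ((ident N \<rhd> \<kappa>\<^sub>0\<^sub>1) \<lhd> r)" unfolding e using E P M T by simp
    also have "\<dots> = e" using W(1)[of e] Q(3) E P T by simp
    finally show ?thesis .
  qed
  have id: "ident N \<rhd> \<mu> = Ide2 C m0"
    by (rule H0.product_arr_eqI[OF ab(1), of _ m0])
      (use k1[of a s] k1[of b t] T P ab(2,3) st mu M c in \<open>simp_all add: in_hom_hom_cat\<close>)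
  \<comment> \<open>The same reduction for composition, over \<open>C2 N\<close>: the projection
    square is used for the composite arrow and then for each of the two factors.\<close>
  have k2: "(pi02 N \<rhd> \<mu>) \<bullet> (pi12 N \<rhd> (pi1 N \<rhd> e)) = ((pi01 N \<rhd> \<mu>) \<bullet> (pi12 N \<rhd> \<mu>)) \<bullet> (pi12 N \<rhd> (pi1 N \<rhd> e))"
    if E: "e \<in> Cell C" "Dom2 C e = m0" "Cod2 C e = \<kappa> \<cdot> r" "r \<in> Arr C" "Dom C r = S" "Cod C r = X"
      and e: "\<mu> \<bullet> (pi1 N \<rhd> e) = (pi0 N \<rhd> e) \<bullet> (\<kappa>\<^sub>0\<^sub>1 \<lhd> r)" for e r
  proof -
    have "(pi02 N \<rhd> \<mu>) \<bullet> (pi12 N \<rhd> (pi1 N \<rhd> e)) = (pi02 N \<rhd> \<mu>) \<bullet> (pi02 N \<rhd> (pi1 N \<rhd> e))" using W(4)[of e] E P by simp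
    also have "\<dots> = pi02 N \<rhd> (\<mu> \<bullet> (pi1 N \<rhd> e))" using E P M T by simp
    also have "\<dots> = (pi02 N \<rhd> (pi0 N \<rhd> e)) \<bullet> ((pi02 N \<rhd> \<kappa>\<^sub>0\<^sub>1) \<lhd> r)" unfolding e using E P M T by simp
    also have "\<dots> = (pi01 N \<rhd> (pi0 N \<rhd> e)) \<bullet> (((pi01 N \<rhd> \<kappa>\<^sub>0\<^sub>1) \<bullet> (pi12 N \<rhd> \<kappa>\<^sub>0\<^sub>1)) \<lhd> r)"
      using W(3)[of e] E P by (simp only: Q(4))
    also have "\<dots> = (pi01 N \<rhd> ((pi0 N \<rhd> e) \<bullet> (\<kappa>\<^sub>0\<^sub>1 \<lhd> r))) \<bullet> (pi12 N \<rhd> (\<kappa>\<^sub>0\<^sub>1 \<lhd> r))"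
      using E P M T c by simp
    also have "\<dots> = (pi01 N \<rhd> \<mu>) \<bullet> ((pi01 N \<rhd> (pi1 N \<rhd> e)) \<bullet> (pi12 N \<rhd> (\<kappa>\<^sub>0\<^sub>1 \<lhd> r)))"
      unfolding e[symmetric] using E P M T c by simp
    also have "\<dots> = (pi01 N \<rhd> \<mu>) \<bullet> (pi12 N \<rhd> ((pi0 N \<rhd> e) \<bullet> (\<kappa>\<^sub>0\<^sub>1 \<lhd> r)))"
      using W(5)[of e] E P M T c by simp
    also have "\<dots> = ((pi01 N \<rhd> \<mu>) \<bullet> (pi12 N \<rhd> \<mu>)) \<bullet> (pi12 N \<rhd> (pi1 N \<rhd> e))"
      unfolding e[symmetric] using E P M T c by simp
    finally show ?thesis .
  qed
  have co: "pi02 N \<rhd> \<mu> = (pi01 N \<rhd> \<mu>) \<bullet> (pi12 N \<rhd> \<mu>)"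
    by (rule H2.product_arr_eqI[OF P2, of _ "pi02 N \<cdot> (pi0 N \<cdot> m0)"])
      (use k2[of a s] k2[of b t] T P ab(2,3) st mu M c in \<open>simp_all add: in_hom_hom_cat\<close>)
  have "is_cocone C N X m0 \<mu>"
    unfolding is_cocone_def using mu(1) id co P T by (simp add: in_hom_def)
  then obtain m where m: "in_hom C m S X" "\<kappa> \<cdot> m = m0" "\<kappa>\<^sub>0\<^sub>1 \<lhd> m = \<mu>"
    using strict_quotient_lift[OF q] by blast
  have ha: "in_hom (hom_cat C (C0 N) X) a (\<kappa> \<cdot> m) (\<kappa> \<cdot> s)" "in_hom (hom_cat C (C0 N) X) b (\<kappa> \<cdot> m) (\<kappa> \<cdot> t)"
    using P ab m by (auto simp: in_hom_def)
  obtain A where A: "in_hom (hom_cat C S X) A m s" "\<kappa> \<rhd> A = a"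
    using strict_quotient_lift_cell[OF q m(1) strict_product_hom(1)[OF S] ha(1)] mu(2) m(3) by metis
  obtain B where B: "in_hom (hom_cat C S X) B m t" "\<kappa> \<rhd> B = b"
    using strict_quotient_lift_cell[OF q m(1) strict_product_hom(2)[OF S] ha(2)] mu(3) m(3) by metis
  \<comment> \<open>A morphism \<open>f\<close> from a groupoid factors through \<kappa>, so the
    product property over \<open>Y\<close> is a restriction of the one over \<open>C0 N\<close>;
    general stages are then reached through their own nerves.\<close>
  have "product_diagram (hom_cat C Y X) (f \<rhd> A) (f \<rhd> B)" if Y: "groupoid_obj C Y" "in_hom C f Y S" for Y f
  proof -
    obtain h where h: "in_hom C h Y (C0 N)" "h \<cdot> \<kappa> = f" using nerve_presentationD(15)[OF N Y] by blast
    have "product_diagram (hom_cat C Y X) (h \<rhd> a) (h \<rhd> b)"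
      by (rule cartesian_closed_product_precomp[OF cc G(1) Y(1) h(1) ab(1)])
    moreover have "h \<rhd> a = f \<rhd> A" "h \<rhd> b = f \<rhd> B"
      using h A B T unfolding h(2)[symmetric] A(2)[symmetric] B(2)[symmetric] by (auto simp: in_hom_def)
    ultimately show ?thesis by simp
  qed
  from product_diagram_from_groupoids[OF g A(1) B(1) this] A(1) B(1) show ?thesis by blast
qed

end

subsection \<open>Classifiers of retractions and isomorphisms\<close>

text \<open>The cotensor of \<open>X\<close> with the walking retraction: \<open>u\<close> is a
  section of \<open>v\<close>. It is an intermediate step, as invertibility is later imposed by two
  overlapping one-sided equations. The vertices at \<open>Dom2 C u\<close> and
  \<open>Cod2 C v\<close> coincide, so a 2-cell has two components.\<close>

definition retraction_classifier :: "('o, 'm, 'c) twocat \<Rightarrow> 'o \<Rightarrow> 'o \<Rightarrow> 'c \<Rightarrow> 'c \<Rightarrow> bool" where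
  "retraction_classifier C X R u v \<longleftrightarrow> X \<in> Obj C \<and> R \<in> Obj C \<and>
     u \<in> Arr (hom_cat C R X) \<and> v \<in> Arr (hom_cat C R X) \<and> Cod2 C u = Dom2 C v \<and> Cod2 C v = Dom2 C u \<and>
     u \<bullet>\<^bsub>C\<^esub> v = Ide2 C (Dom2 C u) \<and>
     (\<forall>A \<alpha> \<beta>. \<alpha> \<in> Arr (hom_cat C A X) \<and> \<beta> \<in> Arr (hom_cat C A X) \<and> Cod2 C \<alpha> = Dom2 C \<beta> \<and>
        Cod2 C \<beta> = Dom2 C \<alpha> \<and> \<alpha> \<bullet>\<^bsub>C\<^esub> \<beta> = Ide2 C (Dom2 C \<alpha>) \<longrightarrow>
        (\<exists>!h. in_hom C h A R \<and> h \<rhd>\<^bsub>C\<^esub> u = \<alpha> \<and> h \<rhd>\<^bsub>C\<^esub> v = \<beta>)) \<and>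
     (\<forall>A h h' t0 t1. in_hom C h A R \<and> in_hom C h' A R \<and>
        in_hom (hom_cat C A X) t0 (h \<cdot>\<^bsub>C\<^esub> Dom2 C u) (h' \<cdot>\<^bsub>C\<^esub> Dom2 C u) \<and>
        in_hom (hom_cat C A X) t1 (h \<cdot>\<^bsub>C\<^esub> Cod2 C u) (h' \<cdot>\<^bsub>C\<^esub> Cod2 C u) \<and>
        (h \<rhd>\<^bsub>C\<^esub> u) \<bullet>\<^bsub>C\<^esub> t1 = t0 \<bullet>\<^bsub>C\<^esub> (h' \<rhd>\<^bsub>C\<^esub> u) \<and> (h \<rhd>\<^bsub>C\<^esub> v) \<bullet>\<^bsub>C\<^esub> t0 = t1 \<bullet>\<^bsub>C\<^esub> (h' \<rhd>\<^bsub>C\<^esub> v) \<longrightarrow>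
        (\<exists>!\<theta>. in_hom (hom_cat C A R) \<theta> h h' \<and> \<theta> \<lhd>\<^bsub>C\<^esub> Dom2 C u = t0 \<and> \<theta> \<lhd>\<^bsub>C\<^esub> Cod2 C u = t1))"

text \<open>The cotensor of \<open>X\<close> with the walking isomorphism. The inverse is determined
  by \<open>w\<close>, and compatibility of a 2-cell with \<open>w\<close> entails compatibility
  with the inverse, so the universal property mentions \<open>w\<close> alone.\<close>

definition iso_classifier :: "('o, 'm, 'c) twocat \<Rightarrow> 'o \<Rightarrow> 'o \<Rightarrow> 'c \<Rightarrow> bool" where
  "iso_classifier C X I w \<longleftrightarrow> X \<in> Obj C \<and> I \<in> Obj C \<and>
     w \<in> Arr (hom_cat C I X) \<and> is_iso (hom_cat C I X) w \<and>
     (\<forall>A \<alpha>. is_iso (hom_cat C A X) \<alpha> \<longrightarrow> (\<exists>!h. in_hom C h A I \<and> h \<rhd>\<^bsub>C\<^esub> w = \<alpha>)) \<and>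
     (\<forall>A h h' t0 t1. in_hom C h A I \<and> in_hom C h' A I \<and>
        in_hom (hom_cat C A X) t0 (h \<cdot>\<^bsub>C\<^esub> Dom2 C w) (h' \<cdot>\<^bsub>C\<^esub> Dom2 C w) \<and>
        in_hom (hom_cat C A X) t1 (h \<cdot>\<^bsub>C\<^esub> Cod2 C w) (h' \<cdot>\<^bsub>C\<^esub> Cod2 C w) \<and>
        (h \<rhd>\<^bsub>C\<^esub> w) \<bullet>\<^bsub>C\<^esub> t1 = t0 \<bullet>\<^bsub>C\<^esub> (h' \<rhd>\<^bsub>C\<^esub> w) \<longrightarrow>
        (\<exists>!\<theta>. in_hom (hom_cat C A I) \<theta> h h' \<and> \<theta> \<lhd>\<^bsub>C\<^esub> Dom2 C w = t0 \<and> \<theta> \<lhd>\<^bsub>C\<^esub> Cod2 C w = t1))"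

context two_category
begin

section \<open>Inverses under whiskering\<close>

lemma whisker_r_inverse:
  assumes "is_inverse (hom_cat C A X) \<alpha> \<beta>" "in_hom C f X Y"
  shows "is_inverse (hom_cat C A Y) (\<alpha> \<lhd> f) (\<beta> \<lhd> f)"
proof -
  have "A \<in> Obj C" "X \<in> Obj C" using assms(1) dom_obj cod_obj Dom2_in_Arr unfolding inverse_cell_iff by metis+
  from functor_inverse[OF hom_category[OF this] postcomp_functor[OF assms(2)] assms(1)]
  show ?thesis by (simp add: postcomp_def)
qed

lemma whisker_l_inverse:
  assumes "is_inverse (hom_cat C A X) \<alpha> \<beta>" "in_hom C f B A"
  shows "is_inverse (hom_cat C B X) (f \<rhd> \<alpha>) (f \<rhd> \<beta>)"
proof -
  have "A \<in> Obj C" "X \<in> Obj C" using assms(1) dom_obj cod_obj Dom2_in_Arr unfolding inverse_cell_iff by metis+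
  from functor_inverse[OF hom_category[OF this] precomp_functor[OF assms(2)] assms(1)]
  show ?thesis by (simp add: precomp_def)
qed

lemma is_inverse_cell_unique:
  assumes "is_inverse (hom_cat C A X) \<alpha> \<beta>" "is_inverse (hom_cat C A X) \<alpha> \<beta>'"
  shows "\<beta> = \<beta>'"
proof -
  have "A \<in> Obj C" "X \<in> Obj C" using assms(1) dom_obj cod_obj Dom2_in_Arr unfolding inverse_cell_iff by metis+
  from category.is_inverse_unique[OF hom_category[OF this] assms] show ?thesis .
qed

lemma is_inverse_cell_sym:
  "is_inverse (hom_cat C A X) \<alpha> \<beta> \<Longrightarrow> is_inverse (hom_cat C A X) \<beta> \<alpha>"
  by (auto simp: inverse_cell_iff)

lemma is_inverse_cellI:
  assumes "in_hom (hom_cat C A X) \<alpha> f g" "in_hom (hom_cat C A X) \<beta> g f" "\<alpha> \<bullet> \<beta> = Ide2 C f" "\<beta> \<bullet> \<alpha> = Ide2 C g"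
  shows "is_inverse (hom_cat C A X) \<alpha> \<beta>"
  using assms by (auto simp: inverse_cell_iff in_hom_hom_cat)

text \<open>The codomain of \<open>x\<close> is not known in advance: cancelling the invertible
  component at the domain end shows that both codomains name the same 2-cell, hence agree. This
  situation arises for 2-cells produced by transport.\<close>

lemma arrow_object_iso_eqI:
  assumes P: "arrow_object C X P ev" and b: "is_iso (hom_cat C A P) b"
    and x: "x \<in> Cell C" "Dom2 C x = Dom2 C b"
    and e0: "x \<lhd> fst ev 0 = b \<lhd> fst ev 0" "x \<lhd> fst ev 1 = b \<lhd> fst ev 1"
  shows "x = b"
proof -
  note a = arrow_object_hom'[OF P]
  obtain b' where b': "is_inverse (hom_cat C A P) b b'" using b by (auto simp: is_iso_def)
  note i = whisker_r_inverse[OF b' arrow_object_hom(3)[OF P]]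
  have B: "b \<in> Cell C" "Cod C (Dom2 C b) = P" "Dom C (Dom2 C b) = A" using b' by (auto simp: inverse_cell_iff)
  have xt: "Cod C (Dom2 C x) = P" "Dom C (Dom2 C x) = A" using x B by simp_all
  have n: "(Dom2 C b \<rhd> univ_cell ev) \<bullet> (b \<lhd> fst ev 1) = (b \<lhd> fst ev 0) \<bullet> (Cod2 C b \<rhd> univ_cell ev)"
    using whisker_exchange[of b "univ_cell ev"] B a by simp
  have n': "(Dom2 C x \<rhd> univ_cell ev) \<bullet> (x \<lhd> fst ev 1) = (x \<lhd> fst ev 0) \<bullet> (Cod2 C x \<rhd> univ_cell ev)"
    using whisker_exchange[of x "univ_cell ev"] x xt a by simp
  have eq: "(b \<lhd> fst ev 0) \<bullet> (Cod2 C b \<rhd> univ_cell ev) = (b \<lhd> fst ev 0) \<bullet> (Cod2 C x \<rhd> univ_cell ev)"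
    using n n' x(2) unfolding e0 by simp
  have "Cod2 C (x \<lhd> fst ev 0) = Cod2 C (b \<lhd> fst ev 0)" unfolding e0 by simp
  then have cc: "Cod2 C x \<cdot> fst ev 0 = Cod2 C b \<cdot> fst ev 0" using x xt a B by simp
  have "(b' \<lhd> fst ev 0) \<bullet> ((b \<lhd> fst ev 0) \<bullet> (Cod2 C b \<rhd> univ_cell ev)) = Cod2 C b \<rhd> univ_cell ev"
    by (rule VComp_cancel_l(1)[OF i]) (use B a in simp_all)
  moreover have "(b' \<lhd> fst ev 0) \<bullet> ((b \<lhd> fst ev 0) \<bullet> (Cod2 C x \<rhd> univ_cell ev)) = Cod2 C x \<rhd> univ_cell ev"
    by (rule VComp_cancel_l(1)[OF i]) (use B a x xt cc in simp_all)
  ultimately have n1: "Cod2 C x \<rhd> univ_cell ev = Cod2 C b \<rhd> univ_cell ev" by (metis eq)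
  have dd: "Cod2 C x = Cod2 C b"
    by (rule arrow_object_eqI[OF P _ _ n1, of A]) (use x xt B in \<open>simp_all add: in_hom_def\<close>)
  show ?thesis
    by (rule arrow_object_cell_eqI[OF P, of A _ "Dom2 C b" "Cod2 C b"])
      (use dd e0 x xt B in \<open>simp_all add: in_hom_hom_cat\<close>)
qed

section \<open>2-cells into the pair classifier\<close>

lemma pair_classifier_eqI:
  assumes V: "pair_classifier C X V u v" and h: "in_hom C h A V" "in_hom C h' A V" "h \<rhd> u = h' \<rhd> u" "h \<rhd> v = h' \<rhd> v"
  shows "h = h'"
proof -
  have "h \<rhd> u \<in> Arr (hom_cat C A X)" "h \<rhd> v \<in> Arr (hom_cat C A X)" "Cod2 C (h \<rhd> u) = Dom2 C (h \<rhd> v)"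
    using h(1) pair_classifier_hom[OF V] by (auto simp: in_hom_def)
  from pair_classifier_lift[OF V this] h show ?thesis by metis
qed

lemma pair_classifier_nat:
  assumes V: "pair_classifier C X V u v" and t: "in_hom (hom_cat C A V) \<theta> h h'"
  shows "in_hom (hom_cat C A X) (\<theta> \<lhd> Dom2 C u) (h \<cdot> Dom2 C u) (h' \<cdot> Dom2 C u)"
    "in_hom (hom_cat C A X) (\<theta> \<lhd> Cod2 C u) (h \<cdot> Cod2 C u) (h' \<cdot> Cod2 C u)"
    "in_hom (hom_cat C A X) (\<theta> \<lhd> Cod2 C v) (h \<cdot> Cod2 C v) (h' \<cdot> Cod2 C v)"
    "(h \<rhd> u) \<bullet> (\<theta> \<lhd> Cod2 C u) = (\<theta> \<lhd> Dom2 C u) \<bullet> (h' \<rhd> u)" "(h \<rhd> v) \<bullet> (\<theta> \<lhd> Cod2 C v) = (\<theta> \<lhd> Cod2 C u) \<bullet> (h' \<rhd> v)"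
  using pair_classifier_hom[OF V] t whisker_exchange[of \<theta> u] whisker_exchange[of \<theta> v]
  by (auto simp: in_hom_hom_cat)

lemma pair_classifier_cell_eqI:
  assumes V: "pair_classifier C X V u v"
    and t: "in_hom (hom_cat C A V) \<theta> h h'" "in_hom (hom_cat C A V) \<theta>' h h'"
    and e: "\<theta> \<lhd> Dom2 C u = \<theta>' \<lhd> Dom2 C u" "\<theta> \<lhd> Cod2 C u = \<theta>' \<lhd> Cod2 C u" "\<theta> \<lhd> Cod2 C v = \<theta>' \<lhd> Cod2 C v"
  shows "\<theta> = \<theta>'"
proof -
  have h: "in_hom C h A V" "in_hom C h' A V" using t by (auto simp: in_hom_def)
  from pair_classifier_lift_cell[OF V h pair_classifier_nat[OF V t(1)]] t e show ?thesis by metis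
qed

text \<open>The isomorphisms move the two outer vertices while the middle vertex stays fixed with
  identity component. This is what makes the composition morphism from the pair classifier to the
  arrow object an isofibration.\<close>

lemma pair_classifier_transport:
  assumes V: "pair_classifier C X V u v" and h: "in_hom C h A V"
    and b: "is_inverse (hom_cat C A X) b0 b0'" "is_inverse (hom_cat C A X) b2 b2'"
      "Dom2 C b0 = h \<cdot> Dom2 C u" "Dom2 C b2 = h \<cdot> Cod2 C v"
  shows "\<exists>\<theta>. is_iso (hom_cat C A V) \<theta> \<and> Dom2 C \<theta> = h \<and> \<theta> \<lhd> Dom2 C u = b0 \<and> \<theta> \<lhd> Cod2 C v = b2"
proof -
  note V' = pair_classifier_hom[OF V]
  have H: "h \<in> Arr C" "Dom C h = A" "Cod C h = V" using h by (auto simp: in_hom_def)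
  have B: "b0 \<in> Cell C" "b0' \<in> Cell C" "Dom2 C b0' = Cod2 C b0" "Cod2 C b0' = h \<cdot> Dom2 C u"
    "b2 \<in> Cell C" "b2' \<in> Cell C" "Dom2 C b2' = Cod2 C b2" "Cod2 C b2' = h \<cdot> Cod2 C v"
    "Dom C (Cod2 C b0) = A" "Cod C (Cod2 C b0) = X" "Dom C (Cod2 C b2) = A" "Cod C (Cod2 C b2) = X"
    using b by (auto simp: inverse_cell_iff)
  have T1: "b0' \<bullet> (h \<rhd> u) \<in> Arr (hom_cat C A X)" "(h \<rhd> v) \<bullet> b2 \<in> Arr (hom_cat C A X)"
    "Cod2 C (b0' \<bullet> (h \<rhd> u)) = Dom2 C ((h \<rhd> v) \<bullet> b2)"
    using H B V' b by simp_all
  \<comment> \<open>The transported pair: the first arrow is precomposed with the inverse of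
    \<open>b0\<close>, the second is postcomposed with \<open>b2\<close>.\<close>
  obtain h' where h': "in_hom C h' A V" "h' \<rhd> u = b0' \<bullet> (h \<rhd> u)" "h' \<rhd> v = (h \<rhd> v) \<bullet> b2"
    using pair_classifier_lift[OF V T1] by blast
  have H': "h' \<in> Arr C" "Dom C h' = A" "Cod C h' = V" using h' by (auto simp: in_hom_def)
  have "Dom2 C (h' \<rhd> u) = h' \<cdot> Dom2 C u" "Cod2 C (h' \<rhd> u) = h' \<cdot> Cod2 C u" "Cod2 C (h' \<rhd> v) = h' \<cdot> Cod2 C v"
    using H' V' by simp_all
  then have E: "h' \<cdot> Dom2 C u = Cod2 C b0" "h' \<cdot> Cod2 C u = h \<cdot> Cod2 C u" "h' \<cdot> Cod2 C v = Cod2 C b2"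
    unfolding h'(2,3) using H B V' b(3,4) by simp_all
  have tt: "in_hom (hom_cat C A X) b0 (h \<cdot> Dom2 C u) (h' \<cdot> Dom2 C u)"
    "in_hom (hom_cat C A X) (Ide2 C (h \<cdot> Cod2 C u)) (h \<cdot> Cod2 C u) (h' \<cdot> Cod2 C u)"
    "in_hom (hom_cat C A X) b2 (h \<cdot> Cod2 C v) (h' \<cdot> Cod2 C v)"
    unfolding E using H B V' b(3,4) by (simp_all add: in_hom_hom_cat)
  have "b0 \<bullet> (b0' \<bullet> (h \<rhd> u)) = h \<rhd> u" by (rule VComp_cancel_l(2)[OF b(1)]) (use H V' b in simp_all)
  then have nn: "(h \<rhd> u) \<bullet> Ide2 C (h \<cdot> Cod2 C u) = b0 \<bullet> (h' \<rhd> u)" "(h \<rhd> v) \<bullet> b2 = Ide2 C (h \<cdot> Cod2 C u) \<bullet> (h' \<rhd> v)"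
    unfolding h'(2,3) using H B V' b(3,4) by simp_all
  obtain \<theta> where t: "in_hom (hom_cat C A V) \<theta> h h'" "\<theta> \<lhd> Dom2 C u = b0" "\<theta> \<lhd> Cod2 C u = Ide2 C (h \<cdot> Cod2 C u)"
    "\<theta> \<lhd> Cod2 C v = b2"
    using pair_classifier_lift_cell[OF V h h'(1) tt nn] by blast
  have iI: "is_inverse (hom_cat C A X) (Ide2 C (h \<cdot> Cod2 C u)) (Ide2 C (h \<cdot> Cod2 C u))"
    by (rule is_inverse_Ide2) (use H V' in \<open>simp add: in_hom_def\<close>)
  have n1: "(h' \<rhd> u) \<bullet> Ide2 C (h \<cdot> Cod2 C u) = b0' \<bullet> (h \<rhd> u)"
    by (rule inverse_cell_natural[OF b(1) iI _ _ nn(1)]) (use H H' V' B b E in \<open>simp_all add: in_hom_hom_cat\<close>)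
  have n2: "(h' \<rhd> v) \<bullet> b2' = Ide2 C (h \<cdot> Cod2 C u) \<bullet> (h \<rhd> v)"
    by (rule inverse_cell_natural[OF iI b(2) _ _ nn(2)]) (use H H' V' B b E in \<open>simp_all add: in_hom_hom_cat\<close>)
  have tt': "in_hom (hom_cat C A X) b0' (h' \<cdot> Dom2 C u) (h \<cdot> Dom2 C u)"
    "in_hom (hom_cat C A X) (Ide2 C (h \<cdot> Cod2 C u)) (h' \<cdot> Cod2 C u) (h \<cdot> Cod2 C u)"
    "in_hom (hom_cat C A X) b2' (h' \<cdot> Cod2 C v) (h \<cdot> Cod2 C v)"
    unfolding E using H B V' b(3,4) by (simp_all add: in_hom_hom_cat)
  obtain \<theta>' where t': "in_hom (hom_cat C A V) \<theta>' h' h" "\<theta>' \<lhd> Dom2 C u = b0'" "\<theta>' \<lhd> Cod2 C u = Ide2 C (h \<cdot> Cod2 C u)"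
    "\<theta>' \<lhd> Cod2 C v = b2'"
    using pair_classifier_lift_cell[OF V h'(1) h tt' n1 n2] by blast
  have tc: "\<theta> \<in> Cell C" "Dom2 C \<theta> = h" "Cod2 C \<theta> = h'" "\<theta>' \<in> Cell C" "Dom2 C \<theta>' = h'" "Cod2 C \<theta>' = h"
    using t(1) t'(1) by (auto simp: in_hom_def)
  have bb: "b0 \<bullet> b0' = Ide2 C (h \<cdot> Dom2 C u)" "b2 \<bullet> b2' = Ide2 C (h \<cdot> Cod2 C v)" "b0' \<bullet> b0 = Ide2 C (Cod2 C b0)"
    "b2' \<bullet> b2 = Ide2 C (Cod2 C b2)" using b by (auto simp: inverse_cell_iff)
  have "\<theta> \<bullet> \<theta>' = Ide2 C h"
    by (rule pair_classifier_cell_eqI[OF V, of A _ h h])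
      (use tc H H' V' t t' bb in \<open>simp_all add: in_hom_hom_cat\<close>)
  moreover have "\<theta>' \<bullet> \<theta> = Ide2 C h'"
    by (rule pair_classifier_cell_eqI[OF V, of A _ h' h'])
      (use tc H H' V' t t' bb E in \<open>simp_all add: in_hom_hom_cat\<close>)
  ultimately have "is_inverse (hom_cat C A V) \<theta> \<theta>'" by (intro is_inverse_cellI[OF t(1) t'(1)])
  then show ?thesis using t tc by (auto simp: is_iso_def)
qed

section \<open>The classifier of retractions\<close>

lemma retraction_classifier_lift:
  assumes "retraction_classifier C X R u v" "\<alpha> \<in> Arr (hom_cat C A X)" "\<beta> \<in> Arr (hom_cat C A X)"
    "Cod2 C \<alpha> = Dom2 C \<beta>" "Cod2 C \<beta> = Dom2 C \<alpha>" "\<alpha> \<bullet> \<beta> = Ide2 C (Dom2 C \<alpha>)"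
  shows "\<exists>!h. in_hom C h A R \<and> h \<rhd> u = \<alpha> \<and> h \<rhd> v = \<beta>"
  using assms unfolding retraction_classifier_def by blast

lemma retraction_classifier_lift_cell:
  assumes "retraction_classifier C X R u v" "in_hom C h A R" "in_hom C h' A R"
    "in_hom (hom_cat C A X) t0 (h \<cdot> Dom2 C u) (h' \<cdot> Dom2 C u)"
    "in_hom (hom_cat C A X) t1 (h \<cdot> Cod2 C u) (h' \<cdot> Cod2 C u)"
    "(h \<rhd> u) \<bullet> t1 = t0 \<bullet> (h' \<rhd> u)" "(h \<rhd> v) \<bullet> t0 = t1 \<bullet> (h' \<rhd> v)"
  shows "\<exists>!\<theta>. in_hom (hom_cat C A R) \<theta> h h' \<and> \<theta> \<lhd> Dom2 C u = t0 \<and> \<theta> \<lhd> Cod2 C u = t1"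
  using assms unfolding retraction_classifier_def by blast

lemma retraction_classifier_hom:
  assumes "retraction_classifier C X R u v"
  shows "X \<in> Obj C" "R \<in> Obj C" "u \<in> Cell C" "v \<in> Cell C" "Dom C (Dom2 C u) = R" "Dom C (Dom2 C v) = R"
    "Cod C (Dom2 C u) = X" "Cod C (Dom2 C v) = X" "Cod2 C u = Dom2 C v" "Cod2 C v = Dom2 C u"
    "u \<bullet> v = Ide2 C (Dom2 C u)"
proof -
  have "X \<in> Obj C \<and> R \<in> Obj C \<and>
     u \<in> Arr (hom_cat C R X) \<and> v \<in> Arr (hom_cat C R X) \<and> Cod2 C u = Dom2 C v \<and> Cod2 C v = Dom2 C u \<and>
    u \<bullet> v = Ide2 C (Dom2 C u)"
    using assms unfolding retraction_classifier_def by blast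
  then show "X \<in> Obj C" "R \<in> Obj C" "u \<in> Cell C" "v \<in> Cell C" "Dom C (Dom2 C u) = R" "Dom C (Dom2 C v) = R"
    "Cod C (Dom2 C u) = X" "Cod C (Dom2 C v) = X" "Cod2 C u = Dom2 C v" "Cod2 C v = Dom2 C u"
    "u \<bullet> v = Ide2 C (Dom2 C u)" by auto
qed

text \<open>Requiring the composite of a composable pair to be an identity is a pullback of the
  composition morphism against the morphism naming identities; composition is an isofibration by
  transport, so the pullback exists.\<close>

lemma retraction_classifier_exists:
  assumes "pita C" "X \<in> Obj C"
  shows "\<exists>R u v. retraction_classifier C X R u v"
proof -
  obtain P ev where P: "arrow_object C X P ev" using assms unfolding pita_def by blast
  note a = arrow_object_hom'[OF P]
  obtain V u0 v0 where V: "pair_classifier C X V u0 v0" using pair_classifier_exists[OF assms] by blast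
  note V' = pair_classifier_hom[OF V]
  \<comment> \<open>\<open>c\<close> sends a composable pair to its composite, and \<open>e\<close>
    sends an object to its identity arrow.\<close>
  have "in_hom (hom_cat C V X) (u0 \<bullet> v0) (Dom2 C u0) (Cod2 C v0)" using V' by (simp add: in_hom_hom_cat)
  from arrow_object_lift[OF P this] obtain c where c: "in_hom C c V P" "c \<rhd> univ_cell ev = u0 \<bullet> v0" by blast
  have "in_hom (hom_cat C X X) (Ide2 C (Ide C X)) (Ide C X) (Ide C X)" using assms(2) by (simp add: in_hom_hom_cat)
  from arrow_object_lift[OF P this] obtain e where e: "in_hom C e X P" "e \<rhd> univ_cell ev = Ide2 C (Ide C X)" by blast
  have CE: "c \<in> Arr C" "Dom C c = V" "Cod C c = P" "e \<in> Arr C" "Dom C e = X" "Cod C e = P"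
    using c e by (auto simp: in_hom_def)
  have "Dom2 C (c \<rhd> univ_cell ev) = c \<cdot> fst ev 0" "Cod2 C (c \<rhd> univ_cell ev) = c \<cdot> fst ev 1"
    "Dom2 C (e \<rhd> univ_cell ev) = e \<cdot> fst ev 0" "Cod2 C (e \<rhd> univ_cell ev) = e \<cdot> fst ev 1"
    using CE a by simp_all
  moreover have ii: "Dom2 C (Ide2 C (Ide C X)) = Ide C X" "Cod2 C (Ide2 C (Ide C X)) = Ide C X"
    using assms(2) by simp_all
  ultimately have ce: "c \<cdot> fst ev 0 = Dom2 C u0" "c \<cdot> fst ev 1 = Cod2 C v0" "e \<cdot> fst ev 0 = Ide C X" "e \<cdot> fst ev 1 = Ide C X"
    unfolding c(2) e(2) ii using V' by simp_all
  \<comment> \<open>The two end components of an isomorphism out of the composite are used to move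
    the outer vertices of the pair.\<close>
  have "\<exists>a. is_iso (hom_cat C A V) a \<and> Dom2 C a = h \<and> a \<lhd> c = b"
    if h: "in_hom C h A V" and b: "is_iso (hom_cat C A P) b" "Dom2 C b = h \<cdot> c" for A h b
  proof -
    obtain b' where b': "is_inverse (hom_cat C A P) b b'" using b by (auto simp: is_iso_def)
    have H: "h \<in> Arr C" "Dom C h = A" "Cod C h = V" using h by (auto simp: in_hom_def)
    note i = whisker_r_inverse[OF b' arrow_object_hom(3)[OF P]] whisker_r_inverse[OF b' arrow_object_hom(4)[OF P]]
    have B: "b \<in> Cell C" "Cod C (Dom2 C b) = P" "Dom C (Dom2 C b) = A" using b' by (auto simp: inverse_cell_iff)
    have "Dom2 C (b \<lhd> fst ev 0) = h \<cdot> (c \<cdot> fst ev 0)" "Dom2 C (b \<lhd> fst ev 1) = h \<cdot> (c \<cdot> fst ev 1)"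
      using B b H CE a by simp_all
    then obtain \<theta> where t: "is_iso (hom_cat C A V) \<theta>" "Dom2 C \<theta> = h" "\<theta> \<lhd> Dom2 C u0 = b \<lhd> fst ev 0" "\<theta> \<lhd> Cod2 C v0 = b \<lhd> fst ev 1"
      using pair_classifier_transport[OF V h i] unfolding ce by blast
    have tc: "\<theta> \<in> Cell C" "Cod C (Dom2 C \<theta>) = V" "Dom C (Dom2 C \<theta>) = A" using t(1) by (auto simp: is_iso_def inverse_cell_iff)
    have e0: "(\<theta> \<lhd> c) \<lhd> fst ev 0 = b \<lhd> fst ev 0" "(\<theta> \<lhd> c) \<lhd> fst ev 1 = b \<lhd> fst ev 1"
      using whisker_r_comp[of c "fst ev 0" \<theta>] whisker_r_comp[of c "fst ev 1" \<theta>] tc CE a t V' unfolding ce by simp_all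
    have ww: "in_hom (hom_cat C A X) (b \<lhd> fst ev 0) (Dom2 C b \<cdot> fst ev 0) (Cod2 C b \<cdot> fst ev 0)"
       "in_hom (hom_cat C A X) (b \<lhd> fst ev 1) (Dom2 C b \<cdot> fst ev 1) (Cod2 C b \<cdot> fst ev 1)"
      using B a by (simp_all add: in_hom_hom_cat)
    have "\<theta> \<lhd> c = b"
      by (rule arrow_object_iso_eqI[OF P b(1) _ _ e0]) (use tc CE b(2) t(2) in simp_all)
    then show ?thesis using t by blast
  qed
  then have "isofibration C c"
    using CE by (auto simp: isofibration_def isofibration_functor_def postcomp_def)
  then obtain p q where pq: "strict_pullback C p q c e"
    using assms(1) CE unfolding pita_def by metis
  define R where "R = Dom C p"
  note h = strict_pullback_hom[OF pq, folded R_def]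
  have pq': "p \<in> Arr C" "q \<in> Arr C" "Dom C p = R" "Dom C q = R" "Cod C p = V" "Cod C q = X"
    using h CE by (auto simp: in_hom_def)
  have RO: "R \<in> Obj C" using pq' dom_obj by metis
  define u where "u = p \<rhd> u0"
  define v where "v = p \<rhd> v0"
  have "p \<cdot> (c \<cdot> fst ev 0) = (p \<cdot> c) \<cdot> fst ev 0" "p \<cdot> (c \<cdot> fst ev 1) = (p \<cdot> c) \<cdot> fst ev 1"
    "p \<rhd> (c \<rhd> univ_cell ev) = (p \<cdot> c) \<rhd> univ_cell ev"
    "q \<cdot> (e \<cdot> fst ev 0) = (q \<cdot> e) \<cdot> fst ev 0" "q \<cdot> (e \<cdot> fst ev 1) = (q \<cdot> e) \<cdot> fst ev 1"
    "q \<rhd> (e \<rhd> univ_cell ev) = (q \<cdot> e) \<rhd> univ_cell ev"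
    using pq' CE a by simp_all
  then have "p \<cdot> Dom2 C u0 = q \<cdot> Ide C X" "p \<cdot> Cod2 C v0 = q \<cdot> Ide C X" "p \<rhd> (u0 \<bullet> v0) = q \<rhd> Ide2 C (Ide C X)"
    unfolding ce c(2) e(2) h(3) by simp_all
  then have pe: "p \<cdot> Dom2 C u0 = q" "p \<cdot> Cod2 C v0 = q" "(p \<rhd> u0) \<bullet> (p \<rhd> v0) = Ide2 C q"
    using pq' V' assms(2) by simp_all
  have uv: "u \<in> Cell C" "v \<in> Cell C" "Dom2 C u = q" "Cod2 C u = p \<cdot> Dom2 C v0"
    "Dom2 C v = p \<cdot> Dom2 C v0" "Cod2 C v = q" "u \<bullet> v = Ide2 C q"
    using pq' V' pe by (auto simp: u_def v_def)
  have lift: "\<exists>!h. in_hom C h A R \<and> h \<rhd> u = \<alpha> \<and> h \<rhd> v = \<beta>"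
    if ab: "\<alpha> \<in> Arr (hom_cat C A X)" "\<beta> \<in> Arr (hom_cat C A X)" "Cod2 C \<alpha> = Dom2 C \<beta>" "Cod2 C \<beta> = Dom2 C \<alpha>"
      "\<alpha> \<bullet> \<beta> = Ide2 C (Dom2 C \<alpha>)" for A \<alpha> \<beta>
  proof -
    obtain k where k: "in_hom C k A V" "k \<rhd> u0 = \<alpha>" "k \<rhd> v0 = \<beta>" using pair_classifier_lift[OF V ab(1-3)] by blast
    have K: "k \<in> Arr C" "Dom C k = A" "Cod C k = V" using k by (auto simp: in_hom_def)
    have AB: "\<alpha> \<in> Cell C" "Dom C (Dom2 C \<alpha>) = A" "Cod C (Dom2 C \<alpha>) = X" using ab by auto
    have kce: "k \<cdot> c = Dom2 C \<alpha> \<cdot> e"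
    proof (rule arrow_object_eqI[OF P, of _ A])
      show "in_hom C (k \<cdot> c) A P" "in_hom C (Dom2 C \<alpha> \<cdot> e) A P" using K CE AB by (auto simp: in_hom_def)
      have "(k \<cdot> c) \<rhd> univ_cell ev = k \<rhd> (c \<rhd> univ_cell ev)" "(Dom2 C \<alpha> \<cdot> e) \<rhd> univ_cell ev = Dom2 C \<alpha> \<rhd> (e \<rhd> univ_cell ev)"
        using K CE AB a by simp_all
      moreover have "k \<rhd> (u0 \<bullet> v0) = \<alpha> \<bullet> \<beta>" using k K V' by simp
      moreover have "Dom2 C \<alpha> \<rhd> Ide2 C (Ide C X) = Ide2 C (Dom2 C \<alpha>)" using AB assms(2) by simp
      ultimately show "(k \<cdot> c) \<rhd> univ_cell ev = (Dom2 C \<alpha> \<cdot> e) \<rhd> univ_cell ev"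
        unfolding c(2) e(2) using ab(5) by simp
    qed
    have kd: "k \<cdot> Dom2 C u0 = Dom2 C \<alpha>" using k(2)[symmetric] K V' by simp
    have "in_hom C k A (Dom C c)" "in_hom C (Dom2 C \<alpha>) A (Dom C e)" using K CE AB by (auto simp: in_hom_def)
    from strict_pullback_lift[OF pq this kce, folded R_def]
    have ex: "\<exists>!h. in_hom C h A R \<and> h \<cdot> p = k \<and> h \<cdot> q = Dom2 C \<alpha>" .
    have "h \<rhd> u = \<alpha> \<and> h \<rhd> v = \<beta> \<longleftrightarrow> h \<cdot> p = k \<and> h \<cdot> q = Dom2 C \<alpha>" if hh: "in_hom C h A R" for h
    proof -
      have H: "h \<in> Arr C" "Dom C h = A" "Cod C h = R" using hh by (auto simp: in_hom_def)
      have e1: "h \<rhd> u = (h \<cdot> p) \<rhd> u0" "h \<rhd> v = (h \<cdot> p) \<rhd> v0" using H pq' V' by (auto simp: u_def v_def)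
      have e2: "h \<cdot> q = (h \<cdot> p) \<cdot> Dom2 C u0" unfolding pe(1)[symmetric] using H pq' V' by simp
      have "in_hom C (h \<cdot> p) A V" using H pq' by (simp add: in_hom_def)
      from pair_classifier_eqI[OF V this k(1)] show ?thesis unfolding e1 e2 using k(2,3) kd by auto
    qed
    with ex show ?thesis by (simp cong: conj_cong)
  qed
  have cell: "\<exists>!\<theta>. in_hom (hom_cat C A R) \<theta> h h' \<and> \<theta> \<lhd> Dom2 C u = t0 \<and> \<theta> \<lhd> Cod2 C u = t1"
    if hh: "in_hom C h A R" "in_hom C h' A R"
      and t: "in_hom (hom_cat C A X) t0 (h \<cdot> Dom2 C u) (h' \<cdot> Dom2 C u)"
        "in_hom (hom_cat C A X) t1 (h \<cdot> Cod2 C u) (h' \<cdot> Cod2 C u)"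
      and n: "(h \<rhd> u) \<bullet> t1 = t0 \<bullet> (h' \<rhd> u)" "(h \<rhd> v) \<bullet> t0 = t1 \<bullet> (h' \<rhd> v)" for A h h' t0 t1
  proof -
    have H: "h \<in> Arr C" "h' \<in> Arr C" "Dom C h = A" "Dom C h' = A" "Cod C h = R" "Cod C h' = R"
      using hh by (auto simp: in_hom_def)
    have hp: "in_hom C (h \<cdot> p) A V" "in_hom C (h' \<cdot> p) A V" using H pq' by (auto simp: in_hom_def)
    have tp: "in_hom (hom_cat C A X) t0 ((h \<cdot> p) \<cdot> Dom2 C u0) ((h' \<cdot> p) \<cdot> Dom2 C u0)"
      "in_hom (hom_cat C A X) t1 ((h \<cdot> p) \<cdot> Cod2 C u0) ((h' \<cdot> p) \<cdot> Cod2 C u0)"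
      "in_hom (hom_cat C A X) t0 ((h \<cdot> p) \<cdot> Cod2 C v0) ((h' \<cdot> p) \<cdot> Cod2 C v0)"
      "((h \<cdot> p) \<rhd> u0) \<bullet> t1 = t0 \<bullet> ((h' \<cdot> p) \<rhd> u0)"
      "((h \<cdot> p) \<rhd> v0) \<bullet> t0 = t1 \<bullet> ((h' \<cdot> p) \<rhd> v0)"
      using t n H pq' V' uv pe by (simp_all add: u_def v_def)
    obtain tp where tpp: "in_hom (hom_cat C A V) tp (h \<cdot> p) (h' \<cdot> p)" "tp \<lhd> Dom2 C u0 = t0" "tp \<lhd> Cod2 C u0 = t1"
      "tp \<lhd> Cod2 C v0 = t0" using pair_classifier_lift_cell[OF V hp tp] by blast
    have TP: "tp \<in> Cell C" "Dom2 C tp = h \<cdot> p" "Cod2 C tp = h' \<cdot> p" using tpp(1) by (auto simp: in_hom_def)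
    have TQ: "t0 \<in> Cell C" "Dom2 C t0 = h \<cdot> q" "Cod2 C t0 = h' \<cdot> q" using t(1) uv by (auto simp: in_hom_def)
    \<comment> \<open>Both ends of the composite carry the component \<open>t0\<close>, as do both
      ends of an identity arrow; the two 2-cells into the arrow object therefore agree on
      components.\<close>
    have "tp \<lhd> c = t0 \<lhd> e"
    proof (rule arrow_object_cell_eqI[OF P, of A _ "h \<cdot> (p \<cdot> c)" "h' \<cdot> (p \<cdot> c)"])
      show "in_hom (hom_cat C A P) (tp \<lhd> c) (h \<cdot> (p \<cdot> c)) (h' \<cdot> (p \<cdot> c))" using TP H pq' CE by (simp add: in_hom_hom_cat)
      show "in_hom (hom_cat C A P) (t0 \<lhd> e) (h \<cdot> (p \<cdot> c)) (h' \<cdot> (p \<cdot> c))" unfolding h(3) using TQ H pq' CE by (simp add: in_hom_hom_cat)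
      have "(tp \<lhd> c) \<lhd> fst ev 0 = tp \<lhd> (c \<cdot> fst ev 0)" "(tp \<lhd> c) \<lhd> fst ev 1 = tp \<lhd> (c \<cdot> fst ev 1)"
        "(t0 \<lhd> e) \<lhd> fst ev 0 = t0 \<lhd> (e \<cdot> fst ev 0)" "(t0 \<lhd> e) \<lhd> fst ev 1 = t0 \<lhd> (e \<cdot> fst ev 1)"
        using TP TQ H pq' CE a by simp_all
      moreover have "t0 \<lhd> Ide C X = t0" using TQ H pq' by simp
      ultimately show "(tp \<lhd> c) \<lhd> fst ev 0 = (t0 \<lhd> e) \<lhd> fst ev 0" "(tp \<lhd> c) \<lhd> fst ev 1 = (t0 \<lhd> e) \<lhd> fst ev 1"
        unfolding ce using tpp by simp_all
    qed
    moreover have "in_hom C h A (Dom C p)" "in_hom C h' A (Dom C p)" "in_hom (hom_cat C A (Dom C c)) tp (h \<cdot> p) (h' \<cdot> p)"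
      "in_hom (hom_cat C A (Dom C e)) t0 (h \<cdot> q) (h' \<cdot> q)" using H tpp t(1) CE pq' uv by (auto simp: in_hom_def)
    ultimately have ex: "\<exists>!\<theta>. in_hom (hom_cat C A R) \<theta> h h' \<and> \<theta> \<lhd> p = tp \<and> \<theta> \<lhd> q = t0"
      using strict_pullback_lift_cell[OF pq] pq' by metis
    moreover have "\<theta> \<lhd> p = tp \<and> \<theta> \<lhd> q = t0 \<longleftrightarrow> \<theta> \<lhd> Dom2 C u = t0 \<and> \<theta> \<lhd> Cod2 C u = t1"
      if th: "in_hom (hom_cat C A R) \<theta> h h'" for \<theta>
    proof -
      have thc: "\<theta> \<in> Cell C" "Dom2 C \<theta> = h" "Cod2 C \<theta> = h'" using th by (auto simp: in_hom_def)
      have ww: "(\<theta> \<lhd> p) \<lhd> Dom2 C u0 = \<theta> \<lhd> (p \<cdot> Dom2 C u0)" "(\<theta> \<lhd> p) \<lhd> Cod2 C u0 = \<theta> \<lhd> (p \<cdot> Cod2 C u0)"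
        "(\<theta> \<lhd> p) \<lhd> Cod2 C v0 = \<theta> \<lhd> (p \<cdot> Cod2 C v0)"
        using thc H pq' V' by simp_all
      have "in_hom (hom_cat C A V) (\<theta> \<lhd> p) (h \<cdot> p) (h' \<cdot> p)" using thc H pq' by (auto simp: in_hom_def)
      note eqI = pair_classifier_cell_eqI[OF V this tpp(1)]
      have ww': "(\<theta> \<lhd> p) \<lhd> Dom2 C u0 = \<theta> \<lhd> Dom2 C u" "(\<theta> \<lhd> p) \<lhd> Cod2 C u0 = \<theta> \<lhd> Cod2 C u"
        "(\<theta> \<lhd> p) \<lhd> Cod2 C v0 = \<theta> \<lhd> Dom2 C u" "q = Dom2 C u"
        unfolding ww pe uv using V' by simp_all
      show ?thesis unfolding ww'(4) using eqI ww'(1-3) tpp(2-4) by metis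
    qed
    ultimately show ?thesis by (simp cong: conj_cong)
  qed
  have T: "u \<in> Arr (hom_cat C R X)" "v \<in> Arr (hom_cat C R X)" "Cod2 C u = Dom2 C v" "Cod2 C v = Dom2 C u"
    "u \<bullet> v = Ide2 C (Dom2 C u)"
    using uv pq' V' by simp_all
  have "retraction_classifier C X R u v"
    unfolding retraction_classifier_def
    apply (intro conjI allI impI)
    subgoal by (rule assms(2))
    subgoal by (rule RO)
    subgoal by (rule T)
    subgoal by (rule T)
    subgoal by (rule T)
    subgoal by (rule T)
    subgoal by (rule T)
    subgoal using lift by blast
    subgoal using cell by blast
    done
  then show ?thesis by blast
qed

lemma retraction_classifier_eqI:
  assumes R: "retraction_classifier C X R u v" and h: "in_hom C h A R" "in_hom C h' A R" "h \<rhd> u = h' \<rhd> u" "h \<rhd> v = h' \<rhd> v"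
  shows "h = h'"
proof -
  note R' = retraction_classifier_hom[OF R]
  have H: "h \<in> Arr C" "Dom C h = A" "Cod C h = R" using h(1) by (auto simp: in_hom_def)
  have "(h \<rhd> u) \<bullet> (h \<rhd> v) = h \<rhd> (u \<bullet> v)" by (rule whisker_l_VComp[symmetric]) (use H R' in simp_all)
  then have "h \<rhd> u \<in> Arr (hom_cat C A X)" "h \<rhd> v \<in> Arr (hom_cat C A X)" "Cod2 C (h \<rhd> u) = Dom2 C (h \<rhd> v)"
    "Cod2 C (h \<rhd> v) = Dom2 C (h \<rhd> u)" "(h \<rhd> u) \<bullet> (h \<rhd> v) = Ide2 C (Dom2 C (h \<rhd> u))"
    using H R' by simp_all
  from retraction_classifier_lift[OF R this] h show ?thesis by metis
qed

lemma retraction_classifier_nat: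
  assumes R: "retraction_classifier C X R u v" and t: "in_hom (hom_cat C A R) \<theta> h h'"
  shows "in_hom (hom_cat C A X) (\<theta> \<lhd> Dom2 C u) (h \<cdot> Dom2 C u) (h' \<cdot> Dom2 C u)"
    "in_hom (hom_cat C A X) (\<theta> \<lhd> Cod2 C u) (h \<cdot> Cod2 C u) (h' \<cdot> Cod2 C u)"
    "(h \<rhd> u) \<bullet> (\<theta> \<lhd> Cod2 C u) = (\<theta> \<lhd> Dom2 C u) \<bullet> (h' \<rhd> u)" "(h \<rhd> v) \<bullet> (\<theta> \<lhd> Dom2 C u) = (\<theta> \<lhd> Cod2 C u) \<bullet> (h' \<rhd> v)"
  using retraction_classifier_hom[OF R] t whisker_exchange[of \<theta> u] whisker_exchange[of \<theta> v]
  by (auto simp: in_hom_hom_cat)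

lemma retraction_classifier_cell_eqI:
  assumes R: "retraction_classifier C X R u v"
    and t: "in_hom (hom_cat C A R) \<theta> h h'" "in_hom (hom_cat C A R) \<theta>' h h'"
    and e: "\<theta> \<lhd> Dom2 C u = \<theta>' \<lhd> Dom2 C u" "\<theta> \<lhd> Cod2 C u = \<theta>' \<lhd> Cod2 C u"
  shows "\<theta> = \<theta>'"
proof -
  have h: "in_hom C h A R" "in_hom C h' A R" using t by (auto simp: in_hom_def)
  from retraction_classifier_lift_cell[OF R h retraction_classifier_nat[OF R t(1)]] t e show ?thesis by metis
qed

text \<open>Both vertices move independently, and conjugating \<open>u\<close> and \<open>v\<close>
  with the two isomorphisms preserves the retraction equation. It provides the isofibration needed
  for the classifier of isomorphisms.\<close>

lemma retraction_classifier_transport: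
  assumes R: "retraction_classifier C X R u v" and h: "in_hom C h A R"
    and b: "is_inverse (hom_cat C A X) b0 b0'" "is_inverse (hom_cat C A X) b1 b1'"
      "Dom2 C b0 = h \<cdot> Dom2 C u" "Dom2 C b1 = h \<cdot> Cod2 C u"
  shows "\<exists>\<theta>. is_iso (hom_cat C A R) \<theta> \<and> Dom2 C \<theta> = h \<and> \<theta> \<lhd> Dom2 C u = b0 \<and> \<theta> \<lhd> Cod2 C u = b1"
proof -
  note R' = retraction_classifier_hom[OF R]
  have H: "h \<in> Arr C" "Dom C h = A" "Cod C h = R" using h by (auto simp: in_hom_def)
  have B: "b0 \<in> Cell C" "b0' \<in> Cell C" "Dom2 C b0' = Cod2 C b0" "Cod2 C b0' = h \<cdot> Dom2 C u"
    "b1 \<in> Cell C" "b1' \<in> Cell C" "Dom2 C b1' = Cod2 C b1" "Cod2 C b1' = h \<cdot> Cod2 C u"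
    "Dom C (Cod2 C b0) = A" "Cod C (Cod2 C b0) = X" "Dom C (Cod2 C b1) = A" "Cod C (Cod2 C b1) = X"
    using b by (auto simp: inverse_cell_iff)
  have bb: "b0 \<bullet> b0' = Ide2 C (h \<cdot> Dom2 C u)" "b1 \<bullet> b1' = Ide2 C (h \<cdot> Cod2 C u)" "b0' \<bullet> b0 = Ide2 C (Cod2 C b0)"
    "b1' \<bullet> b1 = Ide2 C (Cod2 C b1)" using b by (auto simp: inverse_cell_iff)
  have huv: "(h \<rhd> u) \<bullet> (h \<rhd> v) = Ide2 C (h \<cdot> Dom2 C u)"
    using whisker_l_VComp[of h u v] H R' by simp
  define \<alpha> where "\<alpha> = b0' \<bullet> ((h \<rhd> u) \<bullet> b1)"
  define \<beta> where "\<beta> = b1' \<bullet> ((h \<rhd> v) \<bullet> b0)"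
  \<comment> \<open>First \<open>b1\<close> cancels against its inverse in the middle, then the
    retraction equation restricted along \<open>h\<close> applies.\<close>
  have "\<alpha> \<bullet> \<beta> = b0' \<bullet> ((h \<rhd> u) \<bullet> (b1 \<bullet> (b1' \<bullet> ((h \<rhd> v) \<bullet> b0))))"
    unfolding \<alpha>_def \<beta>_def using H R' B b(3,4) by simp
  also have "b1 \<bullet> (b1' \<bullet> ((h \<rhd> v) \<bullet> b0)) = (h \<rhd> v) \<bullet> b0"
    by (rule VComp_cancel_l(2)[OF b(2)]) (use H R' B b(3,4) in simp_all)
  also have "(h \<rhd> u) \<bullet> ((h \<rhd> v) \<bullet> b0) = ((h \<rhd> u) \<bullet> (h \<rhd> v)) \<bullet> b0" using H R' B b(3,4) by simp
  also have "b0' \<bullet> \<dots> = Ide2 C (Cod2 C b0)" unfolding huv using H R' B b(3,4) bb by simp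
  finally have ab: "\<alpha> \<bullet> \<beta> = Ide2 C (Cod2 C b0)" .
  have T: "\<alpha> \<in> Cell C" "Dom2 C \<alpha> = Cod2 C b0" "Cod2 C \<alpha> = Cod2 C b1" "\<beta> \<in> Cell C" "Dom2 C \<beta> = Cod2 C b1" "Cod2 C \<beta> = Cod2 C b0"
    unfolding \<alpha>_def \<beta>_def using H R' B b(3,4) by simp_all
  have T': "\<alpha> \<in> Arr (hom_cat C A X)" "\<beta> \<in> Arr (hom_cat C A X)" "Cod2 C \<alpha> = Dom2 C \<beta>" "Cod2 C \<beta> = Dom2 C \<alpha>"
    "\<alpha> \<bullet> \<beta> = Ide2 C (Dom2 C \<alpha>)" using T B ab by simp_all
  obtain h' where h': "in_hom C h' A R" "h' \<rhd> u = \<alpha>" "h' \<rhd> v = \<beta>"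
    using retraction_classifier_lift[OF R T'] by blast
  have H': "h' \<in> Arr C" "Dom C h' = A" "Cod C h' = R" using h' by (auto simp: in_hom_def)
  have "Dom2 C (h' \<rhd> u) = h' \<cdot> Dom2 C u" "Cod2 C (h' \<rhd> u) = h' \<cdot> Cod2 C u"
    using H' R' by simp_all
  then have E: "h' \<cdot> Dom2 C u = Cod2 C b0" "h' \<cdot> Cod2 C u = Cod2 C b1"
    unfolding h'(2,3) using T by simp_all
  have tt: "in_hom (hom_cat C A X) b0 (h \<cdot> Dom2 C u) (h' \<cdot> Dom2 C u)"
    "in_hom (hom_cat C A X) b1 (h \<cdot> Cod2 C u) (h' \<cdot> Cod2 C u)"
    "in_hom (hom_cat C A X) b0' (h' \<cdot> Dom2 C u) (h \<cdot> Dom2 C u)"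
    "in_hom (hom_cat C A X) b1' (h' \<cdot> Cod2 C u) (h \<cdot> Cod2 C u)"
    unfolding E using H B R' b(3,4) by (simp_all add: in_hom_hom_cat)
  have nn: "(h \<rhd> u) \<bullet> b1 = b0 \<bullet> (h' \<rhd> u)" "(h \<rhd> v) \<bullet> b0 = b1 \<bullet> (h' \<rhd> v)"
    unfolding h'(2,3) \<alpha>_def \<beta>_def
    by (rule VComp_cancel_l(2)[OF b(1), symmetric], use H R' B b(3,4) in simp_all)
      (rule VComp_cancel_l(2)[OF b(2), symmetric], use H R' B b(3,4) in simp_all)
  have nn': "(h' \<rhd> u) \<bullet> b1' = b0' \<bullet> (h \<rhd> u)" "(h' \<rhd> v) \<bullet> b0' = b1' \<bullet> (h \<rhd> v)"
    by (rule inverse_cell_natural[OF b(1,2) _ _ nn(1)], use H H' R' B b E in \<open>simp_all add: in_hom_hom_cat\<close>)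
      (rule inverse_cell_natural[OF b(2,1) _ _ nn(2)], use H H' R' B b E in \<open>simp_all add: in_hom_hom_cat\<close>)
  obtain \<theta> where t: "in_hom (hom_cat C A R) \<theta> h h'" "\<theta> \<lhd> Dom2 C u = b0" "\<theta> \<lhd> Cod2 C u = b1"
    using retraction_classifier_lift_cell[OF R h h'(1) tt(1,2) nn] by blast
  obtain \<theta>' where t': "in_hom (hom_cat C A R) \<theta>' h' h" "\<theta>' \<lhd> Dom2 C u = b0'" "\<theta>' \<lhd> Cod2 C u = b1'"
    using retraction_classifier_lift_cell[OF R h'(1) h tt(3,4) nn'] by blast
  have tc: "\<theta> \<in> Cell C" "Dom2 C \<theta> = h" "Cod2 C \<theta> = h'" "\<theta>' \<in> Cell C" "Dom2 C \<theta>' = h'" "Cod2 C \<theta>' = h"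
    using t(1) t'(1) by (auto simp: in_hom_def)
  have "\<theta> \<bullet> \<theta>' = Ide2 C h"
    by (rule retraction_classifier_cell_eqI[OF R, of A _ h h])
      (use tc H H' R' t t' bb in \<open>simp_all add: in_hom_hom_cat\<close>)
  moreover have "\<theta>' \<bullet> \<theta> = Ide2 C h'"
    by (rule retraction_classifier_cell_eqI[OF R, of A _ h' h'])
      (use tc H H' R' t t' bb E in \<open>simp_all add: in_hom_hom_cat\<close>)
  ultimately have "is_inverse (hom_cat C A R) \<theta> \<theta>'" by (intro is_inverse_cellI[OF t(1) t'(1)])
  then show ?thesis using t tc by (auto simp: is_iso_def)
qed

text \<open>Two retractions are glued so that the second arrow of the first is the first arrow of
  the second: \<open>w\<close> followed by \<open>w'\<close>, and \<open>w'\<close> followed by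
  \<open>w''\<close>, are identities. Then \<open>w''\<close> equals \<open>w\<close>, and
  \<open>w\<close> is invertible with inverse \<open>w'\<close>.\<close>

lemma iso_classifier_exists:
  assumes "pita C" "X \<in> Obj C"
  shows "\<exists>I w. iso_classifier C X I w"
proof -
  obtain P ev where P: "arrow_object C X P ev" using assms unfolding pita_def by blast
  note a = arrow_object_hom'[OF P]
  obtain R u v where R: "retraction_classifier C X R u v" using retraction_classifier_exists[OF assms] by blast
  note R' = retraction_classifier_hom[OF R]
  have "in_hom (hom_cat C R X) u (Dom2 C u) (Cod2 C u)" "in_hom (hom_cat C R X) v (Dom2 C v) (Cod2 C v)"
    using R' by (simp_all add: in_hom_hom_cat)
  note l = this[THEN arrow_object_lift[OF P]]
  obtain c where c: "in_hom C c R P" "c \<rhd> univ_cell ev = v" using l(2) by blast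
  obtain e where e: "in_hom C e R P" "e \<rhd> univ_cell ev = u" using l(1) by blast
  have CE: "c \<in> Arr C" "Dom C c = R" "Cod C c = P" "e \<in> Arr C" "Dom C e = R" "Cod C e = P"
    using c e by (auto simp: in_hom_def)
  have "Dom2 C (c \<rhd> univ_cell ev) = c \<cdot> fst ev 0" "Cod2 C (c \<rhd> univ_cell ev) = c \<cdot> fst ev 1"
    "Dom2 C (e \<rhd> univ_cell ev) = e \<cdot> fst ev 0" "Cod2 C (e \<rhd> univ_cell ev) = e \<cdot> fst ev 1"
    using CE a by simp_all
  then have ce: "c \<cdot> fst ev 0 = Cod2 C u" "c \<cdot> fst ev 1 = Dom2 C u" "e \<cdot> fst ev 0 = Dom2 C u" "e \<cdot> fst ev 1 = Cod2 C u"
    unfolding c(2) e(2) using R' by simp_all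
  \<comment> \<open>\<open>c\<close> names \<open>v\<close>, which runs from \<open>Cod2 C u\<close>
    to \<open>Dom2 C u\<close>; hence the two components appear in exchanged order in the
    transport.\<close>
  have "\<exists>a. is_iso (hom_cat C A R) a \<and> Dom2 C a = h \<and> a \<lhd> c = b"
    if h: "in_hom C h A R" and b: "is_iso (hom_cat C A P) b" "Dom2 C b = h \<cdot> c" for A h b
  proof -
    obtain b' where b': "is_inverse (hom_cat C A P) b b'" using b by (auto simp: is_iso_def)
    have H: "h \<in> Arr C" "Dom C h = A" "Cod C h = R" using h by (auto simp: in_hom_def)
    note i = whisker_r_inverse[OF b' arrow_object_hom(3)[OF P]] whisker_r_inverse[OF b' arrow_object_hom(4)[OF P]]
    have B: "b \<in> Cell C" "Cod C (Dom2 C b) = P" "Dom C (Dom2 C b) = A" using b' by (auto simp: inverse_cell_iff)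
    have "Dom2 C (b \<lhd> fst ev 0) = h \<cdot> (c \<cdot> fst ev 0)" "Dom2 C (b \<lhd> fst ev 1) = h \<cdot> (c \<cdot> fst ev 1)"
      using B b H CE a by simp_all
    then obtain \<theta> where t: "is_iso (hom_cat C A R) \<theta>" "Dom2 C \<theta> = h" "\<theta> \<lhd> Dom2 C u = b \<lhd> fst ev 1" "\<theta> \<lhd> Cod2 C u = b \<lhd> fst ev 0"
      using retraction_classifier_transport[OF R h i(2,1)] unfolding ce by blast
    have tc: "\<theta> \<in> Cell C" "Cod C (Dom2 C \<theta>) = R" "Dom C (Dom2 C \<theta>) = A" using t(1) by (auto simp: is_iso_def inverse_cell_iff)
    have e0: "(\<theta> \<lhd> c) \<lhd> fst ev 0 = b \<lhd> fst ev 0" "(\<theta> \<lhd> c) \<lhd> fst ev 1 = b \<lhd> fst ev 1"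
      using whisker_r_comp[of c "fst ev 0" \<theta>] whisker_r_comp[of c "fst ev 1" \<theta>] tc CE a t R' unfolding ce by simp_all
    have "\<theta> \<lhd> c = b"
      by (rule arrow_object_iso_eqI[OF P b(1) _ _ e0]) (use tc CE b(2) t(2) in simp_all)
    then show ?thesis using t by blast
  qed
  then have "isofibration C c"
    using CE by (auto simp: isofibration_def isofibration_functor_def postcomp_def)
  then obtain p q where pq: "strict_pullback C p q c e"
    using assms(1) CE unfolding pita_def by metis
  define I where "I = Dom C p"
  note h = strict_pullback_hom[OF pq, folded I_def]
  have pq': "p \<in> Arr C" "q \<in> Arr C" "Dom C p = I" "Dom C q = I" "Cod C p = R" "Cod C q = R"
    using h CE by (auto simp: in_hom_def)
  have IO: "I \<in> Obj C" using pq' dom_obj by metis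
  define w where "w = p \<rhd> u"
  define w' where "w' = p \<rhd> v"
  define w'' where "w'' = q \<rhd> v"
  have "p \<cdot> (c \<cdot> fst ev 0) = (p \<cdot> c) \<cdot> fst ev 0" "p \<cdot> (c \<cdot> fst ev 1) = (p \<cdot> c) \<cdot> fst ev 1"
    "p \<rhd> (c \<rhd> univ_cell ev) = (p \<cdot> c) \<rhd> univ_cell ev"
    "q \<cdot> (e \<cdot> fst ev 0) = (q \<cdot> e) \<cdot> fst ev 0" "q \<cdot> (e \<cdot> fst ev 1) = (q \<cdot> e) \<cdot> fst ev 1"
    "q \<rhd> (e \<rhd> univ_cell ev) = (q \<cdot> e) \<rhd> univ_cell ev"
    using pq' CE a by simp_all
  then have pe: "p \<cdot> Cod2 C u = q \<cdot> Dom2 C u" "p \<cdot> Dom2 C u = q \<cdot> Cod2 C u" "p \<rhd> v = q \<rhd> u"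
    unfolding ce c(2) e(2) h(3) by simp_all
  have W: "w \<in> Cell C" "w' \<in> Cell C" "Dom2 C w = p \<cdot> Dom2 C u" "Cod2 C w = p \<cdot> Cod2 C u"
    "Dom2 C w' = p \<cdot> Cod2 C u" "Cod2 C w' = p \<cdot> Dom2 C u" "w'' \<in> Cell C" "Dom2 C w'' = p \<cdot> Dom2 C u" "Cod2 C w'' = p \<cdot> Cod2 C u"
    using pq' R' pe by (auto simp: w_def w'_def w''_def)
  have "w \<bullet> w' = p \<rhd> (u \<bullet> v)" unfolding w_def w'_def
    by (rule whisker_l_VComp[symmetric]) (use pq' R' in simp_all)
  moreover have "w' \<bullet> w'' = q \<rhd> (u \<bullet> v)" unfolding w'_def w''_def pe
    by (rule whisker_l_VComp[symmetric]) (use pq' R' in simp_all)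
  ultimately have ww: "w \<bullet> w' = Ide2 C (p \<cdot> Dom2 C u)" "w' \<bullet> w'' = Ide2 C (p \<cdot> Cod2 C u)" using pq' R' pe by simp_all
  \<comment> \<open>\<open>w\<close> and \<open>w''\<close> are inverse to \<open>w'\<close> on
    opposite sides, so they coincide.\<close>
  have "w = w \<bullet> (w' \<bullet> w'')" using W ww(2) by simp
  also have "\<dots> = (w \<bullet> w') \<bullet> w''" using W by simp
  also have "\<dots> = w''" unfolding ww using W by simp
  finally have w'': "w'' = w" by simp
  then have pw: "q \<rhd> v = p \<rhd> u" by (simp add: w_def w''_def)
  have wi: "is_inverse (hom_cat C I X) w w'"
    using W ww pq' R' by (simp add: inverse_cell_iff w'')
  have lift: "\<exists>!h. in_hom C h A I \<and> h \<rhd> w = \<alpha>" if i: "is_iso (hom_cat C A X) \<alpha>" for A \<alpha>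
  proof -
    obtain \<beta> where ab: "is_inverse (hom_cat C A X) \<alpha> \<beta>" using i by (auto simp: is_iso_def)
    have T: "\<alpha> \<in> Arr (hom_cat C A X)" "\<beta> \<in> Arr (hom_cat C A X)" "Cod2 C \<alpha> = Dom2 C \<beta>" "Cod2 C \<beta> = Dom2 C \<alpha>"
      "\<alpha> \<bullet> \<beta> = Ide2 C (Dom2 C \<alpha>)" "\<beta> \<bullet> \<alpha> = Ide2 C (Dom2 C \<beta>)"
      using ab by (auto simp: inverse_cell_iff)
    obtain k where k: "in_hom C k A R" "k \<rhd> u = \<alpha>" "k \<rhd> v = \<beta>" using retraction_classifier_lift[OF R T(1-5)] by blast
    obtain k' where k': "in_hom C k' A R" "k' \<rhd> u = \<beta>" "k' \<rhd> v = \<alpha>"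
      using retraction_classifier_lift[OF R T(2,1) T(4,3) T(6)] by blast
    have K: "k \<in> Arr C" "Dom C k = A" "Cod C k = R" "k' \<in> Arr C" "Dom C k' = A" "Cod C k' = R"
      using k k' by (auto simp: in_hom_def)
    have "(k \<cdot> c) \<rhd> univ_cell ev = k \<rhd> (c \<rhd> univ_cell ev)" "(k' \<cdot> e) \<rhd> univ_cell ev = k' \<rhd> (e \<rhd> univ_cell ev)"
      using K CE a by simp_all
    then have kk: "(k \<cdot> c) \<rhd> univ_cell ev = (k' \<cdot> e) \<rhd> univ_cell ev" unfolding c(2) e(2) k k' by simp
    have kce: "k \<cdot> c = k' \<cdot> e"
      by (rule arrow_object_eqI[OF P _ _ kk, of A]) (use K CE in \<open>auto simp: in_hom_def\<close>)
    have "in_hom C k A (Dom C c)" "in_hom C k' A (Dom C e)" using K CE by (auto simp: in_hom_def)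
    from strict_pullback_lift[OF pq this kce, folded I_def]
    have ex: "\<exists>!h. in_hom C h A I \<and> h \<cdot> p = k \<and> h \<cdot> q = k'" .
    have "h \<rhd> w = \<alpha> \<longleftrightarrow> h \<cdot> p = k \<and> h \<cdot> q = k'" if hh: "in_hom C h A I" for h
    proof -
      have H: "h \<in> Arr C" "Dom C h = A" "Cod C h = I" using hh by (auto simp: in_hom_def)
      have e1: "h \<rhd> w = (h \<cdot> p) \<rhd> u" "h \<rhd> w' = (h \<cdot> p) \<rhd> v" "h \<rhd> w' = (h \<cdot> q) \<rhd> u" "h \<rhd> w = (h \<cdot> q) \<rhd> v"
        using H pq' R' by (simp_all add: w_def w'_def pe pw)
      have hp: "in_hom C (h \<cdot> p) A R" "in_hom C (h \<cdot> q) A R" using H pq' by (simp_all add: in_hom_def)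
      show ?thesis
      proof
        assume hw: "h \<rhd> w = \<alpha>"
        \<comment> \<open>Whiskering preserves inverses and inverses are unique, so the value at
          \<open>w\<close> determines the value at \<open>w'\<close>.\<close>
        have "h \<rhd> w' = \<beta>" using is_inverse_cell_unique[OF ab] whisker_l_inverse[OF wi hh] unfolding hw by blast
        then show "h \<cdot> p = k \<and> h \<cdot> q = k'"
          using hw e1 k k' retraction_classifier_eqI[OF R hp(1) k(1)] retraction_classifier_eqI[OF R hp(2) k'(1)] by metis
      next
        assume "h \<cdot> p = k \<and> h \<cdot> q = k'"
        then show "h \<rhd> w = \<alpha>" using e1 k by metis
      qed
    qed
    with ex show ?thesis by (simp cong: conj_cong)
  qed
  have cell: "\<exists>!\<theta>. in_hom (hom_cat C A I) \<theta> h h' \<and> \<theta> \<lhd> Dom2 C w = t0 \<and> \<theta> \<lhd> Cod2 C w = t1"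
    if hh: "in_hom C h A I" "in_hom C h' A I"
      and t: "in_hom (hom_cat C A X) t0 (h \<cdot> Dom2 C w) (h' \<cdot> Dom2 C w)"
        "in_hom (hom_cat C A X) t1 (h \<cdot> Cod2 C w) (h' \<cdot> Cod2 C w)"
      and n: "(h \<rhd> w) \<bullet> t1 = t0 \<bullet> (h' \<rhd> w)" for A h h' t0 t1
  proof -
    have H: "h \<in> Arr C" "h' \<in> Arr C" "Dom C h = A" "Dom C h' = A" "Cod C h = I" "Cod C h' = I"
      using hh by (auto simp: in_hom_def)
    have t0c: "t0 \<in> Cell C" "Dom2 C t0 = h \<cdot> Dom2 C w" "Cod2 C t0 = h' \<cdot> Dom2 C w"
      "t1 \<in> Cell C" "Dom2 C t1 = h \<cdot> Cod2 C w" "Cod2 C t1 = h' \<cdot> Cod2 C w" using t by (auto simp: in_hom_def)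
    have n': "(h \<rhd> w') \<bullet> t0 = t1 \<bullet> (h' \<rhd> w')"
      by (rule inverse_cell_natural[OF whisker_l_inverse[OF wi hh(1)] whisker_l_inverse[OF wi hh(2)] _ _ n[symmetric], symmetric])
        (use t W H pq' R' in \<open>simp_all add: in_hom_hom_cat\<close>)
    have e1: "(h \<cdot> p) \<rhd> u = h \<rhd> w" "(h \<cdot> p) \<rhd> v = h \<rhd> w'" "(h \<cdot> q) \<rhd> u = h \<rhd> w'" "(h \<cdot> q) \<rhd> v = h \<rhd> w"
       "(h' \<cdot> p) \<rhd> u = h' \<rhd> w" "(h' \<cdot> p) \<rhd> v = h' \<rhd> w'" "(h' \<cdot> q) \<rhd> u = h' \<rhd> w'" "(h' \<cdot> q) \<rhd> v = h' \<rhd> w"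
      using H pq' R' by (simp_all add: w_def w'_def pe pw)
    have hp: "in_hom C (h \<cdot> p) A R" "in_hom C (h' \<cdot> p) A R" "in_hom C (h \<cdot> q) A R" "in_hom C (h' \<cdot> q) A R"
      using H pq' by (auto simp: in_hom_def)
    have tt: "in_hom (hom_cat C A X) t0 ((h \<cdot> p) \<cdot> Dom2 C u) ((h' \<cdot> p) \<cdot> Dom2 C u)"
      "in_hom (hom_cat C A X) t1 ((h \<cdot> p) \<cdot> Cod2 C u) ((h' \<cdot> p) \<cdot> Cod2 C u)"
      "in_hom (hom_cat C A X) t1 ((h \<cdot> q) \<cdot> Dom2 C u) ((h' \<cdot> q) \<cdot> Dom2 C u)"
      "in_hom (hom_cat C A X) t0 ((h \<cdot> q) \<cdot> Cod2 C u) ((h' \<cdot> q) \<cdot> Cod2 C u)"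
      using t H pq' R' W pe by simp_all
    obtain tp where tpp: "in_hom (hom_cat C A R) tp (h \<cdot> p) (h' \<cdot> p)" "tp \<lhd> Dom2 C u = t0" "tp \<lhd> Cod2 C u = t1"
      using retraction_classifier_lift_cell[OF R hp(1,2) tt(1,2), unfolded e1, OF n n'] by blast
    obtain tq where tqq: "in_hom (hom_cat C A R) tq (h \<cdot> q) (h' \<cdot> q)" "tq \<lhd> Dom2 C u = t1" "tq \<lhd> Cod2 C u = t0"
      using retraction_classifier_lift_cell[OF R hp(3,4) tt(3,4), unfolded e1, OF n' n] by blast
    have TP: "tp \<in> Cell C" "Dom2 C tp = h \<cdot> p" "Cod2 C tp = h' \<cdot> p" "tq \<in> Cell C" "Dom2 C tq = h \<cdot> q" "Cod2 C tq = h' \<cdot> q"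
      using tpp(1) tqq(1) by (auto simp: in_hom_def)
    have "tp \<lhd> c = tq \<lhd> e"
    proof (rule arrow_object_cell_eqI[OF P, of A _ "h \<cdot> (p \<cdot> c)" "h' \<cdot> (p \<cdot> c)"])
      show "in_hom (hom_cat C A P) (tp \<lhd> c) (h \<cdot> (p \<cdot> c)) (h' \<cdot> (p \<cdot> c))" using TP H pq' CE by (simp add: in_hom_hom_cat)
      show "in_hom (hom_cat C A P) (tq \<lhd> e) (h \<cdot> (p \<cdot> c)) (h' \<cdot> (p \<cdot> c))" unfolding h(3) using TP H pq' CE by (simp add: in_hom_hom_cat)
      have "(tp \<lhd> c) \<lhd> fst ev 0 = tp \<lhd> (c \<cdot> fst ev 0)" "(tp \<lhd> c) \<lhd> fst ev 1 = tp \<lhd> (c \<cdot> fst ev 1)"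
        "(tq \<lhd> e) \<lhd> fst ev 0 = tq \<lhd> (e \<cdot> fst ev 0)" "(tq \<lhd> e) \<lhd> fst ev 1 = tq \<lhd> (e \<cdot> fst ev 1)"
        using TP H pq' CE a by simp_all
      then show "(tp \<lhd> c) \<lhd> fst ev 0 = (tq \<lhd> e) \<lhd> fst ev 0" "(tp \<lhd> c) \<lhd> fst ev 1 = (tq \<lhd> e) \<lhd> fst ev 1"
        unfolding ce using tpp tqq by simp_all
    qed
    moreover have "in_hom C h A (Dom C p)" "in_hom C h' A (Dom C p)" "in_hom (hom_cat C A (Dom C c)) tp (h \<cdot> p) (h' \<cdot> p)"
      "in_hom (hom_cat C A (Dom C e)) tq (h \<cdot> q) (h' \<cdot> q)" using H tpp tqq CE pq' by (auto simp: in_hom_def)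
    ultimately have ex: "\<exists>!\<theta>. in_hom (hom_cat C A I) \<theta> h h' \<and> \<theta> \<lhd> p = tp \<and> \<theta> \<lhd> q = tq"
      using strict_pullback_lift_cell[OF pq] pq' by metis
    moreover have "\<theta> \<lhd> p = tp \<and> \<theta> \<lhd> q = tq \<longleftrightarrow> \<theta> \<lhd> Dom2 C w = t0 \<and> \<theta> \<lhd> Cod2 C w = t1"
      if th: "in_hom (hom_cat C A I) \<theta> h h'" for \<theta>
    proof -
      have thc: "\<theta> \<in> Cell C" "Dom2 C \<theta> = h" "Cod2 C \<theta> = h'" using th by (auto simp: in_hom_def)
      have ww: "(\<theta> \<lhd> p) \<lhd> Dom2 C u = \<theta> \<lhd> (p \<cdot> Dom2 C u)" "(\<theta> \<lhd> p) \<lhd> Cod2 C u = \<theta> \<lhd> (p \<cdot> Cod2 C u)"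
        "(\<theta> \<lhd> q) \<lhd> Dom2 C u = \<theta> \<lhd> (q \<cdot> Dom2 C u)" "(\<theta> \<lhd> q) \<lhd> Cod2 C u = \<theta> \<lhd> (q \<cdot> Cod2 C u)"
        using thc H pq' R' by simp_all
      have "in_hom (hom_cat C A R) (\<theta> \<lhd> p) (h \<cdot> p) (h' \<cdot> p)" "in_hom (hom_cat C A R) (\<theta> \<lhd> q) (h \<cdot> q) (h' \<cdot> q)"
        using thc H pq' by (auto simp: in_hom_def)
      note eqI = retraction_classifier_cell_eqI[OF R this(1) tpp(1)] retraction_classifier_cell_eqI[OF R this(2) tqq(1)]
      show ?thesis using eqI ww tpp(2-) tqq(2-) unfolding W pe by metis
    qed
    ultimately show ?thesis by (simp cong: conj_cong)
  qed
  have "w \<in> Arr (hom_cat C I X)" "is_iso (hom_cat C I X) w" using wi by (auto simp: is_iso_def inverse_cell_iff)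
  then have "iso_classifier C X I w"
    unfolding iso_classifier_def
    apply (intro conjI allI impI)
    subgoal by (rule assms(2))
    subgoal by (rule IO)
    subgoal by blast
    subgoal by blast
    subgoal using lift by blast
    subgoal using cell by blast
    done
  then show ?thesis by blast
qed

lemma iso_classifier_lift:
  assumes "iso_classifier C X I w" "is_iso (hom_cat C A X) \<alpha>"
  shows "\<exists>!h. in_hom C h A I \<and> h \<rhd> w = \<alpha>"
  using assms unfolding iso_classifier_def by blast

lemma iso_classifier_lift_cell:
  assumes "iso_classifier C X I w" "in_hom C h A I" "in_hom C h' A I"
    "in_hom (hom_cat C A X) t0 (h \<cdot> Dom2 C w) (h' \<cdot> Dom2 C w)"
    "in_hom (hom_cat C A X) t1 (h \<cdot> Cod2 C w) (h' \<cdot> Cod2 C w)"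
    "(h \<rhd> w) \<bullet> t1 = t0 \<bullet> (h' \<rhd> w)"
  shows "\<exists>!\<theta>. in_hom (hom_cat C A I) \<theta> h h' \<and> \<theta> \<lhd> Dom2 C w = t0 \<and> \<theta> \<lhd> Cod2 C w = t1"
  using assms unfolding iso_classifier_def by blast

lemma iso_classifier_hom:
  assumes "iso_classifier C X I w"
  shows "X \<in> Obj C" "I \<in> Obj C" "w \<in> Cell C" "Dom C (Dom2 C w) = I" "Cod C (Dom2 C w) = X"
    "is_iso (hom_cat C I X) w"
proof -
  have "X \<in> Obj C \<and> I \<in> Obj C \<and> w \<in> Arr (hom_cat C I X) \<and> is_iso (hom_cat C I X) w"
    using assms unfolding iso_classifier_def by blast
  then show "X \<in> Obj C" "I \<in> Obj C" "w \<in> Cell C" "Dom C (Dom2 C w) = I" "Cod C (Dom2 C w) = X"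
    "is_iso (hom_cat C I X) w" by auto
qed

text \<open>An isomorphism out of the codomain can be composed onto the classified one, with the
  domain left unchanged. This permits the pullback that forces the codomain to be a restriction of
  the internal product.\<close>

lemma isofibration_iso_classifier_cod:
  assumes I: "iso_classifier C X I w"
  shows "isofibration C (Cod2 C w)"
proof -
  note w = iso_classifier_hom[OF I]
  have "\<exists>a. is_iso (hom_cat C A I) a \<and> Dom2 C a = h \<and> a \<lhd> Cod2 C w = b"
    if h: "in_hom C h A I" and b: "is_iso (hom_cat C A X) b" "Dom2 C b = h \<cdot> Cod2 C w" for A h b
  proof -
    have H: "h \<in> Arr C" "Dom C h = A" "Cod C h = I" using h by (auto simp: in_hom_def)
    have AO: "A \<in> Obj C" using in_homD[OF h] by blast
    interpret A: category "hom_cat C A X" by (rule hom_category[OF AO w(1)])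
    obtain b' where b': "is_inverse (hom_cat C A X) b b'" using b by (auto simp: is_iso_def)
    obtain w' where w': "is_inverse (hom_cat C I X) w w'" using w by (auto simp: is_iso_def)
    have B: "b \<in> Cell C" "b' \<in> Cell C" "Dom2 C b' = Cod2 C b" "Cod2 C b' = h \<cdot> Cod2 C w" "Dom C (Cod2 C b) = A" "Cod C (Cod2 C b) = X"
      "b \<bullet> b' = Ide2 C (h \<cdot> Cod2 C w)" "b' \<bullet> b = Ide2 C (Cod2 C b)"
      using b' b by (auto simp: inverse_cell_iff)
    have "is_iso (hom_cat C A X) ((h \<rhd> w) \<bullet> b)"
      using A.is_inverse_comp[OF whisker_l_inverse[OF w' h] b'] b H w by (auto simp: is_iso_def)
    from iso_classifier_lift[OF I this] obtain h' where h': "in_hom C h' A I" "h' \<rhd> w = (h \<rhd> w) \<bullet> b" by blast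
    have H': "h' \<in> Arr C" "Dom C h' = A" "Cod C h' = I" using h' by (auto simp: in_hom_def)
    have "Dom2 C (h' \<rhd> w) = h' \<cdot> Dom2 C w" "Cod2 C (h' \<rhd> w) = h' \<cdot> Cod2 C w" using H' w by simp_all
    then have E: "h' \<cdot> Dom2 C w = h \<cdot> Dom2 C w" "h' \<cdot> Cod2 C w = Cod2 C b" unfolding h'(2) using H w B b(2) by simp_all
    have t: "in_hom (hom_cat C A X) (Ide2 C (h \<cdot> Dom2 C w)) (h \<cdot> Dom2 C w) (h' \<cdot> Dom2 C w)"
      "in_hom (hom_cat C A X) b (h \<cdot> Cod2 C w) (h' \<cdot> Cod2 C w)"
      "in_hom (hom_cat C A X) (Ide2 C (h \<cdot> Dom2 C w)) (h' \<cdot> Dom2 C w) (h \<cdot> Dom2 C w)"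
      "in_hom (hom_cat C A X) b' (h' \<cdot> Cod2 C w) (h \<cdot> Cod2 C w)"
      unfolding E using H w B b(2) by (simp_all add: in_hom_hom_cat)
    have n: "(h \<rhd> w) \<bullet> b = Ide2 C (h \<cdot> Dom2 C w) \<bullet> (h' \<rhd> w)" "(h' \<rhd> w) \<bullet> b' = Ide2 C (h \<cdot> Dom2 C w) \<bullet> (h \<rhd> w)"
      unfolding h'(2) using H w B b(2) by simp_all
    obtain \<theta> where th: "in_hom (hom_cat C A I) \<theta> h h'" "\<theta> \<lhd> Dom2 C w = Ide2 C (h \<cdot> Dom2 C w)" "\<theta> \<lhd> Cod2 C w = b"
      using iso_classifier_lift_cell[OF I h h'(1) t(1,2) n(1)] by blast
    obtain \<theta>' where th': "in_hom (hom_cat C A I) \<theta>' h' h" "\<theta>' \<lhd> Dom2 C w = Ide2 C (h \<cdot> Dom2 C w)" "\<theta>' \<lhd> Cod2 C w = b'"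
      using iso_classifier_lift_cell[OF I h'(1) h t(3,4) n(2)] by blast
    have tc: "\<theta> \<in> Cell C" "Dom2 C \<theta> = h" "Cod2 C \<theta> = h'" "\<theta>' \<in> Cell C" "Dom2 C \<theta>' = h'" "Cod2 C \<theta>' = h"
      using th(1) th'(1) by (auto simp: in_hom_def)
    have one: "x = Ide2 C k" if k: "in_hom C k A I" and x: "in_hom (hom_cat C A I) x k k"
      "x \<lhd> Dom2 C w = Ide2 C (k \<cdot> Dom2 C w)" "x \<lhd> Cod2 C w = Ide2 C (k \<cdot> Cod2 C w)" for x k
    proof -
      have K: "k \<in> Arr C" "Dom C k = A" "Cod C k = I" using k by (auto simp: in_hom_def)
      have "in_hom (hom_cat C A X) (Ide2 C (k \<cdot> Dom2 C w)) (k \<cdot> Dom2 C w) (k \<cdot> Dom2 C w)"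
        "in_hom (hom_cat C A X) (Ide2 C (k \<cdot> Cod2 C w)) (k \<cdot> Cod2 C w) (k \<cdot> Cod2 C w)"
        "(k \<rhd> w) \<bullet> Ide2 C (k \<cdot> Cod2 C w) = Ide2 C (k \<cdot> Dom2 C w) \<bullet> (k \<rhd> w)"
        "in_hom (hom_cat C A I) (Ide2 C k) k k" "Ide2 C k \<lhd> Dom2 C w = Ide2 C (k \<cdot> Dom2 C w)" "Ide2 C k \<lhd> Cod2 C w = Ide2 C (k \<cdot> Cod2 C w)"
        using K w by (simp_all add: in_hom_hom_cat)
      then show ?thesis using iso_classifier_lift_cell[OF I k k] x by blast
    qed
    have "\<theta> \<bullet> \<theta>' = Ide2 C h"
      by (rule one[OF h]) (use tc th(2,3) th'(2,3) H H' w B b(2) in \<open>simp_all add: in_hom_hom_cat\<close>)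
    moreover have "\<theta>' \<bullet> \<theta> = Ide2 C h'"
      by (rule one[OF h'(1)]) (use tc th(2,3) th'(2,3) H H' w B b(2) E in \<open>simp_all add: in_hom_hom_cat\<close>)
    ultimately have "is_inverse (hom_cat C A I) \<theta> \<theta>'" by (intro is_inverse_cellI[OF th(1) th'(1)])
    then show ?thesis using th tc by (auto simp: is_iso_def)
  qed
  then show ?thesis using w by (simp add: isofibration_def isofibration_functor_def postcomp_def)
qed

end

subsection \<open>The object of exponential-shaped diagrams\<close>

lemma ball_L_cat:
  "(\<forall>j \<in> Obj L_cat. Q j) \<longleftrightarrow> Q 0 \<and> Q 1 \<and> Q 2 \<and> Q 3"
  "(\<forall>u \<in> Arr L_cat. R u) \<longleftrightarrow> R (0, 0) \<and> R (1, 1) \<and> R (2, 2) \<and> R (3, 3) \<and> R (3, 0) \<and> R (3, 1) \<and> R (3, 2)"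
proof -
  have j: "j \<le> 3 \<longleftrightarrow> j = 0 \<or> j = 1 \<or> j = 2 \<or> j = (3::nat)" for j by auto
  have "Obj L_cat = {0, 1, 2, 3}" "Arr L_cat = {(0, 0), (1, 1), (2, 2), (3, 3), (3, 0), (3, 1), (3, 2)}"
    by (auto simp: L_cat_def j simp del: One_nat_def)
  then show "(\<forall>j \<in> Obj L_cat. Q j) \<longleftrightarrow> Q 0 \<and> Q 1 \<and> Q 2 \<and> Q 3"
    "(\<forall>u \<in> Arr L_cat. R u) \<longleftrightarrow> R (0, 0) \<and> R (1, 1) \<and> R (2, 2) \<and> R (3, 3) \<and> R (3, 0) \<and> R (3, 1) \<and> R (3, 2)"
    by auto
qed

lemma L_cat_simps [simp]:
  "Obj L_cat = {0..3}" "Arr L_cat = {(i, j). i \<le> 3 \<and> j \<le> 3 \<and> (i = j \<or> i = 3)}"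
  "Dom L_cat = fst" "Cod L_cat = snd" "Ide L_cat = (\<lambda>i. (i, i))" "Comp L_cat = (\<lambda>u v. (fst u, snd v))"
  by (auto simp: L_cat_def)

context two_category
begin

text \<open>A diagram whose legs to 2 and 0 form a product is the same as a pair \<open>d\<close>
  into \<open>S\<close>, an isomorphism from the vertex 3 onto \<open>d \<cdot> m\<close>, and an
  arbitrary arrow out of the vertex 3. These data are collected by two pullbacks, using the
  classifier of isomorphisms and the arrow object.\<close>

lemma L_object_exists:
  assumes pita: "pita C" and S: "strict_product C X X S s t"
    and A: "in_hom (hom_cat C S X) \<pi> m s" and B: "in_hom (hom_cat C S X) \<pi>' m t"
    and prod: "\<And>Y f. in_hom C f Y S \<Longrightarrow> product_diagram (hom_cat C Y X) (f \<rhd> \<pi>) (f \<rhd> \<pi>')"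
  shows "\<exists>L ev. L_object C X L ev"
proof -
  have st: "s \<in> Arr C" "t \<in> Arr C" "Dom C s = S" "Dom C t = S" "Cod C s = X" "Cod C t = X"
    using strict_product_hom[OF S] by (auto simp: in_hom_def)
  have SO: "S \<in> Obj C" "X \<in> Obj C" using st dom_obj cod_obj by metis+
  have pp: "\<pi> \<in> Cell C" "\<pi>' \<in> Cell C" "Dom2 C \<pi> = m" "Dom2 C \<pi>' = m" "Cod2 C \<pi> = s" "Cod2 C \<pi>' = t"
    "m \<in> Arr C" "Dom C m = S" "Cod C m = X"
    using A B Dom2_in_Arr unfolding in_hom_hom_cat by auto
  obtain E ev1 where E: "arrow_object C X E ev1" using pita SO unfolding pita_def by blast
  note a = arrow_object_hom'[OF E]
  obtain I w where I: "iso_classifier C X I w" using iso_classifier_exists[OF pita SO(2)] by blast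
  note w = iso_classifier_hom[OF I]
  \<comment> \<open>First pullback: an isomorphism whose codomain is the internal product of the
    pair picked by \<open>q1\<close>.\<close>
  obtain p1 q1 where pb1: "strict_pullback C p1 q1 (Cod2 C w) m"
    using pita isofibration_iso_classifier_cod[OF I] pp w unfolding pita_def by (metis Cod_Cod2)
  define L1 where "L1 = Dom C p1"
  have h1: "p1 \<in> Arr C" "q1 \<in> Arr C" "Dom C p1 = L1" "Dom C q1 = L1" "Cod C p1 = I" "Cod C q1 = S"
    "p1 \<cdot> Cod2 C w = q1 \<cdot> m"
    using strict_pullback_hom[OF pb1, folded L1_def] w pp by (auto simp: in_hom_def)
  have "p1 \<cdot> Dom2 C w \<in> Arr C" "Cod C (p1 \<cdot> Dom2 C w) = Cod C (fst ev1 0)" using h1 w a by simp_all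
  \<comment> \<open>Second pullback: an arrow starting at the domain of that isomorphism; it becomes
    the edge from 3 to 1.\<close>
  then obtain p2 q2 where pb2: "strict_pullback C p2 q2 (fst ev1 0) (p1 \<cdot> Dom2 C w)"
    using pita isofibration_arrow_dom[OF E] unfolding pita_def by metis
  define L where "L = Dom C p2"
  have h2: "p2 \<in> Arr C" "q2 \<in> Arr C" "Dom C p2 = L" "Dom C q2 = L" "Cod C p2 = E" "Cod C q2 = L1"
    "p2 \<cdot> fst ev1 0 = q2 \<cdot> (p1 \<cdot> Dom2 C w)"
    using strict_pullback_hom[OF pb2, folded L_def] h1 w a by (auto simp: in_hom_def)
  have LO: "L \<in> Obj C" using h2 dom_obj by metis
  \<comment> \<open>Universal data over \<open>L\<close>: the isomorphism \<open>W\<close>, the pair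
    \<open>D\<close> and the additional arrow \<open>e\<close>.\<close>
  define W where "W = q2 \<rhd> (p1 \<rhd> w)"
  define D where "D = q2 \<cdot> q1"
  define e where "e = p2 \<rhd> univ_cell ev1"
  define x3 where "x3 = Dom2 C W"
  define x1 where "x1 = Cod2 C e"
  have q2p1: "q2 \<cdot> (p1 \<cdot> Cod2 C w) = D \<cdot> m" unfolding h1(7) D_def using h1 h2 pp by simp
  have T: "D \<in> Arr C" "Dom C D = L" "Cod C D = S" "W \<in> Cell C" "Dom2 C W = x3" "Cod2 C W = D \<cdot> m"
    "e \<in> Cell C" "Dom2 C e = x3" "Cod2 C e = x1" "x3 \<in> Arr C" "x1 \<in> Arr C" "Dom C x3 = L" "Cod C x3 = X" "Dom C x1 = L" "Cod C x1 = X"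
    "x3 = q2 \<cdot> (p1 \<cdot> Dom2 C w)" "x1 = p2 \<cdot> fst ev1 1"
    using h1 h2 w a pp q2p1 by (simp_all add: D_def W_def e_def x3_def x1_def)
  obtain w' where w': "is_inverse (hom_cat C I X) w w'" using w by (auto simp: is_iso_def)
  have "in_hom C p1 L1 I" "in_hom C q2 L L1" using h1 h2 by (auto simp: in_hom_def)
  from whisker_l_inverse[OF whisker_l_inverse[OF w' this(1)] this(2)]
  obtain W' where W': "is_inverse (hom_cat C L X) W W'" unfolding W_def by blast
  have lift: "\<exists>!h. in_hom C h A L \<and> h \<cdot> D = d \<and> h \<rhd> W = \<phi> \<and> h \<rhd> e = \<epsilon>"
    if d: "in_hom C d A S" and \<phi>: "is_iso (hom_cat C A X) \<phi>" "Cod2 C \<phi> = d \<cdot> m"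
      and \<epsilon>: "\<epsilon> \<in> Arr (hom_cat C A X)" "Dom2 C \<epsilon> = Dom2 C \<phi>" for A d \<phi> \<epsilon>
  proof -
    have dT: "d \<in> Arr C" "Dom C d = A" "Cod C d = S" using d by (auto simp: in_hom_def)
    obtain k where k: "in_hom C k A I" "k \<rhd> w = \<phi>" using iso_classifier_lift[OF I \<phi>(1)] by blast
    have K: "k \<in> Arr C" "Dom C k = A" "Cod C k = I" using k by (auto simp: in_hom_def)
    have kw: "k \<cdot> Dom2 C w = Dom2 C \<phi>" "k \<cdot> Cod2 C w = Cod2 C \<phi>" using k(2)[symmetric] K w by simp_all
    have kd: "k \<cdot> Cod2 C w = d \<cdot> m" using kw \<phi> by simp
    have "in_hom C k A (Dom C (Cod2 C w))" "in_hom C d A (Dom C m)" using k d w pp by simp_all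
    from strict_pullback_lift[OF pb1 this kd, folded L1_def]
    obtain l where l: "in_hom C l A L1" "l \<cdot> p1 = k" "l \<cdot> q1 = d" by blast
    have lT: "l \<in> Arr C" "Dom C l = A" "Cod C l = L1" using l by (auto simp: in_hom_def)
    have "in_hom (hom_cat C A X) \<epsilon> (Dom2 C \<epsilon>) (Cod2 C \<epsilon>)" using \<epsilon> by (auto simp: in_hom_def)
    from arrow_object_lift[OF E this] obtain k' where k': "in_hom C k' A E" "k' \<rhd> univ_cell ev1 = \<epsilon>" by blast
    have K': "k' \<in> Arr C" "Dom C k' = A" "Cod C k' = E" using k' by (auto simp: in_hom_def)
    have "Dom2 C (k' \<rhd> univ_cell ev1) = k' \<cdot> fst ev1 0" using K' a by simp
    then have kd': "k' \<cdot> fst ev1 0 = l \<cdot> (p1 \<cdot> Dom2 C w)"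
      using \<epsilon>(2) kw(1) comp_assoc'[of l p1 "Dom2 C w"] lT h1 w unfolding k'(2) l(2)[symmetric] by simp
    have "in_hom C k' A (Dom C (fst ev1 0))" "in_hom C l A (Dom C (p1 \<cdot> Dom2 C w))" using k' l a h1 w by simp_all
    from strict_pullback_lift[OF pb2 this kd', folded L_def]
    have ex: "\<exists>!h. in_hom C h A L \<and> h \<cdot> p2 = k' \<and> h \<cdot> q2 = l" .
    have "h \<cdot> D = d \<and> h \<rhd> W = \<phi> \<and> h \<rhd> e = \<epsilon> \<longleftrightarrow> h \<cdot> p2 = k' \<and> h \<cdot> q2 = l" if hh: "in_hom C h A L" for h
    proof -
      have H: "h \<in> Arr C" "Dom C h = A" "Cod C h = L" using hh by (auto simp: in_hom_def)
      have e1: "h \<rhd> e = (h \<cdot> p2) \<rhd> univ_cell ev1" "h \<rhd> W = ((h \<cdot> q2) \<cdot> p1) \<rhd> w" "h \<cdot> D = (h \<cdot> q2) \<cdot> q1"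
        using H h1 h2 a w by (auto simp: e_def W_def D_def)
      have hp: "in_hom C (h \<cdot> p2) A E" "in_hom C (h \<cdot> q2) A L1" "in_hom C ((h \<cdot> q2) \<cdot> p1) A I"
        using H h1 h2 by (auto simp: in_hom_def)
      show ?thesis unfolding e1
      proof (intro iffI)
        assume as: "(h \<cdot> q2) \<cdot> q1 = d \<and> ((h \<cdot> q2) \<cdot> p1) \<rhd> w = \<phi> \<and> (h \<cdot> p2) \<rhd> univ_cell ev1 = \<epsilon>"
        then have "h \<cdot> p2 = k'" using arrow_object_eqI[OF E hp(1) k'(1)] k' by simp
        moreover have "(h \<cdot> q2) \<cdot> p1 = k" using as iso_classifier_lift[OF I \<phi>(1)] hp(3) k by blast
        then have "h \<cdot> q2 = l"
          by (intro strict_pullback_eqI[OF pb1, folded L1_def, OF hp(2) l(1)]) (simp_all add: as l)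
        ultimately show "h \<cdot> p2 = k' \<and> h \<cdot> q2 = l" by blast
      next
        assume "h \<cdot> p2 = k' \<and> h \<cdot> q2 = l"
        then show "(h \<cdot> q2) \<cdot> q1 = d \<and> ((h \<cdot> q2) \<cdot> p1) \<rhd> w = \<phi> \<and> (h \<cdot> p2) \<rhd> univ_cell ev1 = \<epsilon>"
          using l k k' by simp
      qed
    qed
    with ex show ?thesis by (simp cong: conj_cong)
  qed
  have cell: "\<exists>!\<theta>. in_hom (hom_cat C A L) \<theta> h h' \<and> \<theta> \<lhd> D = \<delta> \<and> \<theta> \<lhd> x3 = t3 \<and> \<theta> \<lhd> x1 = t1"
    if hh: "in_hom C h A L" "in_hom C h' A L"
      and tt: "in_hom (hom_cat C A S) \<delta> (h \<cdot> D) (h' \<cdot> D)" "in_hom (hom_cat C A X) t3 (h \<cdot> x3) (h' \<cdot> x3)"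
        "in_hom (hom_cat C A X) t1 (h \<cdot> x1) (h' \<cdot> x1)"
      and n: "(h \<rhd> W) \<bullet> (\<delta> \<lhd> m) = t3 \<bullet> (h' \<rhd> W)" "(h \<rhd> e) \<bullet> t1 = t3 \<bullet> (h' \<rhd> e)" for A h h' \<delta> t3 t1
  proof -
    have H: "h \<in> Arr C" "h' \<in> Arr C" "Dom C h = A" "Dom C h' = A" "Cod C h = L" "Cod C h' = L"
      using hh by (auto simp: in_hom_def)
    have dc: "\<delta> \<in> Cell C" "Dom2 C \<delta> = h \<cdot> D" "Cod2 C \<delta> = h' \<cdot> D" using tt by (auto simp: in_hom_def)
    have hp: "in_hom C (h \<cdot> p2) A E" "in_hom C (h' \<cdot> p2) A E" "in_hom C (h \<cdot> q2) A L1" "in_hom C (h' \<cdot> q2) A L1"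
      "in_hom C ((h \<cdot> q2) \<cdot> p1) A I" "in_hom C ((h' \<cdot> q2) \<cdot> p1) A I"
      using H h1 h2 by (auto simp: in_hom_def)
    have x3: "p2 \<cdot> fst ev1 0 = x3" using h2 T by simp
    have te: "in_hom (hom_cat C A X) t3 ((h \<cdot> p2) \<cdot> fst ev1 0) ((h' \<cdot> p2) \<cdot> fst ev1 0)"
      "in_hom (hom_cat C A X) t1 ((h \<cdot> p2) \<cdot> fst ev1 1) ((h' \<cdot> p2) \<cdot> fst ev1 1)"
      "((h \<cdot> p2) \<rhd> univ_cell ev1) \<bullet> t1 = t3 \<bullet> ((h' \<cdot> p2) \<rhd> univ_cell ev1)"
      using tt n(2) H h2 a T by (simp_all add: e_def)
    have tw: "in_hom (hom_cat C A X) t3 (((h \<cdot> q2) \<cdot> p1) \<cdot> Dom2 C w) (((h' \<cdot> q2) \<cdot> p1) \<cdot> Dom2 C w)"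
      "in_hom (hom_cat C A X) (\<delta> \<lhd> m) (((h \<cdot> q2) \<cdot> p1) \<cdot> Cod2 C w) (((h' \<cdot> q2) \<cdot> p1) \<cdot> Cod2 C w)"
      "(((h \<cdot> q2) \<cdot> p1) \<rhd> w) \<bullet> (\<delta> \<lhd> m) = t3 \<bullet> (((h' \<cdot> q2) \<cdot> p1) \<rhd> w)"
      using tt n(1) H h2 h1(1-6) w T(1-15) pp dc q2p1 by (simp_all add: W_def T(16) in_hom_hom_cat)
    obtain te where tee: "in_hom (hom_cat C A E) te (h \<cdot> p2) (h' \<cdot> p2)" "te \<lhd> fst ev1 0 = t3" "te \<lhd> fst ev1 1 = t1"
      using arrow_object_lift_cell[OF E hp(1,2) te] by blast
    obtain tw where tww: "in_hom (hom_cat C A I) tw ((h \<cdot> q2) \<cdot> p1) ((h' \<cdot> q2) \<cdot> p1)" "tw \<lhd> Dom2 C w = t3" "tw \<lhd> Cod2 C w = \<delta> \<lhd> m"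
      using iso_classifier_lift_cell[OF I hp(5,6) tw] by blast
    have pr1: "in_hom (hom_cat C A (Dom C (Cod2 C w))) tw ((h \<cdot> q2) \<cdot> p1) ((h' \<cdot> q2) \<cdot> p1)"
      "in_hom (hom_cat C A (Dom C m)) \<delta> ((h \<cdot> q2) \<cdot> q1) ((h' \<cdot> q2) \<cdot> q1)"
      using tww(1) tt(1) w pp H h2(1-6) h1(1-6) by (simp_all add: D_def)
    note ex1 = strict_pullback_lift_cell[OF pb1, folded L1_def, OF hp(3,4) pr1 tww(3)]
    obtain tl where tl: "in_hom (hom_cat C A L1) tl (h \<cdot> q2) (h' \<cdot> q2)" "tl \<lhd> p1 = tw" "tl \<lhd> q1 = \<delta>"
      using ex1 by blast
    have tlT: "tl \<in> Cell C" "Dom2 C tl = h \<cdot> q2" "Cod2 C tl = h' \<cdot> q2" using tl by (auto simp: in_hom_def)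
    have "tl \<lhd> (p1 \<cdot> Dom2 C w) = (tl \<lhd> p1) \<lhd> Dom2 C w" using tlT H h1(1-6) h2(1-6) w by simp
    then have pr2: "te \<lhd> fst ev1 0 = tl \<lhd> (p1 \<cdot> Dom2 C w)" by (simp only: tl tww tee)
    have pr3: "in_hom (hom_cat C A (Dom C (fst ev1 0))) te (h \<cdot> p2) (h' \<cdot> p2)"
      "in_hom (hom_cat C A (Dom C (p1 \<cdot> Dom2 C w))) tl (h \<cdot> q2) (h' \<cdot> q2)"
      using tee(1) tl(1) a h1(1-6) w by simp_all
    note ex = strict_pullback_lift_cell[OF pb2, folded L_def, OF hh pr3 pr2]
    moreover have "\<theta> \<lhd> p2 = te \<and> \<theta> \<lhd> q2 = tl \<longleftrightarrow> \<theta> \<lhd> D = \<delta> \<and> \<theta> \<lhd> x3 = t3 \<and> \<theta> \<lhd> x1 = t1"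
      if th: "in_hom (hom_cat C A L) \<theta> h h'" for \<theta>
    proof -
      have thc: "\<theta> \<in> Cell C" "Dom2 C \<theta> = h" "Cod2 C \<theta> = h'" using th by (auto simp: in_hom_def)
      have ww: "(\<theta> \<lhd> p2) \<lhd> fst ev1 0 = \<theta> \<lhd> x3" "(\<theta> \<lhd> p2) \<lhd> fst ev1 1 = \<theta> \<lhd> x1"
        "(\<theta> \<lhd> q2) \<lhd> q1 = \<theta> \<lhd> D" "((\<theta> \<lhd> q2) \<lhd> p1) \<lhd> Dom2 C w = \<theta> \<lhd> x3"
        "((\<theta> \<lhd> q2) \<lhd> p1) \<lhd> Cod2 C w = ((\<theta> \<lhd> q2) \<lhd> q1) \<lhd> m"
      proof -
        show "(\<theta> \<lhd> p2) \<lhd> fst ev1 0 = \<theta> \<lhd> x3" "(\<theta> \<lhd> p2) \<lhd> fst ev1 1 = \<theta> \<lhd> x1"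
          unfolding x3[symmetric] T(17) using thc H h2(1-6) a by simp_all
        show "(\<theta> \<lhd> q2) \<lhd> q1 = \<theta> \<lhd> D" unfolding D_def using thc H h2 h1 by simp
        show "((\<theta> \<lhd> q2) \<lhd> p1) \<lhd> Dom2 C w = \<theta> \<lhd> x3" unfolding T(16) using thc H h2(1-6) h1 w by simp
        have "((\<theta> \<lhd> q2) \<lhd> p1) \<lhd> Cod2 C w = (\<theta> \<lhd> q2) \<lhd> (p1 \<cdot> Cod2 C w)"
           using thc H h2(1-6) h1(1-6) w by simp
        also have "\<dots> = ((\<theta> \<lhd> q2) \<lhd> q1) \<lhd> m" unfolding h1(7) using thc H h2(1-6) h1(1-6) pp by simp
        finally show "((\<theta> \<lhd> q2) \<lhd> p1) \<lhd> Cod2 C w = ((\<theta> \<lhd> q2) \<lhd> q1) \<lhd> m" .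
      qed
      have hq: "in_hom (hom_cat C A E) (\<theta> \<lhd> p2) (h \<cdot> p2) (h' \<cdot> p2)" "in_hom (hom_cat C A L1) (\<theta> \<lhd> q2) (h \<cdot> q2) (h' \<cdot> q2)"
        "in_hom (hom_cat C A I) ((\<theta> \<lhd> q2) \<lhd> p1) ((h \<cdot> q2) \<cdot> p1) ((h' \<cdot> q2) \<cdot> p1)"
        using thc H h1 h2 by (auto simp: in_hom_hom_cat)
      show ?thesis
      proof (intro iffI)
        assume as: "\<theta> \<lhd> D = \<delta> \<and> \<theta> \<lhd> x3 = t3 \<and> \<theta> \<lhd> x1 = t1"
        have "\<theta> \<lhd> p2 = te"
          by (rule arrow_object_cell_eqI[OF E hq(1) tee(1)]) (simp_all only: ww tee as)
        moreover have "(\<theta> \<lhd> q2) \<lhd> p1 = tw"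
          using iso_classifier_lift_cell[OF I hp(5,6) tw] hq(3) tww ww(3-5) as by metis
        ultimately show "\<theta> \<lhd> p2 = te \<and> \<theta> \<lhd> q2 = tl" using ex1 hq(2) ww(3) as tl by metis
      next
        assume as: "\<theta> \<lhd> p2 = te \<and> \<theta> \<lhd> q2 = tl"
        show "\<theta> \<lhd> D = \<delta> \<and> \<theta> \<lhd> x3 = t3 \<and> \<theta> \<lhd> x1 = t1"
          unfolding ww(1-3)[symmetric] using as tee tl by simp
      qed
    qed
    ultimately show ?thesis by (simp cong: conj_cong)
  qed
  \<comment> \<open>Here \<open>s\<close> gives the vertex 2 and \<open>t\<close> the vertex 0, and
    the legs are the projections transported along \<open>W\<close>. In
    \<open>exponential_morphism\<close> the object \<open>S\<close> instead pairs the vertices 0 and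
    1.\<close>
  define ev :: "(nat, nat \<times> nat, 'm, 'c) fctr" where
    "ev = (\<lambda>j. if j = 0 then D \<cdot> t else if j = 1 then x1 else if j = 2 then D \<cdot> s else x3,
        \<lambda>(i, j). if i = j then Ide2 C (if j = 0 then D \<cdot> t else if j = 1 then x1 else if j = 2 then D \<cdot> s else x3)
           else if j = 0 then W \<bullet> (D \<rhd> \<pi>') else if j = 1 then e else W \<bullet> (D \<rhd> \<pi>))"
  have ev: "fst ev 0 = D \<cdot> t" "fst ev 1 = x1" "fst ev 2 = D \<cdot> s" "fst ev 3 = x3"
    "snd ev (0, 0) = Ide2 C (D \<cdot> t)" "snd ev (1, 1) = Ide2 C x1" "snd ev (2, 2) = Ide2 C (D \<cdot> s)" "snd ev (3, 3) = Ide2 C x3"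
    "snd ev (3, 0) = W \<bullet> (D \<rhd> \<pi>')" "snd ev (3, 1) = e" "snd ev (3, 2) = W \<bullet> (D \<rhd> \<pi>)"
    by (simp_all add: ev_def)
  have evf: "is_functor L_cat (hom_cat C L X) ev"
    unfolding is_functor_def ball_L_cat using T(1-15) st pp SO by (simp add: ev in_hom_def del: One_nat_def)
  have "iso_functor (hom_cat C A L) (full_subcat (fun_cat L_cat (hom_cat C A X)) (L_diagrams C A X)) (cotensor_functor C L_cat ev)"
    if AO: "A \<in> Obj C" for A
  proof (rule cotensorI[OF category_L_cat evf AO])
    fix h assume h: "in_hom C h A L"
    have H: "h \<in> Arr C" "Dom C h = A" "Cod C h = L" using h by (auto simp: in_hom_def)
    have "product_diagram (hom_cat C A' X) (k \<rhd> (h \<rhd> snd ev (3, 2))) (k \<rhd> (h \<rhd> snd ev (3, 0)))"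
      if k: "in_hom C k A' A" for k A'
    proof -
      have K: "k \<in> Arr C" "Dom C k = A'" "Cod C k = A" using k by (auto simp: in_hom_def)
      have AO': "A' \<in> Obj C" using in_homD[OF k] by blast
      interpret H: category "hom_cat C A' X" by (rule hom_category[OF AO' SO(2)])
      have kh: "in_hom C (k \<cdot> h) A' L" "in_hom C (k \<cdot> (h \<cdot> D)) A' S" using K H T by (auto simp: in_hom_def)
      \<comment> \<open>Whiskering keeps \<open>W\<close> invertible, so the transported legs form a
        product at every stage.\<close>
      have "product_diagram (hom_cat C A' X) (((k \<cdot> h) \<rhd> W) \<bullet> ((k \<cdot> (h \<cdot> D)) \<rhd> \<pi>)) (((k \<cdot> h) \<rhd> W) \<bullet> ((k \<cdot> (h \<cdot> D)) \<rhd> \<pi>'))"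
        using H.product_diagram_iso[OF prod[OF kh(2)] whisker_l_inverse[OF W' kh(1)]] K H T pp by simp
      then show ?thesis using K H T pp by (simp add: ev)
    qed
    then show "cotensor_obj C L_cat ev h \<in> L_diagrams C A X"
      by (simp add: cotensor_obj_def L_diagrams_def)
  next
    fix F :: "(nat, nat \<times> nat, 'm, 'c) fctr" assume F: "is_functor L_cat (hom_cat C A X) F" and Z: "F \<in> L_diagrams C A X"
    interpret H: category "hom_cat C A X" by (rule hom_category[OF AO SO(2)])
    note f = functorD_hom[OF category_L_cat F]
    have fo: "in_hom C (fst F 0) A X" "in_hom C (fst F 1) A X" "in_hom C (fst F 2) A X" "in_hom C (fst F 3) A X"
      using f(1)[of 0] f(1)[of 1] f(1)[of 2] f(1)[of 3] by simp_all
    have fi: "snd F (0, 0) = Ide2 C (fst F 0)" "snd F (1, 1) = Ide2 C (fst F 1)" "snd F (2, 2) = Ide2 C (fst F 2)"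
      "snd F (3, 3) = Ide2 C (fst F 3)"
      using f(2)[of 0] f(2)[of 1] f(2)[of 2] f(2)[of 3] by simp_all
    have fa: "in_hom (hom_cat C A X) (snd F (3, 0)) (fst F 3) (fst F 0)" "in_hom (hom_cat C A X) (snd F (3, 1)) (fst F 3) (fst F 1)"
      "in_hom (hom_cat C A X) (snd F (3, 2)) (fst F 3) (fst F 2)"
      using f(3)[of "(3, 0)"] f(3)[of "(3, 1)"] f(3)[of "(3, 2)"] by simp_all
    have FC: "snd F (3, 0) \<in> Cell C" "Dom2 C (snd F (3, 0)) = fst F 3" "Cod2 C (snd F (3, 0)) = fst F 0"
      "snd F (3, 1) \<in> Cell C" "Dom2 C (snd F (3, 1)) = fst F 3" "Cod2 C (snd F (3, 1)) = fst F 1"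
      "snd F (3, 2) \<in> Cell C" "Dom2 C (snd F (3, 2)) = fst F 3" "Cod2 C (snd F (3, 2)) = fst F 2" "Dom C (fst F 3) = A" "Cod C (fst F 3) = X"
      using fa by (simp_all add: in_hom_hom_cat)
    have IA: "in_hom C (Ide C A) A A" using AO by (simp add: in_hom_def)
    have "product_diagram (hom_cat C A X) (Ide C A \<rhd> snd F (3, 2)) (Ide C A \<rhd> snd F (3, 0))"
      using Z IA unfolding L_diagrams_def by blast
    then have pF: "product_diagram (hom_cat C A X) (snd F (3, 2)) (snd F (3, 0))" using FC by simp
    obtain d where d: "in_hom C d A S" "d \<cdot> s = fst F 2" "d \<cdot> t = fst F 0" using strict_product_lift[OF S fo(3,1)] by blast
    have dT: "d \<in> Arr C" "Dom C d = A" "Cod C d = S" using d by (auto simp: in_hom_def)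
    \<comment> \<open>The comparison with the internal product is the isomorphism component of the
      lift; it is forced because the projections over \<open>d\<close> are jointly monic.\<close>
    obtain \<phi> \<phi>' where ph: "is_inverse (hom_cat C A X) \<phi> \<phi>'" "in_hom (hom_cat C A X) \<phi> (fst F 3) (d \<cdot> m)"
      "\<phi> \<bullet> (d \<rhd> \<pi>) = snd F (3, 2)" "\<phi> \<bullet> (d \<rhd> \<pi>') = snd F (3, 0)"
      using H.product_diagram_comparison[OF pF prod[OF d(1)]] FC dT pp d(2,3) st by auto
    have phc: "\<phi> \<in> Cell C" "Dom2 C \<phi> = fst F 3" "Cod2 C \<phi> = d \<cdot> m" using ph(2) by (auto simp: in_hom_def)
    have "is_iso (hom_cat C A X) \<phi>" "snd F (3, 1) \<in> Arr (hom_cat C A X)" "Dom2 C (snd F (3, 1)) = Dom2 C \<phi>"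
      using ph(1) FC phc by (auto simp: is_iso_def)
    note ex = lift[OF d(1) this(1) phc(3) this(2,3)]
    have "((\<forall>j\<in>Obj L_cat. k \<cdot> fst ev j = fst F j) \<and> (\<forall>w\<in>Arr L_cat. k \<rhd> snd ev w = snd F w)) \<longleftrightarrow>
       k \<cdot> D = d \<and> k \<rhd> W = \<phi> \<and> k \<rhd> e = snd F (3, 1)"
      (is "?l \<longleftrightarrow> ?r") if k: "in_hom C k A L" for k
    proof -
      have K: "k \<in> Arr C" "Dom C k = A" "Cod C k = L" using k by (auto simp: in_hom_def)
      have tk: "k \<rhd> Ide2 C (D \<cdot> t) = Ide2 C (k \<cdot> (D \<cdot> t))" "k \<rhd> Ide2 C x1 = Ide2 C (k \<cdot> x1)"
        "k \<rhd> Ide2 C (D \<cdot> s) = Ide2 C (k \<cdot> (D \<cdot> s))" "k \<rhd> Ide2 C x3 = Ide2 C (k \<cdot> x3)"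
        "k \<rhd> (W \<bullet> (D \<rhd> \<pi>)) = (k \<rhd> W) \<bullet> ((k \<cdot> D) \<rhd> \<pi>)" "k \<rhd> (W \<bullet> (D \<rhd> \<pi>')) = (k \<rhd> W) \<bullet> ((k \<cdot> D) \<rhd> \<pi>')"
        "k \<cdot> (D \<cdot> t) = (k \<cdot> D) \<cdot> t" "k \<cdot> (D \<cdot> s) = (k \<cdot> D) \<cdot> s"
        "in_hom (hom_cat C A X) (k \<rhd> W) (k \<cdot> x3) ((k \<cdot> D) \<cdot> m)" "in_hom (hom_cat C A X) (k \<rhd> e) (k \<cdot> x3) (k \<cdot> x1)"
        "in_hom C (k \<cdot> D) A S"
        using K T st pp by (simp_all add: in_hom_def)
      show ?thesis
      proof
        assume ?l
        then have l: "k \<cdot> (D \<cdot> t) = fst F 0" "k \<cdot> x1 = fst F 1" "k \<cdot> (D \<cdot> s) = fst F 2" "k \<cdot> x3 = fst F 3"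
          "k \<rhd> (W \<bullet> (D \<rhd> \<pi>')) = snd F (3, 0)" "k \<rhd> e = snd F (3, 1)" "k \<rhd> (W \<bullet> (D \<rhd> \<pi>)) = snd F (3, 2)"
          unfolding ball_L_cat ev by blast+
        have kD: "k \<cdot> D = d"
          by (rule strict_product_eqI[OF S tk(11) d(1)]) (use l tk d in simp_all)
        have "k \<rhd> W = \<phi>"
          by (rule H.product_arr_eqI[OF prod[OF d(1)], of _ "fst F 3"])
            (use tk l ph kD dT pp in simp_all)
        with kD l show ?r by blast
      next
        assume r: ?r
        then have "k \<cdot> x3 = fst F 3" "k \<cdot> x1 = fst F 1" using tk(9,10) ph(2) fa(2) by (simp_all add: in_hom_hom_cat)
        then show ?l unfolding ball_L_cat ev tk fi using r d ph by simp
      qed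
    qed
    with ex show "\<exists>!h. in_hom C h A L \<and> (\<forall>j\<in>Obj L_cat. h \<cdot> fst ev j = fst F j) \<and>
         (\<forall>w\<in>Arr L_cat. h \<rhd> snd ev w = snd F w)" by (simp cong: conj_cong)
  next
    fix k k' tf assume k: "in_hom C k A L" "in_hom C k' A L"
      and tf: "\<forall>j\<in>Obj L_cat. in_hom (hom_cat C A X) (tf j) (k \<cdot> fst ev j) (k' \<cdot> fst ev j)"
        "\<forall>w\<in>Arr L_cat. (k \<rhd> snd ev w) \<bullet> tf (Cod L_cat w) = tf (Dom L_cat w) \<bullet> (k' \<rhd> snd ev w)"
    interpret H: category "hom_cat C A X" by (rule hom_category[OF AO SO(2)])
    have K: "k \<in> Arr C" "Dom C k = A" "Cod C k = L" "k' \<in> Arr C" "Dom C k' = A" "Cod C k' = L" using k by (auto simp: in_hom_def)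
    have to: "in_hom (hom_cat C A X) (tf 0) (k \<cdot> (D \<cdot> t)) (k' \<cdot> (D \<cdot> t))" "in_hom (hom_cat C A X) (tf 1) (k \<cdot> x1) (k' \<cdot> x1)"
      "in_hom (hom_cat C A X) (tf 2) (k \<cdot> (D \<cdot> s)) (k' \<cdot> (D \<cdot> s))" "in_hom (hom_cat C A X) (tf 3) (k \<cdot> x3) (k' \<cdot> x3)"
      using tf(1) unfolding ball_L_cat ev by blast+
    have tn: "(k \<rhd> (W \<bullet> (D \<rhd> \<pi>'))) \<bullet> tf 0 = tf 3 \<bullet> (k' \<rhd> (W \<bullet> (D \<rhd> \<pi>')))" "(k \<rhd> e) \<bullet> tf 1 = tf 3 \<bullet> (k' \<rhd> e)"
      "(k \<rhd> (W \<bullet> (D \<rhd> \<pi>))) \<bullet> tf 2 = tf 3 \<bullet> (k' \<rhd> (W \<bullet> (D \<rhd> \<pi>)))"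
      using tf(2) unfolding ball_L_cat ev by simp_all
    have TC: "tf 0 \<in> Cell C" "Dom2 C (tf 0) = k \<cdot> (D \<cdot> t)" "Cod2 C (tf 0) = k' \<cdot> (D \<cdot> t)"
      "tf 2 \<in> Cell C" "Dom2 C (tf 2) = k \<cdot> (D \<cdot> s)" "Cod2 C (tf 2) = k' \<cdot> (D \<cdot> s)"
      "tf 3 \<in> Cell C" "Dom2 C (tf 3) = k \<cdot> x3" "Cod2 C (tf 3) = k' \<cdot> x3"
      using to by (simp_all add: in_hom_hom_cat)
    have kD: "in_hom C (k \<cdot> D) A S" "in_hom C (k' \<cdot> D) A S" using K T by (auto simp: in_hom_def)
    have "in_hom (hom_cat C A X) (tf 2) ((k \<cdot> D) \<cdot> s) ((k' \<cdot> D) \<cdot> s)" "in_hom (hom_cat C A X) (tf 0) ((k \<cdot> D) \<cdot> t) ((k' \<cdot> D) \<cdot> t)"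
      using to K T st by simp_all
    note exd = strict_product_lift_cell[OF S kD this]
    then obtain \<delta> where \<delta>: "in_hom (hom_cat C A S) \<delta> (k \<cdot> D) (k' \<cdot> D)" "\<delta> \<lhd> s = tf 2" "\<delta> \<lhd> t = tf 0" by blast
    have dT: "\<delta> \<in> Cell C" "Dom2 C \<delta> = k \<cdot> D" "Cod2 C \<delta> = k' \<cdot> D" using \<delta> by (auto simp: in_hom_def)
    \<comment> \<open>For either projection \<sigma>, the naturality square of the leg is rewritten
      as the square of \<open>W\<close> followed by \<sigma>; joint monicity of the projections then
      gives the square of \<open>W\<close> itself.\<close>
    have key: "((k \<rhd> W) \<bullet> (\<delta> \<lhd> m)) \<bullet> ((k' \<cdot> D) \<rhd> \<sigma>) = (tf 3 \<bullet> (k' \<rhd> W)) \<bullet> ((k' \<cdot> D) \<rhd> \<sigma>)"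
      if s: "\<sigma> \<in> Cell C" "Dom2 C \<sigma> = m" and e: "(k \<rhd> (W \<bullet> (D \<rhd> \<sigma>))) \<bullet> (\<delta> \<lhd> Cod2 C \<sigma>) = tf 3 \<bullet> (k' \<rhd> (W \<bullet> (D \<rhd> \<sigma>)))" for \<sigma>
    proof -
      have sD: "Dom C (Cod2 C \<sigma>) = S" "Cod2 C \<sigma> \<in> Arr C" "Cod C (Cod2 C \<sigma>) = X" using s pp by simp_all
      have "((k \<rhd> W) \<bullet> (\<delta> \<lhd> m)) \<bullet> ((k' \<cdot> D) \<rhd> \<sigma>) = (k \<rhd> W) \<bullet> ((\<delta> \<lhd> Dom2 C \<sigma>) \<bullet> (Cod2 C \<delta> \<rhd> \<sigma>))"
        using K T st pp s sD dT by simp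
      also have "\<dots> = (k \<rhd> W) \<bullet> ((Dom2 C \<delta> \<rhd> \<sigma>) \<bullet> (\<delta> \<lhd> Cod2 C \<sigma>))"
        by (subst whisker_exchange) (use K T st pp s sD dT in simp_all)
      also have "\<dots> = (k \<rhd> (W \<bullet> (D \<rhd> \<sigma>))) \<bullet> (\<delta> \<lhd> Cod2 C \<sigma>)"
        using K T st pp s sD dT by simp
      also have "\<dots> = (tf 3 \<bullet> (k' \<rhd> W)) \<bullet> ((k' \<cdot> D) \<rhd> \<sigma>)"
        unfolding e using K T st pp s sD dT TC by simp
      finally show ?thesis .
    qed
    have kk: "((k \<rhd> W) \<bullet> (\<delta> \<lhd> m)) \<bullet> ((k' \<cdot> D) \<rhd> \<pi>) = (tf 3 \<bullet> (k' \<rhd> W)) \<bullet> ((k' \<cdot> D) \<rhd> \<pi>)"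
      by (rule key) (use pp tn \<delta> in simp_all)
    have kk': "((k \<rhd> W) \<bullet> (\<delta> \<lhd> m)) \<bullet> ((k' \<cdot> D) \<rhd> \<pi>') = (tf 3 \<bullet> (k' \<rhd> W)) \<bullet> ((k' \<cdot> D) \<rhd> \<pi>')"
      by (rule key) (use pp tn \<delta> in simp_all)
    have nat: "(k \<rhd> W) \<bullet> (\<delta> \<lhd> m) = tf 3 \<bullet> (k' \<rhd> W)"
    proof (rule H.product_arr_eqI[OF prod[OF kD(2)], of _ "k \<cdot> x3"])
      show "in_hom (hom_cat C A X) ((k \<rhd> W) \<bullet> (\<delta> \<lhd> m)) (k \<cdot> x3) (Dom (hom_cat C A X) ((k' \<cdot> D) \<rhd> \<pi>))"
        "in_hom (hom_cat C A X) (tf 3 \<bullet> (k' \<rhd> W)) (k \<cdot> x3) (Dom (hom_cat C A X) ((k' \<cdot> D) \<rhd> \<pi>))"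
        using K T st pp dT TC by (simp_all add: in_hom_hom_cat)
    qed (simp_all only: hom_cat_simps kk kk')
    have ex: "\<exists>!\<theta>. in_hom (hom_cat C A L) \<theta> k k' \<and> \<theta> \<lhd> D = \<delta> \<and> \<theta> \<lhd> x3 = tf 3 \<and> \<theta> \<lhd> x1 = tf 1"
      by (rule cell[OF k \<delta>(1) to(4,2) nat tn(2)])
    have "\<theta> \<lhd> D = \<delta> \<and> \<theta> \<lhd> x3 = tf 3 \<and> \<theta> \<lhd> x1 = tf 1 \<longleftrightarrow>
        \<theta> \<lhd> (D \<cdot> t) = tf 0 \<and> \<theta> \<lhd> x1 = tf 1 \<and> \<theta> \<lhd> (D \<cdot> s) = tf 2 \<and> \<theta> \<lhd> x3 = tf 3"
      if th: "in_hom (hom_cat C A L) \<theta> k k'" for \<theta>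
    proof -
      have thT: "\<theta> \<in> Cell C" "Dom2 C \<theta> = k" "Cod2 C \<theta> = k'" using th by (auto simp: in_hom_def)
      have e: "\<theta> \<lhd> (D \<cdot> t) = (\<theta> \<lhd> D) \<lhd> t" "\<theta> \<lhd> (D \<cdot> s) = (\<theta> \<lhd> D) \<lhd> s" "in_hom (hom_cat C A S) (\<theta> \<lhd> D) (k \<cdot> D) (k' \<cdot> D)"
        using thT K T st by (simp_all add: in_hom_hom_cat)
      then show ?thesis using exd \<delta> by metis
    qed
    with ex show "\<exists>!\<theta>. in_hom (hom_cat C A L) \<theta> k k' \<and> (\<forall>j\<in>Obj L_cat. \<theta> \<lhd> fst ev j = tf j)"
      unfolding ball_L_cat ev by (simp cong: conj_cong)
  qed
  then have "L_object C X L ev" using SO LO evf by (simp add: L_object_def)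
  then show ?thesis by blast
qed

end

subsection \<open>The opposite of a complete congruence\<close>

text \<open>The two descriptions range over the same predicate up to the order of conjuncts, so the
  equality holds whether or not the projections have a universal property.\<close>

lemma pairing_swap:
  assumes "Dom D a = Dom D b" "Dom D p = Dom D q"
  shows "pairing D q p b a = pairing D p q a b"
proof -
  have "(\<lambda>m. in_hom D m (Dom D b) (Dom D q) \<and> m \<cdot>\<^bsub>D\<^esub> q = b \<and> m \<cdot>\<^bsub>D\<^esub> p = a) =
    (\<lambda>m. in_hom D m (Dom D a) (Dom D p) \<and> m \<cdot>\<^bsub>D\<^esub> p = a \<and> m \<cdot>\<^bsub>D\<^esub> q = b)" using assms by auto
  then show ?thesis by (simp add: pairing_def)
qed

lemma pullback_square_swap:
  assumes "pullback_square D p q f g"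
  shows "pullback_square D q p g f"
proof -
  obtain w x y z where h: "in_hom D p w x" "in_hom D q w y" "in_hom D f x z" "in_hom D g y z" "p \<cdot>\<^bsub>D\<^esub> f = q \<cdot>\<^bsub>D\<^esub> g"
    and u: "\<And>v a b. in_hom D a v x \<Longrightarrow> in_hom D b v y \<Longrightarrow> a \<cdot>\<^bsub>D\<^esub> f = b \<cdot>\<^bsub>D\<^esub> g \<Longrightarrow>
           \<exists>!m. in_hom D m v w \<and> m \<cdot>\<^bsub>D\<^esub> p = a \<and> m \<cdot>\<^bsub>D\<^esub> q = b"
    using assms unfolding pullback_square_def by blast
  have "\<exists>!m. in_hom D m v w \<and> m \<cdot>\<^bsub>D\<^esub> q = b \<and> m \<cdot>\<^bsub>D\<^esub> p = a"
    if "in_hom D b v y" "in_hom D a v x" "b \<cdot>\<^bsub>D\<^esub> g = a \<cdot>\<^bsub>D\<^esub> f" for v a b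
    using u[OF that(2,1) that(3)[symmetric]] by metis
  then show ?thesis unfolding pullback_square_def
    using h by (intro exI[of _ w] exI[of _ y] exI[of _ x] exI[of _ z]) simp
qed

lemma op_intcat_simps [simp]:
  "C0 (op_intcat N) = C0 N" "C1 (op_intcat N) = C1 N" "C2 (op_intcat N) = C2 N" "pi0 (op_intcat N) = pi1 N"
  "pi1 (op_intcat N) = pi0 N" "ident (op_intcat N) = ident N" "pi01 (op_intcat N) = pi12 N"
  "pi12 (op_intcat N) = pi01 N" "pi02 (op_intcat N) = pi02 N"
  by (simp_all add: op_intcat_def)

context category
begin

section \<open>Pullback squares and internal categories\<close>

lemma pullback_square_hom:
  assumes "pullback_square D p q f g"
  shows "p \<in> Arr D" "q \<in> Arr D" "f \<in> Arr D" "g \<in> Arr D" "Dom D q = Dom D p" "Cod D p = Dom D f" "Cod D q = Dom D g"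
    "Cod D f = Cod D g" "p \<cdot> f = q \<cdot> g"
  using assms unfolding pullback_square_def in_hom_def by metis+

lemma pullback_square_lift:
  assumes P: "pullback_square D p q f g" and a: "in_hom D a v (Dom D f)" "in_hom D b v (Dom D g)" "a \<cdot> f = b \<cdot> g"
  shows "\<exists>!m. in_hom D m v (Dom D p) \<and> m \<cdot> p = a \<and> m \<cdot> q = b"
  using assms unfolding pullback_square_def in_hom_def by metis

lemma pullback_pairing_hom:
  assumes P: "pullback_square D p q f g" and a: "in_hom D a v (Dom D f)" "in_hom D b v (Dom D g)" "a \<cdot> f = b \<cdot> g"
  shows "in_hom D (pairing D p q a b) v (Dom D p)" "pairing D p q a b \<cdot> p = a" "pairing D p q a b \<cdot> q = b"
proof -
  have "\<exists>!m. in_hom D m (Dom D a) (Dom D p) \<and> m \<cdot> p = a \<and> m \<cdot> q = b"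
    using pullback_square_lift[OF assms] a(1) by (simp add: in_hom_def)
  from theI'[OF this] show "in_hom D (pairing D p q a b) v (Dom D p)" "pairing D p q a b \<cdot> p = a" "pairing D p q a b \<cdot> q = b"
    using a by (auto simp: pairing_def in_hom_def)
qed

lemma pullback_pairing_eqI:
  assumes P: "pullback_square D p q f g" and m: "in_hom D m v (Dom D p)" "m \<cdot> p = a" "m \<cdot> q = b"
  shows "pairing D p q a b = m"
proof -
  note h = pullback_square_hom[OF P]
  have "(m \<cdot> p) \<cdot> f = (m \<cdot> q) \<cdot> g" using m(1) h by (simp add: in_hom_def)
  then have ab: "in_hom D a v (Dom D f)" "in_hom D b v (Dom D g)" "a \<cdot> f = b \<cdot> g"
    using m h by (auto simp: in_hom_def)
  from pullback_square_lift[OF P ab] pullback_pairing_hom[OF P ab] m show ?thesis by metis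
qed

lemma comp_pullback_pairing:
  assumes P: "pullback_square D p q f g" and a: "in_hom D a v (Dom D f)" "in_hom D b v (Dom D g)" "a \<cdot> f = b \<cdot> g"
    and n: "in_hom D n w v"
  shows "n \<cdot> pairing D p q a b = pairing D p q (n \<cdot> a) (n \<cdot> b)"
proof (rule pullback_pairing_eqI[symmetric, OF P])
  note * = pullback_pairing_hom[OF P a] and h = pullback_square_hom[OF P]
  show "in_hom D (n \<cdot> pairing D p q a b) w (Dom D p)" using * n by (auto simp: in_hom_def)
  have "(n \<cdot> pairing D p q a b) \<cdot> p = n \<cdot> (pairing D p q a b \<cdot> p)" "(n \<cdot> pairing D p q a b) \<cdot> q = n \<cdot> (pairing D p q a b \<cdot> q)"
    using *(1) n h by (simp_all add: in_hom_def)
  then show "(n \<cdot> pairing D p q a b) \<cdot> p = n \<cdot> a" "(n \<cdot> pairing D p q a b) \<cdot> q = n \<cdot> b" by (simp_all only: *)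
qed

lemma internal_categoryD:
  assumes "internal_category D N"
  shows "in_hom D (pi0 N) (C1 N) (C0 N)" "in_hom D (pi1 N) (C1 N) (C0 N)" "in_hom D (ident N) (C0 N) (C1 N)"
    "in_hom D (pi01 N) (C2 N) (C1 N)" "in_hom D (pi12 N) (C2 N) (C1 N)" "in_hom D (pi02 N) (C2 N) (C1 N)"
    "pullback_square D (pi01 N) (pi12 N) (pi1 N) (pi0 N)"
    "ident N \<cdot> pi0 N = Ide D (C0 N)" "ident N \<cdot> pi1 N = Ide D (C0 N)"
    "pi02 N \<cdot> pi0 N = pi01 N \<cdot> pi0 N" "pi02 N \<cdot> pi1 N = pi12 N \<cdot> pi1 N"
    "icomp D N (pi0 N \<cdot> ident N) (Ide D (C1 N)) = Ide D (C1 N)" "icomp D N (Ide D (C1 N)) (pi1 N \<cdot> ident N) = Ide D (C1 N)"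
    "\<And>A a b c. in_hom D a A (C1 N) \<Longrightarrow> in_hom D b A (C1 N) \<Longrightarrow> in_hom D c A (C1 N) \<Longrightarrow>
        a \<cdot> pi1 N = b \<cdot> pi0 N \<Longrightarrow> b \<cdot> pi1 N = c \<cdot> pi0 N \<Longrightarrow>
        icomp D N (icomp D N a b) c = icomp D N a (icomp D N b c)"
  using assms unfolding internal_category_def by blast+

lemma icomp_hom:
  assumes N: "internal_category D N" and a: "in_hom D a A (C1 N)" "in_hom D b A (C1 N)" "a \<cdot> pi1 N = b \<cdot> pi0 N"
  shows "in_hom D (icomp D N a b) A (C1 N)"
proof -
  note n = internal_categoryD[OF N]
  have "in_hom D a A (Dom D (pi1 N))" "in_hom D b A (Dom D (pi0 N))" using a n by (auto simp: in_hom_def)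
  from pullback_pairing_hom[OF n(7) this a(3)] show ?thesis unfolding icomp_def using n(4,6) by (auto simp: in_hom_def)
qed

text \<open>Exchanging the projections of the pullback together with the arguments leaves the
  mediating morphism unchanged. Composition in the opposite is thus the original one with arguments
  exchanged, and the unit and associativity laws become their mirror images.\<close>

lemma internal_category_op:
  assumes N: "internal_category D N"
  shows "internal_category D (op_intcat N)"
proof -
  note n = internal_categoryD[OF N]
  have sw: "icomp D (op_intcat N) b a = icomp D N a b" if "Dom D a = Dom D b" for a b
    using pairing_swap[OF that, of "pi01 N" "pi12 N"] n(4,5) by (simp add: icomp_def in_hom_def)
  have T: "Dom D (pi1 N \<cdot> ident N) = C1 N" "Dom D (pi0 N \<cdot> ident N) = C1 N" "Dom D (Ide D (C1 N)) = C1 N"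
    using n(1,2,3) in_homD(4)[OF n(1)] by (auto simp: in_hom_def)
  have assoc: "icomp D (op_intcat N) (icomp D (op_intcat N) a b) c = icomp D (op_intcat N) a (icomp D (op_intcat N) b c)"
    if h: "in_hom D a A (C1 N)" "in_hom D b A (C1 N)" "in_hom D c A (C1 N)" "a \<cdot> pi0 N = b \<cdot> pi1 N" "b \<cdot> pi0 N = c \<cdot> pi1 N" for A a b c
  proof -
    have d: "Dom D a = A" "Dom D b = A" "Dom D c = A" using h by (auto simp: in_hom_def)
    have i: "Dom D (icomp D N b a) = A" "Dom D (icomp D N c b) = A"
      using icomp_hom[OF N h(2,1)] icomp_hom[OF N h(3,2)] h(4,5) by (simp_all add: in_hom_def)
    have "icomp D (op_intcat N) (icomp D (op_intcat N) a b) c = icomp D N c (icomp D N b a)"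
      using sw[of b a] sw[of c "icomp D N b a"] d i by simp
    also have "\<dots> = icomp D N (icomp D N c b) a" by (rule n(14)[symmetric, of _ A]) (use h in auto)
    also have "\<dots> = icomp D (op_intcat N) a (icomp D (op_intcat N) b c)"
      using sw[of c b] sw[of "icomp D N c b" a] d i by simp
    finally show ?thesis .
  qed
  then have "\<forall>A a b c. in_hom D a A (C1 N) \<and> in_hom D b A (C1 N) \<and> in_hom D c A (C1 N) \<and>
        a \<cdot> pi0 N = b \<cdot> pi1 N \<and> b \<cdot> pi0 N = c \<cdot> pi1 N \<longrightarrow>
        icomp D (op_intcat N) (icomp D (op_intcat N) a b) c = icomp D (op_intcat N) a (icomp D (op_intcat N) b c)"
    by blast
  then show ?thesis unfolding internal_category_def op_intcat_simps
    using n(1-11) pullback_square_swap[OF n(7)] sw[of "Ide D (C1 N)" "pi1 N \<cdot> ident N"]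
      sw[of "pi0 N \<cdot> ident N" "Ide D (C1 N)"] n(12,13) T by simp
qed

end

context two_category
begin

lemma strict_product_swap:
  assumes P: "strict_product C X Y P p q"
  shows "strict_product C Y X P q p"
proof -
  note h = strict_product_hom[OF P]
  have pq: "p \<in> Arr C" "q \<in> Arr C" "Dom C p = P" "Dom C q = P" "Cod C p = X" "Cod C q = Y" using h by (auto simp: in_hom_def)
  have "iso_functor (hom_cat C B P) (prod_cat (hom_cat C B Y) (hom_cat C B X)) (span_functor C q p)" if B: "B \<in> Obj C" for B
  proof (rule iso_functorI)
    show "is_functor (hom_cat C B P) (prod_cat (hom_cat C B Y) (hom_cat C B X)) (span_functor C q p)"
      using pq by (auto simp: is_functor_def prod_cat_def span_functor_def in_hom_def)
    show "Dom (hom_cat C B P) f \<in> Obj (hom_cat C B P) \<and> Cod (hom_cat C B P) f \<in> Obj (hom_cat C B P)"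
      if "f \<in> Arr (hom_cat C B P)" for f using that by (rule hom_cat_Dom_Cod)
    show "Dom (prod_cat (hom_cat C B Y) (hom_cat C B X)) f \<in> Obj (prod_cat (hom_cat C B Y) (hom_cat C B X)) \<and>
         Cod (prod_cat (hom_cat C B Y) (hom_cat C B X)) f \<in> Obj (prod_cat (hom_cat C B Y) (hom_cat C B X))"
      if "f \<in> Arr (prod_cat (hom_cat C B Y) (hom_cat C B X))" for f
      using that by (auto simp: prod_cat_def in_hom_def)
    show "\<exists>!x. x \<in> Obj (hom_cat C B P) \<and> fst (span_functor C q p) x = y"
      if y: "y \<in> Obj (prod_cat (hom_cat C B Y) (hom_cat C B X))" for y
    proof -
      obtain y1 y2 where yy: "y = (y1, y2)" "in_hom C y1 B Y" "in_hom C y2 B X" using y by (auto simp: prod_cat_def)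
      have "x \<in> Obj (hom_cat C B P) \<and> fst (span_functor C q p) x = y \<longleftrightarrow> in_hom C x B P \<and> x \<cdot> p = y2 \<and> x \<cdot> q = y1" for x
        by (auto simp: span_functor_def yy)
      with strict_product_lift[OF P yy(3,2)] show ?thesis by simp
    qed
    show "\<exists>!a. in_hom (hom_cat C B P) a x x' \<and> snd (span_functor C q p) a = b"
      if x: "x \<in> Obj (hom_cat C B P)" "x' \<in> Obj (hom_cat C B P)"
       and b: "in_hom (prod_cat (hom_cat C B Y) (hom_cat C B X)) b (fst (span_functor C q p) x) (fst (span_functor C q p) x')" for x x' b
    proof -
      obtain b1 b2 where bb: "b = (b1, b2)" "in_hom (hom_cat C B Y) b1 (x \<cdot> q) (x' \<cdot> q)" "in_hom (hom_cat C B X) b2 (x \<cdot> p) (x' \<cdot> p)"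
        using b by (cases b) (auto simp: prod_cat_def in_hom_def span_functor_def)
      have "snd (span_functor C q p) a = b \<longleftrightarrow> a \<lhd> p = b2 \<and> a \<lhd> q = b1" for a
        by (auto simp: span_functor_def bb)
      with strict_product_lift_cell[OF P _ _ bb(3,2)] x show ?thesis by simp
    qed
  qed
  then show ?thesis using h unfolding strict_product_def by blast
qed

text \<open>The completeness square of the opposite congruence turns out to be the original one
  precomposed with the reversal \<tau>. An involution is its own inverse, so lifts are transported
  by composing with \<tau> once more.\<close>

lemma strict_pullback_precomp:
  assumes P: "strict_pullback C a b f g" and t: "in_hom C \<tau> (Dom C a) (Dom C a)" "\<tau> \<cdot> \<tau> = Ide C (Dom C a)"
  shows "strict_pullback C (\<tau> \<cdot> a) (\<tau> \<cdot> b) f g"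
proof -
  define P where "P = Dom C a"
  note h = strict_pullback_hom[OF P]
  have fg: "f \<in> Arr C" "g \<in> Arr C" "Cod C g = Cod C f" using P by (auto simp: strict_pullback_def in_hom_def)
  have T: "\<tau> \<in> Arr C" "Dom C \<tau> = P" "Cod C \<tau> = P" "a \<in> Arr C" "b \<in> Arr C" "Dom C a = P" "Dom C b = P"
    "Cod C a = Dom C f" "Cod C b = Dom C g" "\<tau> \<cdot> \<tau> = Ide C P"
    using t h by (auto simp: in_hom_def P_def)
  define X Y where "X = Dom C f" and "Y = Dom C g"
  let ?D = "\<lambda>B. hom_cat C B P" and ?E = "\<lambda>B. pullback_cat (hom_cat C B X) (postcomp C f) (hom_cat C B Y) (postcomp C g)"
  have "iso_functor (?D B) (?E B) (span_functor C (\<tau> \<cdot> a) (\<tau> \<cdot> b))" if B: "B \<in> Obj C" for B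
  proof (rule iso_functorI)
    have e1: "(x \<cdot> (\<tau> \<cdot> a)) \<cdot> f = (x \<cdot> (\<tau> \<cdot> b)) \<cdot> g" if "in_hom C x B P" for x
      using that T fg h(3) by (simp add: in_hom_def)
    have e2: "(x \<lhd> (\<tau> \<cdot> a)) \<lhd> f = (x \<lhd> (\<tau> \<cdot> b)) \<lhd> g" if "x \<in> Arr (hom_cat C B P)" for x
    proof -
      have "(x \<lhd> (\<tau> \<cdot> a)) \<lhd> f = (x \<lhd> \<tau>) \<lhd> (a \<cdot> f)" "(x \<lhd> (\<tau> \<cdot> b)) \<lhd> g = (x \<lhd> \<tau>) \<lhd> (b \<cdot> g)"
        using that T fg by simp_all
      then show ?thesis by (simp only: h(3))
    qed
    show "is_functor (?D B) (?E B) (span_functor C (\<tau> \<cdot> a) (\<tau> \<cdot> b))"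
      unfolding is_functor_def
      apply (intro conjI ballI impI)
      subgoal for x using T fg e1[of x] by (simp add: prod_cat_def pullback_cat_def span_functor_def in_hom_def postcomp_def X_def Y_def)
      subgoal for x using T fg by (simp add: prod_cat_def pullback_cat_def span_functor_def in_hom_def postcomp_def X_def Y_def)
      subgoal for x using T fg e2[of x] by (simp add: prod_cat_def pullback_cat_def span_functor_def in_hom_def postcomp_def X_def Y_def)
      subgoal for x y using T fg by (simp add: prod_cat_def pullback_cat_def span_functor_def in_hom_def postcomp_def X_def Y_def)
      done
    show "Dom (?D B) f \<in> Obj (?D B) \<and> Cod (?D B) f \<in> Obj (?D B)"
      if "f \<in> Arr (?D B)" for f using that by (rule hom_cat_Dom_Cod)
    show "Dom (?E B) k \<in> Obj (?E B) \<and> Cod (?E B) k \<in> Obj (?E B)" if kE: "k \<in> Arr (?E B)" for k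
    proof -
      obtain k1 k2 where k: "k = (k1, k2)" "k1 \<in> Arr (hom_cat C B X)" "k2 \<in> Arr (hom_cat C B Y)" "k1 \<lhd> f = k2 \<lhd> g"
        using kE by (auto simp: prod_cat_def pullback_cat_def postcomp_def)
      have "Dom2 C (k1 \<lhd> f) = Dom2 C k1 \<cdot> f" "Dom2 C (k2 \<lhd> g) = Dom2 C k2 \<cdot> g"
        "Cod2 C (k1 \<lhd> f) = Cod2 C k1 \<cdot> f" "Cod2 C (k2 \<lhd> g) = Cod2 C k2 \<cdot> g"
        using k(2,3) fg by (simp_all add: X_def Y_def)
      then have "Dom2 C k1 \<cdot> f = Dom2 C k2 \<cdot> g" "Cod2 C k1 \<cdot> f = Cod2 C k2 \<cdot> g" by (simp_all add: k(4))
      then show ?thesis using k T fg by (simp add: prod_cat_def pullback_cat_def postcomp_def in_hom_def X_def Y_def)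
    qed
    have tt: "(x \<cdot> \<tau>) \<cdot> \<tau> = x" if "in_hom C x B P" for x using that T by (simp add: in_hom_def)
    have tt2: "(x \<lhd> \<tau>) \<lhd> \<tau> = x" if "x \<in> Arr (hom_cat C B P)" for x
      using that T whisker_r_comp[of \<tau> \<tau> x] by simp
    show "\<exists>!x. x \<in> Obj (?D B) \<and> fst (span_functor C (\<tau> \<cdot> a) (\<tau> \<cdot> b)) x = y" if y: "y \<in> Obj (?E B)" for y
    proof -
      obtain y1 y2 where yy: "y = (y1, y2)" "in_hom C y1 B X" "in_hom C y2 B Y" "y1 \<cdot> f = y2 \<cdot> g"
        using y by (auto simp: prod_cat_def pullback_cat_def postcomp_def)
      have ex: "\<exists>!h. in_hom C h B P \<and> h \<cdot> a = y1 \<and> h \<cdot> b = y2"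
        using strict_pullback_lift[OF P, of y1 B y2] yy T by (simp add: X_def Y_def)
      then obtain k where k: "in_hom C k B P" "k \<cdot> a = y1" "k \<cdot> b = y2" by blast
      have i: "fst (span_functor C (\<tau> \<cdot> a) (\<tau> \<cdot> b)) x = y \<longleftrightarrow> (x \<cdot> \<tau>) \<cdot> a = y1 \<and> (x \<cdot> \<tau>) \<cdot> b = y2" "in_hom C (x \<cdot> \<tau>) B P"
        if "in_hom C x B P" for x using that T by (auto simp: span_functor_def yy in_hom_def)
      have "in_hom C (k \<cdot> \<tau>) B P \<and> fst (span_functor C (\<tau> \<cdot> a) (\<tau> \<cdot> b)) (k \<cdot> \<tau>) = y"
        using i(2)[OF k(1)] i(1)[OF i(2)[OF k(1)]] tt[OF k(1)] k by simp
      moreover have "x = k \<cdot> \<tau>" if "in_hom C x B P \<and> fst (span_functor C (\<tau> \<cdot> a) (\<tau> \<cdot> b)) x = y" for x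
      proof -
        have "x \<cdot> \<tau> = k" using i[of x] that ex k by blast
        then show ?thesis using tt[of x] that by metis
      qed
      ultimately show ?thesis by (simp, blast)
    qed
    show "\<exists>!c. in_hom (?D B) c x x' \<and> snd (span_functor C (\<tau> \<cdot> a) (\<tau> \<cdot> b)) c = k"
      if x: "x \<in> Obj (?D B)" "x' \<in> Obj (?D B)"
       and kE: "in_hom (?E B) k (fst (span_functor C (\<tau> \<cdot> a) (\<tau> \<cdot> b)) x) (fst (span_functor C (\<tau> \<cdot> a) (\<tau> \<cdot> b)) x')" for x x' k
    proof -
      have x': "in_hom C x B P" "in_hom C x' B P" using x by auto
      then have xt: "in_hom C (x \<cdot> \<tau>) B P" "in_hom C (x' \<cdot> \<tau>) B P" using T by (auto simp: in_hom_def)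
      obtain k1 k2 where k12: "k = (k1, k2)" by (cases k)
      have "k1 \<in> Arr (hom_cat C B X) \<and> k2 \<in> Arr (hom_cat C B Y) \<and> k1 \<lhd> f = k2 \<lhd> g \<and>
          Dom2 C k1 = x \<cdot> (\<tau> \<cdot> a) \<and> Dom2 C k2 = x \<cdot> (\<tau> \<cdot> b) \<and> Cod2 C k1 = x' \<cdot> (\<tau> \<cdot> a) \<and> Cod2 C k2 = x' \<cdot> (\<tau> \<cdot> b)"
        using kE x' T unfolding in_hom_def[of "?E B"] k12
        by (simp add: prod_cat_def pullback_cat_def span_functor_def postcomp_def in_hom_def[of C] X_def Y_def)
      moreover have "(x \<cdot> \<tau>) \<cdot> a = x \<cdot> (\<tau> \<cdot> a)" "(x' \<cdot> \<tau>) \<cdot> a = x' \<cdot> (\<tau> \<cdot> a)" "(x \<cdot> \<tau>) \<cdot> b = x \<cdot> (\<tau> \<cdot> b)" "(x' \<cdot> \<tau>) \<cdot> b = x' \<cdot> (\<tau> \<cdot> b)"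
        using x' T by (simp_all add: in_hom_def)
      ultimately have kk: "k = (k1, k2)" "in_hom (hom_cat C B X) k1 ((x \<cdot> \<tau>) \<cdot> a) ((x' \<cdot> \<tau>) \<cdot> a)"
         "in_hom (hom_cat C B Y) k2 ((x \<cdot> \<tau>) \<cdot> b) ((x' \<cdot> \<tau>) \<cdot> b)" "k1 \<lhd> f = k2 \<lhd> g"
        using k12 x' T by (simp_all add: in_hom_def X_def Y_def)
      have ex: "\<exists>!c. in_hom (hom_cat C B P) c (x \<cdot> \<tau>) (x' \<cdot> \<tau>) \<and> c \<lhd> a = k1 \<and> c \<lhd> b = k2"
        using strict_pullback_lift_cell[OF P, of "x \<cdot> \<tau>" B "x' \<cdot> \<tau>" k1 k2, unfolded T(6), folded X_def Y_def, OF xt kk(2-4)] .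
      then obtain c where c: "in_hom (hom_cat C B P) c (x \<cdot> \<tau>) (x' \<cdot> \<tau>)" "c \<lhd> a = k1" "c \<lhd> b = k2" by blast
      have i: "snd (span_functor C (\<tau> \<cdot> a) (\<tau> \<cdot> b)) d = k \<longleftrightarrow> (d \<lhd> \<tau>) \<lhd> a = k1 \<and> (d \<lhd> \<tau>) \<lhd> b = k2"
        if "d \<in> Arr (hom_cat C B P)" for d using that T by (auto simp: span_functor_def kk)
      have cA: "c \<in> Arr (hom_cat C B P)" using c by (auto simp: in_hom_def)
      have "in_hom (hom_cat C B P) (c \<lhd> \<tau>) ((x \<cdot> \<tau>) \<cdot> \<tau>) ((x' \<cdot> \<tau>) \<cdot> \<tau>)"
        using c(1) x' T by (simp add: in_hom_def)
      then have c2: "in_hom (hom_cat C B P) (c \<lhd> \<tau>) x x'" by (simp only: tt x')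
      then have c3: "c \<lhd> \<tau> \<in> Arr (hom_cat C B P)" by (simp only: in_hom_def)
      have "snd (span_functor C (\<tau> \<cdot> a) (\<tau> \<cdot> b)) (c \<lhd> \<tau>) = k" unfolding i[OF c3] tt2[OF cA] using c by blast
      moreover have "d = c \<lhd> \<tau>" if d: "in_hom (hom_cat C B P) d x x'" "snd (span_functor C (\<tau> \<cdot> a) (\<tau> \<cdot> b)) d = k" for d
      proof -
        have dA: "d \<in> Arr (hom_cat C B P)" using d by (simp only: in_hom_def)
        have "in_hom (hom_cat C B P) (d \<lhd> \<tau>) (x \<cdot> \<tau>) (x' \<cdot> \<tau>)" using d(1) T by (auto simp: in_hom_def)
        then have "d \<lhd> \<tau> = c" using i[OF dA] d(2) ex c by blast
        then show ?thesis using tt2[OF dA] by metis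
      qed
      ultimately show ?thesis using c2 by blast
    qed
  qed
  moreover have "in_hom C (\<tau> \<cdot> a) P X" "in_hom C (\<tau> \<cdot> b) P Y" "in_hom C f X (Cod C f)" "in_hom C g Y (Cod C f)"
    "(\<tau> \<cdot> a) \<cdot> f = (\<tau> \<cdot> b) \<cdot> g"
    using T fg h(3) by (simp_all add: in_hom_def X_def Y_def)
  ultimately show ?thesis unfolding strict_pullback_def by blast
qed

text \<open>Exchanging the projections of the product together with source and target leaves the
  pairing morphism itself unchanged, so its fibration properties carry over literally.\<close>

lemma gbo_congruence_op:
  assumes N: "gbo_congruence C N"
  shows "gbo_congruence C (op_intcat N)"
proof -
  have ic: "internal_category C N" using N by (simp add: gbo_congruence_def internal_double_category_def)
  note n = internal_categoryD[OF ic]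
  have d: "Dom C (pi0 N) = Dom C (pi1 N)" using n(1,2) by (auto simp: in_hom_def)
  have sw: "strict_product C (C0 N) (C0 N) Q q p \<and> pairing C q p (pi1 N) (pi0 N) = pairing C p q (pi0 N) (pi1 N)"
    if "strict_product C (C0 N) (C0 N) Q p q" for Q p q
    using strict_product_swap[OF that] pairing_swap[OF d, of p q] strict_product_hom[OF that] by (simp add: in_hom_def)
  obtain Q p q where Q: "strict_product C (C0 N) (C0 N) Q p q" "isofibration C (pairing C p q (pi0 N) (pi1 N))"
    using N unfolding gbo_congruence_def internal_double_category_def by blast
  obtain Q' p' q' where Q': "strict_product C (C0 N) (C0 N) Q' p' q'" "discrete_opfibration C (pairing C p' q' (pi0 N) (pi1 N))"
    using N unfolding gbo_congruence_def by blast
  have "isofibration C (pairing C q p (pi1 N) (pi0 N))" "discrete_opfibration C (pairing C q' p' (pi1 N) (pi0 N))"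
    using Q Q' sw by metis+
  then have "\<exists>Q p q. strict_product C (C0 N) (C0 N) Q p q \<and> isofibration C (pairing C p q (pi1 N) (pi0 N))"
    "\<exists>Q p q. strict_product C (C0 N) (C0 N) Q p q \<and> discrete_opfibration C (pairing C p q (pi1 N) (pi0 N))"
    using sw[OF Q(1)] sw[OF Q'(1)] by blast+
  then show ?thesis
    using N internal_category_op[OF ic]
    unfolding gbo_congruence_def internal_double_category_def op_intcat_simps by blast
qed

text \<open>Lifting along the pairing into the product amounts to lifting both components
  simultaneously. Expressing this with \<open>pi0 N\<close> and \<open>pi1 N\<close> removes the
  choice of the product.\<close>

lemma gbo_congruence_lift:
  assumes N: "gbo_congruence C N" and x: "in_hom C x A (C1 N)"
    and b: "in_hom (hom_cat C A (C0 N)) \<beta>\<^sub>0 (x \<cdot> pi0 N) y\<^sub>0" "in_hom (hom_cat C A (C0 N)) \<beta>\<^sub>1 (x \<cdot> pi1 N) y\<^sub>1"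
  shows "\<exists>!a. a \<in> Arr (hom_cat C A (C1 N)) \<and> Dom2 C a = x \<and> a \<lhd> pi0 N = \<beta>\<^sub>0 \<and> a \<lhd> pi1 N = \<beta>\<^sub>1"
proof -
  have ic: "internal_category C N" using N by (simp add: gbo_congruence_def internal_double_category_def)
  note n = internal_categoryD[OF ic]
  obtain Q p q where Q: "strict_product C (C0 N) (C0 N) Q p q" and D: "discrete_opfibration C (pairing C p q (pi0 N) (pi1 N))"
    using N unfolding gbo_congruence_def by blast
  note pq = strict_product_hom[OF Q]
  define f where "f = pairing C p q (pi0 N) (pi1 N)"
  note f = strict_product_pairing[OF Q n(1,2), folded f_def]
  have X: "x \<in> Arr C" "Dom C x = A" "Cod C x = C1 N" "f \<in> Arr C" "Dom C f = C1 N" "Cod C f = Q"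
     "p \<in> Arr C" "Dom C p = Q" "Cod C p = C0 N" "q \<in> Arr C" "Dom C q = Q" "Cod C q = C0 N"
     "A \<in> Obj C"
    using x f pq in_homD(4)[OF x] by (auto simp: in_hom_def)
  have y: "in_hom C y\<^sub>0 A (C0 N)" "in_hom C y\<^sub>1 A (C0 N)" using b by (auto simp: in_hom_def)
  obtain h' where h': "in_hom C h' A Q" "h' \<cdot> p = y\<^sub>0" "h' \<cdot> q = y\<^sub>1" using strict_product_lift[OF Q y] by blast
  have xf: "in_hom C (x \<cdot> f) A Q" "(x \<cdot> f) \<cdot> p = x \<cdot> pi0 N" "(x \<cdot> f) \<cdot> q = x \<cdot> pi1 N"
    using X unfolding f(2,3)[symmetric] by (auto simp: in_hom_def)
  have b': "in_hom (hom_cat C A (C0 N)) \<beta>\<^sub>0 ((x \<cdot> f) \<cdot> p) (h' \<cdot> p)" "in_hom (hom_cat C A (C0 N)) \<beta>\<^sub>1 ((x \<cdot> f) \<cdot> q) (h' \<cdot> q)"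
    unfolding xf h' by (rule b)+
  obtain \<theta> where th: "in_hom (hom_cat C A Q) \<theta> (x \<cdot> f) h'" "\<theta> \<lhd> p = \<beta>\<^sub>0" "\<theta> \<lhd> q = \<beta>\<^sub>1"
    using strict_product_lift_cell[OF Q xf(1) h'(1) b'] by blast
  have "\<exists>!a. a \<in> Arr (hom_cat C A (C1 N)) \<and> Dom2 C a = x \<and> a \<lhd> f = \<theta>"
    using D X x th(1) unfolding f_def[symmetric] discrete_opfibration_def dof_functor_def
    by (simp add: postcomp_def in_hom_hom_cat)
  moreover have "a \<lhd> f = \<theta> \<longleftrightarrow> a \<lhd> pi0 N = \<beta>\<^sub>0 \<and> a \<lhd> pi1 N = \<beta>\<^sub>1" if a: "a \<in> Arr (hom_cat C A (C1 N))" "Dom2 C a = x" for a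
  proof -
    have e: "(a \<lhd> f) \<lhd> p = a \<lhd> pi0 N" "(a \<lhd> f) \<lhd> q = a \<lhd> pi1 N"
      unfolding f(2,3)[symmetric] using a X by simp_all
    show ?thesis
    proof
      assume as: "a \<lhd> pi0 N = \<beta>\<^sub>0 \<and> a \<lhd> pi1 N = \<beta>\<^sub>1"
      \<comment> \<open>Only the domain of \<open>a\<close> is prescribed; the components also
        determine \<open>Cod2 C a \<cdot> f\<close>, which is needed before the two 2-cells into the
        product can be compared.\<close>
      then have "Cod2 C (a \<lhd> pi0 N) = h' \<cdot> p" "Cod2 C (a \<lhd> pi1 N) = h' \<cdot> q" using b' by (simp_all add: in_hom_hom_cat)
      then have "(Cod2 C a \<cdot> f) \<cdot> p = h' \<cdot> p" "(Cod2 C a \<cdot> f) \<cdot> q = h' \<cdot> q"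
        unfolding e[symmetric] using a X by simp_all
      then have "Cod2 C a \<cdot> f = h'" by (intro strict_product_eqI[OF Q _ h'(1)]) (use a X in \<open>auto simp: in_hom_def\<close>)
      then have "in_hom (hom_cat C A Q) (a \<lhd> f) (x \<cdot> f) h'" using a X by (simp add: in_hom_hom_cat)
      from strict_product_cell_eqI[OF Q this th(1)] show "a \<lhd> f = \<theta>" using e as th by metis
    next
      assume "a \<lhd> f = \<theta>"
      then show "a \<lhd> pi0 N = \<beta>\<^sub>0 \<and> a \<lhd> pi1 N = \<beta>\<^sub>1" using e th by metis
    qed
  qed
  ultimately show ?thesis by (simp only: cong: conj_cong)
qed

text \<open>The universal 2-cell is invertible because \<open>X\<close> is a groupoid, and its
  inverse is named by exactly one morphism, which justifies the description. Inverting twice returns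
  the universal 2-cell, whence the involution.\<close>

lemma arrow_reversal:
  assumes P: "arrow_object C X P ev" and X: "groupoid_obj C X"
  defines "\<tau> \<equiv> arrow_reversal C X P ev"
  shows "in_hom C \<tau> P P" "is_inverse (hom_cat C P X) (univ_cell ev) (\<tau> \<rhd> univ_cell ev)"
    "\<tau> \<cdot> \<tau> = Ide C P" "\<tau> \<cdot> fst ev 0 = fst ev 1" "\<tau> \<cdot> fst ev 1 = fst ev 0"
proof -
  note a = arrow_object_hom'[OF P] and PO = arrow_object_hom(2)[OF P]
  obtain \<beta> where b: "is_inverse (hom_cat C P X) (univ_cell ev) \<beta>"
    using groupoid_objD[OF X, of "univ_cell ev"] a by auto
  have bT: "\<beta> \<in> Cell C" "Dom2 C \<beta> = fst ev 1" "Cod2 C \<beta> = fst ev 0" using b a by (auto simp: inverse_cell_iff)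
  have "in_hom (hom_cat C P X) \<beta> (fst ev 1) (fst ev 0)" using bT a by (auto simp: in_hom_hom_cat)
  note ex = arrow_object_lift[OF P this]
  have iff: "in_hom C t P P \<and> is_inverse (hom_cat C P X) (univ_cell ev) (t \<rhd> univ_cell ev) \<longleftrightarrow>
     in_hom C t P P \<and> t \<rhd> univ_cell ev = \<beta>" for t
    using is_inverse_cell_unique[OF b] b by blast
  have "in_hom C \<tau> P P \<and> is_inverse (hom_cat C P X) (univ_cell ev) (\<tau> \<rhd> univ_cell ev)"
    unfolding \<tau>_def arrow_reversal_def iff by (rule theI'[OF ex])
  then show t: "in_hom C \<tau> P P" and i: "is_inverse (hom_cat C P X) (univ_cell ev) (\<tau> \<rhd> univ_cell ev)" by blast+
  have T: "\<tau> \<in> Arr C" "Dom C \<tau> = P" "Cod C \<tau> = P" using t by (auto simp: in_hom_def)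
  have "\<tau> \<rhd> univ_cell ev = \<beta>" using is_inverse_cell_unique[OF b i] by simp
  then have "Dom2 C (\<tau> \<rhd> univ_cell ev) = fst ev 1" "Cod2 C (\<tau> \<rhd> univ_cell ev) = fst ev 0" using bT by simp_all
  then show "\<tau> \<cdot> fst ev 0 = fst ev 1" "\<tau> \<cdot> fst ev 1 = fst ev 0" using T a by simp_all
  have "\<tau> \<rhd> (\<tau> \<rhd> univ_cell ev) = univ_cell ev"
    using is_inverse_cell_unique[OF whisker_l_inverse[OF i t] is_inverse_cell_sym[OF i]] .
  then have "(\<tau> \<cdot> \<tau>) \<rhd> univ_cell ev = Ide C P \<rhd> univ_cell ev" using T a by simp
  then show "\<tau> \<cdot> \<tau> = Ide C P"
    by (intro arrow_object_eqI[OF P, of _ P]) (use T PO in \<open>auto simp: in_hom_def\<close>)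
qed

text \<open>A discrete opfibration lifts 2-cells with prescribed domain, while here the codomain
  \<open>fst ev 1 \<cdot> ident N\<close> is prescribed. The inverse of the universal 2-cell is
  therefore lifted from that end, and the lift is inverted in the groupoid \<open>C1 N\<close>; its
  other end is the reflection.\<close>

lemma reflection_ex1:
  assumes N: "gbo_congruence C N" and P: "arrow_object C (C0 N) P ev"
  shows "\<exists>!r. in_hom C r P (C1 N) \<and> (\<exists>\<rho>. in_hom (hom_cat C P (C1 N)) \<rho> r (fst ev 1 \<cdot> ident N) \<and>
             \<rho> \<lhd> pi0 N = univ_cell ev \<and> \<rho> \<lhd> pi1 N = Ide2 C (fst ev 1))"
proof -
  have ic: "internal_category C N" and G: "groupoid_obj C (C0 N)" "groupoid_obj C (C1 N)"
    using N by (auto simp: gbo_congruence_def internal_double_category_def)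
  note n = internal_categoryD[OF ic] and a = arrow_object_hom'[OF P]
  have T: "pi0 N \<in> Arr C" "pi1 N \<in> Arr C" "ident N \<in> Arr C" "Dom C (pi0 N) = C1 N" "Dom C (pi1 N) = C1 N"
    "Cod C (pi0 N) = C0 N" "Cod C (pi1 N) = C0 N" "Dom C (ident N) = C0 N" "Cod C (ident N) = C1 N"
    using n(1-3) by (auto simp: in_hom_def)
  obtain \<beta> where b: "is_inverse (hom_cat C P (C0 N)) (univ_cell ev) \<beta>"
    using groupoid_objD[OF G(1), of "univ_cell ev"] a by auto
  have bT: "\<beta> \<in> Cell C" "Dom2 C \<beta> = fst ev 1" "Cod2 C \<beta> = fst ev 0" using b a by (auto simp: inverse_cell_iff)
  have xe: "in_hom C (fst ev 1 \<cdot> ident N) P (C1 N)" using a T by (auto simp: in_hom_def)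
  have x01: "(fst ev 1 \<cdot> ident N) \<cdot> pi0 N = fst ev 1" "(fst ev 1 \<cdot> ident N) \<cdot> pi1 N = fst ev 1"
    using a T n(8,9) by simp_all
  have b01: "in_hom (hom_cat C P (C0 N)) \<beta> ((fst ev 1 \<cdot> ident N) \<cdot> pi0 N) (fst ev 0)"
    "in_hom (hom_cat C P (C0 N)) (Ide2 C (fst ev 1)) ((fst ev 1 \<cdot> ident N) \<cdot> pi1 N) (fst ev 1)"
    unfolding x01 using bT a by (auto simp: in_hom_hom_cat)
  note ex = gbo_congruence_lift[OF N xe b01]
  then obtain \<sigma> where s: "\<sigma> \<in> Arr (hom_cat C P (C1 N))" "Dom2 C \<sigma> = fst ev 1 \<cdot> ident N" "\<sigma> \<lhd> pi0 N = \<beta>" "\<sigma> \<lhd> pi1 N = Ide2 C (fst ev 1)"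
    by blast
  have sC: "\<sigma> \<in> Cell C" "Dom C (Dom2 C \<sigma>) = P" "Cod C (Dom2 C \<sigma>) = C1 N" using s by auto
  obtain \<rho> where r: "is_inverse (hom_cat C P (C1 N)) \<sigma> \<rho>" using groupoid_objD[OF G(2), of \<sigma>] sC by auto
  have i1: "is_inverse (hom_cat C P (C0 N)) (Ide2 C (fst ev 1)) (Ide2 C (fst ev 1))"
    by (rule is_inverse_Ide2) (use a in \<open>auto simp: in_hom_def\<close>)
  \<comment> \<open>Inversion exchanges lifts of \<beta> with lifts of the universal 2-cell, so
    uniqueness of the former gives uniqueness of the latter.\<close>
  have inv: "x \<lhd> pi0 N = univ_cell ev \<and> x \<lhd> pi1 N = Ide2 C (fst ev 1) \<longleftrightarrow> y \<lhd> pi0 N = \<beta> \<and> y \<lhd> pi1 N = Ide2 C (fst ev 1)"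
    if "is_inverse (hom_cat C P (C1 N)) x y" for x y
    using whisker_r_inverse[OF that n(1)] whisker_r_inverse[OF that n(2)] b i1 is_inverse_cell_unique is_inverse_cell_sym
    by metis
  have rT: "\<rho> \<in> Cell C" "Cod2 C \<rho> = fst ev 1 \<cdot> ident N" "Dom2 C \<rho> = Cod2 C \<sigma>" using r s by (auto simp: inverse_cell_iff)
  have rr: "in_hom (hom_cat C P (C1 N)) \<rho> (Cod2 C \<sigma>) (fst ev 1 \<cdot> ident N)" using rT sC by (simp add: in_hom_hom_cat)
  have "\<rho> \<lhd> pi0 N = univ_cell ev \<and> \<rho> \<lhd> pi1 N = Ide2 C (fst ev 1)"
    using inv[OF is_inverse_cell_sym[OF r]] s by blast
  moreover have "in_hom C (Cod2 C \<sigma>) P (C1 N)" using sC by (simp add: in_hom_def)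
  moreover have "r' = Cod2 C \<sigma>" if "in_hom C r' P (C1 N)" and r': "in_hom (hom_cat C P (C1 N)) \<rho>' r' (fst ev 1 \<cdot> ident N)"
     "\<rho>' \<lhd> pi0 N = univ_cell ev \<and> \<rho>' \<lhd> pi1 N = Ide2 C (fst ev 1)" for r' \<rho>'
  proof -
    have r'T: "\<rho>' \<in> Cell C" "Dom2 C \<rho>' = r'" "Cod2 C \<rho>' = fst ev 1 \<cdot> ident N" "Dom C (Dom2 C \<rho>') = P" "Cod C (Dom2 C \<rho>') = C1 N"
      using r'(1) by (auto simp: in_hom_def)
    obtain \<sigma>' where s': "is_inverse (hom_cat C P (C1 N)) \<rho>' \<sigma>'" using groupoid_objD[OF G(2), of \<rho>'] r'T by auto
    have "\<sigma>' \<in> Arr (hom_cat C P (C1 N))" "Dom2 C \<sigma>' = fst ev 1 \<cdot> ident N" "Cod2 C \<sigma>' = r'"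
      using s' r'T xe by (auto simp: inverse_cell_iff in_hom_def)
    moreover have "\<sigma>' \<lhd> pi0 N = \<beta> \<and> \<sigma>' \<lhd> pi1 N = Ide2 C (fst ev 1)" using inv[OF s'] r'(2) by blast
    ultimately have "\<sigma>' = \<sigma>" using ex s by blast
    then show ?thesis using \<open>Cod2 C \<sigma>' = r'\<close> by simp
  qed
  ultimately show ?thesis using rr by blast
qed

text \<open>The condition on the pairing into a chosen product is replaced by conditions on
  \<open>pi0 N\<close> and \<open>pi1 N\<close>, so that the reflections of a congruence and of its
  opposite become comparable.\<close>

lemma reflection_eq:
  assumes N: "gbo_congruence C N" and P: "arrow_object C (C0 N) P ev" and Q: "strict_product C (C0 N) (C0 N) Q p q"
  shows "reflection C N p q P ev = (THE r. in_hom C r P (C1 N) \<and>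
     (\<exists>\<rho>. in_hom (hom_cat C P (C1 N)) \<rho> r (fst ev 1 \<cdot> ident N) \<and>
             \<rho> \<lhd> pi0 N = univ_cell ev \<and> \<rho> \<lhd> pi1 N = Ide2 C (fst ev 1)))"
proof -
  have ic: "internal_category C N"
    using N by (auto simp: gbo_congruence_def internal_double_category_def)
  note n = internal_categoryD[OF ic] and a = arrow_object_hom'[OF P] and pq = strict_product_hom[OF Q]
  define f where "f = pairing C p q (pi0 N) (pi1 N)"
  note f = strict_product_pairing[OF Q n(1,2), folded f_def]
  have T: "pi0 N \<in> Arr C" "pi1 N \<in> Arr C" "Dom C (pi0 N) = C1 N" "Dom C (pi1 N) = C1 N"
    "Cod C (pi0 N) = C0 N" "Cod C (pi1 N) = C0 N" "f \<in> Arr C" "Dom C f = C1 N" "Cod C f = Q"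
    "p \<in> Arr C" "q \<in> Arr C" "Dom C p = Q" "Dom C q = Q" "Cod C p = C0 N" "Cod C q = C0 N"
    using n(1,2) f(1) pq by (auto simp: in_hom_def)
  have ee: "in_hom C (fst ev 0) P (C0 N)" "in_hom C (fst ev 1) P (C0 N)" using a by (auto simp: in_hom_def)
  obtain h where h: "in_hom C h P Q" "h \<cdot> p = fst ev 0" "h \<cdot> q = fst ev 1" using strict_product_lift[OF Q ee] by blast
  obtain h' where h': "in_hom C h' P Q" "h' \<cdot> p = fst ev 1" "h' \<cdot> q = fst ev 1" using strict_product_lift[OF Q ee(2,2)] by blast
  have c: "in_hom (hom_cat C P (C0 N)) (univ_cell ev) (h \<cdot> p) (h' \<cdot> p)"
    "in_hom (hom_cat C P (C0 N)) (Ide2 C (fst ev 1)) (h \<cdot> q) (h' \<cdot> q)"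
    unfolding h h' using a by (auto simp: in_hom_hom_cat)
  note pr = strict_product_pairing2[OF Q h(1) h'(1) c]
  have "\<rho> \<lhd> f = pairing2 C p q (univ_cell ev) (Ide2 C (fst ev 1)) \<longleftrightarrow>
     \<rho> \<lhd> pi0 N = univ_cell ev \<and> \<rho> \<lhd> pi1 N = Ide2 C (fst ev 1)"
    if r: "in_hom (hom_cat C P (C1 N)) \<rho> r (fst ev 1 \<cdot> ident N)" for r \<rho>
  proof -
    have R: "\<rho> \<in> Cell C" "Dom C (Dom2 C \<rho>) = P" "Cod C (Dom2 C \<rho>) = C1 N" using r by (auto simp: in_hom_def)
    have e: "(\<rho> \<lhd> f) \<lhd> p = \<rho> \<lhd> pi0 N" "(\<rho> \<lhd> f) \<lhd> q = \<rho> \<lhd> pi1 N"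
      unfolding f(2,3)[symmetric] using R T by simp_all
    show ?thesis
    proof
      assume "\<rho> \<lhd> f = pairing2 C p q (univ_cell ev) (Ide2 C (fst ev 1))"
      then show "\<rho> \<lhd> pi0 N = univ_cell ev \<and> \<rho> \<lhd> pi1 N = Ide2 C (fst ev 1)" using e pr(2,3) by metis
    next
      assume as: "\<rho> \<lhd> pi0 N = univ_cell ev \<and> \<rho> \<lhd> pi1 N = Ide2 C (fst ev 1)"
      have F: "\<rho> \<lhd> f \<in> Cell C" "in_hom C (Dom2 C (\<rho> \<lhd> f)) P Q" "in_hom C (Cod2 C (\<rho> \<lhd> f)) P Q" using R T by (auto simp: in_hom_def)
      have "Dom2 C (\<rho> \<lhd> f) \<cdot> p = Dom2 C ((\<rho> \<lhd> f) \<lhd> p)" "Dom2 C (\<rho> \<lhd> f) \<cdot> q = Dom2 C ((\<rho> \<lhd> f) \<lhd> q)"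
        "Cod2 C (\<rho> \<lhd> f) \<cdot> p = Cod2 C ((\<rho> \<lhd> f) \<lhd> p)" "Cod2 C (\<rho> \<lhd> f) \<cdot> q = Cod2 C ((\<rho> \<lhd> f) \<lhd> q)"
        using R T by simp_all
      then have "Dom2 C (\<rho> \<lhd> f) \<cdot> p = h \<cdot> p" "Dom2 C (\<rho> \<lhd> f) \<cdot> q = h \<cdot> q" "Cod2 C (\<rho> \<lhd> f) \<cdot> p = h' \<cdot> p" "Cod2 C (\<rho> \<lhd> f) \<cdot> q = h' \<cdot> q"
        unfolding e h h' using as a by simp_all
      then have "Dom2 C (\<rho> \<lhd> f) = h" "Cod2 C (\<rho> \<lhd> f) = h'"
        using strict_product_eqI[OF Q F(2) h(1)] strict_product_eqI[OF Q F(3) h'(1)] by blast+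
      then have "in_hom (hom_cat C P Q) (\<rho> \<lhd> f) h h'" using F by (auto simp: in_hom_def)
      from pr(4)[OF this] show "\<rho> \<lhd> f = pairing2 C p q (univ_cell ev) (Ide2 C (fst ev 1))" using e as by simp
    qed
  qed
  then show ?thesis unfolding reflection_def f_def[symmetric] by (metis (no_types, lifting))
qed

text \<open>The top and the left side of the opposite square are the original ones precomposed with
  \<tau>. The other two sides are unchanged once the projections of the products and of the object
  of triples are exchanged.\<close>

lemma complete_congruence_op:
  assumes "complete_congruence C N"
  shows "complete_congruence C (op_intcat N)"
proof -
  have gbo: "gbo_congruence C N" using assms by (simp add: complete_congruence_def)
  have ic: "internal_category C N" and G: "groupoid_obj C (C0 N)" "groupoid_obj C (C1 N)"
    using gbo by (auto simp: gbo_congruence_def internal_double_category_def)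
  note n = internal_categoryD[OF ic] and gbo' = gbo_congruence_op[OF gbo]
  obtain Q p q R s t u v P ev where
    Q: "strict_product C (C0 N) (C0 N) Q p q" and R: "strict_product C (C1 N) (C1 N) R s t" and
    uv: "pullback_square C u v (pi12 N) (pi01 N)" and P: "arrow_object C (C0 N) P ev" and
    pb: "strict_pullback C (triple C N u v (reflection C N p q P ev) (arrow_reversal C (C0 N) P ev \<cdot> reflection C N p q P ev)
          (reflection C N p q P ev)) (pairing C p q (fst ev 0) (fst ev 1))
        (pairing C s t (u \<cdot> pi02 N) (v \<cdot> pi02 N)) (pairing C s t (p \<cdot> ident N) (q \<cdot> ident N))"
    using assms unfolding complete_congruence_def Let_def by blast
  note a = arrow_object_hom'[OF P] and PO = arrow_object_hom(2)[OF P]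
  define \<tau> where "\<tau> = arrow_reversal C (C0 N) P ev"
  note \<tau> = arrow_reversal[OF P G(1), folded \<tau>_def]
  define r where "r = reflection C N p q P ev"
  have "in_hom C r P (C1 N) \<and> (\<exists>\<rho>. in_hom (hom_cat C P (C1 N)) \<rho> r (fst ev 1 \<cdot> ident N) \<and>
             \<rho> \<lhd> pi0 N = univ_cell ev \<and> \<rho> \<lhd> pi1 N = Ide2 C (fst ev 1))"
    unfolding r_def reflection_eq[OF gbo P Q] by (rule theI'[OF reflection_ex1[OF gbo P]])
  then obtain \<rho> where r: "in_hom C r P (C1 N)" "in_hom (hom_cat C P (C1 N)) \<rho> r (fst ev 1 \<cdot> ident N)"
      "\<rho> \<lhd> pi0 N = univ_cell ev" "\<rho> \<lhd> pi1 N = Ide2 C (fst ev 1)" by blast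
  have T: "\<tau> \<in> Arr C" "Dom C \<tau> = P" "Cod C \<tau> = P" "r \<in> Arr C" "Dom C r = P" "Cod C r = C1 N" "\<rho> \<in> Cell C"
     "Dom2 C \<rho> = r" "Cod2 C \<rho> = fst ev 1 \<cdot> ident N"
    "pi0 N \<in> Arr C" "pi1 N \<in> Arr C" "ident N \<in> Arr C" "Dom C (pi0 N) = C1 N" "Dom C (pi1 N) = C1 N"
    "Cod C (pi0 N) = C0 N" "Cod C (pi1 N) = C0 N" "Dom C (ident N) = C0 N" "Cod C (ident N) = C1 N"
    using \<tau>(1) r(1,2) n(1-3) by (auto simp: in_hom_def)
  have "Dom2 C (\<rho> \<lhd> pi0 N) = r \<cdot> pi0 N" "Dom2 C (\<rho> \<lhd> pi1 N) = r \<cdot> pi1 N" using T by simp_all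
  then have r01: "r \<cdot> pi0 N = fst ev 0" "r \<cdot> pi1 N = fst ev 1" unfolding r using a by simp_all
  \<comment> \<open>The 2-cell exhibiting \<open>\<tau> \<cdot> r\<close> as reflection of the
    opposite: its component at \<open>pi0 N\<close> is an identity and that at \<open>pi1 N\<close>
    is the universal 2-cell, as required after exchanging source and target.\<close>
  define \<rho>' where "\<rho>' = (\<tau> \<rhd> \<rho>) \<bullet> (univ_cell ev \<lhd> ident N)"
  have te: "\<tau> \<cdot> (fst ev 1 \<cdot> ident N) = fst ev 0 \<cdot> ident N"
  proof -
    have "\<tau> \<cdot> (fst ev 1 \<cdot> ident N) = (\<tau> \<cdot> fst ev 1) \<cdot> ident N" by (rule comp_assoc'[symmetric]) (use T a in simp_all)
    then show ?thesis by (simp only: \<tau>(5))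
  qed
  have \<rho>': "in_hom (hom_cat C P (C1 N)) \<rho>' (\<tau> \<cdot> r) (fst ev 1 \<cdot> ident N)"
    unfolding \<rho>'_def using T a te by (simp add: in_hom_hom_cat)
  have "\<rho>' \<lhd> pi0 N = (\<tau> \<rhd> (\<rho> \<lhd> pi0 N)) \<bullet> (univ_cell ev \<lhd> (ident N \<cdot> pi0 N))"
    "\<rho>' \<lhd> pi1 N = (\<tau> \<rhd> (\<rho> \<lhd> pi1 N)) \<bullet> (univ_cell ev \<lhd> (ident N \<cdot> pi1 N))"
    unfolding \<rho>'_def using T(1-18) a te by simp_all
  then have "\<rho>' \<lhd> pi0 N = (\<tau> \<rhd> univ_cell ev) \<bullet> univ_cell ev" "\<rho>' \<lhd> pi1 N = Ide2 C (fst ev 0) \<bullet> univ_cell ev"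
    unfolding r n using T a \<tau>(5) by simp_all
  then have "\<rho>' \<lhd> pi0 N = Ide2 C (fst ev 1)" "\<rho>' \<lhd> pi1 N = univ_cell ev"
    using \<tau>(2) a by (auto simp: inverse_cell_iff)
  then have "in_hom C (\<tau> \<cdot> r) P (C1 (op_intcat N)) \<and> (\<exists>\<rho>. in_hom (hom_cat C P (C1 (op_intcat N))) \<rho> (\<tau> \<cdot> r) (fst ev 1 \<cdot> ident (op_intcat N)) \<and>
             \<rho> \<lhd> pi0 (op_intcat N) = univ_cell ev \<and> \<rho> \<lhd> pi1 (op_intcat N) = Ide2 C (fst ev 1))"
    using \<rho>' T by (auto simp: in_hom_def)
  moreover have Q': "strict_product C (C0 (op_intcat N)) (C0 (op_intcat N)) Q q p" and
    P': "arrow_object C (C0 (op_intcat N)) P ev" and R': "strict_product C (C1 (op_intcat N)) (C1 (op_intcat N)) R t s" and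
    uv': "pullback_square C v u (pi12 (op_intcat N)) (pi01 (op_intcat N))"
    using strict_product_swap[OF Q] strict_product_swap[OF R] P pullback_square_swap[OF uv] by simp_all
  ultimately have r': "reflection C (op_intcat N) q p P ev = \<tau> \<cdot> r"
    unfolding reflection_eq[OF gbo' P' Q'] using reflection_ex1[OF gbo' P'] by (blast intro: the1_equality)
  note pq = strict_product_hom[OF Q] and sth = strict_product_hom[OF R] and uvh = pullback_square_hom[OF uv]
  have p1h: "pi01 N \<in> Arr C" "pi12 N \<in> Arr C" "Dom C (pi01 N) = C2 N" "Dom C (pi12 N) = C2 N" "Cod C (pi01 N) = C1 N" "Cod C (pi12 N) = C1 N"
     "pi02 N \<in> Arr C" "Dom C (pi02 N) = C2 N" "Cod C (pi02 N) = C1 N"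
    using n(4-6) by (auto simp: in_hom_def)
  have D: "Dom C p = Dom C q" "Dom C s = Dom C t" "Dom C u = Dom C v" "Dom C (fst ev 0) = Dom C (fst ev 1)"
    "Dom C (pi01 N) = Dom C (pi12 N)" "Dom C (u \<cdot> pi02 N) = Dom C (v \<cdot> pi02 N)" "Dom C (p \<cdot> ident N) = Dom C (q \<cdot> ident N)"
    "Dom C r = Dom C (\<tau> \<cdot> r)"
    using pq sth uvh a T p1h by (auto simp: in_hom_def)
  \<comment> \<open>The two halves of the triple; \<tau> exchanges them, so reversing the triple
    amounts to precomposition with \<tau>.\<close>
  define x y where "x = pairing C (pi01 N) (pi12 N) r (\<tau> \<cdot> r)" and "y = pairing C (pi01 N) (pi12 N) (\<tau> \<cdot> r) r"
  have "\<tau> \<cdot> (\<tau> \<cdot> r) = (\<tau> \<cdot> \<tau>) \<cdot> r" by (rule comp_assoc'[symmetric]) (use T in simp_all)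
  then have ttr: "\<tau> \<cdot> (\<tau> \<cdot> r) = r" using \<tau>(3) T by simp
  have tr: "(\<tau> \<cdot> r) \<cdot> pi0 N = fst ev 1" "(\<tau> \<cdot> r) \<cdot> pi1 N = fst ev 0" using T r01 \<tau>(4,5) by simp_all
  have c: "r \<cdot> pi1 N = (\<tau> \<cdot> r) \<cdot> pi0 N" "(\<tau> \<cdot> r) \<cdot> pi1 N = r \<cdot> pi0 N" unfolding tr r01 by simp_all
  have rh: "in_hom C r P (Dom C (pi1 N))" "in_hom C r P (Dom C (pi0 N))" "in_hom C (\<tau> \<cdot> r) P (Dom C (pi1 N))" "in_hom C (\<tau> \<cdot> r) P (Dom C (pi0 N))"
    using T by (auto simp: in_hom_def)
  note xh = pullback_pairing_hom[OF n(7) rh(1,4) c(1), folded x_def] and yh = pullback_pairing_hom[OF n(7) rh(3,2) c(2), folded y_def]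
  have xyh: "x \<in> Arr C" "y \<in> Arr C" "Dom C x = P" "Dom C y = P" "Cod C x = C2 N" "Cod C y = C2 N"
    using xh(1) yh(1) p1h by (auto simp: in_hom_def)
  have txy: "\<tau> \<cdot> x = y" "\<tau> \<cdot> y = x"
    using comp_pullback_pairing[OF n(7) rh(1,4) c(1) \<tau>(1)] comp_pullback_pairing[OF n(7) rh(3,2) c(2) \<tau>(1)]
    unfolding x_def y_def ttr by simp_all
  have "triple C (op_intcat N) v u (\<tau> \<cdot> r) (\<tau> \<cdot> (\<tau> \<cdot> r)) (\<tau> \<cdot> r) = pairing C v u x y"
    unfolding triple_def ttr op_intcat_simps x_def y_def
    using pairing_swap[OF D(8) D(5)] pairing_swap[OF D(8)[symmetric] D(5)] by simp
  also have "\<dots> = pairing C u v y x" using xyh D(3) by (simp add: pairing_swap)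
  also have "\<dots> = \<tau> \<cdot> pairing C u v x y"
  proof -
    have h: "in_hom C x P (Dom C (pi12 N))" "in_hom C y P (Dom C (pi01 N))" using xyh p1h by (auto simp: in_hom_def)
    from comp_pullback_pairing[OF uv h _ \<tau>(1)] show ?thesis unfolding txy using xh yh by simp
  qed
  also have "pairing C u v x y = triple C N u v r (\<tau> \<cdot> r) r" by (simp add: triple_def x_def y_def)
  finally have e1: "triple C (op_intcat N) v u (\<tau> \<cdot> r) (\<tau> \<cdot> (\<tau> \<cdot> r)) (\<tau> \<cdot> r) = \<tau> \<cdot> triple C N u v r (\<tau> \<cdot> r) r" .
  have eh: "in_hom C (fst ev 0) P (C0 N)" "in_hom C (fst ev 1) P (C0 N)" using a by (auto simp: in_hom_def)
  note pe = strict_product_pairing[OF Q eh]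
  have "pairing C q p (fst ev 0) (fst ev 1) = pairing C p q (fst ev 1) (fst ev 0)" using D by (simp add: pairing_swap)
  also have "\<dots> = \<tau> \<cdot> pairing C p q (fst ev 0) (fst ev 1)"
  proof (rule strict_product_pairing_eqI[OF Q])
    show "in_hom C (\<tau> \<cdot> pairing C p q (fst ev 0) (fst ev 1)) P Q" using pe(1) T by (auto simp: in_hom_def)
    have "(\<tau> \<cdot> pairing C p q (fst ev 0) (fst ev 1)) \<cdot> p = \<tau> \<cdot> (pairing C p q (fst ev 0) (fst ev 1) \<cdot> p)"
      "(\<tau> \<cdot> pairing C p q (fst ev 0) (fst ev 1)) \<cdot> q = \<tau> \<cdot> (pairing C p q (fst ev 0) (fst ev 1) \<cdot> q)"
      using pe(1) T pq by (simp_all add: in_hom_def)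
    then show "(\<tau> \<cdot> pairing C p q (fst ev 0) (fst ev 1)) \<cdot> p = fst ev 1" "(\<tau> \<cdot> pairing C p q (fst ev 0) (fst ev 1)) \<cdot> q = fst ev 0"
      unfolding pe \<tau> by simp_all
  qed
  finally have e2: "pairing C q p (fst ev 0) (fst ev 1) = \<tau> \<cdot> pairing C p q (fst ev 0) (fst ev 1)" .
  have e3: "pairing C t s (v \<cdot> pi02 N) (u \<cdot> pi02 N) = pairing C s t (u \<cdot> pi02 N) (v \<cdot> pi02 N)"
    "pairing C t s (q \<cdot> ident N) (p \<cdot> ident N) = pairing C s t (p \<cdot> ident N) (q \<cdot> ident N)"
    using pairing_swap[OF D(6) D(2)] pairing_swap[OF D(7) D(2)] by simp_all
  define tr where "tr = triple C N u v r (\<tau> \<cdot> r) r"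
  have "in_hom C x P (Dom C (pi12 N))" "in_hom C y P (Dom C (pi01 N))" using xyh p1h by (auto simp: in_hom_def)
  from pullback_pairing_hom(1)[OF uv this] have "Dom C tr = P"
    using xh yh by (simp add: tr_def triple_def x_def[symmetric] y_def[symmetric] in_hom_def)
  then have "strict_pullback C (\<tau> \<cdot> tr) (\<tau> \<cdot> pairing C p q (fst ev 0) (fst ev 1))
     (pairing C s t (u \<cdot> pi02 N) (v \<cdot> pi02 N)) (pairing C s t (p \<cdot> ident N) (q \<cdot> ident N))"
    using strict_pullback_precomp[OF pb[folded r_def \<tau>_def, folded tr_def]] \<tau>(1,3) by simp
  then have "strict_pullback C (triple C (op_intcat N) v u (\<tau> \<cdot> r) (\<tau> \<cdot> (\<tau> \<cdot> r)) (\<tau> \<cdot> r)) (pairing C q p (fst ev 0) (fst ev 1))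
        (pairing C t s (v \<cdot> pi02 N) (u \<cdot> pi02 N)) (pairing C t s (q \<cdot> ident N) (p \<cdot> ident N))"
    unfolding e1 e2 e3 tr_def .
  then have "let r = reflection C (op_intcat N) q p P ev;
             \<tau> = arrow_reversal C (C0 (op_intcat N)) P ev
         in strict_pullback C
              (triple C (op_intcat N) v u r (\<tau> \<cdot> r) r)
              (pairing C q p (fst ev 0) (fst ev 1))
              (pairing C t s (v \<cdot> pi02 (op_intcat N)) (u \<cdot> pi02 (op_intcat N)))
              (pairing C t s (q \<cdot> ident (op_intcat N)) (p \<cdot> ident (op_intcat N)))"
    unfolding Let_def r' op_intcat_simps \<tau>_def .
  then show ?thesis unfolding complete_congruence_def using gbo' Q' R' uv' P' by blast
qed

end

subsection \<open>Opposites of morphisms and 2-cells out of groupoids\<close>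

text \<open>Both objects are presented by the same \<open>C0 N\<close> and \<open>C1 N\<close>, so
  morphisms and 2-cells from a groupoid into \<open>X\<close> correspond bijectively to those into
  \<open>X\<^sub>o\<close>, with 2-cells reversed. The pullback \<open>composable\<close> is
  recorded separately because a presentation keeps only equations between the structure maps; it
  turns matching lifts to \<open>C1 N\<close> into a lift to \<open>C2 N\<close>.\<close>

locale opposed_presentations = two_category C for C :: "('o, 'm, 'c) twocat" (structure) +
  fixes N :: "('o, 'm) intcat" and X X\<^sub>o :: 'o and \<gamma> \<gamma>\<^sub>o :: 'm and \<gamma>\<^sub>0\<^sub>1 \<gamma>\<^sub>o\<^sub>0\<^sub>1 :: 'c
  assumes pres: "nerve_presentation C X N \<gamma> \<gamma>\<^sub>0\<^sub>1"
    and pres_op: "nerve_presentation C X\<^sub>o (op_intcat N) \<gamma>\<^sub>o \<gamma>\<^sub>o\<^sub>0\<^sub>1"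
    and composable: "pullback_square C (pi01 N) (pi12 N) (pi1 N) (pi0 N)"
begin

abbreviation opm :: "'m \<Rightarrow> 'm" where "opm \<equiv> op1 C \<gamma> \<gamma>\<^sub>o"
abbreviation opc :: "'c \<Rightarrow> 'c" where "opc \<equiv> op2 C N \<gamma>\<^sub>0\<^sub>1 \<gamma>\<^sub>o\<^sub>0\<^sub>1"

lemmas T = nerve_presentation_type[OF pres]
lemmas To = nerve_presentation_type[OF pres_op, unfolded op_intcat_simps]
lemmas D = nerve_presentationD[OF pres]
lemmas Do = nerve_presentationD[OF pres_op, unfolded op_intcat_simps]

lemma op1_eqI:
  assumes A: "groupoid_obj C A" and h: "in_hom C h A (C0 N)" "h \<cdot> \<gamma> = f"
  shows "opm f = h \<cdot> \<gamma>\<^sub>o"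
proof -
  have f: "in_hom C f A X" using h T by (auto simp: in_hom_def)
  have "\<exists>!h. in_hom C h A (C0 N) \<and> h \<cdot> \<gamma> = f" by (rule D(15)[OF A f])
  then have "lift_along C \<gamma> f = h" using h f T unfolding lift_along_def in_hom_def by (auto intro: the1_equality)
  then show ?thesis by (simp add: op1_def)
qed

lemma op2_eqI:
  assumes A: "groupoid_obj C A" and a: "in_hom C a A (C1 N)" "a \<rhd> \<gamma>\<^sub>0\<^sub>1 = \<alpha>"
  shows "opc \<alpha> = a \<rhd> \<gamma>\<^sub>o\<^sub>0\<^sub>1"
proof -
  have \<alpha>: "\<alpha> \<in> Arr (hom_cat C A X)" using a T by (auto simp: in_hom_def)
  have "\<exists>!a. in_hom C a A (C1 N) \<and> a \<rhd> \<gamma>\<^sub>0\<^sub>1 = \<alpha>" by (rule D(16)[OF A \<alpha>])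
  then have "(THE a. in_hom C a (Dom C (Dom2 C \<alpha>)) (C1 N) \<and> a \<rhd> \<gamma>\<^sub>0\<^sub>1 = \<alpha>) = a"
    using a \<alpha> by (auto intro: the1_equality)
  then show ?thesis by (simp add: op2_def)
qed

lemma lift_ex:
  assumes "groupoid_obj C A" "in_hom C f A X"
  obtains h where "in_hom C h A (C0 N)" "h \<cdot> \<gamma> = f" "opm f = h \<cdot> \<gamma>\<^sub>o"
  using D(15)[OF assms] op1_eqI[OF assms(1)] by blast

lemma lift_eqI:
  assumes "groupoid_obj C A" "in_hom C h A (C0 N)" "in_hom C h' A (C0 N)" "h \<cdot> \<gamma> = h' \<cdot> \<gamma>"
  shows "h = h'"
proof -
  have "in_hom C (h \<cdot> \<gamma>) A X" using assms(2) T by (auto simp: in_hom_def)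
  from D(15)[OF assms(1) this] assms show ?thesis by metis
qed

lemma lift_op_eqI:
  assumes "groupoid_obj C A" "in_hom C h A (C0 N)" "in_hom C h' A (C0 N)" "h \<cdot> \<gamma>\<^sub>o = h' \<cdot> \<gamma>\<^sub>o"
  shows "h = h'"
proof -
  have "in_hom C (h \<cdot> \<gamma>\<^sub>o) A X\<^sub>o" using assms(2) To by (auto simp: in_hom_def)
  from Do(15)[OF assms(1) this] assms show ?thesis by metis
qed

lemma lift_cell_ex:
  assumes A: "groupoid_obj C A" and \<alpha>: "in_hom (hom_cat C A X) \<alpha> f' f"
  obtains a where "in_hom C a A (C1 N)" "a \<rhd> \<gamma>\<^sub>0\<^sub>1 = \<alpha>" "opc \<alpha> = a \<rhd> \<gamma>\<^sub>o\<^sub>0\<^sub>1"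
    "(a \<cdot> pi0 N) \<cdot> \<gamma> = f'" "(a \<cdot> pi1 N) \<cdot> \<gamma> = f" "opm f' = (a \<cdot> pi0 N) \<cdot> \<gamma>\<^sub>o" "opm f = (a \<cdot> pi1 N) \<cdot> \<gamma>\<^sub>o"
proof -
  have "\<alpha> \<in> Arr (hom_cat C A X)" using \<alpha> by (auto simp: in_hom_def)
  then obtain a where a: "in_hom C a A (C1 N)" "a \<rhd> \<gamma>\<^sub>0\<^sub>1 = \<alpha>" using D(16)[OF A] by blast
  have aT: "a \<in> Arr C" "Dom C a = A" "Cod C a = C1 N" using a by (auto simp: in_hom_def)
  have "Dom2 C (a \<rhd> \<gamma>\<^sub>0\<^sub>1) = (a \<cdot> pi0 N) \<cdot> \<gamma>" "Cod2 C (a \<rhd> \<gamma>\<^sub>0\<^sub>1) = (a \<cdot> pi1 N) \<cdot> \<gamma>" using aT T by simp_all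
  then have e: "(a \<cdot> pi0 N) \<cdot> \<gamma> = f'" "(a \<cdot> pi1 N) \<cdot> \<gamma> = f" unfolding a(2) using \<alpha> by (simp_all add: in_hom_def)
  have "in_hom C (a \<cdot> pi0 N) A (C0 N)" "in_hom C (a \<cdot> pi1 N) A (C0 N)" using aT T by (auto simp: in_hom_def)
  from op1_eqI[OF A this(1) e(1)] op1_eqI[OF A this(2) e(2)] show ?thesis
    using a op2_eqI[OF A a] e by (intro that[of a]) simp_all
qed

lemma op1_hom:
  assumes "groupoid_obj C A" "in_hom C f A X"
  shows "in_hom C (opm f) A X\<^sub>o"
proof -
  obtain h where "in_hom C h A (C0 N)" "opm f = h \<cdot> \<gamma>\<^sub>o" by (rule lift_ex[OF assms])
  then show ?thesis using To by (auto simp: in_hom_def)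
qed

lemma op1_comp:
  assumes A: "groupoid_obj C A" "groupoid_obj C A'" and f: "in_hom C f A X" and k: "in_hom C k A' A"
  shows "opm (k \<cdot> f) = k \<cdot> opm f"
proof -
  obtain h where h: "in_hom C h A (C0 N)" "h \<cdot> \<gamma> = f" "opm f = h \<cdot> \<gamma>\<^sub>o" by (rule lift_ex[OF A(1) f])
  have "in_hom C (k \<cdot> h) A' (C0 N)" "(k \<cdot> h) \<cdot> \<gamma> = k \<cdot> (h \<cdot> \<gamma>)" "(k \<cdot> h) \<cdot> \<gamma>\<^sub>o = k \<cdot> (h \<cdot> \<gamma>\<^sub>o)"
    using h(1) k T To by (auto simp: in_hom_def)
  then show ?thesis using op1_eqI[OF A(2), of "k \<cdot> h" "k \<cdot> f"] by (simp add: h)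
qed

lemma op1_inject:
  assumes A: "groupoid_obj C A" and f: "in_hom C f A X" "in_hom C f' A X" and e: "opm f = opm f'"
  shows "f = f'"
proof -
  obtain h where h: "in_hom C h A (C0 N)" "h \<cdot> \<gamma> = f" "opm f = h \<cdot> \<gamma>\<^sub>o" by (rule lift_ex[OF A f(1)])
  obtain h' where h': "in_hom C h' A (C0 N)" "h' \<cdot> \<gamma> = f'" "opm f' = h' \<cdot> \<gamma>\<^sub>o" by (rule lift_ex[OF A f(2)])
  have "h = h'" by (rule lift_op_eqI[OF A h(1) h'(1)]) (use e h h' in simp)
  then show ?thesis using h h' by simp
qed

lemma op1_surj:
  assumes A: "groupoid_obj C A" and g: "in_hom C g A X\<^sub>o"
  obtains f where "in_hom C f A X" "opm f = g"
proof -
  obtain h where h: "in_hom C h A (C0 N)" "h \<cdot> \<gamma>\<^sub>o = g" using Do(15)[OF A g] by blast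
  then have "in_hom C (h \<cdot> \<gamma>) A X" using T by (auto simp: in_hom_def)
  with op1_eqI[OF A h(1)] h(2) that show ?thesis by blast
qed

lemma op2_hom:
  assumes A: "groupoid_obj C A" and \<alpha>: "in_hom (hom_cat C A X) \<alpha> f' f"
  shows "in_hom (hom_cat C A X\<^sub>o) (opc \<alpha>) (opm f) (opm f')"
proof -
  obtain a where a: "in_hom C a A (C1 N)" "opc \<alpha> = a \<rhd> \<gamma>\<^sub>o\<^sub>0\<^sub>1" "opm f' = (a \<cdot> pi0 N) \<cdot> \<gamma>\<^sub>o" "opm f = (a \<cdot> pi1 N) \<cdot> \<gamma>\<^sub>o"
    by (rule lift_cell_ex[OF A \<alpha>])
  then show ?thesis using T To by (simp add: in_hom_def)
qed

lemma op2_whisker: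
  assumes A: "groupoid_obj C A" "groupoid_obj C A'" and \<alpha>: "in_hom (hom_cat C A X) \<alpha> f' f" and k: "in_hom C k A' A"
  shows "opc (k \<rhd> \<alpha>) = k \<rhd> opc \<alpha>"
proof -
  obtain a where a: "in_hom C a A (C1 N)" "a \<rhd> \<gamma>\<^sub>0\<^sub>1 = \<alpha>" "opc \<alpha> = a \<rhd> \<gamma>\<^sub>o\<^sub>0\<^sub>1"
    by (rule lift_cell_ex[OF A(1) \<alpha>])
  have "in_hom C (k \<cdot> a) A' (C1 N)" "(k \<cdot> a) \<rhd> \<gamma>\<^sub>0\<^sub>1 = k \<rhd> (a \<rhd> \<gamma>\<^sub>0\<^sub>1)" "(k \<cdot> a) \<rhd> \<gamma>\<^sub>o\<^sub>0\<^sub>1 = k \<rhd> (a \<rhd> \<gamma>\<^sub>o\<^sub>0\<^sub>1)"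
    using a(1) k T To by (auto simp: in_hom_def)
  then show ?thesis using op2_eqI[OF A(2), of "k \<cdot> a" "k \<rhd> \<alpha>"] by (simp add: a)
qed

lemma op2_inject:
  assumes A: "groupoid_obj C A" and \<alpha>: "in_hom (hom_cat C A X) \<alpha> f' f" "in_hom (hom_cat C A X) \<alpha>' f' f" and e: "opc \<alpha> = opc \<alpha>'"
  shows "\<alpha> = \<alpha>'"
proof -
  obtain a where a: "in_hom C a A (C1 N)" "a \<rhd> \<gamma>\<^sub>0\<^sub>1 = \<alpha>" "opc \<alpha> = a \<rhd> \<gamma>\<^sub>o\<^sub>0\<^sub>1"
    by (rule lift_cell_ex[OF A \<alpha>(1)])
  obtain a' where a': "in_hom C a' A (C1 N)" "a' \<rhd> \<gamma>\<^sub>0\<^sub>1 = \<alpha>'" "opc \<alpha>' = a' \<rhd> \<gamma>\<^sub>o\<^sub>0\<^sub>1"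
    by (rule lift_cell_ex[OF A \<alpha>(2)])
  have "a \<rhd> \<gamma>\<^sub>o\<^sub>0\<^sub>1 \<in> Arr (hom_cat C A X\<^sub>o)" using a(1) To by (auto simp: in_hom_def)
  from Do(16)[OF A this] have "a = a'" using a a' e by metis
  then show ?thesis using a a' by simp
qed

lemma op2_surj:
  assumes A: "groupoid_obj C A" and f: "in_hom C f A X" "in_hom C f' A X"
    and \<beta>: "in_hom (hom_cat C A X\<^sub>o) \<beta> (opm f) (opm f')"
  obtains \<alpha> where "in_hom (hom_cat C A X) \<alpha> f' f" "opc \<alpha> = \<beta>"
proof -
  have "\<beta> \<in> Arr (hom_cat C A X\<^sub>o)" using \<beta> by (auto simp: in_hom_def)
  then obtain a where a: "in_hom C a A (C1 N)" "a \<rhd> \<gamma>\<^sub>o\<^sub>0\<^sub>1 = \<beta>" using Do(16)[OF A] by blast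
  have aT: "a \<in> Arr C" "Dom C a = A" "Cod C a = C1 N" using a by (auto simp: in_hom_def)
  obtain h where h: "in_hom C h A (C0 N)" "h \<cdot> \<gamma> = f" "opm f = h \<cdot> \<gamma>\<^sub>o" by (rule lift_ex[OF A f(1)])
  obtain h' where h': "in_hom C h' A (C0 N)" "h' \<cdot> \<gamma> = f'" "opm f' = h' \<cdot> \<gamma>\<^sub>o" by (rule lift_ex[OF A f(2)])
  have "Dom2 C (a \<rhd> \<gamma>\<^sub>o\<^sub>0\<^sub>1) = (a \<cdot> pi1 N) \<cdot> \<gamma>\<^sub>o" "Cod2 C (a \<rhd> \<gamma>\<^sub>o\<^sub>0\<^sub>1) = (a \<cdot> pi0 N) \<cdot> \<gamma>\<^sub>o" using aT To by simp_all
  then have e: "(a \<cdot> pi1 N) \<cdot> \<gamma>\<^sub>o = h \<cdot> \<gamma>\<^sub>o" "(a \<cdot> pi0 N) \<cdot> \<gamma>\<^sub>o = h' \<cdot> \<gamma>\<^sub>o"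
    unfolding a(2) using \<beta> h(3) h'(3) by (simp_all add: in_hom_def)
  have p: "in_hom C (a \<cdot> pi0 N) A (C0 N)" "in_hom C (a \<cdot> pi1 N) A (C0 N)" using aT T by (auto simp: in_hom_def)
  \<comment> \<open>Composition with \<open>\<gamma>\<^sub>o\<close> is injective on morphisms from
    a groupoid, so the ends of the lift agree already in \<open>C0 N\<close>.\<close>
  have "a \<cdot> pi1 N = h" "a \<cdot> pi0 N = h'"
    using lift_op_eqI[OF A p(2) h(1) e(1)] lift_op_eqI[OF A p(1) h'(1) e(2)] by blast+
  moreover have "Dom2 C (a \<rhd> \<gamma>\<^sub>0\<^sub>1) = (a \<cdot> pi0 N) \<cdot> \<gamma>" "Cod2 C (a \<rhd> \<gamma>\<^sub>0\<^sub>1) = (a \<cdot> pi1 N) \<cdot> \<gamma>" "a \<rhd> \<gamma>\<^sub>0\<^sub>1 \<in> Arr (hom_cat C A X)"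
    using aT T by simp_all
  ultimately have "in_hom (hom_cat C A X) (a \<rhd> \<gamma>\<^sub>0\<^sub>1) f' f" using h(2) h'(2) by (simp add: in_hom_def)
  moreover have "opc (a \<rhd> \<gamma>\<^sub>0\<^sub>1) = \<beta>" using op2_eqI[OF A a(1)] a(2) by simp
  ultimately show ?thesis by (rule that)
qed

lemma op2_Ide2:
  assumes A: "groupoid_obj C A" and f: "in_hom C f A X"
  shows "opc (Ide2 C f) = Ide2 C (opm f)"
proof -
  obtain h where h: "in_hom C h A (C0 N)" "h \<cdot> \<gamma> = f" "opm f = h \<cdot> \<gamma>\<^sub>o" by (rule lift_ex[OF A f(1)])
  have i: "ident N \<rhd> \<gamma>\<^sub>0\<^sub>1 = Ide2 C \<gamma>" "ident N \<rhd> \<gamma>\<^sub>o\<^sub>0\<^sub>1 = Ide2 C \<gamma>\<^sub>o"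
    using strict_quotient_hom(3)[OF D(17)] strict_quotient_hom(3)[OF nerve_presentationD(17)[OF pres_op]] by simp_all
  have "in_hom C (h \<cdot> ident N) A (C1 N)" "(h \<cdot> ident N) \<rhd> \<gamma>\<^sub>0\<^sub>1 = h \<rhd> (ident N \<rhd> \<gamma>\<^sub>0\<^sub>1)"
     "(h \<cdot> ident N) \<rhd> \<gamma>\<^sub>o\<^sub>0\<^sub>1 = h \<rhd> (ident N \<rhd> \<gamma>\<^sub>o\<^sub>0\<^sub>1)" "h \<rhd> Ide2 C \<gamma> = Ide2 C (h \<cdot> \<gamma>)" "h \<rhd> Ide2 C \<gamma>\<^sub>o = Ide2 C (h \<cdot> \<gamma>\<^sub>o)"
    using h(1) T To by (auto simp: in_hom_def)
  then show ?thesis using op2_eqI[OF A, of "h \<cdot> ident N" "Ide2 C f"] by (simp add: h i)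
qed

text \<open>Composable 2-cells have lifts \<open>a\<close>, \<open>b\<close> to \<open>C1 N\<close>
  with matching ends, hence a common lift \<open>k\<close> to \<open>C2 N\<close>. The cocone laws
  of both presentations evaluate \<open>pi02 N\<close> along the same \<open>k\<close>, with the
  factors in opposite orders.\<close>

lemma op2_VComp:
  assumes A: "groupoid_obj C A" and \<alpha>: "in_hom (hom_cat C A X) \<alpha> f'' f'" and \<beta>: "in_hom (hom_cat C A X) \<beta> f' f"
  shows "opc (\<alpha> \<bullet> \<beta>) = opc \<beta> \<bullet> opc \<alpha>"
proof -
  obtain a where a: "in_hom C a A (C1 N)" "a \<rhd> \<gamma>\<^sub>0\<^sub>1 = \<alpha>" "opc \<alpha> = a \<rhd> \<gamma>\<^sub>o\<^sub>0\<^sub>1" "(a \<cdot> pi1 N) \<cdot> \<gamma> = f'"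
    by (rule lift_cell_ex[OF A \<alpha>])
  obtain b where b: "in_hom C b A (C1 N)" "b \<rhd> \<gamma>\<^sub>0\<^sub>1 = \<beta>" "opc \<beta> = b \<rhd> \<gamma>\<^sub>o\<^sub>0\<^sub>1" "(b \<cdot> pi0 N) \<cdot> \<gamma> = f'"
    by (rule lift_cell_ex[OF A \<beta>])
  have AB: "a \<in> Arr C" "Dom C a = A" "Cod C a = C1 N" "b \<in> Arr C" "Dom C b = A" "Cod C b = C1 N"
    using a b by (auto simp: in_hom_def)
  have "in_hom C (a \<cdot> pi1 N) A (C0 N)" "in_hom C (b \<cdot> pi0 N) A (C0 N)" using AB T by (auto simp: in_hom_def)
  from lift_eqI[OF A this] a(4) b(4) have ab: "a \<cdot> pi1 N = b \<cdot> pi0 N" by simp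
  have "in_hom C a A (Dom C (pi1 N))" "in_hom C b A (Dom C (pi0 N))" using a b T by auto
  from pullback_square_lift[OF composable this ab]
  obtain k where k: "in_hom C k A (C2 N)" "k \<cdot> pi01 N = a" "k \<cdot> pi12 N = b" unfolding T(10) by blast
  have kT: "k \<in> Arr C" "Dom C k = A" "Cod C k = C2 N" using k by (auto simp: in_hom_def)
  have c: "pi02 N \<rhd> \<gamma>\<^sub>0\<^sub>1 = (pi01 N \<rhd> \<gamma>\<^sub>0\<^sub>1) \<bullet> (pi12 N \<rhd> \<gamma>\<^sub>0\<^sub>1)" "pi02 N \<rhd> \<gamma>\<^sub>o\<^sub>0\<^sub>1 = (pi12 N \<rhd> \<gamma>\<^sub>o\<^sub>0\<^sub>1) \<bullet> (pi01 N \<rhd> \<gamma>\<^sub>o\<^sub>0\<^sub>1)"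
    using strict_quotient_hom(4)[OF D(17)] strict_quotient_hom(4)[OF nerve_presentationD(17)[OF pres_op]] by simp_all
  have cc: "Cod2 C (pi01 N \<rhd> \<gamma>\<^sub>0\<^sub>1) = Dom2 C (pi12 N \<rhd> \<gamma>\<^sub>0\<^sub>1)" "Cod2 C (pi12 N \<rhd> \<gamma>\<^sub>o\<^sub>0\<^sub>1) = Dom2 C (pi01 N \<rhd> \<gamma>\<^sub>o\<^sub>0\<^sub>1)"
  proof -
    have "pi01 N \<cdot> (pi1 N \<cdot> \<gamma>) = pi12 N \<cdot> (pi0 N \<cdot> \<gamma>)" "pi12 N \<cdot> (pi0 N \<cdot> \<gamma>\<^sub>o) = pi01 N \<cdot> (pi1 N \<cdot> \<gamma>\<^sub>o)"
      using nerve_presentation_comp(5)[OF pres, of \<gamma>] nerve_presentation_comp(5)[OF pres_op, of \<gamma>\<^sub>o] T To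
      unfolding op_intcat_simps by blast+
    then show "Cod2 C (pi01 N \<rhd> \<gamma>\<^sub>0\<^sub>1) = Dom2 C (pi12 N \<rhd> \<gamma>\<^sub>0\<^sub>1)" "Cod2 C (pi12 N \<rhd> \<gamma>\<^sub>o\<^sub>0\<^sub>1) = Dom2 C (pi01 N \<rhd> \<gamma>\<^sub>o\<^sub>0\<^sub>1)"
      using T To by simp_all
  qed
  have "(k \<cdot> pi02 N) \<rhd> \<gamma>\<^sub>0\<^sub>1 = k \<rhd> (pi02 N \<rhd> \<gamma>\<^sub>0\<^sub>1)" "(k \<cdot> pi02 N) \<rhd> \<gamma>\<^sub>o\<^sub>0\<^sub>1 = k \<rhd> (pi02 N \<rhd> \<gamma>\<^sub>o\<^sub>0\<^sub>1)"
    using kT T To by simp_all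
  moreover have "k \<rhd> ((pi01 N \<rhd> \<gamma>\<^sub>0\<^sub>1) \<bullet> (pi12 N \<rhd> \<gamma>\<^sub>0\<^sub>1)) = ((k \<cdot> pi01 N) \<rhd> \<gamma>\<^sub>0\<^sub>1) \<bullet> ((k \<cdot> pi12 N) \<rhd> \<gamma>\<^sub>0\<^sub>1)"
    "k \<rhd> ((pi12 N \<rhd> \<gamma>\<^sub>o\<^sub>0\<^sub>1) \<bullet> (pi01 N \<rhd> \<gamma>\<^sub>o\<^sub>0\<^sub>1)) = ((k \<cdot> pi12 N) \<rhd> \<gamma>\<^sub>o\<^sub>0\<^sub>1) \<bullet> ((k \<cdot> pi01 N) \<rhd> \<gamma>\<^sub>o\<^sub>0\<^sub>1)"
  proof -
    have "k \<rhd> ((pi01 N \<rhd> \<gamma>\<^sub>0\<^sub>1) \<bullet> (pi12 N \<rhd> \<gamma>\<^sub>0\<^sub>1)) = (k \<rhd> (pi01 N \<rhd> \<gamma>\<^sub>0\<^sub>1)) \<bullet> (k \<rhd> (pi12 N \<rhd> \<gamma>\<^sub>0\<^sub>1))"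
      by (rule whisker_l_VComp[OF _ _ _ cc(1)]) (use kT T in simp_all)
    moreover have "k \<rhd> ((pi12 N \<rhd> \<gamma>\<^sub>o\<^sub>0\<^sub>1) \<bullet> (pi01 N \<rhd> \<gamma>\<^sub>o\<^sub>0\<^sub>1)) = (k \<rhd> (pi12 N \<rhd> \<gamma>\<^sub>o\<^sub>0\<^sub>1)) \<bullet> (k \<rhd> (pi01 N \<rhd> \<gamma>\<^sub>o\<^sub>0\<^sub>1))"
      by (rule whisker_l_VComp[OF _ _ _ cc(2)]) (use kT T To in simp_all)
    moreover have "(k \<cdot> pi01 N) \<rhd> \<gamma>\<^sub>0\<^sub>1 = k \<rhd> (pi01 N \<rhd> \<gamma>\<^sub>0\<^sub>1)" "(k \<cdot> pi12 N) \<rhd> \<gamma>\<^sub>0\<^sub>1 = k \<rhd> (pi12 N \<rhd> \<gamma>\<^sub>0\<^sub>1)"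
      "(k \<cdot> pi01 N) \<rhd> \<gamma>\<^sub>o\<^sub>0\<^sub>1 = k \<rhd> (pi01 N \<rhd> \<gamma>\<^sub>o\<^sub>0\<^sub>1)" "(k \<cdot> pi12 N) \<rhd> \<gamma>\<^sub>o\<^sub>0\<^sub>1 = k \<rhd> (pi12 N \<rhd> \<gamma>\<^sub>o\<^sub>0\<^sub>1)"
      by (rule whisker_l_comp, use kT T To in simp_all)+
    ultimately show "k \<rhd> ((pi01 N \<rhd> \<gamma>\<^sub>0\<^sub>1) \<bullet> (pi12 N \<rhd> \<gamma>\<^sub>0\<^sub>1)) = ((k \<cdot> pi01 N) \<rhd> \<gamma>\<^sub>0\<^sub>1) \<bullet> ((k \<cdot> pi12 N) \<rhd> \<gamma>\<^sub>0\<^sub>1)"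
      "k \<rhd> ((pi12 N \<rhd> \<gamma>\<^sub>o\<^sub>0\<^sub>1) \<bullet> (pi01 N \<rhd> \<gamma>\<^sub>o\<^sub>0\<^sub>1)) = ((k \<cdot> pi12 N) \<rhd> \<gamma>\<^sub>o\<^sub>0\<^sub>1) \<bullet> ((k \<cdot> pi01 N) \<rhd> \<gamma>\<^sub>o\<^sub>0\<^sub>1)"
      by (simp_all only:)
  qed
  ultimately have "(k \<cdot> pi02 N) \<rhd> \<gamma>\<^sub>0\<^sub>1 = \<alpha> \<bullet> \<beta>" "(k \<cdot> pi02 N) \<rhd> \<gamma>\<^sub>o\<^sub>0\<^sub>1 = opc \<beta> \<bullet> opc \<alpha>"
    unfolding c k a(2,3) b(2,3) by simp_all
  moreover have "in_hom C (k \<cdot> pi02 N) A (C1 N)" using kT T by (auto simp: in_hom_def)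
  ultimately show ?thesis using op2_eqI[OF A] by metis
qed

end

subsection \<open>Families of exponential diagrams\<close>

text \<open>Restriction along \<open>k\<close> is an equality of diagrams rather than an
  isomorphism; this strictness gives the 2-cells over a nerve the correct boundary. The stage
  \<open>A\<close> is not an argument of \<open>D\<close>, being the domain of \<open>f\<close> and
  \<open>g\<close>.\<close>

definition exponential_family ::
  "('o, 'm, 'c) twocat \<Rightarrow> 'o \<Rightarrow> ('m \<Rightarrow> 'm \<Rightarrow> 'c \<times> 'c \<times> 'c) \<Rightarrow> bool" where
  "exponential_family C X D \<longleftrightarrow> (\<forall>A f g. groupoid_obj C A \<and> in_hom C f A X \<and> in_hom C g A X \<longrightarrow>
     (\<exists>p q e. D f g = (p, q, e) \<and> exponential_diagram (hom_cat C A X) p q e \<and> Cod2 C q = f \<and> Cod2 C e = g \<and>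
        (\<forall>A' k. groupoid_obj C A' \<and> in_hom C k A' A \<longrightarrow>
           D (k \<cdot>\<^bsub>C\<^esub> f) (k \<cdot>\<^bsub>C\<^esub> g) = (k \<rhd>\<^bsub>C\<^esub> p, k \<rhd>\<^bsub>C\<^esub> q, k \<rhd>\<^bsub>C\<^esub> e))))"

abbreviation exponential_object ::
  "('o, 'm, 'c) twocat \<Rightarrow> ('m \<Rightarrow> 'm \<Rightarrow> 'c \<times> 'c \<times> 'c) \<Rightarrow> 'm \<Rightarrow> 'm \<Rightarrow> 'm" where
  "exponential_object C D f g \<equiv> Cod2 C (fst (D f g))"

context two_category
begin

section \<open>Restriction of induced arrows along morphisms of groupoids\<close>

lemma whisker_pairing:
  assumes P: "product_diagram (hom_cat C A X) p q" and P': "product_diagram (hom_cat C A' X) (k \<rhd> p) (k \<rhd> q)"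
    and a: "in_hom (hom_cat C A X) a z (Cod2 C p)" "in_hom (hom_cat C A X) b z (Cod2 C q)" and k: "in_hom C k A' A"
  shows "k \<rhd> pairing (hom_cat C A X) p q a b = pairing (hom_cat C A' X) (k \<rhd> p) (k \<rhd> q) (k \<rhd> a) (k \<rhd> b)"
proof -
  have z: "z \<in> Arr C" "Dom C z = A" "Cod C z = X" using a(1) Dom2_in_Arr by (auto simp: in_hom_def)
  have K: "k \<in> Arr C" "Dom C k = A'" "Cod C k = A" using k by (auto simp: in_hom_def)
  have O: "A \<in> Obj C" "A' \<in> Obj C" "X \<in> Obj C" using z K dom_obj cod_obj by metis+
  interpret A: category "hom_cat C A X" using hom_category O by blast
  interpret A': category "hom_cat C A' X" using hom_category O by blast
  have a': "in_hom (hom_cat C A X) a z (Cod (hom_cat C A X) p)" "in_hom (hom_cat C A X) b z (Cod (hom_cat C A X) q)"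
    using a by simp_all
  note m = A.pairing_hom[OF P a']
  define m where "m = pairing (hom_cat C A X) p q a b"
  have mT: "m \<in> Cell C" "Dom2 C m = z" "Cod2 C m = Dom2 C p" "m \<bullet> p = a" "m \<bullet> q = b"
    using m unfolding m_def[symmetric] by (simp_all add: in_hom_hom_cat)
  have pT: "p \<in> Cell C" "q \<in> Cell C" "Dom2 C q = Dom2 C p" "Dom C (Dom2 C p) = A" "Cod C (Dom2 C p) = X"
    using A.product_diagram_arr[OF P] by auto
  have "(k \<rhd> m) \<bullet> (k \<rhd> p) = k \<rhd> (m \<bullet> p)" "(k \<rhd> m) \<bullet> (k \<rhd> q) = k \<rhd> (m \<bullet> q)"
    by (rule whisker_l_VComp[symmetric], use K mT(1-3) pT z in simp_all)+
  then have c: "(k \<rhd> m) \<bullet> (k \<rhd> p) = k \<rhd> a" "(k \<rhd> m) \<bullet> (k \<rhd> q) = k \<rhd> b" by (simp_all only: mT)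
  show ?thesis unfolding m_def[symmetric]
    by (rule A'.pairing_eqI[OF P', symmetric, of _ "k \<cdot> z"]) (use c K mT(1-3) pT z in \<open>simp_all add: in_hom_hom_cat\<close>)
qed

text \<open>By \<open>exponential_inducedI\<close> it is enough to test one product over
  \<open>A'\<close>, and the restriction of a product over \<open>A\<close> is such a product. The
  equation there is the whiskering of the equation over \<open>A\<close>.\<close>

lemma exponential_induced_precomp:
  assumes cc: "cartesian_closed_obj C X" and G: "groupoid_obj C A" "groupoid_obj C A'" and k: "in_hom C k A' A"
    and d: "exponential_diagram (hom_cat C A X) p q e" "exponential_diagram (hom_cat C A X) p' q' e'"
    and \<alpha>: "in_hom (hom_cat C A X) \<alpha> (Cod2 C q') (Cod2 C q)" and \<beta>: "in_hom (hom_cat C A X) \<beta> (Cod2 C e) (Cod2 C e')"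
    and ind: "exponential_induced (hom_cat C A X) (p, q, e) (p', q', e') \<alpha> \<beta> \<theta>"
  shows "exponential_induced (hom_cat C A' X) (k \<rhd> p, k \<rhd> q, k \<rhd> e) (k \<rhd> p', k \<rhd> q', k \<rhd> e') (k \<rhd> \<alpha>) (k \<rhd> \<beta>) (k \<rhd> \<theta>)"
proof -
  have K: "k \<in> Arr C" "Dom C k = A'" "Cod C k = A" using k by (auto simp: in_hom_def)
  have O: "A \<in> Obj C" "A' \<in> Obj C" "X \<in> Obj C" using G cartesian_closed_objD[OF cc] by (auto simp: groupoid_obj_def)
  interpret A: category "hom_cat C A X" using hom_category O by blast
  interpret A': category "hom_cat C A' X" using hom_category O by blast
  note D = A.exponential_diagramD[OF d(1), simplified] A.exponential_diagramD[OF d(2), simplified]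
  note pc = cartesian_closed_product_precomp[OF cc G k]
  have pe: "exponential_diagram (hom_cat C A' X) (k \<rhd> p) (k \<rhd> q) (k \<rhd> e)" "exponential_diagram (hom_cat C A' X) (k \<rhd> p') (k \<rhd> q') (k \<rhd> e')"
    using cartesian_closed_exponential_precomp[OF cc G k] d by blast+
  have PT: "p \<in> Cell C" "q \<in> Cell C" "e \<in> Cell C" "Dom2 C q = Dom2 C p" "Dom2 C e = Dom2 C p" "Dom C (Dom2 C p) = A" "Cod C (Dom2 C p) = X"
    "p' \<in> Cell C" "q' \<in> Cell C" "e' \<in> Cell C" "Dom2 C q' = Dom2 C p'" "Dom2 C e' = Dom2 C p'" "Dom C (Dom2 C p') = A" "Cod C (Dom2 C p') = X"
    using D by auto
  have ab: "\<alpha> \<in> Cell C" "Dom2 C \<alpha> = Cod2 C q'" "Cod2 C \<alpha> = Cod2 C q" "\<beta> \<in> Cell C" "Dom2 C \<beta> = Cod2 C e" "Cod2 C \<beta> = Cod2 C e'"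
    using \<alpha> \<beta> by (auto simp: in_hom_def)
  have "in_hom (hom_cat C A X) \<theta> (Cod (hom_cat C A X) p) (Cod (hom_cat C A X) p')"
    using ind unfolding A.exponential_induced_iff by blast
  then have th: "\<theta> \<in> Cell C" "Dom2 C \<theta> = Cod2 C p" "Cod2 C \<theta> = Cod2 C p'" by (auto simp: in_hom_def)
  have "Cod2 C p \<in> Obj (hom_cat C A X)" "Cod2 C q' \<in> Obj (hom_cat C A X)" using PT by (auto simp: in_hom_def)
  from A.cartesian_closed_productE[OF cartesian_closed_objD(2)[OF cc G(1)] this]
  obtain u v where uv: "product_diagram (hom_cat C A X) u v" "Cod2 C u = Cod2 C p" "Cod2 C v = Cod2 C q'" by auto
  have uvT: "u \<in> Cell C" "v \<in> Cell C" "Dom2 C v = Dom2 C u" "Dom C (Dom2 C u) = A" "Cod C (Dom2 C u) = X"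
    using A.product_diagram_arr[OF uv(1)] by auto
  have eq: "pairing (hom_cat C A X) p' q' (u \<bullet> \<theta>) v \<bullet> e' = pairing (hom_cat C A X) p q u (v \<bullet> \<alpha>) \<bullet> e \<bullet> \<beta>"
    using ind uv unfolding A.exponential_induced_iff by simp
  define x where "x = pairing (hom_cat C A X) p' q' (u \<bullet> \<theta>) v"
  define y where "y = pairing (hom_cat C A X) p q u (v \<bullet> \<alpha>)"
  have h: "in_hom (hom_cat C A X) (u \<bullet> \<theta>) (Dom2 C u) (Cod2 C p')" "in_hom (hom_cat C A X) v (Dom2 C u) (Cod2 C q')"
     "in_hom (hom_cat C A X) u (Dom2 C u) (Cod2 C p)" "in_hom (hom_cat C A X) (v \<bullet> \<alpha>) (Dom2 C u) (Cod2 C q)"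
    using uvT uv(2,3) th ab by (simp_all add: in_hom_hom_cat)
  have xy: "x \<in> Cell C" "Dom2 C x = Dom2 C u" "Cod2 C x = Dom2 C p'" "y \<in> Cell C" "Dom2 C y = Dom2 C u" "Cod2 C y = Dom2 C p"
    using A.pairing_hom(1)[OF D(11), of "u \<bullet> \<theta>" "Dom2 C u" v] A.pairing_hom(1)[OF D(1), of u "Dom2 C u" "v \<bullet> \<alpha>"] h
    by (simp_all add: x_def y_def in_hom_def[of "hom_cat _ _ _"])
  have "k \<rhd> x = pairing (hom_cat C A' X) (k \<rhd> p') (k \<rhd> q') (k \<rhd> (u \<bullet> \<theta>)) (k \<rhd> v)"
    unfolding x_def by (rule whisker_pairing[OF D(11) pc[OF D(11)] h(1,2) k])
  moreover have "k \<rhd> (u \<bullet> \<theta>) = (k \<rhd> u) \<bullet> (k \<rhd> \<theta>)" using K uvT uv th by simp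
  moreover have "k \<rhd> y = pairing (hom_cat C A' X) (k \<rhd> p) (k \<rhd> q) (k \<rhd> u) (k \<rhd> (v \<bullet> \<alpha>))"
    unfolding y_def by (rule whisker_pairing[OF D(1) pc[OF D(1)] h(3,4) k])
  moreover have "k \<rhd> (v \<bullet> \<alpha>) = (k \<rhd> v) \<bullet> (k \<rhd> \<alpha>)" using K uvT uv ab by simp
  moreover have "k \<rhd> (x \<bullet> e') = (k \<rhd> x) \<bullet> (k \<rhd> e')" using K xy PT uvT by simp
  moreover have "k \<rhd> (y \<bullet> e \<bullet> \<beta>) = (k \<rhd> y) \<bullet> (k \<rhd> e) \<bullet> (k \<rhd> \<beta>)" using K xy PT uvT ab by simp
  ultimately have eq': "pairing (hom_cat C A' X) (k \<rhd> p') (k \<rhd> q') ((k \<rhd> u) \<bullet> (k \<rhd> \<theta>)) (k \<rhd> v) \<bullet> (k \<rhd> e') =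
     pairing (hom_cat C A' X) (k \<rhd> p) (k \<rhd> q) (k \<rhd> u) ((k \<rhd> v) \<bullet> (k \<rhd> \<alpha>)) \<bullet> (k \<rhd> e) \<bullet> (k \<rhd> \<beta>)"
    using eq unfolding x_def[symmetric] y_def[symmetric] by simp
  show ?thesis
  proof (rule A'.exponential_inducedI(2)[OF pc[OF D(1)] pc[OF D(11)] _ _ _ _ _ pc[OF uv(1)]])
    show "in_hom (hom_cat C A' X) (k \<rhd> e) (Dom (hom_cat C A' X) (k \<rhd> p)) (k \<cdot> Cod2 C e)"
      "in_hom (hom_cat C A' X) (k \<rhd> e') (Dom (hom_cat C A' X) (k \<rhd> p')) (k \<cdot> Cod2 C e')"
      "in_hom (hom_cat C A' X) (k \<rhd> \<alpha>) (Cod (hom_cat C A' X) (k \<rhd> q')) (Cod (hom_cat C A' X) (k \<rhd> q))"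
      "in_hom (hom_cat C A' X) (k \<rhd> \<beta>) (k \<cdot> Cod2 C e) (k \<cdot> Cod2 C e')"
      "in_hom (hom_cat C A' X) (k \<rhd> \<theta>) (Cod (hom_cat C A' X) (k \<rhd> p)) (Cod (hom_cat C A' X) (k \<rhd> p'))"
      using K PT ab th by (simp_all add: in_hom_hom_cat)
    show "Cod (hom_cat C A' X) (k \<rhd> u) = Cod (hom_cat C A' X) (k \<rhd> p)" "Cod (hom_cat C A' X) (k \<rhd> v) = Cod (hom_cat C A' X) (k \<rhd> q')"
      using K PT uvT uv(2,3) by simp_all
  qed (use eq' in simp)
qed

section \<open>Induced arrows within and between families\<close>

lemma exponential_familyE:
  assumes "exponential_family C X D" "groupoid_obj C A" "in_hom C f A X" "in_hom C g A X"
  obtains p q e where "D f g = (p, q, e)" "exponential_diagram (hom_cat C A X) p q e" "Cod2 C q = f" "Cod2 C e = g"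
    "\<forall>A' k. groupoid_obj C A' \<and> in_hom C k A' A \<longrightarrow> D (k \<cdot> f) (k \<cdot> g) = (k \<rhd> p, k \<rhd> q, k \<rhd> e)"
proof -
  have "\<exists>p q e. D f g = (p, q, e) \<and> exponential_diagram (hom_cat C A X) p q e \<and> Cod2 C q = f \<and> Cod2 C e = g \<and>
        (\<forall>A' k. groupoid_obj C A' \<and> in_hom C k A' A \<longrightarrow> D (k \<cdot> f) (k \<cdot> g) = (k \<rhd> p, k \<rhd> q, k \<rhd> e))"
    using assms unfolding exponential_family_def by blast
  then show ?thesis using that by blast
qed

lemma exponential_family_object:
  assumes D: "exponential_family C X D" and A: "groupoid_obj C A" and f: "in_hom C f A X" "in_hom C g A X"
  shows "in_hom C (exponential_object C D f g) A X"
    "groupoid_obj C A' \<Longrightarrow> in_hom C k A' A \<Longrightarrow> exponential_object C D (k \<cdot> f) (k \<cdot> g) = k \<cdot> exponential_object C D f g"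
proof -
  obtain p q e where d: "D f g = (p, q, e)" "exponential_diagram (hom_cat C A X) p q e"
    "\<forall>A' k. groupoid_obj C A' \<and> in_hom C k A' A \<longrightarrow> D (k \<cdot> f) (k \<cdot> g) = (k \<rhd> p, k \<rhd> q, k \<rhd> e)"
    by (rule exponential_familyE[OF assms])
  have O: "A \<in> Obj C" "X \<in> Obj C" using in_homD(4,5)[OF f(1)] by blast+
  interpret A: category "hom_cat C A X" using hom_category O by blast
  have p: "p \<in> Cell C" "Dom C (Dom2 C p) = A" "Cod C (Dom2 C p) = X" using A.exponential_diagramD(2)[OF d(2)] by auto
  show "in_hom C (exponential_object C D f g) A X" using p d by (auto simp: in_hom_def)
  show "exponential_object C D (k \<cdot> f) (k \<cdot> g) = k \<cdot> exponential_object C D f g" if "groupoid_obj C A'" "in_hom C k A' A"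
    using d(3)[rule_format, OF conjI[OF that]] d(1) p that by (simp add: in_hom_def)
qed

text \<open>Two families appear so that the same facts yield both the transition 2-cells within one
  family and the comparison between two choices of exponentials.\<close>

lemma exponential_family_induced:
  assumes cc: "cartesian_closed_obj C X" and D: "exponential_family C X D" "exponential_family C X D'"
    and A: "groupoid_obj C A"
    and \<alpha>: "in_hom (hom_cat C A X) \<alpha> f' f" and \<beta>: "in_hom (hom_cat C A X) \<beta> g g'"
  shows "\<exists>!\<theta>. exponential_induced (hom_cat C A X) (D f g) (D' f' g') \<alpha> \<beta> \<theta>"
    "exponential_induced (hom_cat C A X) (D f g) (D' f' g') \<alpha> \<beta> \<theta> \<Longrightarrow>
      in_hom (hom_cat C A X) \<theta> (exponential_object C D f g) (exponential_object C D' f' g')"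
    "exponential_induced (hom_cat C A X) (D f g) (D' f' g') \<alpha> \<beta> \<theta> \<Longrightarrow> groupoid_obj C A' \<Longrightarrow> in_hom C k A' A \<Longrightarrow>
      exponential_induced (hom_cat C A' X) (D (k \<cdot> f) (k \<cdot> g)) (D' (k \<cdot> f') (k \<cdot> g')) (k \<rhd> \<alpha>) (k \<rhd> \<beta>) (k \<rhd> \<theta>)"
proof -
  have f: "in_hom C f A X" "in_hom C f' A X" "in_hom C g A X" "in_hom C g' A X"
    using \<alpha> \<beta> by (auto simp: in_hom_def)
  obtain p q e where d: "D f g = (p, q, e)" "exponential_diagram (hom_cat C A X) p q e" "Cod2 C q = f" "Cod2 C e = g"
    "\<forall>A' k. groupoid_obj C A' \<and> in_hom C k A' A \<longrightarrow> D (k \<cdot> f) (k \<cdot> g) = (k \<rhd> p, k \<rhd> q, k \<rhd> e)"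
    by (rule exponential_familyE[OF D(1) A f(1,3)])
  obtain p' q' e' where d': "D' f' g' = (p', q', e')" "exponential_diagram (hom_cat C A X) p' q' e'" "Cod2 C q' = f'" "Cod2 C e' = g'"
    "\<forall>A' k. groupoid_obj C A' \<and> in_hom C k A' A \<longrightarrow> D' (k \<cdot> f') (k \<cdot> g') = (k \<rhd> p', k \<rhd> q', k \<rhd> e')"
    by (rule exponential_familyE[OF D(2) A f(2,4)])
  have O: "A \<in> Obj C" "X \<in> Obj C" using in_homD(4,5)[OF f(1)] by blast+
  interpret A: category "hom_cat C A X" using hom_category O by blast
  have ab: "in_hom (hom_cat C A X) \<alpha> (Cod (hom_cat C A X) q') (Cod (hom_cat C A X) q)"
    "in_hom (hom_cat C A X) \<beta> (Cod (hom_cat C A X) e) (Cod (hom_cat C A X) e')"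
    using \<alpha> \<beta> d d' by simp_all
  show "\<exists>!\<theta>. exponential_induced (hom_cat C A X) (D f g) (D' f' g') \<alpha> \<beta> \<theta>"
    unfolding d(1) d'(1) by (rule A.exponential_induced_unique[OF cartesian_closed_objD(2)[OF cc A] d(2) d'(2) ab])
  show "in_hom (hom_cat C A X) \<theta> (exponential_object C D f g) (exponential_object C D' f' g')"
    if "exponential_induced (hom_cat C A X) (D f g) (D' f' g') \<alpha> \<beta> \<theta>"
  proof -
    have "in_hom (hom_cat C A X) \<theta> (Cod (hom_cat C A X) p) (Cod (hom_cat C A X) p')"
      using that unfolding d(1) d'(1) A.exponential_induced_iff by blast
    then show ?thesis by (simp add: d(1) d'(1))
  qed
  show "exponential_induced (hom_cat C A' X) (D (k \<cdot> f) (k \<cdot> g)) (D' (k \<cdot> f') (k \<cdot> g')) (k \<rhd> \<alpha>) (k \<rhd> \<beta>) (k \<rhd> \<theta>)"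
    if "exponential_induced (hom_cat C A X) (D f g) (D' f' g') \<alpha> \<beta> \<theta>" "groupoid_obj C A'" "in_hom C k A' A"
    unfolding d(5)[rule_format, OF conjI[OF that(2,3)]] d'(5)[rule_format, OF conjI[OF that(2,3)]]
    by (rule exponential_induced_precomp[OF cc A that(2,3) d(2) d'(2) _ _ that(1)[unfolded d(1) d'(1)]]) (use ab in simp_all)
qed

lemma exponential_family_Ide:
  assumes D: "exponential_family C X D" and A: "groupoid_obj C A" and f: "in_hom C f A X" "in_hom C g A X"
  shows "exponential_induced (hom_cat C A X) (D f g) (D f g) (Ide2 C f) (Ide2 C g) (Ide2 C (exponential_object C D f g))"
proof -
  obtain p q e where d: "D f g = (p, q, e)" "exponential_diagram (hom_cat C A X) p q e" "Cod2 C q = f" "Cod2 C e = g"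
    by (rule exponential_familyE[OF D(1) A f])
  have O: "A \<in> Obj C" "X \<in> Obj C" using in_homD(4,5)[OF f(1)] by blast+
  interpret A: category "hom_cat C A X" using hom_category O by blast
  show ?thesis using A.exponential_induced_Ide[OF d(2)] by (simp add: d(1) d(3,4))
qed

lemma exponential_family_comp:
  assumes cc: "cartesian_closed_obj C X"
    and D: "exponential_family C X D" "exponential_family C X D'" "exponential_family C X D''" and A: "groupoid_obj C A"
    and \<alpha>: "in_hom (hom_cat C A X) \<alpha> f' f" and \<beta>: "in_hom (hom_cat C A X) \<beta> g g'"
    and \<alpha>': "in_hom (hom_cat C A X) \<alpha>' f'' f'" and \<beta>': "in_hom (hom_cat C A X) \<beta>' g' g''"
    and i: "exponential_induced (hom_cat C A X) (D f g) (D' f' g') \<alpha> \<beta> \<theta>"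
      "exponential_induced (hom_cat C A X) (D' f' g') (D'' f'' g'') \<alpha>' \<beta>' \<theta>'"
  shows "exponential_induced (hom_cat C A X) (D f g) (D'' f'' g'') (\<alpha>' \<bullet> \<alpha>) (\<beta> \<bullet> \<beta>') (\<theta> \<bullet> \<theta>')"
proof -
  have f: "in_hom C f A X" "in_hom C f' A X" "in_hom C f'' A X" "in_hom C g A X" "in_hom C g' A X" "in_hom C g'' A X"
    using \<alpha> \<beta> \<alpha>' \<beta>' by (auto simp: in_hom_def)
  obtain p q e where d: "D f g = (p, q, e)" "exponential_diagram (hom_cat C A X) p q e" "Cod2 C q = f" "Cod2 C e = g"
    by (rule exponential_familyE[OF D(1) A f(1,4)])
  obtain p' q' e' where d': "D' f' g' = (p', q', e')" "exponential_diagram (hom_cat C A X) p' q' e'" "Cod2 C q' = f'" "Cod2 C e' = g'"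
    by (rule exponential_familyE[OF D(2) A f(2,5)])
  obtain p'' q'' e'' where d'': "D'' f'' g'' = (p'', q'', e'')" "exponential_diagram (hom_cat C A X) p'' q'' e''" "Cod2 C q'' = f''" "Cod2 C e'' = g''"
    by (rule exponential_familyE[OF D(3) A f(3,6)])
  have O: "A \<in> Obj C" "X \<in> Obj C" using in_homD(4,5)[OF f(1)] by blast+
  interpret A: category "hom_cat C A X" using hom_category O by blast
  show ?thesis
    using A.exponential_induced_comp[OF cartesian_closed_objD(2)[OF cc A] d(2) d'(2) d''(2) _ _ _ _ i[unfolded d(1) d'(1) d''(1)]]
      \<alpha> \<beta> \<alpha>' \<beta>' d(3,4) d'(3,4) d''(3,4) unfolding d(1) d''(1) by simp
qed

end

subsection \<open>Exponential morphisms\<close>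

locale exponential_setting = opposed_presentations C N X X\<^sub>o \<gamma> \<gamma>\<^sub>o \<gamma>\<^sub>0\<^sub>1 \<gamma>\<^sub>o\<^sub>0\<^sub>1
  for C :: "('o, 'm, 'c) twocat" (structure) and N X X\<^sub>o \<gamma> \<gamma>\<^sub>o \<gamma>\<^sub>0\<^sub>1 \<gamma>\<^sub>o\<^sub>0\<^sub>1 +
  fixes P :: 'o and p q :: 'm
  assumes groupoidant: "groupoidant C" and closed: "cartesian_closed_obj C X"
    and prod: "strict_product C X\<^sub>o X P p q"
begin

text \<open>The clauses of \<open>exponential_morphism\<close> that evaluate \<open>ex\<close> at
  groupoids, with the choice of cores, diagram object and section \<open>E\<close> abstracted into
  the family \<open>D\<close>. Existence and uniqueness are proved at this level.\<close>

definition realizes :: "'m \<Rightarrow> ('m \<Rightarrow> 'm \<Rightarrow> 'c \<times> 'c \<times> 'c) \<Rightarrow> bool" where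
  "realizes ex D \<longleftrightarrow> (\<forall>A. groupoid_obj C A \<longrightarrow>
     (\<forall>f g. in_hom C f A X \<and> in_hom C g A X \<longrightarrow> pairing C p q (opm f) g \<cdot> ex = exponential_object C D f g) \<and>
     (\<forall>f f' g g' \<alpha> \<beta>. in_hom (hom_cat C A X) \<alpha> f' f \<and> in_hom (hom_cat C A X) \<beta> g g' \<longrightarrow>
        exponential_induced (hom_cat C A X) (D f g) (D f' g') \<alpha> \<beta> (pairing2 C p q (opc \<alpha>) \<beta> \<lhd> ex)))"

section \<open>Pairings into the product of \<open>X\<^sub>o\<close> and \<open>X\<close>\<close>

lemma pq_type: "p \<in> Arr C" "q \<in> Arr C" "Dom C p = P" "Dom C q = P" "Cod C p = X\<^sub>o" "Cod C q = X" "P \<in> Obj C"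
  using strict_product_hom[OF prod] in_homD(4)[OF strict_product_hom(1)[OF prod]] by (auto simp: in_hom_def)

lemma pairing_op_hom:
  assumes A: "groupoid_obj C A" and f: "in_hom C f A X" "in_hom C g A X"
  shows "in_hom C (pairing C p q (opm f) g) A P" "pairing C p q (opm f) g \<cdot> p = opm f" "pairing C p q (opm f) g \<cdot> q = g"
  using strict_product_pairing[OF prod op1_hom[OF A f(1)] f(2)] by blast+

lemma pairing2_op_hom:
  assumes A: "groupoid_obj C A" and \<alpha>: "in_hom (hom_cat C A X) \<alpha> f' f" and \<beta>: "in_hom (hom_cat C A X) \<beta> g g'"
  shows "in_hom (hom_cat C A P) (pairing2 C p q (opc \<alpha>) \<beta>) (pairing C p q (opm f) g) (pairing C p q (opm f') g')"
    "pairing2 C p q (opc \<alpha>) \<beta> \<lhd> p = opc \<alpha>" "pairing2 C p q (opc \<alpha>) \<beta> \<lhd> q = \<beta>"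
    "\<And>\<theta>. in_hom (hom_cat C A P) \<theta> (pairing C p q (opm f) g) (pairing C p q (opm f') g') \<Longrightarrow>
       \<theta> \<lhd> p = opc \<alpha> \<Longrightarrow> \<theta> \<lhd> q = \<beta> \<Longrightarrow> pairing2 C p q (opc \<alpha>) \<beta> = \<theta>"
proof -
  have f: "in_hom C f A X" "in_hom C f' A X" "in_hom C g A X" "in_hom C g' A X" using \<alpha> \<beta> by (auto simp: in_hom_def)
  note h = pairing_op_hom[OF A f(1,3)] and h' = pairing_op_hom[OF A f(2,4)]
  have c: "in_hom (hom_cat C A X\<^sub>o) (opc \<alpha>) (pairing C p q (opm f) g \<cdot> p) (pairing C p q (opm f') g' \<cdot> p)"
    "in_hom (hom_cat C A X) \<beta> (pairing C p q (opm f) g \<cdot> q) (pairing C p q (opm f') g' \<cdot> q)"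
    unfolding h h' by (rule op2_hom[OF A \<alpha>], rule \<beta>)
  note r = strict_product_pairing2[OF prod h(1) h'(1) c]
  show "in_hom (hom_cat C A P) (pairing2 C p q (opc \<alpha>) \<beta>) (pairing C p q (opm f) g) (pairing C p q (opm f') g')"
    "pairing2 C p q (opc \<alpha>) \<beta> \<lhd> p = opc \<alpha>" "pairing2 C p q (opc \<alpha>) \<beta> \<lhd> q = \<beta>"
    "\<And>\<theta>. in_hom (hom_cat C A P) \<theta> (pairing C p q (opm f) g) (pairing C p q (opm f') g') \<Longrightarrow>
       \<theta> \<lhd> p = opc \<alpha> \<Longrightarrow> \<theta> \<lhd> q = \<beta> \<Longrightarrow> pairing2 C p q (opc \<alpha>) \<beta> = \<theta>"
    by (fact r(1), fact r(2), fact r(3), rule r(4))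
qed

text \<open>On the nerve of \<open>P\<close> there are universal morphisms \<open>f\<close>, \<open>g\<close> and 2-cells \<open>\<alpha>\<close>, \<open>\<beta>\<close> from groupoids to
  \<open>X\<close>, with \<open>\<eta> = \<langle>f\<^sup>o\<^sup>p, g\<rangle>\<close> and \<open>\<eta>\<^sub>0\<^sub>1 = \<langle>\<alpha>\<^sup>o\<^sup>p, \<beta>\<rangle>\<close>.\<close>

lemma universal_cells:
  assumes M: "nerve_presentation C P M \<eta> \<eta>\<^sub>0\<^sub>1"
  obtains f g \<alpha> \<beta> where "in_hom C f (C0 M) X" "in_hom C g (C0 M) X"
    "in_hom (hom_cat C (C1 M) X) \<alpha> (pi1 M \<cdot> f) (pi0 M \<cdot> f)" "in_hom (hom_cat C (C1 M) X) \<beta> (pi0 M \<cdot> g) (pi1 M \<cdot> g)"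
    "opm f = \<eta> \<cdot> p" "g = \<eta> \<cdot> q" "opc \<alpha> = \<eta>\<^sub>0\<^sub>1 \<lhd> p" "\<beta> = \<eta>\<^sub>0\<^sub>1 \<lhd> q"
proof -
  note MT = nerve_presentation_type[OF M] and G = nerve_presentationD(1-3)[OF M] and h = nerve_presentationD(4,5)[OF M]
  have "in_hom C (\<eta> \<cdot> p) (C0 M) X\<^sub>o" using MT pq_type by (auto simp: in_hom_def)
  then obtain f where f: "in_hom C f (C0 M) X" "opm f = \<eta> \<cdot> p" by (rule op1_surj[OF G(1)])
  have fT: "f \<in> Arr C" "Dom C f = C0 M" "Cod C f = X" using f by (auto simp: in_hom_def)
  have "in_hom (hom_cat C (C1 M) X\<^sub>o) (\<eta>\<^sub>0\<^sub>1 \<lhd> p) (opm (pi0 M \<cdot> f)) (opm (pi1 M \<cdot> f))"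
    unfolding op1_comp[OF G(1,2) f(1) h(1)] op1_comp[OF G(1,2) f(1) h(2)] f(2) using MT pq_type by (simp add: in_hom_hom_cat)
  moreover have "in_hom C (pi0 M \<cdot> f) (C1 M) X" "in_hom C (pi1 M \<cdot> f) (C1 M) X" using fT MT by (auto simp: in_hom_def)
  ultimately obtain \<alpha> where a: "in_hom (hom_cat C (C1 M) X) \<alpha> (pi1 M \<cdot> f) (pi0 M \<cdot> f)" "opc \<alpha> = \<eta>\<^sub>0\<^sub>1 \<lhd> p"
    using op2_surj[OF G(2)] by metis
  have "in_hom C (\<eta> \<cdot> q) (C0 M) X" "in_hom (hom_cat C (C1 M) X) (\<eta>\<^sub>0\<^sub>1 \<lhd> q) (pi0 M \<cdot> (\<eta> \<cdot> q)) (pi1 M \<cdot> (\<eta> \<cdot> q))"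
    using MT pq_type by (auto simp: in_hom_def)
  then show ?thesis using that f a by blast
qed

text \<open>Both sides of each cocone law are induced by the same pair of 2-cells, so uniqueness of
  induced arrows proves it. The contravariant member of the pair is identified through
  \<open>opc\<close>, which is injective on 2-cells with fixed boundary and relates \<alpha> to the
  universal cocone of the nerve of \<open>P\<close>.\<close>

lemma realization_exists:
  assumes D: "exponential_family C X D"
  shows "\<exists>ex. in_hom C ex P X \<and> realizes ex D"
proof -
  obtain M \<eta> \<eta>\<^sub>0\<^sub>1 where M: "nerve_presentation C P M \<eta> \<eta>\<^sub>0\<^sub>1" using nerve_exists[OF groupoidant pq_type(7)] by blast
  note MT = nerve_presentation_type[OF M] and MD = nerve_presentationD[OF M] and Q = strict_quotient_hom[OF nerve_presentationD(17)[OF M]]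
  note G = MD(1-3) and Mc = nerve_presentation_comp[OF M] and pqT = pq_type
  obtain f g \<alpha> \<beta> where fg: "in_hom C f (C0 M) X" "in_hom C g (C0 M) X"
    and ab: "in_hom (hom_cat C (C1 M) X) \<alpha> (pi1 M \<cdot> f) (pi0 M \<cdot> f)" "in_hom (hom_cat C (C1 M) X) \<beta> (pi0 M \<cdot> g) (pi1 M \<cdot> g)"
    and u: "opm f = \<eta> \<cdot> p" "g = \<eta> \<cdot> q" "opc \<alpha> = \<eta>\<^sub>0\<^sub>1 \<lhd> p" "\<beta> = \<eta>\<^sub>0\<^sub>1 \<lhd> q"
    by (rule universal_cells[OF M])
  have fT: "f \<in> Arr C" "Dom C f = C0 M" "Cod C f = X" "g \<in> Arr C" "Dom C g = C0 M" "Cod C g = X"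
    "\<alpha> \<in> Cell C" "Dom2 C \<alpha> = pi1 M \<cdot> f" "Cod2 C \<alpha> = pi0 M \<cdot> f" "\<beta> \<in> Cell C" "Dom2 C \<beta> = pi0 M \<cdot> g" "Cod2 C \<beta> = pi1 M \<cdot> g"
    using fg ab by (auto simp: in_hom_def)
  note ind = exponential_family_induced[OF closed D D] and obj = exponential_family_object[OF D]
  define b where "b = exponential_object C D f g"
  obtain \<mu> where mu: "exponential_induced (hom_cat C (C1 M) X) (D (pi0 M \<cdot> f) (pi0 M \<cdot> g)) (D (pi1 M \<cdot> f) (pi1 M \<cdot> g)) \<alpha> \<beta> \<mu>"
    using ind(1)[OF G(2) ab] by blast
  have bT: "in_hom C b (C0 M) X" unfolding b_def by (rule obj(1)[OF G(1) fg])
  have bk: "exponential_object C D (k \<cdot> f) (k \<cdot> g) = k \<cdot> b" if "groupoid_obj C A'" "in_hom C k A' (C0 M)" for A' k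
    unfolding b_def by (rule obj(2)[OF G(1) fg that])
  have muT: "in_hom (hom_cat C (C1 M) X) \<mu> (pi0 M \<cdot> b) (pi1 M \<cdot> b)"
    using ind(2)[OF G(2) ab mu] unfolding bk[OF G(2) MD(4)] bk[OF G(2) MD(5)] .
  have muC: "\<mu> \<in> Cell C" "Dom2 C \<mu> = pi0 M \<cdot> b" "Cod2 C \<mu> = pi1 M \<cdot> b" using muT by (auto simp: in_hom_def)
  have "ident M \<rhd> \<mu> = Ide2 C b"
  proof -
    have i: "ident M \<cdot> (pi0 M \<cdot> f) = f" "ident M \<cdot> (pi1 M \<cdot> f) = f" "ident M \<cdot> (pi0 M \<cdot> g) = g" "ident M \<cdot> (pi1 M \<cdot> g) = g"
      using Mc fT by simp_all
    \<comment> \<open>\<alpha> is known only through its image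
      \<open>\<eta>\<^sub>0\<^sub>1 \<lhd> p\<close> under \<open>opc\<close>; its restriction to
      identities is computed there and recovered by injectivity.\<close>
    have "opc (ident M \<rhd> \<alpha>) = ident M \<rhd> opc \<alpha>" by (rule op2_whisker[OF G(2,1) ab(1) MD(6)])
    also have "\<dots> = (ident M \<rhd> \<eta>\<^sub>0\<^sub>1) \<lhd> p" unfolding u using MT pqT by simp
    also have "\<dots> = Ide2 C (\<eta> \<cdot> p)" unfolding Q(3) using MT pqT by simp
    also have "\<dots> = opc (Ide2 C f)" unfolding op2_Ide2[OF G(1) fg(1)] u ..
    finally have e: "opc (ident M \<rhd> \<alpha>) = opc (Ide2 C f)" .
    have "ident M \<rhd> \<alpha> = Ide2 C f"
      by (rule op2_inject[OF G(1) _ _ e, of f f]) (use fT MT i in \<open>simp_all add: in_hom_hom_cat\<close>)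
    moreover have "ident M \<rhd> \<beta> = (ident M \<rhd> \<eta>\<^sub>0\<^sub>1) \<lhd> q" unfolding u using MT pqT by simp
    then have "ident M \<rhd> \<beta> = Ide2 C g" unfolding Q(3) u using MT pqT by simp
    ultimately have "exponential_induced (hom_cat C (C0 M) X) (D f g) (D f g) (Ide2 C f) (Ide2 C g) (ident M \<rhd> \<mu>)"
      using ind(3)[OF G(2) ab mu G(1) MD(6)] unfolding i by simp
    moreover have "in_hom (hom_cat C (C0 M) X) (Ide2 C f) f f" "in_hom (hom_cat C (C0 M) X) (Ide2 C g) g g"
      using fT by (simp_all add: in_hom_hom_cat)
    ultimately show ?thesis
      using ind(1)[OF G(1)] exponential_family_Ide[OF D G(1) fg] unfolding b_def by blast
  qed
  moreover have "pi02 M \<rhd> \<mu> = (pi01 M \<rhd> \<mu>) \<bullet> (pi12 M \<rhd> \<mu>)"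
  proof -
    have i: "pi02 M \<cdot> (pi0 M \<cdot> f) = pi01 M \<cdot> (pi0 M \<cdot> f)" "pi02 M \<cdot> (pi1 M \<cdot> f) = pi12 M \<cdot> (pi1 M \<cdot> f)"
      "pi02 M \<cdot> (pi0 M \<cdot> g) = pi01 M \<cdot> (pi0 M \<cdot> g)" "pi02 M \<cdot> (pi1 M \<cdot> g) = pi12 M \<cdot> (pi1 M \<cdot> g)"
      "pi01 M \<cdot> (pi1 M \<cdot> f) = pi12 M \<cdot> (pi0 M \<cdot> f)" "pi01 M \<cdot> (pi1 M \<cdot> g) = pi12 M \<cdot> (pi0 M \<cdot> g)"
      using Mc fT by simp_all
    have w: "in_hom (hom_cat C (C2 M) X) (pi01 M \<rhd> \<alpha>) (pi12 M \<cdot> (pi0 M \<cdot> f)) (pi01 M \<cdot> (pi0 M \<cdot> f))"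
      "in_hom (hom_cat C (C2 M) X) (pi12 M \<rhd> \<alpha>) (pi12 M \<cdot> (pi1 M \<cdot> f)) (pi12 M \<cdot> (pi0 M \<cdot> f))"
      "in_hom (hom_cat C (C2 M) X) (pi01 M \<rhd> \<beta>) (pi01 M \<cdot> (pi0 M \<cdot> g)) (pi12 M \<cdot> (pi0 M \<cdot> g))"
      "in_hom (hom_cat C (C2 M) X) (pi12 M \<rhd> \<beta>) (pi12 M \<cdot> (pi0 M \<cdot> g)) (pi12 M \<cdot> (pi1 M \<cdot> g))"
      "in_hom (hom_cat C (C2 M) X) (pi02 M \<rhd> \<alpha>) (pi12 M \<cdot> (pi1 M \<cdot> f)) (pi01 M \<cdot> (pi0 M \<cdot> f))"
      "in_hom (hom_cat C (C2 M) X) (pi02 M \<rhd> \<beta>) (pi01 M \<cdot> (pi0 M \<cdot> g)) (pi12 M \<cdot> (pi1 M \<cdot> g))"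
      using fT MT i by (simp_all add: in_hom_hom_cat)
    then have w': "in_hom (hom_cat C (C2 M) X) ((pi12 M \<rhd> \<alpha>) \<bullet> (pi01 M \<rhd> \<alpha>)) (pi12 M \<cdot> (pi1 M \<cdot> f)) (pi01 M \<cdot> (pi0 M \<cdot> f))"
      by (simp add: in_hom_hom_cat)
    have Qc: "Cod2 C (pi01 M \<rhd> \<eta>\<^sub>0\<^sub>1) = Dom2 C (pi12 M \<rhd> \<eta>\<^sub>0\<^sub>1)" using MT Mc by simp
    have "opc (pi02 M \<rhd> \<alpha>) = pi02 M \<rhd> opc \<alpha>" by (rule op2_whisker[OF G(2,3) ab(1) MD(9)])
    also have "\<dots> = (pi02 M \<rhd> \<eta>\<^sub>0\<^sub>1) \<lhd> p" unfolding u using MT pqT by simp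
    also have "\<dots> = (pi01 M \<rhd> (\<eta>\<^sub>0\<^sub>1 \<lhd> p)) \<bullet> (pi12 M \<rhd> (\<eta>\<^sub>0\<^sub>1 \<lhd> p))" unfolding Q(4) using MT pqT Qc by simp
    also have "\<dots> = opc (pi01 M \<rhd> \<alpha>) \<bullet> opc (pi12 M \<rhd> \<alpha>)"
      unfolding op2_whisker[OF G(2,3) ab(1) MD(7)] op2_whisker[OF G(2,3) ab(1) MD(8)] u ..
    \<comment> \<open>\<open>opc\<close> reverses composition, so \<alpha> composes in the order
      opposite to \<beta>, as the contravariant argument of an induced arrow demands.\<close>
    also have "\<dots> = opc ((pi12 M \<rhd> \<alpha>) \<bullet> (pi01 M \<rhd> \<alpha>))" by (rule op2_VComp[OF G(3) w(2,1), symmetric])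
    finally have "pi02 M \<rhd> \<alpha> = (pi12 M \<rhd> \<alpha>) \<bullet> (pi01 M \<rhd> \<alpha>)" by (rule op2_inject[OF G(3) w(5) w'])
    moreover have "pi02 M \<rhd> \<beta> = (pi02 M \<rhd> \<eta>\<^sub>0\<^sub>1) \<lhd> q" unfolding u using MT pqT by simp
    then have "pi02 M \<rhd> \<beta> = (pi01 M \<rhd> \<beta>) \<bullet> (pi12 M \<rhd> \<beta>)" unfolding Q(4) u using MT pqT Qc by simp
    moreover note i1 = ind(3)[OF G(2) ab mu G(3) MD(7), unfolded i] and i2 = ind(3)[OF G(2) ab mu G(3) MD(8)]
      and i3 = ind(3)[OF G(2) ab mu G(3) MD(9), unfolded i]
    note exponential_family_comp[OF closed D D D G(3) w(1,3,2,4) i1 i2]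
    ultimately show ?thesis using i3 ind(1)[OF G(3) w(5,6)] by metis
  qed
  ultimately have "is_cocone C M X b \<mu>" using bT muT by (simp add: is_cocone_def)
  then obtain ex where ex: "in_hom C ex P X" "\<eta> \<cdot> ex = b" "\<eta>\<^sub>0\<^sub>1 \<lhd> ex = \<mu>"
    using strict_quotient_lift[OF MD(17)] by blast
  have exT: "ex \<in> Arr C" "Dom C ex = P" "Cod C ex = X" using ex by (auto simp: in_hom_def)
  \<comment> \<open>A lift \<open>w\<close> of a pairing to \<open>C0 M\<close> restricts the
    universal pair \<open>f\<close>, \<open>g\<close> to the given one; in the first component this
    uses injectivity of \<open>opm\<close>.\<close>
  have lifted: "w \<cdot> f = f1 \<and> w \<cdot> g = g1" if A: "groupoid_obj C A" and f1: "in_hom C f1 A X" "in_hom C g1 A X"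
    and w: "in_hom C w A (C0 M)" "w \<cdot> \<eta> = pairing C p q (opm f1) g1" for A f1 g1 w
  proof -
    note pr = pairing_op_hom[OF A f1]
    have wT: "w \<in> Arr C" "Dom C w = A" "Cod C w = C0 M" using w by (auto simp: in_hom_def)
    have "opm (w \<cdot> f) = (w \<cdot> \<eta>) \<cdot> p" "w \<cdot> g = (w \<cdot> \<eta>) \<cdot> q"
      unfolding op1_comp[OF G(1) A fg(1) w(1)] u using wT MT pqT by simp_all
    then have "opm (w \<cdot> f) = opm f1" "w \<cdot> g = g1" unfolding w(2) pr .
    moreover have "in_hom C (w \<cdot> f) A X" using wT fT by (auto simp: in_hom_def)
    ultimately show ?thesis using op1_inject[OF A _ f1(1)] by blast
  qed
  have "pairing C p q (opm f1) g1 \<cdot> ex = exponential_object C D f1 g1"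
    if A: "groupoid_obj C A" and f1: "in_hom C f1 A X" "in_hom C g1 A X" for A f1 g1
  proof -
    note pr = pairing_op_hom[OF A f1]
    obtain w where w: "in_hom C w A (C0 M)" "w \<cdot> \<eta> = pairing C p q (opm f1) g1" using MD(15)[OF A pr(1)] by blast
    have "(w \<cdot> \<eta>) \<cdot> ex = w \<cdot> (\<eta> \<cdot> ex)" using w(1) MT exT by (auto simp: in_hom_def)
    then show ?thesis using bk[OF A w(1)] lifted[OF A f1 w] ex(2) w(2) by simp
  qed
  moreover have "exponential_induced (hom_cat C A X) (D f1 g1) (D f1' g1') \<alpha>1 \<beta>1 (pairing2 C p q (opc \<alpha>1) \<beta>1 \<lhd> ex)"
    if A: "groupoid_obj C A" and a1: "in_hom (hom_cat C A X) \<alpha>1 f1' f1" and b1: "in_hom (hom_cat C A X) \<beta>1 g1 g1'"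
    for A f1 f1' g1 g1' \<alpha>1 \<beta>1
  proof -
    define \<theta> where "\<theta> = pairing2 C p q (opc \<alpha>1) \<beta>1"
    note th = pairing2_op_hom(1-3)[OF A a1 b1, folded \<theta>_def]
    have f1: "in_hom C f1 A X" "in_hom C g1 A X" "in_hom C f1' A X" "in_hom C g1' A X" using a1 b1 by (auto simp: in_hom_def)
    have "\<theta> \<in> Arr (hom_cat C A P)" using th(1) by (simp only: in_hom_def)
    then obtain w where w: "in_hom C w A (C1 M)" "w \<rhd> \<eta>\<^sub>0\<^sub>1 = \<theta>" using MD(16)[OF A] by blast
    have wT: "w \<in> Arr C" "Dom C w = A" "Cod C w = C1 M" using w by (auto simp: in_hom_def)
    have "Dom2 C (w \<rhd> \<eta>\<^sub>0\<^sub>1) = (w \<cdot> pi0 M) \<cdot> \<eta>" "Cod2 C (w \<rhd> \<eta>\<^sub>0\<^sub>1) = (w \<cdot> pi1 M) \<cdot> \<eta>" using wT MT by simp_all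
    then have w01: "(w \<cdot> pi0 M) \<cdot> \<eta> = pairing C p q (opm f1) g1" "(w \<cdot> pi1 M) \<cdot> \<eta> = pairing C p q (opm f1') g1'"
      unfolding w(2) using th(1) by (simp_all add: in_hom_def)
    have wh: "in_hom C (w \<cdot> pi0 M) A (C0 M)" "in_hom C (w \<cdot> pi1 M) A (C0 M)" using wT MT by (auto simp: in_hom_def)
    have e: "w \<cdot> (pi0 M \<cdot> f) = f1" "w \<cdot> (pi0 M \<cdot> g) = g1" "w \<cdot> (pi1 M \<cdot> f) = f1'" "w \<cdot> (pi1 M \<cdot> g) = g1'"
      using lifted[OF A f1(1,2) wh(1) w01(1)] lifted[OF A f1(3,4) wh(2) w01(2)] wT MT fT by simp_all
    have "w \<rhd> opc \<alpha> = (w \<rhd> \<eta>\<^sub>0\<^sub>1) \<lhd> p" "w \<rhd> \<beta> = (w \<rhd> \<eta>\<^sub>0\<^sub>1) \<lhd> q"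
      unfolding u using wT MT pqT by simp_all
    then have "opc (w \<rhd> \<alpha>) = opc \<alpha>1" "w \<rhd> \<beta> = \<beta>1"
      unfolding op2_whisker[OF G(2) A ab(1) w(1)] w(2) th(2,3) by simp_all
    moreover have "in_hom (hom_cat C A X) (w \<rhd> \<alpha>) f1' f1" using wT fT MT e f1(3) by (simp add: in_hom_def)
    ultimately have "w \<rhd> \<alpha> = \<alpha>1" "w \<rhd> \<beta> = \<beta>1" using op2_inject[OF A _ a1] by blast+
    moreover have "\<theta> \<lhd> ex = w \<rhd> \<mu>" unfolding w(2)[symmetric] ex(3)[symmetric] using wT MT exT by simp
    ultimately show ?thesis using ind(3)[OF G(2) ab mu A w(1)] unfolding e \<theta>_def by simp
  qed
  ultimately show ?thesis using ex(1) unfolding realizes_def by blast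
qed

lemma realization_unique:
  assumes D: "exponential_family C X D" "exponential_family C X D'"
    and ex: "in_hom C ex P X" "realizes ex D" and ex': "in_hom C ex' P X" "realizes ex' D'"
  shows "isomorphic (hom_cat C P X) ex ex'"
proof -
  obtain M \<eta> \<eta>\<^sub>0\<^sub>1 where M: "nerve_presentation C P M \<eta> \<eta>\<^sub>0\<^sub>1" using nerve_exists[OF groupoidant pq_type(7)] by blast
  note MT = nerve_presentation_type[OF M] and MD = nerve_presentationD[OF M]
  note G = MD(1-3) and pqT = pq_type
  obtain f g \<alpha> \<beta> where fg: "in_hom C f (C0 M) X" "in_hom C g (C0 M) X"
    and ab: "in_hom (hom_cat C (C1 M) X) \<alpha> (pi1 M \<cdot> f) (pi0 M \<cdot> f)" "in_hom (hom_cat C (C1 M) X) \<beta> (pi0 M \<cdot> g) (pi1 M \<cdot> g)"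
    and u: "opm f = \<eta> \<cdot> p" "g = \<eta> \<cdot> q" "opc \<alpha> = \<eta>\<^sub>0\<^sub>1 \<lhd> p" "\<beta> = \<eta>\<^sub>0\<^sub>1 \<lhd> q"
    by (rule universal_cells[OF M])
  have fT: "f \<in> Arr C" "Dom C f = C0 M" "Cod C f = X" "g \<in> Arr C" "Dom C g = C0 M" "Cod C g = X"
    "\<alpha> \<in> Cell C" "Dom2 C \<alpha> = pi1 M \<cdot> f" "Cod2 C \<alpha> = pi0 M \<cdot> f" "\<beta> \<in> Cell C" "Dom2 C \<beta> = pi0 M \<cdot> g" "Cod2 C \<beta> = pi1 M \<cdot> g"
    using fg ab by (auto simp: in_hom_def)
  have eT: "ex \<in> Arr C" "Dom C ex = P" "Cod C ex = X" "ex' \<in> Arr C" "Dom C ex' = P" "Cod C ex' = X"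
    using ex ex' by (auto simp: in_hom_def)
  \<comment> \<open>\<eta> is itself the pairing of the universal pair, so the two realization
    hypotheses can be evaluated on the nerve.\<close>
  have eta: "pairing C p q (opm f) g = \<eta>"
    by (rule strict_product_pairing_eqI[OF prod]) (use MT u in \<open>auto simp: in_hom_def\<close>)
  have pf: "in_hom C (pi0 M \<cdot> f) (C1 M) X" "in_hom C (pi0 M \<cdot> g) (C1 M) X" "in_hom C (pi1 M \<cdot> f) (C1 M) X" "in_hom C (pi1 M \<cdot> g) (C1 M) X"
    using fT MT by (auto simp: in_hom_def)
  have pe: "pairing C p q (opm (pi0 M \<cdot> f)) (pi0 M \<cdot> g) = pi0 M \<cdot> \<eta>" "pairing C p q (opm (pi1 M \<cdot> f)) (pi1 M \<cdot> g) = pi1 M \<cdot> \<eta>"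
    unfolding op1_comp[OF G(1,2) fg(1) MD(4)] op1_comp[OF G(1,2) fg(1) MD(5)]
    by (rule strict_product_pairing_eqI[OF prod, of _ "C1 M"]; use MT u pqT in \<open>simp add: in_hom_def\<close>)+
  have eta1: "pairing2 C p q (opc \<alpha>) \<beta> = \<eta>\<^sub>0\<^sub>1"
  proof (rule pairing2_op_hom(4)[OF G(2) ab])
    show "in_hom (hom_cat C (C1 M) P) \<eta>\<^sub>0\<^sub>1 (pairing C p q (opm (pi0 M \<cdot> f)) (pi0 M \<cdot> g)) (pairing C p q (opm (pi1 M \<cdot> f)) (pi1 M \<cdot> g))"
      unfolding pe using MT by (simp add: in_hom_hom_cat)
  qed (use u in simp_all)
  have re: "\<eta> \<cdot> ex = exponential_object C D f g" "\<eta> \<cdot> ex' = exponential_object C D' f g"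
    using ex(2) ex'(2) G(1) fg unfolding realizes_def eta[symmetric] by blast+
  have ri: "exponential_induced (hom_cat C (C1 M) X) (D (pi0 M \<cdot> f) (pi0 M \<cdot> g)) (D (pi1 M \<cdot> f) (pi1 M \<cdot> g)) \<alpha> \<beta> (\<eta>\<^sub>0\<^sub>1 \<lhd> ex)"
    "exponential_induced (hom_cat C (C1 M) X) (D' (pi0 M \<cdot> f) (pi0 M \<cdot> g)) (D' (pi1 M \<cdot> f) (pi1 M \<cdot> g)) \<alpha> \<beta> (\<eta>\<^sub>0\<^sub>1 \<lhd> ex')"
    using ex(2) ex'(2) G(2) ab unfolding realizes_def eta1[symmetric] by blast+
  have I: "in_hom (hom_cat C (C0 M) X) (Ide2 C f) f f" "in_hom (hom_cat C (C0 M) X) (Ide2 C g) g g"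
    using fT by (simp_all add: in_hom_hom_cat)
  obtain \<sigma> where s: "exponential_induced (hom_cat C (C0 M) X) (D f g) (D' f g) (Ide2 C f) (Ide2 C g) \<sigma>"
    using exponential_family_induced(1)[OF closed D G(1) I] by blast
  obtain \<sigma>' where s': "exponential_induced (hom_cat C (C0 M) X) (D' f g) (D f g) (Ide2 C f) (Ide2 C g) \<sigma>'"
    using exponential_family_induced(1)[OF closed D(2,1) G(1) I] by blast
  have sh: "in_hom (hom_cat C (C0 M) X) \<sigma> (\<eta> \<cdot> ex) (\<eta> \<cdot> ex')" "in_hom (hom_cat C (C0 M) X) \<sigma>' (\<eta> \<cdot> ex') (\<eta> \<cdot> ex)"
    unfolding re by (rule exponential_family_induced(2)[OF closed D G(1) I s], rule exponential_family_induced(2)[OF closed D(2,1) G(1) I s'])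
  have II: "Ide2 C f \<bullet> Ide2 C f = Ide2 C f" "Ide2 C g \<bullet> Ide2 C g = Ide2 C g" using fT by simp_all
  \<comment> \<open>The composite is induced by identities, as is the identity 2-cell, so the two
    coincide; arbitrary families are allowed in order to cover both composites.\<close>
  have inv: "x \<bullet> y = Ide2 C (exponential_object C E f g)"
    if E: "exponential_family C X E" "exponential_family C X E'"
      and x: "exponential_induced (hom_cat C (C0 M) X) (E f g) (E' f g) (Ide2 C f) (Ide2 C g) x"
      and y: "exponential_induced (hom_cat C (C0 M) X) (E' f g) (E f g) (Ide2 C f) (Ide2 C g) y" for E E' x y
  proof -
    have "exponential_induced (hom_cat C (C0 M) X) (E f g) (E f g) (Ide2 C f) (Ide2 C g) (x \<bullet> y)"
      using exponential_family_comp[OF closed E E(1) G(1) I I x y] unfolding II .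
    then show ?thesis using exponential_family_induced(1)[OF closed E(1,1) G(1) I] exponential_family_Ide[OF E(1) G(1) fg] by blast
  qed
  have ss: "\<sigma> \<bullet> \<sigma>' = Ide2 C (\<eta> \<cdot> ex)" "\<sigma>' \<bullet> \<sigma> = Ide2 C (\<eta> \<cdot> ex')"
    unfolding re by (rule inv[OF D s s'], rule inv[OF D(2,1) s' s])
  \<comment> \<open>Both sides are the arrow induced by \<alpha> and \<beta> from \<open>E\<close>
    at the source to \<open>E'\<close> at the target: the restricted identities are absorbed in the
    composite pairs.\<close>
  have natural: "(pi0 M \<rhd> x) \<bullet> (\<eta>\<^sub>0\<^sub>1 \<lhd> e') = (\<eta>\<^sub>0\<^sub>1 \<lhd> e) \<bullet> (pi1 M \<rhd> x)"
    if E: "exponential_family C X E" "exponential_family C X E'"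
      and x: "exponential_induced (hom_cat C (C0 M) X) (E f g) (E' f g) (Ide2 C f) (Ide2 C g) x"
      and e: "exponential_induced (hom_cat C (C1 M) X) (E (pi0 M \<cdot> f) (pi0 M \<cdot> g)) (E (pi1 M \<cdot> f) (pi1 M \<cdot> g)) \<alpha> \<beta> (\<eta>\<^sub>0\<^sub>1 \<lhd> e)"
      and e': "exponential_induced (hom_cat C (C1 M) X) (E' (pi0 M \<cdot> f) (pi0 M \<cdot> g)) (E' (pi1 M \<cdot> f) (pi1 M \<cdot> g)) \<alpha> \<beta> (\<eta>\<^sub>0\<^sub>1 \<lhd> e')"
    for E E' x e e'
  proof -
    have J: "in_hom (hom_cat C (C1 M) X) (k \<rhd> Ide2 C f) (k \<cdot> f) (k \<cdot> f)" "in_hom (hom_cat C (C1 M) X) (k \<rhd> Ide2 C g) (k \<cdot> g) (k \<cdot> g)"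
      if "in_hom C k (C1 M) (C0 M)" for k using that fT by (simp_all add: in_hom_def)
    note x0 = exponential_family_induced(3)[OF closed E G(1) I x G(2) MD(4)] and x1 = exponential_family_induced(3)[OF closed E G(1) I x G(2) MD(5)]
    have "exponential_induced (hom_cat C (C1 M) X) (E (pi0 M \<cdot> f) (pi0 M \<cdot> g)) (E' (pi1 M \<cdot> f) (pi1 M \<cdot> g))
        (\<alpha> \<bullet> (pi0 M \<rhd> Ide2 C f)) ((pi0 M \<rhd> Ide2 C g) \<bullet> \<beta>) ((pi0 M \<rhd> x) \<bullet> (\<eta>\<^sub>0\<^sub>1 \<lhd> e'))"
      by (rule exponential_family_comp[OF closed E E(2) G(2) J[OF MD(4)] ab x0 e'])
    moreover have "exponential_induced (hom_cat C (C1 M) X) (E (pi0 M \<cdot> f) (pi0 M \<cdot> g)) (E' (pi1 M \<cdot> f) (pi1 M \<cdot> g))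
        ((pi1 M \<rhd> Ide2 C f) \<bullet> \<alpha>) (\<beta> \<bullet> (pi1 M \<rhd> Ide2 C g)) ((\<eta>\<^sub>0\<^sub>1 \<lhd> e) \<bullet> (pi1 M \<rhd> x))"
      by (rule exponential_family_comp[OF closed E(1,1,2) G(2) ab J[OF MD(5)] e x1])
    moreover have "\<alpha> \<bullet> (pi0 M \<rhd> Ide2 C f) = \<alpha>" "(pi1 M \<rhd> Ide2 C f) \<bullet> \<alpha> = \<alpha>" "(pi0 M \<rhd> Ide2 C g) \<bullet> \<beta> = \<beta>" "\<beta> \<bullet> (pi1 M \<rhd> Ide2 C g) = \<beta>"
      using fT MT by simp_all
    ultimately show ?thesis using exponential_family_induced(1)[OF closed E G(2) ab] by metis
  qed
  obtain \<theta> where th: "in_hom (hom_cat C P X) \<theta> ex ex'" "\<eta> \<rhd> \<theta> = \<sigma>"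
    using strict_quotient_lift_cell[OF MD(17) ex(1) ex'(1) sh(1) natural[OF D s ri]] by blast
  obtain \<theta>' where th': "in_hom (hom_cat C P X) \<theta>' ex' ex" "\<eta> \<rhd> \<theta>' = \<sigma>'"
    using strict_quotient_lift_cell[OF MD(17) ex'(1) ex(1) sh(2) natural[OF D(2,1) s' ri(2,1)]] by blast
  have tT: "\<theta> \<in> Cell C" "Dom2 C \<theta> = ex" "Cod2 C \<theta> = ex'" "\<theta>' \<in> Cell C" "Dom2 C \<theta>' = ex'" "Cod2 C \<theta>' = ex"
    using th(1) th'(1) by (auto simp: in_hom_def)
  have "\<theta> \<bullet> \<theta>' = Ide2 C ex" "\<theta>' \<bullet> \<theta> = Ide2 C ex'"
    by (rule nerve_presentation_cell_eqI[OF M]; use tT eT MT th(2) th'(2) ss in \<open>simp add: in_hom_hom_cat\<close>)+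
  then have "is_inverse (hom_cat C P X) \<theta> \<theta>'" by (intro is_inverse_cellI[OF th(1) th'(1)])
  then show ?thesis using th(1) by (auto simp: isomorphic_def is_iso_def)
qed

end

context two_category
begin

section \<open>From a section over cores to an exponential family\<close>

lemma L_object_hom:
  assumes L: "L_object C X L ev"
  shows "X \<in> Obj C" "L \<in> Obj C" "fst ev 0 \<in> Arr C" "fst ev 1 \<in> Arr C" "fst ev (Suc 0) \<in> Arr C" "fst ev 2 \<in> Arr C" "fst ev 3 \<in> Arr C"
    "Dom C (fst ev 0) = L" "Dom C (fst ev 1) = L" "Dom C (fst ev (Suc 0)) = L" "Dom C (fst ev 2) = L" "Dom C (fst ev 3) = L"
    "Cod C (fst ev 0) = X" "Cod C (fst ev 1) = X" "Cod C (fst ev (Suc 0)) = X" "Cod C (fst ev 2) = X" "Cod C (fst ev 3) = X"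
    "snd ev (3, 0) \<in> Cell C" "Dom2 C (snd ev (3, 0)) = fst ev 3" "Cod2 C (snd ev (3, 0)) = fst ev 0"
    "snd ev (3, 1) \<in> Cell C" "Dom2 C (snd ev (3, 1)) = fst ev 3" "Cod2 C (snd ev (3, 1)) = fst ev 1"
    "snd ev (3, Suc 0) \<in> Cell C" "Dom2 C (snd ev (3, Suc 0)) = fst ev 3" "Cod2 C (snd ev (3, Suc 0)) = fst ev (Suc 0)"
    "snd ev (3, 2) \<in> Cell C" "Dom2 C (snd ev (3, 2)) = fst ev 3" "Cod2 C (snd ev (3, 2)) = fst ev 2"
proof -
  have F: "is_functor L_cat (hom_cat C L X) ev" and "X \<in> Obj C" "L \<in> Obj C" using L unfolding L_object_def by blast+
  then show "X \<in> Obj C" "L \<in> Obj C" by blast+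
  note f = functorD_hom[OF category_L_cat F]
  show "fst ev 0 \<in> Arr C" "fst ev 1 \<in> Arr C" "fst ev (Suc 0) \<in> Arr C" "fst ev 2 \<in> Arr C" "fst ev 3 \<in> Arr C"
    "Dom C (fst ev 0) = L" "Dom C (fst ev 1) = L" "Dom C (fst ev (Suc 0)) = L" "Dom C (fst ev 2) = L" "Dom C (fst ev 3) = L"
    "Cod C (fst ev 0) = X" "Cod C (fst ev 1) = X" "Cod C (fst ev (Suc 0)) = X" "Cod C (fst ev 2) = X" "Cod C (fst ev 3) = X"
    using f(1)[of 0] f(1)[of 1] f(1)[of 2] f(1)[of 3] by (simp_all add: in_hom_def)
  show "snd ev (3, 0) \<in> Cell C" "Dom2 C (snd ev (3, 0)) = fst ev 3" "Cod2 C (snd ev (3, 0)) = fst ev 0"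
    "snd ev (3, 1) \<in> Cell C" "Dom2 C (snd ev (3, 1)) = fst ev 3" "Cod2 C (snd ev (3, 1)) = fst ev 1"
    "snd ev (3, Suc 0) \<in> Cell C" "Dom2 C (snd ev (3, Suc 0)) = fst ev 3" "Cod2 C (snd ev (3, Suc 0)) = fst ev (Suc 0)"
    "snd ev (3, 2) \<in> Cell C" "Dom2 C (snd ev (3, 2)) = fst ev 3" "Cod2 C (snd ev (3, 2)) = fst ev 2"
    using f(3)[of "(3, 0)"] f(3)[of "(3, 1)"] f(3)[of "(3, 2)"] by (simp_all add: in_hom_def)
qed

text \<open>\<open>exp_diagram s t i E j f g\<close> is \<open>\<langle>f, g\<rangle>\<^sup>i\<^sup>s\<^sup>o E j\<close> in the notation of \<open>exponential_morphism\<close>.\<close>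

definition exp_diagram :: "'m \<Rightarrow> 'm \<Rightarrow> 'm \<Rightarrow> 'm \<Rightarrow> 'm \<Rightarrow> 'm \<Rightarrow> 'm \<Rightarrow> 'm" where
  "exp_diagram s t i E j f g = lift_along C i (pairing C s t f g) \<cdot> E \<cdot> j"

text \<open>\<open>E\<close> is a section of the core of the restriction to the vertices 0 and 1, so
  these vertices are recovered as \<open>f\<close> and \<open>g\<close>. Lifts from groupoids to the
  core \<open>K\<close> are unique, whence the strict compatibility with \<open>k\<close>.\<close>

lemma exp_diagram_type:
  assumes S: "strict_product C X X S s t" and K: "is_core C S K i" and L: "L_object C X L ev" and M: "is_core C L M j"
    and E: "in_hom C E K M" "E \<cdot> core_map C j i (pairing C s t (fst ev 0) (fst ev 1)) = Ide C K"
    and A: "groupoid_obj C A" and f: "in_hom C f A X" "in_hom C g A X"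
  shows "in_hom C (exp_diagram s t i E j f g) A L" "exp_diagram s t i E j f g \<cdot> fst ev 0 = f" "exp_diagram s t i E j f g \<cdot> fst ev 1 = g"
    "groupoid_obj C A' \<Longrightarrow> in_hom C k A' A \<Longrightarrow> exp_diagram s t i E j (k \<cdot> f) (k \<cdot> g) = k \<cdot> exp_diagram s t i E j f g"
proof -
  note ev = L_object_hom[OF L]
  define pr where "pr = pairing C s t f g"
  note pr = strict_product_pairing[OF S f, folded pr_def]
  note l = core_lift_along[OF K pr(1) disjI1[OF A]]
  define l where "l = lift_along C i pr"
  have T: "l \<in> Arr C" "Dom C l = A" "Cod C l = K" "i \<in> Arr C" "Dom C i = K" "Cod C i = S" "E \<in> Arr C" "Dom C E = K" "Cod C E = M"
    "j \<in> Arr C" "Dom C j = M" "Cod C j = L" "s \<in> Arr C" "t \<in> Arr C" "Dom C s = S" "Dom C t = S" "Cod C s = X" "Cod C t = X"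
    using l(1) is_core_hom[OF K] is_core_hom[OF M] E(1) strict_product_hom[OF S] unfolding l_def by (auto simp: in_hom_def)
  have d: "exp_diagram s t i E j f g = l \<cdot> (E \<cdot> j)" unfolding exp_diagram_def l_def[unfolded pr_def, symmetric] using T by simp
  show dh: "in_hom C (exp_diagram s t i E j f g) A L" unfolding d using T by (simp add: in_hom_def)
  have e: "in_hom C (fst ev 0) L X" "in_hom C (fst ev 1) L X" using ev by (auto simp: in_hom_def)
  define m where "m = pairing C s t (fst ev 0) (fst ev 1)"
  note m = strict_product_pairing[OF S e, folded m_def]
  have mT: "m \<in> Arr C" "Dom C m = L" "Cod C m = S" using m by (auto simp: in_hom_def)
  have "in_hom C (j \<cdot> m) M S" using T mT by (simp add: in_hom_def)
  note c = core_lift_along[OF K this disjI1[OF core_groupoid[OF M]]]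
  define c' where "c' = core_map C j i m"
  have c': "in_hom C c' M K" "c' \<cdot> i = j \<cdot> m" "E \<cdot> c' = Ide C K" using c E(2) unfolding c'_def m_def core_map_def by simp_all
  have c'T: "c' \<in> Arr C" "Dom C c' = M" "Cod C c' = K" using c' by (auto simp: in_hom_def)
  have "(l \<cdot> (E \<cdot> j)) \<cdot> m = l \<cdot> (E \<cdot> (j \<cdot> m))" "l \<cdot> (E \<cdot> (c' \<cdot> i)) = l \<cdot> ((E \<cdot> c') \<cdot> i)" using T mT c'T by simp_all
  moreover have "l \<cdot> (Ide C K \<cdot> i) = pr" using T l(2) unfolding l_def by simp
  ultimately have dm: "exp_diagram s t i E j f g \<cdot> m = pr" unfolding d c' by simp
  have "exp_diagram s t i E j f g \<cdot> (m \<cdot> s) = (exp_diagram s t i E j f g \<cdot> m) \<cdot> s" "exp_diagram s t i E j f g \<cdot> (m \<cdot> t) = (exp_diagram s t i E j f g \<cdot> m) \<cdot> t"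
    using dh mT T by (simp_all add: in_hom_def)
  then show "exp_diagram s t i E j f g \<cdot> fst ev 0 = f" "exp_diagram s t i E j f g \<cdot> fst ev 1 = g" unfolding m dm pr .
  show "exp_diagram s t i E j (k \<cdot> f) (k \<cdot> g) = k \<cdot> exp_diagram s t i E j f g" if A': "groupoid_obj C A'" and k: "in_hom C k A' A"
  proof -
    have kT: "k \<in> Arr C" "Dom C k = A'" "Cod C k = A" using k by (auto simp: in_hom_def)
    have prT: "pr \<in> Arr C" "Dom C pr = A" "Cod C pr = S" using pr by (auto simp: in_hom_def)
    have "pairing C s t (k \<cdot> f) (k \<cdot> g) = k \<cdot> pr"
    proof (rule strict_product_pairing_eqI[OF S])
      show "in_hom C (k \<cdot> pr) A' S" using kT prT by (simp add: in_hom_def)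
      have "(k \<cdot> pr) \<cdot> s = k \<cdot> (pr \<cdot> s)" "(k \<cdot> pr) \<cdot> t = k \<cdot> (pr \<cdot> t)" using kT prT T by simp_all
      then show "(k \<cdot> pr) \<cdot> s = k \<cdot> f" "(k \<cdot> pr) \<cdot> t = k \<cdot> g" unfolding pr .
    qed
    moreover have "lift_along C i (k \<cdot> pr) = k \<cdot> l"
    proof (rule lift_along_eqI[OF K _ _ A'])
      show "in_hom C (k \<cdot> l) A' K" using kT T by (simp add: in_hom_def)
      have "(k \<cdot> l) \<cdot> i = k \<cdot> (l \<cdot> i)" using kT T by simp
      then show "(k \<cdot> l) \<cdot> i = k \<cdot> pr" using l(2) unfolding l_def by simp
    qed
    ultimately have "exp_diagram s t i E j (k \<cdot> f) (k \<cdot> g) = (k \<cdot> l) \<cdot> E \<cdot> j" by (simp add: exp_diagram_def)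
    then show ?thesis unfolding d using kT T by simp
  qed
qed

text \<open>Strict naturality of \<open>exp_diagram\<close> passes to its three arrows by
  whiskering, so together with exponentiality at each stage it gives a family.\<close>

lemma exp_diagram_family:
  assumes S: "strict_product C X X S s t" and K: "is_core C S K i" and L: "L_object C X L ev" and M: "is_core C L M j"
    and E: "in_hom C E K M" "E \<cdot> core_map C j i (pairing C s t (fst ev 0) (fst ev 1)) = Ide C K"
    and x: "\<And>A f g. groupoid_obj C A \<Longrightarrow> in_hom C f A X \<Longrightarrow> in_hom C g A X \<Longrightarrow>
      exponential_object_diagram C X ev (exp_diagram s t i E j f g)"
  shows "exponential_family C X (\<lambda>f g. L_arrows C ev (exp_diagram s t i E j f g))"
    "groupoid_obj C A \<Longrightarrow> in_hom C f A X \<Longrightarrow> in_hom C g A X \<Longrightarrow>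
      exponential_object C (\<lambda>f g. L_arrows C ev (exp_diagram s t i E j f g)) f g = exp_diagram s t i E j f g \<cdot> fst ev 2"
proof -
  note ev = L_object_hom[OF L]
  note ty = exp_diagram_type[OF S K L M E]
  show "exponential_object C (\<lambda>f g. L_arrows C ev (exp_diagram s t i E j f g)) f g = exp_diagram s t i E j f g \<cdot> fst ev 2"
    if "groupoid_obj C A" "in_hom C f A X" "in_hom C g A X"
    using ty(1)[OF that] ev by (simp add: L_arrows_def in_hom_def)
  show "exponential_family C X (\<lambda>f g. L_arrows C ev (exp_diagram s t i E j f g))"
    unfolding exponential_family_def
  proof (intro allI impI)
    fix A f g assume "groupoid_obj C A \<and> in_hom C f A X \<and> in_hom C g A X"
    then have A: "groupoid_obj C A" "in_hom C f A X" "in_hom C g A X" by auto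
    define d where "d = exp_diagram s t i E j f g"
    have dT: "d \<in> Arr C" "Dom C d = A" "Cod C d = L" "d \<cdot> fst ev 0 = f" "d \<cdot> fst ev 1 = g"
      using ty(1-3)[OF A, folded d_def] by (auto simp: in_hom_def)
    have "exponential_diagram (hom_cat C A X) (d \<rhd> snd ev (3, 2)) (d \<rhd> snd ev (3, 0)) (d \<rhd> snd ev (3, 1))"
      using x[OF A, folded d_def] dT by (simp add: exponential_object_diagram_def L_arrows_def)
    moreover have La: "L_arrows C ev (exp_diagram s t i E j f g) = (d \<rhd> snd ev (3, 2), d \<rhd> snd ev (3, 0), d \<rhd> snd ev (3, 1))"
      by (simp add: L_arrows_def d_def)
    moreover have "Cod2 C (d \<rhd> snd ev (3, 0)) = f" "Cod2 C (d \<rhd> snd ev (3, 1)) = g" using dT ev by simp_all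
    moreover have "L_arrows C ev (exp_diagram s t i E j (k \<cdot> f) (k \<cdot> g)) =
        (k \<rhd> (d \<rhd> snd ev (3, 2)), k \<rhd> (d \<rhd> snd ev (3, 0)), k \<rhd> (d \<rhd> snd ev (3, 1)))"
      if "groupoid_obj C A'" "in_hom C k A' A" for A' k
      using ty(4)[OF A that] that dT ev by (simp add: L_arrows_def in_hom_def d_def[symmetric])
    ultimately show "\<exists>p q e. L_arrows C ev (exp_diagram s t i E j f g) = (p, q, e) \<and> exponential_diagram (hom_cat C A X) p q e \<and>
        Cod2 C q = f \<and> Cod2 C e = g \<and> (\<forall>A' k. groupoid_obj C A' \<and> in_hom C k A' A \<longrightarrow>
          L_arrows C ev (exp_diagram s t i E j (k \<cdot> f) (k \<cdot> g)) = (k \<rhd> p, k \<rhd> q, k \<rhd> e))"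
      unfolding La by blast
  qed
qed

text \<open>At any stage a product diagram is isomorphic to a restriction of the internal product,
  and restrictions of the latter are again products. This extends preservation beyond groupoids, as
  membership in \<open>L_diagrams\<close> demands.\<close>

lemma product_diagram_precomp:
  assumes S: "strict_product C X X S s t" and X: "X \<in> Obj C"
    and \<pi>: "in_hom (hom_cat C S X) \<pi> m s" "in_hom (hom_cat C S X) \<pi>' m t"
    and prod: "\<And>Y f. in_hom C f Y S \<Longrightarrow> product_diagram (hom_cat C Y X) (f \<rhd> \<pi>) (f \<rhd> \<pi>')"
    and ab: "product_diagram (hom_cat C A X) a b" and k: "in_hom C k A' A"
  shows "product_diagram (hom_cat C A' X) (k \<rhd> a) (k \<rhd> b)"
proof -
  have O: "A' \<in> Obj C" "A \<in> Obj C" using in_homD(4,5)[OF k] by blast+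
  interpret A: category "hom_cat C A X" using hom_category O X by blast
  interpret A': category "hom_cat C A' X" using hom_category O X by blast
  have abT: "a \<in> Cell C" "b \<in> Cell C" "Dom2 C b = Dom2 C a" "Dom C (Dom2 C a) = A" "Cod C (Dom2 C a) = X"
    using A.product_diagram_arr[OF ab] by auto
  have "in_hom C (Cod2 C a) A X" "in_hom C (Cod2 C b) A X" using abT by (auto simp: in_hom_def)
  then obtain d where d: "in_hom C d A S" "d \<cdot> s = Cod2 C a" "d \<cdot> t = Cod2 C b" using strict_product_lift[OF S] by blast
  have T: "d \<in> Arr C" "Dom C d = A" "Cod C d = S" "k \<in> Arr C" "Dom C k = A'" "Cod C k = A"
    "\<pi> \<in> Cell C" "\<pi>' \<in> Cell C" "Dom2 C \<pi> = m" "Dom2 C \<pi>' = m" "Cod2 C \<pi> = s" "Cod2 C \<pi>' = t" "Dom C m = S" "Cod C m = X" "m \<in> Arr C"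
    using d k \<pi> Dom2_in_Arr by (auto simp: in_hom_def)
  obtain \<sigma> \<sigma>' where s: "is_inverse (hom_cat C A X) \<sigma> \<sigma>'" "in_hom (hom_cat C A X) \<sigma> (Dom2 C a) (d \<cdot> m)" "\<sigma> \<bullet> (d \<rhd> \<pi>) = a" "\<sigma> \<bullet> (d \<rhd> \<pi>') = b"
    using A.product_diagram_comparison[OF ab prod[OF d(1)]] T d by auto
  have sT: "\<sigma> \<in> Cell C" "Dom2 C \<sigma> = Dom2 C a" "Cod2 C \<sigma> = d \<cdot> m" using s(2) by (auto simp: in_hom_def)
  have kd: "in_hom C (k \<cdot> d) A' S" using T by (simp add: in_hom_def)
  have "product_diagram (hom_cat C A' X) ((k \<rhd> \<sigma>) \<bullet> ((k \<cdot> d) \<rhd> \<pi>)) ((k \<rhd> \<sigma>) \<bullet> ((k \<cdot> d) \<rhd> \<pi>'))"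
    using A'.product_diagram_iso[OF prod[OF kd] whisker_l_inverse[OF s(1) k]] T sT abT by simp
  moreover have "(k \<rhd> \<sigma>) \<bullet> ((k \<cdot> d) \<rhd> \<pi>) = k \<rhd> (\<sigma> \<bullet> (d \<rhd> \<pi>))" "(k \<rhd> \<sigma>) \<bullet> ((k \<cdot> d) \<rhd> \<pi>') = k \<rhd> (\<sigma> \<bullet> (d \<rhd> \<pi>'))"
    using T sT abT by simp_all
  ultimately show ?thesis by (simp only: s)
qed

lemma exp_diagram_exists:
  assumes g: "groupoidant C" and cc: "cartesian_closed_obj C X"
  shows "\<exists>S s t K i L ev M j E. strict_product C X X S s t \<and> is_core C S K i \<and> L_object C X L ev \<and> is_core C L M j \<and>
     in_hom C E K M \<and> E \<cdot> core_map C j i (pairing C s t (fst ev 0) (fst ev 1)) = Ide C K \<and>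
     (\<forall>A f g. groupoid_obj C A \<longrightarrow> in_hom C f A X \<longrightarrow> in_hom C g A X \<longrightarrow>
        exponential_object_diagram C X ev (exp_diagram s t i E j f g))"
proof -
  have pita: "pita C" and cores: "\<And>Y. Y \<in> Obj C \<Longrightarrow> \<exists>K i. is_core C Y K i" using g unfolding groupoidant_def by blast+
  have X: "X \<in> Obj C" using cartesian_closed_objD[OF cc] by blast
  obtain S s t where S: "strict_product C X X S s t" using strict_product_exists[OF pita X X] by blast
  note sth = strict_product_hom[OF S]
  obtain K i where K: "is_core C S K i" using cores[OF in_homD(4)[OF sth(1)]] by blast
  obtain m \<pi> \<pi>' where pi: "in_hom (hom_cat C S X) \<pi> m s" "in_hom (hom_cat C S X) \<pi>' m t"
    and prod: "\<And>Y f. in_hom C f Y S \<Longrightarrow> product_diagram (hom_cat C Y X) (f \<rhd> \<pi>) (f \<rhd> \<pi>')"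
    using internal_product_exists[OF g cc S] by blast
  obtain L ev where L: "L_object C X L ev" using L_object_exists[OF pita S pi prod] by blast
  note ev = L_object_hom[OF L]
  obtain M j where M: "is_core C L M j" using cores[OF ev(2)] by blast
  note GK = core_groupoid[OF K]
  have T: "i \<in> Arr C" "Dom C i = K" "Cod C i = S" "s \<in> Arr C" "t \<in> Arr C" "Dom C s = S" "Dom C t = S" "Cod C s = X" "Cod C t = X"
    "j \<in> Arr C" "Dom C j = M" "Cod C j = L"
    using is_core_hom[OF K] is_core_hom[OF M] sth by (auto simp: in_hom_def)
  have KO: "K \<in> Obj C" using T dom_obj by metis
  interpret KX: category "hom_cat C K X" by (rule hom_category[OF KO X])
  have "i \<cdot> s \<in> Obj (hom_cat C K X)" "i \<cdot> t \<in> Obj (hom_cat C K X)" using T by (auto simp: in_hom_def)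
  moreover have "\<forall>x\<in>Obj (hom_cat C K X). \<forall>y\<in>Obj (hom_cat C K X). \<exists>a b e. exponential_diagram (hom_cat C K X) a b e \<and>
      Cod (hom_cat C K X) b = x \<and> Cod (hom_cat C K X) e = y"
    using cartesian_closed_objD(2)[OF cc GK] unfolding cartesian_closed_cat_def by blast
  ultimately obtain a b e where d': "exponential_diagram (hom_cat C K X) a b e" "Cod (hom_cat C K X) b = i \<cdot> s" "Cod (hom_cat C K X) e = i \<cdot> t"
    by blast
  then have d: "exponential_diagram (hom_cat C K X) a b e" "Cod2 C b = i \<cdot> s" "Cod2 C e = i \<cdot> t" by simp_all
  note D = KX.exponential_diagramD[OF d(1), simplified]
  have DT: "a \<in> Cell C" "b \<in> Cell C" "e \<in> Cell C" "Dom2 C b = Dom2 C a" "Dom2 C e = Dom2 C a" "Dom C (Dom2 C a) = K" "Cod C (Dom2 C a) = X"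
    using D by auto
  \<comment> \<open>The chosen exponential as a diagram of shape \<open>L_cat\<close>: 0 is the
    exponent, 1 the base, 2 the exponential and 3 the product.\<close>
  define F :: "(nat, nat \<times> nat, 'm, 'c) fctr" where
    "F = (\<lambda>j. if j = 0 then i \<cdot> s else if j = 1 then i \<cdot> t else if j = 2 then Cod2 C a else Dom2 C a,
        \<lambda>(l, j). if l = j then Ide2 C (if j = 0 then i \<cdot> s else if j = 1 then i \<cdot> t else if j = 2 then Cod2 C a else Dom2 C a)
           else if j = 0 then b else if j = 1 then e else a)"
  have F: "fst F 0 = i \<cdot> s" "fst F 1 = i \<cdot> t" "fst F 2 = Cod2 C a" "fst F 3 = Dom2 C a"
    "snd F (0, 0) = Ide2 C (i \<cdot> s)" "snd F (1, 1) = Ide2 C (i \<cdot> t)" "snd F (2, 2) = Ide2 C (Cod2 C a)" "snd F (3, 3) = Ide2 C (Dom2 C a)"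
    "snd F (3, 0) = b" "snd F (3, 1) = e" "snd F (3, 2) = a"
    by (simp_all add: F_def)
  have Ff: "is_functor L_cat (hom_cat C K X) F"
    unfolding is_functor_def ball_L_cat using T DT d by (simp add: F in_hom_def del: One_nat_def)
  \<comment> \<open>Membership asks for preservation along morphisms from all objects, although the
    product was chosen over a groupoid.\<close>
  have Z: "(restrict (fst F) (Obj L_cat), restrict (snd F) (Arr L_cat)) \<in> L_diagrams C K X"
    using product_diagram_precomp[OF S X pi prod D(1)] F by (simp add: L_diagrams_def)
  have isoL: "iso_functor (hom_cat C K L) (full_subcat (fun_cat L_cat (hom_cat C K X)) (L_diagrams C K X)) (cotensor_functor C L_cat ev)"
    using L KO unfolding L_object_def by blast
  obtain h where h: "in_hom C h K L" "\<forall>j\<in>Obj L_cat. h \<cdot> fst ev j = fst F j" "\<forall>w\<in>Arr L_cat. h \<rhd> snd ev w = snd F w"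
    using cotensor_lift[OF category_L_cat Ff isoL Z] by blast
  have h': "h \<cdot> fst ev 0 = i \<cdot> s" "h \<cdot> fst ev 1 = i \<cdot> t" "h \<rhd> snd ev (3, 0) = b" "h \<rhd> snd ev (3, 1) = e" "h \<rhd> snd ev (3, 2) = a"
    using h(2,3) unfolding ball_L_cat F by blast+
  have hT: "h \<in> Arr C" "Dom C h = K" "Cod C h = L" using h by (auto simp: in_hom_def)
  \<comment> \<open>\<open>K\<close> is a groupoid, so the morphism \<open>h\<close> classifying the
    diagram lifts to the core of \<open>L\<close>.\<close>
  obtain E where E: "in_hom C E K M" "E \<cdot> j = h" using core_lift[OF M h(1)] GK by blast
  have ET: "E \<in> Arr C" "Dom C E = K" "Cod C E = M" using E by (auto simp: in_hom_def)
  have ee: "in_hom C (fst ev 0) L X" "in_hom C (fst ev 1) L X" using ev by (auto simp: in_hom_def)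
  define n where "n = pairing C s t (fst ev 0) (fst ev 1)"
  note n = strict_product_pairing[OF S ee, folded n_def]
  have nT: "n \<in> Arr C" "Dom C n = L" "Cod C n = S" using n by (auto simp: in_hom_def)
  have "in_hom C (j \<cdot> n) M S" using T nT by (simp add: in_hom_def)
  note c = core_lift_along[OF K this disjI1[OF core_groupoid[OF M]]]
  define c' where "c' = core_map C j i n"
  have c': "in_hom C c' M K" "c' \<cdot> i = j \<cdot> n" using c unfolding c'_def core_map_def by simp_all
  have c'T: "c' \<in> Arr C" "Dom C c' = M" "Cod C c' = K" using c' by (auto simp: in_hom_def)
  \<comment> \<open>On the vertices 0 and 1 the diagram restricts to \<open>i\<close>; cancelling
    the core inclusion turns this into the section equation for \<open>E\<close>.\<close>
  have hn: "h \<cdot> n = i"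
  proof (rule strict_product_eqI[OF S, of _ K])
    show "in_hom C (h \<cdot> n) K S" "in_hom C i K S" using hT nT T by (simp_all add: in_hom_def)
    have "(h \<cdot> n) \<cdot> s = h \<cdot> (n \<cdot> s)" "(h \<cdot> n) \<cdot> t = h \<cdot> (n \<cdot> t)" using hT nT T by simp_all
    then show "(h \<cdot> n) \<cdot> s = i \<cdot> s" "(h \<cdot> n) \<cdot> t = i \<cdot> t" unfolding n h' .
  qed
  have "E \<cdot> c' = Ide C K"
  proof (rule core_eqI[OF K, of _ K])
    show "in_hom C (E \<cdot> c') K K" "in_hom C (Ide C K) K K" using ET c'T KO by (simp_all add: in_hom_def)
    have "(E \<cdot> c') \<cdot> i = E \<cdot> (c' \<cdot> i)" "E \<cdot> (j \<cdot> n) = (E \<cdot> j) \<cdot> n" "Ide C K \<cdot> i = i" using ET c'T T nT by simp_all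
    then show "(E \<cdot> c') \<cdot> i = Ide C K \<cdot> i" unfolding c' by (simp only: E hn)
  qed
  then have Ec: "E \<cdot> core_map C j i (pairing C s t (fst ev 0) (fst ev 1)) = Ide C K" unfolding c'_def n_def .
  have "exponential_object_diagram C X ev (exp_diagram s t i E j f k)"
    if A: "groupoid_obj C A" and f: "in_hom C f A X" "in_hom C k A X" for A f k
  proof -
    note pr = strict_product_pairing[OF S f]
    note l = core_lift_along[OF K pr(1) disjI1[OF A]]
    define w where "w = lift_along C i (pairing C s t f k)"
    have w: "in_hom C w A K" using l(1) unfolding w_def .
    have wT: "w \<in> Arr C" "Dom C w = A" "Cod C w = K" using w by (auto simp: in_hom_def)
    have dd: "exp_diagram s t i E j f k = w \<cdot> h" unfolding exp_diagram_def w_def[symmetric] E(2)[symmetric] using wT ET T by simp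
    have "exponential_diagram (hom_cat C A X) (w \<rhd> a) (w \<rhd> b) (w \<rhd> e)"
      by (rule cartesian_closed_exponential_precomp[OF cc GK A w d(1)])
    moreover have "(w \<cdot> h) \<rhd> snd ev (3, 2) = w \<rhd> a" "(w \<cdot> h) \<rhd> snd ev (3, 0) = w \<rhd> b" "(w \<cdot> h) \<rhd> snd ev (3, 1) = w \<rhd> e"
      unfolding h'(3-5)[symmetric] using wT hT ev by simp_all
    ultimately show ?thesis unfolding exponential_object_diagram_def L_arrows_def dd using wT hT by simp
  qed
  then show ?thesis using S K L M E(1) Ec by blast
qed

end

section \<open>Existence and uniqueness of exponential morphisms\<close>

context exponential_setting
begin

text \<open>This separates the choice of \<open>E\<close> from the conditions on \<open>ex\<close>;
  the clause on objects matches because the vertex 2 is the codomain of the first leg of the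
  diagram.\<close>

lemma exponential_morphism_iff:
  "exponential_morphism C N X \<gamma> \<gamma>\<^sub>0\<^sub>1 \<gamma>\<^sub>o \<gamma>\<^sub>o\<^sub>0\<^sub>1 P p q ex \<longleftrightarrow> in_hom C ex P X \<and>
    (\<exists>S s t K i L ev M j E. strict_product C X X S s t \<and> is_core C S K i \<and> L_object C X L ev \<and> is_core C L M j \<and>
     in_hom C E K M \<and> E \<cdot> core_map C j i (pairing C s t (fst ev 0) (fst ev 1)) = Ide C K \<and>
     (\<forall>A f g. groupoid_obj C A \<longrightarrow> in_hom C f A X \<longrightarrow> in_hom C g A X \<longrightarrow>
        exponential_object_diagram C X ev (exp_diagram s t i E j f g)) \<and>
     realizes ex (\<lambda>f g. L_arrows C ev (exp_diagram s t i E j f g)))" (is "?l \<longleftrightarrow> ?r")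
proof -
  have iff: "(\<forall>A. groupoid_obj C A \<longrightarrow>
              (\<forall>f g. in_hom C f A X \<and> in_hom C g A X \<longrightarrow>
                 exponential_object_diagram C X ev (exp_diagram s t i E j f g) \<and>
                 pairing C p q (opm f) g \<cdot> ex = exp_diagram s t i E j f g \<cdot> fst ev 2) \<and>
              (\<forall>f f' g g' \<alpha> \<beta>.
                 in_hom C f A X \<and> in_hom C f' A X \<and> in_hom C g A X \<and> in_hom C g' A X \<and>
                 in_hom (hom_cat C A X) \<alpha> f' f \<and> in_hom (hom_cat C A X) \<beta> g g' \<longrightarrow>
                 exponential_induced (hom_cat C A X)
                   (L_arrows C ev (exp_diagram s t i E j f g)) (L_arrows C ev (exp_diagram s t i E j f' g')) \<alpha> \<beta>
                   (pairing2 C p q (opc \<alpha>) \<beta> \<lhd> ex))) \<longleftrightarrow>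
     (\<forall>A f g. groupoid_obj C A \<longrightarrow> in_hom C f A X \<longrightarrow> in_hom C g A X \<longrightarrow>
        exponential_object_diagram C X ev (exp_diagram s t i E j f g)) \<and>
     realizes ex (\<lambda>f g. L_arrows C ev (exp_diagram s t i E j f g))"
    if H: "strict_product C X X S s t" "is_core C S K i" "L_object C X L ev" "is_core C L M j"
      "in_hom C E K M" "E \<cdot> core_map C j i (pairing C s t (fst ev 0) (fst ev 1)) = Ide C K" for S s t K i L ev M j E
  proof -
    have obj: "exponential_object C (\<lambda>f g. L_arrows C ev (exp_diagram s t i E j f g)) f g = exp_diagram s t i E j f g \<cdot> fst ev 2"
      if "groupoid_obj C A" "in_hom C f A X" "in_hom C g A X" for A f g
      using exp_diagram_type(1)[OF H that] L_object_hom[OF H(3)] by (simp add: L_arrows_def in_hom_def)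
    have ty: "in_hom C f A X \<and> in_hom C f' A X" if "in_hom (hom_cat C A X) \<alpha> f f'" for A \<alpha> f f'
      using that by (auto simp: in_hom_def)
    show ?thesis unfolding realizes_def
      by (intro iffI conjI allI impI; (elim conjE)?) (use obj ty in metis)+
  qed
  show ?thesis
    unfolding exponential_morphism_def Let_def exp_diagram_def[symmetric] by (simp only: iff cong: conj_cong)
qed

lemma exponential_morphism_family:
  assumes "exponential_morphism C N X \<gamma> \<gamma>\<^sub>0\<^sub>1 \<gamma>\<^sub>o \<gamma>\<^sub>o\<^sub>0\<^sub>1 P p q ex"
  shows "in_hom C ex P X" "\<exists>D. exponential_family C X D \<and> realizes ex D"
proof -
  show "in_hom C ex P X" using assms unfolding exponential_morphism_iff by blast
  obtain S s t K i L ev M j E where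
    H: "strict_product C X X S s t" "is_core C S K i" "L_object C X L ev" "is_core C L M j"
      "in_hom C E K M" "E \<cdot> core_map C j i (pairing C s t (fst ev 0) (fst ev 1)) = Ide C K" and
    x: "\<And>A f g. groupoid_obj C A \<Longrightarrow> in_hom C f A X \<Longrightarrow> in_hom C g A X \<Longrightarrow>
        exponential_object_diagram C X ev (exp_diagram s t i E j f g)" and
    r: "realizes ex (\<lambda>f g. L_arrows C ev (exp_diagram s t i E j f g))"
    using assms unfolding exponential_morphism_iff by blast
  have "exponential_family C X (\<lambda>f g. L_arrows C ev (exp_diagram s t i E j f g))"
    by (rule exp_diagram_family[OF H]) (rule x)
  with r show "\<exists>D. exponential_family C X D \<and> realizes ex D" by blast
qed

lemma exponential_morphism_exists: "\<exists>ex. exponential_morphism C N X \<gamma> \<gamma>\<^sub>0\<^sub>1 \<gamma>\<^sub>o \<gamma>\<^sub>o\<^sub>0\<^sub>1 P p q ex"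
proof -
  obtain S s t K i L ev M j E where
    H: "strict_product C X X S s t" "is_core C S K i" "L_object C X L ev" "is_core C L M j"
      "in_hom C E K M" "E \<cdot> core_map C j i (pairing C s t (fst ev 0) (fst ev 1)) = Ide C K" and
    x: "\<And>A f g. groupoid_obj C A \<Longrightarrow> in_hom C f A X \<Longrightarrow> in_hom C g A X \<Longrightarrow>
        exponential_object_diagram C X ev (exp_diagram s t i E j f g)"
    using exp_diagram_exists[OF groupoidant closed] by blast
  have "exponential_family C X (\<lambda>f g. L_arrows C ev (exp_diagram s t i E j f g))"
    by (rule exp_diagram_family[OF H]) (rule x)
  then obtain ex where "in_hom C ex P X" "realizes ex (\<lambda>f g. L_arrows C ev (exp_diagram s t i E j f g))"
    using realization_exists by blast
  then show ?thesis unfolding exponential_morphism_iff using H x by blast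
qed

lemma exponential_morphism_unique:
  assumes "exponential_morphism C N X \<gamma> \<gamma>\<^sub>0\<^sub>1 \<gamma>\<^sub>o \<gamma>\<^sub>o\<^sub>0\<^sub>1 P p q ex"
    and "exponential_morphism C N X \<gamma> \<gamma>\<^sub>0\<^sub>1 \<gamma>\<^sub>o \<gamma>\<^sub>o\<^sub>0\<^sub>1 P p q ex'"
  shows "isomorphic (hom_cat C P X) ex ex'"
  using exponential_morphism_family[OF assms(1)] exponential_morphism_family[OF assms(2)] realization_unique by blast

end

theorem propositionB3p2:
  fixes C :: "('o, 'm, 'c) twocat"
    and N :: "('o, 'm) intcat"
    and X X\<^sub>o P :: 'o
    and \<gamma> \<gamma>\<^sub>o p q :: 'm
    and \<gamma>\<^sub>0\<^sub>1 \<gamma>\<^sub>o\<^sub>0\<^sub>1 :: 'c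
  assumes "two_category C"
    and "groupoidant C"
    and "cartesian_closed_obj C X"
    and "opposition C N X \<gamma> \<gamma>\<^sub>0\<^sub>1 X\<^sub>o \<gamma>\<^sub>o \<gamma>\<^sub>o\<^sub>0\<^sub>1"
    and "strict_product C X\<^sub>o X P p q"
  shows "(\<exists>ex. exponential_morphism C N X \<gamma> \<gamma>\<^sub>0\<^sub>1 \<gamma>\<^sub>o \<gamma>\<^sub>o\<^sub>0\<^sub>1 P p q ex) \<and>
    (\<forall>ex ex'. exponential_morphism C N X \<gamma> \<gamma>\<^sub>0\<^sub>1 \<gamma>\<^sub>o \<gamma>\<^sub>o\<^sub>0\<^sub>1 P p q ex \<and>
       exponential_morphism C N X \<gamma> \<gamma>\<^sub>0\<^sub>1 \<gamma>\<^sub>o \<gamma>\<^sub>o\<^sub>0\<^sub>1 P p q ex' \<longrightarrow>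
       isomorphic (hom_cat C P X) ex ex')"
proof -
  interpret two_category C by fact
  have c: "complete_congruence C N" and q: "strict_quotient C N X \<gamma> \<gamma>\<^sub>0\<^sub>1" "strict_quotient C (op_intcat N) X\<^sub>o \<gamma>\<^sub>o \<gamma>\<^sub>o\<^sub>0\<^sub>1"
    using assms(4) by (auto simp: opposition_def)
  \<comment> \<open>The internal category supplies the pullback of composable pairs that
    \<open>opposed_presentations\<close> records.\<close>
  have "internal_category C N"
    using c by (simp add: complete_congruence_def gbo_congruence_def internal_double_category_def)
  then interpret exponential_setting C N X X\<^sub>o \<gamma> \<gamma>\<^sub>o \<gamma>\<^sub>0\<^sub>1 \<gamma>\<^sub>o\<^sub>0\<^sub>1 P p q
    using assms complete_congruence_presentation[OF assms(2) c q(1)]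
      complete_congruence_presentation[OF assms(2) complete_congruence_op[OF c] q(2)]
    by unfold_locales (auto dest: internal_categoryD(7))
  show ?thesis using exponential_morphism_exists exponential_morphism_unique by blast
qed

end
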